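(* Assume the setting below. For $v\in C_0^\eta(M,\mathbb R^d)$ let $v_t=\int_0^tv\circ T_s\,ds$ and $S_t=\int_0^t\int_0^s(v\circ T_r)\otimes(v\circ T_s)\,dr\,ds$. (a) If $H\in L^p(Y)$ for some $p\ge2$, then there is $C>0$ such that $|v_t|_{p-1}\le Ct^{1/2}\|v\|_\eta$ for all $v\in C_0^\eta(M,\mathbb R^d)$, $t>0$. (b) If $H\in L^p(Y)$ for some $p\ge4$, then there is $C>0$ such that $|S_t|_{(p-1)/2}\le Ct\|v\|_\eta^2$ for all $v\in C_0^\eta(M,\mathbb R^d)$, $t>0$.
   Context: Setting (nonuniformly hyperbolic flow with exponential contraction along stable leaves). Let $(M,d)$ be a bounded metric space, $Y\subset X\subset M$ Borel, $T_t:M\to M$ a measurable semiflow, $h:X\to(0,\infty)$ with $f(x)=T_{h(x)}x$ defining $f:X\to X$, and $\tau:Y\to\mathbb Z^+$ with $F(y)=f^{\tau(y)}y$ defining $F:Y\to Y$. Let $\mu_Y$ be a Borel ergodic $F$-invariant probability measure on $Y$ with $\tau$ integrable; let $\mu_X=\pi_*\mu^\tau$ where $\mu^\tau=(\mu_Y\times\text{counting})/\int\tau\,d\mu_Y$ on $\{(y,\ell):0\le\ell\le\tau(y)-1\}$ and $\pi(y,\ell)=f^\ell y$; assume $h\in L^1(\mu_X)$ and let $\mu_M$ be the image of $(\mu_X\times\text{Lebesgue})/\int h\,d\mu_X$ on $\{(x,u):0\le u\le h(x)\}$ under $(x,u)\mapsto T_ux$. Let $\mathcal W^s$ be a measurable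 partition of $Y$ into stable leaves $W^s_y\ni y$ with $F(W^s_y)\subset W^s_{Fy}$ and $\tau$ constant on stable leaves. Let $\bar\pi:Y\to\bar Y$ be the quotient by $\mathcal W^s$; the quotient map $\bar F:\bar Y\to\bar Y$ is assumed to be a Gibbs–Markov map (in the standard sense of Aaronson–Denker) with partition $\{\bar Y_j\}$ and ergodic invariant probability measure $\bar\mu=\bar\pi_*\mu_Y$. The separation time $s(y,y')$ on $\bar Y$ is the least $n\ge0$ with $\bar F^ny,\bar F^ny'$ in distinct $\bar Y_j$; set $Y_j=\bar\pi^{-1}\bar Y_j$ and $s(y,y')=s(\bar\pi y,\bar\pi y')$ on $Y$. Let $H(y)=\sum_{\ell=0}^{\tau(y)-1}h(f^\ell y)$, assumed integrable with $\inf H>0$; $H_n=\sum_{j=0}^{n-1}H\circ F^j$ and $J(t)(y)$ is the largest $n\ge0$ with $H_n(y)\le t$. There is a measurable $\hat Y\subset Y$ meeting each stable leaf in exactly one point, and constants $C\ge1$, $\gamma_0\in(0,1)$, $\eta\in(0,1]$ with: $|H(y)-H(y')|\le C(\inf_{Y_j}H)\gamma_0^{s(y,y')}$ for $y,y'\in\hat Y\cap Y_j$; $d(T_ty,T_{t'}y)\le C|t-t'|^\eta$ for $y\in\hat Y$, $t,t'\ge0$; $d(T_ty,T_ty')\le C\gamma_0^t$ for $y\in Y$, $y'\in W^s_y$, $t\ge0$; and $d(T_ty,T_ty')\le C\gamma_0^{s(y,y')-J(t)(y)}$ for $y,y'\in\hat Y\cap Y_j$, $t\ge0$. For $v:M\to\mathbb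 R^d$, $\|v\|_\eta=|v|_\infty+\sup_{x\ne x'}|v(x)-v(x')|/d(x,x')^\eta$; $C_0^\eta(M,\mathbb R^d)$ consists of $v$ with $\|v\|_\eta<\infty$ and $\int v\,d\mu_M=0$. $a\otimes b=ab^T$. Norms $|\cdot|_q$ in the conclusions are on $L^q(M,\mu_M)$. *)

theory Defs
  imports "HOL-Probability.Probability"
begin

definition fmap :: "(real \<Rightarrow> 'm \<Rightarrow> 'm) \<Rightarrow> ('m \<Rightarrow> real) \<Rightarrow> 'm \<Rightarrow> 'm" where
  "fmap T h x = T (h x) x"

definition Fmap :: "(real \<Rightarrow> 'm \<Rightarrow> 'm) \<Rightarrow> ('m \<Rightarrow> real) \<Rightarrow> ('m \<Rightarrow> nat) \<Rightarrow> 'm \<Rightarrow> 'm" where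
  "Fmap T h \<tau> y = (fmap T h ^^ \<tau> y) y"

definition Hfun :: "(real \<Rightarrow> 'm \<Rightarrow> 'm) \<Rightarrow> ('m \<Rightarrow> real) \<Rightarrow> ('m \<Rightarrow> nat) \<Rightarrow> 'm \<Rightarrow> real" where
  "Hfun T h \<tau> y = (\<Sum>l<\<tau> y. h ((fmap T h ^^ l) y))"

definition Hsum :: "(real \<Rightarrow> 'm \<Rightarrow> 'm) \<Rightarrow> ('m \<Rightarrow> real) \<Rightarrow> ('m \<Rightarrow> nat) \<Rightarrow> nat \<Rightarrow> 'm \<Rightarrow> real" where
  "Hsum T h \<tau> n y = (\<Sum>j<n. Hfun T h \<tau> ((Fmap T h \<tau> ^^ j) y))"

definition Jfun :: "(real \<Rightarrow> 'm \<Rightarrow> 'm) \<Rightarrow> ('m \<Rightarrow> real) \<Rightarrow> ('m \<Rightarrow> nat) \<Rightarrow> real \<Rightarrow> 'm \<Rightarrow> nat" where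
  "Jfun T h \<tau> t y = (GREATEST n. Hsum T h \<tau> n y \<le> t)"

text \<open>mu_X = pi_* mu^tau, where mu^tau = (mu_Y x counting)/int tau on the tower
  {(y,l): 0 <= l <= tau y - 1} and pi(y,l) = f^l y.  Written out on Borel subsets of X.\<close>

definition tower_measure :: "'m::topological_space set \<Rightarrow> 'm measure \<Rightarrow> ('m \<Rightarrow> 'm) \<Rightarrow> ('m \<Rightarrow> nat) \<Rightarrow> 'm measure" where
  "tower_measure X \<mu>Y f \<tau> = measure_of X (sets (restrict_space borel X))
     (\<lambda>A. (\<integral>\<^sup>+ y. ennreal (\<Sum>l<\<tau> y. indicator A ((f ^^ l) y)) \<partial>\<mu>Y)
           / (\<integral>\<^sup>+ y. ennreal (real (\<tau> y)) \<partial>\<mu>Y))"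

text \<open>mu_M = image of (mu_X x Lebesgue)/int h dmu_X on {(x,u): 0 <= u <= h x} under (x,u) -> T_u x.\<close>

definition suspension_measure :: "'m measure \<Rightarrow> (real \<Rightarrow> 'm::topological_space \<Rightarrow> 'm) \<Rightarrow> ('m \<Rightarrow> real) \<Rightarrow> 'm measure" where
  "suspension_measure \<mu>X T h = measure_of UNIV (sets borel)
     (\<lambda>A. (\<integral>\<^sup>+ x. (\<integral>\<^sup>+ u. indicator {0..h x} u * indicator A (T u x) \<partial>lborel) \<partial>\<mu>X)
           / (\<integral>\<^sup>+ x. ennreal (h x) \<partial>\<mu>X))"

text \<open>Quotient of Y by the partition into stable leaves W y: the points of the quotient are the
  leaves themselves, with the quotient sigma-algebra.\<close>

definition qspace :: "('m::topological_space \<Rightarrow> 'm set) \<Rightarrow> 'm set \<Rightarrow> 'm set measure" where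
  "qspace W Y = measure_of (W ` Y) {B. B \<subseteq> W ` Y \<and> W -` B \<inter> Y \<in> sets borel} (\<lambda>_. 0)"

definition Fbar :: "('m \<Rightarrow> 'm set) \<Rightarrow> ('m \<Rightarrow> 'm) \<Rightarrow> 'm set \<Rightarrow> 'm set" where
  "Fbar W F B = W (F (SOME y. y \<in> B))"

definition preserves_measure :: "'a measure \<Rightarrow> ('a \<Rightarrow> 'a) \<Rightarrow> bool" where
  "preserves_measure M G \<longleftrightarrow> G \<in> measurable M M \<and> distr M M G = M"

definition ergodic_on :: "'a measure \<Rightarrow> ('a \<Rightarrow> 'a) \<Rightarrow> bool" where
  "ergodic_on M G \<longleftrightarrow> (\<forall>A\<in>sets M. G -` A \<inter> space M = A \<longrightarrow> measure M A = 0 \<or> measure M A = 1)"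

definition sep_time :: "'b set set \<Rightarrow> ('b \<Rightarrow> 'b) \<Rightarrow> 'b \<Rightarrow> 'b \<Rightarrow> enat" where
  "sep_time P G x y =
     (if \<exists>n. \<not> (\<exists>a\<in>P. (G ^^ n) x \<in> a \<and> (G ^^ n) y \<in> a)
      then enat (LEAST n. \<not> (\<exists>a\<in>P. (G ^^ n) x \<in> a \<and> (G ^^ n) y \<in> a))
      else \<infinity>)"

text \<open>gp g s k = g^(s - k) for finite s, and 0 (= g^infinity) for s = infinity (0 < g < 1).\<close>

definition gp :: "real \<Rightarrow> enat \<Rightarrow> nat \<Rightarrow> real" where
  "gp g s k = (case s of enat n \<Rightarrow> g powr (real n - real k) | \<infinity> \<Rightarrow> 0)"

text \<open>Gibbs--Markov map in the sense of Aaronson--Denker: countable measurable partition (mod 0)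
  of sets of positive measure, nonsingular, each branch a measurable bijection onto its image which
  is (mod 0) a union of partition elements (Markov), big images, the partition separates points,
  and the inverse Jacobian g = d mu / d(mu o G) has log-Lipschitz distortion w.r.t. theta^s.\<close>

definition gibbs_markov :: "'b measure \<Rightarrow> ('b \<Rightarrow> 'b) \<Rightarrow> 'b set set \<Rightarrow> bool" where
  "gibbs_markov Mb G P \<longleftrightarrow>
     prob_space Mb \<and> G \<in> measurable Mb Mb \<and>
     countable P \<and> P \<subseteq> sets Mb \<and> disjoint P \<and> (\<forall>a\<in>P. 0 < measure Mb a) \<and>
     emeasure Mb (space Mb - \<Union>P) = 0 \<and>
     (\<forall>A\<in>sets Mb. emeasure Mb A = 0 \<longrightarrow> emeasure Mb (G -` A \<inter> space Mb) = 0) \<and>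
     (\<forall>a\<in>P. inj_on G a \<and> (\<forall>A\<in>sets Mb. A \<subseteq> a \<longrightarrow> G ` A \<in> sets Mb) \<and>
        (\<exists>Q\<subseteq>P. emeasure Mb (G ` a - \<Union>Q) = 0 \<and> emeasure Mb (\<Union>Q - G ` a) = 0)) \<and>
     (\<exists>c>0. \<forall>a\<in>P. c \<le> measure Mb (G ` a)) \<and>
     (\<forall>x\<in>space Mb. \<forall>y\<in>space Mb. x \<noteq> y \<longrightarrow> sep_time P G x y \<noteq> \<infinity>) \<and>
     (\<exists>g \<theta> Cd. 0 < \<theta> \<and> \<theta> < 1 \<and> g \<in> borel_measurable Mb \<and> (\<forall>x\<in>space Mb. 0 < g x) \<and>
        (\<forall>a\<in>P. \<forall>A\<in>sets Mb. A \<subseteq> a \<longrightarrow>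
            emeasure Mb A = (\<integral>\<^sup>+ z\<in>G ` A. ennreal (g (the_inv_into a G z)) \<partial>Mb)) \<and>
        (\<forall>a\<in>P. \<forall>x\<in>a. \<forall>y\<in>a. \<bar>ln (g x) - ln (g y)\<bar> \<le> Cd * gp \<theta> (sep_time P G x y) 0))"

definition holder_norm :: "real \<Rightarrow> ('m::metric_space \<Rightarrow> 'b::real_normed_vector) \<Rightarrow> real" where
  "holder_norm \<eta> v = (SUP x. norm (v x)) +
     (SUP p. (if fst p = snd p then 0 else norm (v (fst p) - v (snd p)) / dist (fst p) (snd p) powr \<eta>))"

definition C0_holder :: "real \<Rightarrow> 'm::metric_space measure \<Rightarrow> ('m \<Rightarrow> real^'d) set" where
  "C0_holder \<eta> \<mu> = {v. bounded (range v) \<and> (\<exists>L. \<forall>x x'. norm (v x - v x') \<le> L * dist x x' powr \<eta>)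
                        \<and> integral\<^sup>L \<mu> v = 0}"

definition Lq_norm :: "'a measure \<Rightarrow> real \<Rightarrow> ('a \<Rightarrow> 'b::real_normed_vector) \<Rightarrow> ennreal" where
  "Lq_norm M q g = (let I = (\<integral>\<^sup>+ x. ennreal (norm (g x) powr q) \<partial>M) in
     if I = \<infinity> then \<infinity> else ennreal (enn2real I powr (1 / q)))"

definition in_Lp :: "'a measure \<Rightarrow> real \<Rightarrow> ('a \<Rightarrow> real) \<Rightarrow> bool" where
  "in_Lp M p g \<longleftrightarrow> g \<in> borel_measurable M \<and> integrable M (\<lambda>x. \<bar>g x\<bar> powr p)"

definition outer :: "real^'d \<Rightarrow> real^'d \<Rightarrow> real^'d^'d" where
  "outer a b = (\<chi> i j. a $ i * b $ j)"

definition vint :: "(real \<Rightarrow> 'm \<Rightarrow> 'm) \<Rightarrow> ('m \<Rightarrow> real^'d) \<Rightarrow> real \<Rightarrow> 'm \<Rightarrow> real^'d" where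
  "vint T v t x = (LBINT s=0..t. v (T s x))"

definition Sint :: "(real \<Rightarrow> 'm \<Rightarrow> 'm) \<Rightarrow> ('m \<Rightarrow> real^'d) \<Rightarrow> real \<Rightarrow> 'm \<Rightarrow> real^'d^'d" where
  "Sint T v t x = (LBINT s=0..t. (LBINT r=0..s. outer (v (T r x)) (v (T s x))))"

end

theory Submission
  imports Defs
begin

text \<open>
  The integral of \<open>v\<close> along the flow between consecutive returns to \<open>Y\<close> defines an induced observable over
  \<open>F\<close>. If \<open>H\<close> is almost everywhere constant on stable leaves, this observable is cohomologous, with bounded transfer function, to
  an observable of the Gibbs--Markov quotient, whose oscillation on each partition element is controlled by the
  infimum of \<open>H\<close> there. Iterates of the transfer operator of the quotient need not decay, as no mixing is assumed, but
  for mean zero observables their sums are bounded; a Cesaro average of these sums gives, at every time scale \<open>N\<close>,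
  a decomposition into a reverse martingale difference in \<open>L\<^sup>p\<close>, a bounded coboundary and an error of size
  \<open>O(1/N)\<close>. Moment and maximal inequalities for reverse martingales then bound the Birkhoff sums and the
  iterated sums. If \<open>H\<close> is not constant on leaves, orbits are asymptotic to time shifts of themselves and the
  integrals along orbits are even bounded. Finally the bounds on \<open>Y\<close>, uniform along a whole flow segment, are
  transferred to the suspension through Young's inequality for \<open>H\<close> times a \<open>(p - 1)\<close>-th power, which is where
  one power of integrability is lost.
\<close>

section \<open>Reverse martingale differences\<close>

text \<open>The preimage \<sigma>-algebras of an expanding map decrease with the iterate, so the
  martingales run in reverse time and their maximal functions control sums over final segments of a
  window of \<open>N\<close> returns. Initial segments are recovered as the whole minus a final
  segment, and for iterated sums through Chen's relation. The Cesaro average works because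
  \<open>S w n - L (S w n) = w - (L ^^ n) w\<close>: the mean of the last term over
  \<open>1 \<le> n \<le> N\<close> is \<open>L (S w N) / N\<close>, which is \<open>O(1/N)\<close>
  once the sums are bounded, and over at most \<open>N\<close> returns such errors add up to a
  constant. Leaf representatives come from pointwise choices; measurability of functions built from
  them is recovered from Lipschitz continuity in the separation time. All estimates concern scalar
  observables with sup norm and Hoelder constant at most 1, so the powers of the Hoelder norm come
  from linearity and bilinearity. The condition \<open>p \<ge> 4\<close> for iterated sums keeps the
  exponent \<open>p / 2\<close>, left after pairing two factors in \<open>L\<^sup>p\<close>, above
  the value 2 that the moment inequality requires. For \<open>t < 1\<close> the trivial bounds
  \<open>t \<le> sqrt t\<close> and \<open>t\<^sup>2 \<le> t\<close> suffice.\<close>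

lemma powr_mult_le_add:
  fixes x y s t :: real
  assumes "0 \<le> x" "0 \<le> y" "0 \<le> s" "0 \<le> t"
  shows "x powr s * y powr t \<le> x powr (s + t) + y powr (s + t)"
proof (cases "x \<le> y")
  case True
  have "x powr s * y powr t \<le> y powr s * y powr t"
    using True assms by (intro mult_right_mono powr_mono2) auto
  also have "\<dots> = y powr (s + t)" by (simp add: powr_add)
  finally show ?thesis by (smt (verit) powr_ge_zero)
next
  case False
  have "x powr s * y powr t \<le> x powr s * x powr t"
    using False assms by (intro mult_left_mono powr_mono2) auto
  also have "\<dots> = x powr (s + t)" by (simp add: powr_add)
  finally show ?thesis by (smt (verit) powr_ge_zero)
qed

lemma powr_add_le:
  fixes x y q :: real
  assumes "0 \<le> x" "0 \<le> y" "0 \<le> q"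
  shows "(x + y) powr q \<le> 2 powr q * (x powr q + y powr q)"
proof -
  have "(x + y) powr q \<le> (2 * max x y) powr q" using assms by (intro powr_mono2) auto
  also have "\<dots> = 2 powr q * max x y powr q" using assms by (simp add: powr_mult)
  also have "\<dots> \<le> 2 powr q * (x powr q + y powr q)"
    by (intro mult_left_mono) (auto simp: max_def)
  finally show ?thesis .
qed

text \<open>Weighted arithmetic-geometric mean of \<open>1 + r * x\<close> and \<open>1\<close> with
  weights \<open>1/r\<close> and \<open>1 - 1/r\<close>. It converts a one-step increment into the
  growth of a power of the number of steps.\<close>

lemma powr_bernoulli:
  fixes x r :: real
  assumes "0 \<le> x" "1 \<le> r"
  shows "1 + r * x \<le> (1 + x) powr r"
proof -
  have "(1 + r * x) powr (1/r) * 1 powr (1 - 1/r) \<le> 1/r * (1 + r * x) + (1 - 1/r) * 1"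
    using assms by (intro Youngs_inequality_0) (auto simp: add_pos_nonneg)
  also have "\<dots> = 1 + x" using assms by (simp add: field_simps)
  finally have "((1 + r * x) powr (1/r)) powr r \<le> (1 + x) powr r"
    using assms by (intro powr_mono2) auto
  thus ?thesis using assms by (simp add: powr_powr add_pos_nonneg)
qed

text \<open>The first two summands serve increments with
  \<open>\<bar>b\<bar> \<ge> \<bar>a\<bar> / 2\<close>, where all terms are dominated by
  \<open>\<bar>b\<bar> powr q\<close>; the third is the quadratic remainder for small
  increments.\<close>

definition taylor_const :: "real \<Rightarrow> real" where
  "taylor_const q = 3 powr q + q * 2 powr q + q\<^sup>2 * exp q"

lemma taylor_const_ge1: "2 \<le> q \<Longrightarrow> 1 \<le> taylor_const q"
proof -
  assume q: "2 \<le> q"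
  have "1 \<le> 3 powr q" using q by (simp add: ge_one_powr_ge_zero)
  thus ?thesis using q unfolding taylor_const_def
    by (smt (verit) exp_gt_zero mult_nonneg_nonneg powr_ge_zero zero_le_power2)
qed

text \<open>For a small increment \<open>b = a * x\<close> the power is majorised by the
  exponential, \<open>(1 + x) powr q \<le> exp (q * x)\<close>, and only the exponential is expanded
  to second order, so the absolute power is never differentiated. The linear term is kept exact
  because it must integrate to zero.\<close>

lemma abs_powr_add_le_taylor:
  fixes a b q :: real
  assumes q: "2 \<le> q"
  shows "\<bar>a + b\<bar> powr q \<le> \<bar>a\<bar> powr q + q * (sgn a * \<bar>a\<bar> powr (q - 1)) * b
      + taylor_const q * (\<bar>a\<bar> powr (q - 2) * \<bar>b\<bar> powr 2 + \<bar>b\<bar> powr q)"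
proof (cases "\<bar>b\<bar> < \<bar>a\<bar> / 2")
  case False
  have A: "\<bar>a + b\<bar> powr q \<le> 3 powr q * \<bar>b\<bar> powr q"
  proof -
    have "\<bar>a + b\<bar> powr q \<le> (3 * \<bar>b\<bar>) powr q" using False q by (intro powr_mono2) auto
    thus ?thesis by (simp add: powr_mult)
  qed
  have "\<bar>a\<bar> powr (q - 1) * \<bar>b\<bar> \<le> (2 * \<bar>b\<bar>) powr (q - 1) * \<bar>b\<bar>"
    using False q by (intro mult_right_mono powr_mono2) auto
  also have "\<dots> = 2 powr (q - 1) * \<bar>b\<bar> powr q"
    by (cases "b = 0") (auto simp: powr_mult powr_diff)
  also have "\<dots> \<le> 2 powr q * \<bar>b\<bar> powr q" by (intro mult_right_mono powr_mono) auto
  finally have "q * (\<bar>a\<bar> powr (q - 1) * \<bar>b\<bar>) \<le> q * (2 powr q * \<bar>b\<bar> powr q)"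
    using q by (intro mult_left_mono) auto
  moreover have "- (q * (\<bar>a\<bar> powr (q - 1) * \<bar>b\<bar>)) \<le> q * (sgn a * \<bar>a\<bar> powr (q - 1)) * b"
  proof -
    have "\<bar>q * (sgn a * \<bar>a\<bar> powr (q - 1)) * b\<bar> \<le> q * (\<bar>a\<bar> powr (q - 1) * \<bar>b\<bar>)"
      using q by (auto simp: abs_mult abs_sgn_eq)
    thus ?thesis by linarith
  qed
  moreover have "taylor_const q * \<bar>b\<bar> powr q = 3 powr q * \<bar>b\<bar> powr q + q * (2 powr q * \<bar>b\<bar> powr q) + q\<^sup>2 * exp q * \<bar>b\<bar> powr q"
    by (simp add: taylor_const_def algebra_simps)
  moreover have "0 \<le> q\<^sup>2 * exp q * \<bar>b\<bar> powr q" by simp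
  moreover have "0 \<le> taylor_const q * (\<bar>a\<bar> powr (q - 2) * \<bar>b\<bar> powr 2)" "0 \<le> \<bar>a\<bar> powr q"
    using taylor_const_ge1[OF q] by auto
  ultimately show ?thesis using A unfolding distrib_left by linarith
next
  case True
  hence a: "a \<noteq> 0" by auto
  define x where "x = b / a"
  have x: "\<bar>x\<bar> < 1/2" using True a by (auto simp: x_def abs_divide field_simps)
  have b: "b = a * x" using a by (simp add: x_def)
  obtain t where t: "\<bar>t\<bar> \<le> \<bar>q * x\<bar>" "exp (q * x) = (\<Sum>m<2. (q * x) ^ m / fact m) + exp t / fact 2 * (q * x)\<^sup>2"
    using Maclaurin_exp_le by blast
  have tq: "exp t \<le> exp q"
  proof -
    have "\<bar>q * x\<bar> \<le> q * 1" unfolding abs_mult using x q by (intro mult_mono) auto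
    thus ?thesis using t by auto
  qed
  have "(1 + x) powr q = exp (q * ln (1 + x))" using x by (auto simp: powr_def)
  also have "\<dots> \<le> exp (q * x)" using x q ln_add_one_self_le_self2[of x] by auto
  also have "\<dots> = 1 + q * x + exp t / 2 * (q * x)\<^sup>2" using t by (simp add: numeral_2_eq_2)
  also have "\<dots> \<le> 1 + q * x + exp q * (q * x)\<^sup>2"
  proof -
    have "exp t / 2 * (q * x)\<^sup>2 \<le> exp q * (q * x)\<^sup>2"
      using tq exp_gt_zero[of t] by (intro mult_right_mono zero_le_power2) linarith
    thus ?thesis by linarith
  qed
  also have "\<dots> \<le> 1 + q * x + taylor_const q * x\<^sup>2"
  proof -
    have "exp q * q\<^sup>2 \<le> taylor_const q" using q by (simp add: taylor_const_def)
    hence "exp q * q\<^sup>2 * x\<^sup>2 \<le> taylor_const q * x\<^sup>2" by (intro mult_right_mono) auto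
    thus ?thesis by (simp add: power_mult_distrib algebra_simps)
  qed
  finally have *: "\<bar>a\<bar> powr q * (1 + x) powr q \<le> \<bar>a\<bar> powr q * (1 + q * x + taylor_const q * x\<^sup>2)"
    by (intro mult_left_mono) auto
  have 1: "\<bar>a + b\<bar> powr q = \<bar>a\<bar> powr q * (1 + x) powr q"
  proof -
    have "a + b = a * (1 + x)" by (simp add: b algebra_simps)
    hence "\<bar>a + b\<bar> = \<bar>a\<bar> * (1 + x)" using x by (simp add: abs_mult)
    thus ?thesis using x by (simp add: powr_mult)
  qed
  have 2: "\<bar>a\<bar> powr q * (q * x) = q * (sgn a * \<bar>a\<bar> powr (q - 1)) * b"
    using a by (simp add: b powr_diff sgn_if abs_if)
  have 3: "\<bar>a\<bar> powr q * x\<^sup>2 = \<bar>a\<bar> powr (q - 2) * \<bar>b\<bar> powr 2"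
    using a by (simp add: b powr_diff abs_mult power_mult_distrib powr_numeral)
  have "\<bar>a + b\<bar> powr q \<le> \<bar>a\<bar> powr q + \<bar>a\<bar> powr q * (q * x) + taylor_const q * (\<bar>a\<bar> powr q * x\<^sup>2)"
    using * unfolding 1 by (simp add: algebra_simps)
  moreover have "0 \<le> taylor_const q * \<bar>b\<bar> powr q" using taylor_const_ge1[OF q] by auto
  ultimately show ?thesis unfolding 2 3 by (simp add: algebra_simps)
qed

section \<open>Measure-preserving maps, moments and maxima of reverse martingales\<close>

locale mpt = prob_space M for M :: "'a measure" +
  fixes G :: "'a \<Rightarrow> 'a"
  assumes G_meas [measurable]: "G \<in> measurable M M"
    and G_inv: "distr M M G = M"
begin

lemma integral_G:
  fixes f :: "'a \<Rightarrow> real"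
  assumes [measurable]: "f \<in> borel_measurable M"
  shows "(\<integral>x. f (G x) \<partial>M) = (\<integral>x. f x \<partial>M)"
proof -
  have "(\<integral>x. f x \<partial>distr M M G) = (\<integral>x. f (G x) \<partial>M)" by (rule integral_distr) auto
  thus ?thesis by (simp add: G_inv)
qed

lemma integrable_G:
  fixes f :: "'a \<Rightarrow> real"
  assumes "integrable M f"
  shows "integrable M (\<lambda>x. f (G x))"
  using assms integrable_distr[OF G_meas, of f] by (simp add: G_inv)

lemma AE_G:
  assumes "AE x in M. Q x"
  shows "AE x in M. Q (G x)"
proof -
  have "AE x in distr M M G. Q x" unfolding G_inv by (rule assms)
  thus ?thesis by (rule AE_distrD[OF G_meas])
qed

lemma Gn_meas [measurable]: "(G ^^ n) \<in> measurable M M"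
  by (induction n) (auto intro: measurable_comp[of _ M M] simp: G_meas)

lemma mpt_Gn: "mpt M (G ^^ n)"
proof (unfold_locales)
  show "distr M M (G ^^ n) = M"
  proof (induction n)
    case (Suc n)
    have "distr M M (G ^^ Suc n) = distr (distr M M (G ^^ n)) M G"
      by (subst distr_distr) auto
    thus ?case by (simp only: Suc G_inv)
  qed (simp add: distr_id2)
qed auto

lemma AE_Gn:
  assumes "AE x in M. Q x"
  shows "AE x in M. \<forall>n. Q ((G ^^ n) x)"
  using mpt.AE_G[OF mpt_Gn assms] by (simp add: AE_all_countable)

text \<open>For integrable \<open>d\<close> this says that the conditional expectation of \<open>d\<close> given the preimage
  \<open>\<sigma>\<close>-algebra of \<open>G\<close> vanishes.\<close>

definition reverse_diff :: "('a \<Rightarrow> real) \<Rightarrow> bool" where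
  "reverse_diff d \<longleftrightarrow> (\<forall>\<psi>\<in>borel_measurable M. integrable M (\<lambda>x. d x * \<psi> (G x)) \<longrightarrow> (\<integral>x. d x * \<psi> (G x) \<partial>M) = 0)"

lemma integrable_powr_mult:
  fixes f g :: "'a \<Rightarrow> real"
  assumes [measurable]: "f \<in> borel_measurable M" "g \<in> borel_measurable M"
    and "integrable M (\<lambda>x. \<bar>f x\<bar> powr (s + t))" "integrable M (\<lambda>x. \<bar>g x\<bar> powr (s + t))" "0 \<le> s" "0 \<le> t"
  shows "integrable M (\<lambda>x. \<bar>f x\<bar> powr s * \<bar>g x\<bar> powr t)"
proof (rule Bochner_Integration.integrable_bound)
  show "integrable M (\<lambda>x. \<bar>f x\<bar> powr (s + t) + \<bar>g x\<bar> powr (s + t))" using assms by auto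
  show "AE x in M. norm (\<bar>f x\<bar> powr s * \<bar>g x\<bar> powr t) \<le> norm (\<bar>f x\<bar> powr (s + t) + \<bar>g x\<bar> powr (s + t))"
    using powr_mult_le_add[of "\<bar>f _\<bar>" "\<bar>g _\<bar>" s t] assms by auto
qed auto

lemma integrable_powr_add:
  fixes f g :: "'a \<Rightarrow> real"
  assumes [measurable]: "f \<in> borel_measurable M" "g \<in> borel_measurable M"
    and "integrable M (\<lambda>x. \<bar>f x\<bar> powr q)" "integrable M (\<lambda>x. \<bar>g x\<bar> powr q)" "0 \<le> q"
  shows "integrable M (\<lambda>x. \<bar>f x + g x\<bar> powr q)"
proof (rule Bochner_Integration.integrable_bound)
  show "integrable M (\<lambda>x. 2 powr q * (\<bar>f x\<bar> powr q + \<bar>g x\<bar> powr q))" using assms by auto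
  have "\<bar>f x + g x\<bar> powr q \<le> 2 powr q * (\<bar>f x\<bar> powr q + \<bar>g x\<bar> powr q)" for x
  proof -
    have "\<bar>f x + g x\<bar> powr q \<le> (\<bar>f x\<bar> + \<bar>g x\<bar>) powr q" using assms by (intro powr_mono2) auto
    also have "\<dots> \<le> 2 powr q * (\<bar>f x\<bar> powr q + \<bar>g x\<bar> powr q)" using assms by (intro powr_add_le) auto
    finally show ?thesis .
  qed
  thus "AE x in M. norm (\<bar>f x + g x\<bar> powr q) \<le> norm (2 powr q * (\<bar>f x\<bar> powr q + \<bar>g x\<bar> powr q))" by auto
qed auto

context
  fixes u d :: "nat \<Rightarrow> 'a \<Rightarrow> real" and q A :: real
  assumes q: "2 \<le> q" and A: "0 < A"
    and u0: "\<And>x. u 0 x = 0" and uS: "\<And>k x. u (Suc k) x = d k x + u k (G x)"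
    and d_meas [measurable]: "\<And>k. d k \<in> borel_measurable M"
    and d_int: "\<And>k. integrable M (\<lambda>x. \<bar>d k x\<bar> powr q)"
    and d_diff: "\<And>k. reverse_diff (d k)"
begin

lemma u_meas [measurable]: "u k \<in> borel_measurable M"
proof (induction k)
  case (Suc k)
  have "u (Suc k) = (\<lambda>x. d k x + u k (G x))" using uS by auto
  thus ?case using Suc by simp
next
  case 0
  have "u 0 = (\<lambda>x. 0)" using u0 by auto
  thus ?case by simp
qed

lemma u_int: "integrable M (\<lambda>x. \<bar>u k x\<bar> powr q)"
proof (induction k)
  case (Suc k)
  show ?case unfolding uS using q d_int integrable_G[OF Suc]
    by (intro integrable_powr_add) auto
qed (simp add: u0)

text \<open>Expand \<open>\<bar>u k (G x) + d k x\<bar> powr q\<close> around the first summand: the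
  linear term is \<open>d k\<close> times a function of \<open>G x\<close> and integrates to zero,
  so only the quadratic term produces growth. The differences may depend on \<open>k\<close>, as
  they do for iterated sums.\<close>

lemma reverse_martingale_moment:
  assumes dA: "\<And>k. (\<integral>x. \<bar>d k x\<bar> powr q \<partial>M) \<le> A powr q"
  shows "(\<integral>x. \<bar>u k x\<bar> powr q \<partial>M) \<le> (3 * taylor_const q * k) powr (q/2) * A powr q"
proof (induction k)
  case 0 thus ?case by (simp add: u0)
next
  case (Suc k)
  define c where "c = taylor_const q"
  have c: "1 \<le> c" using taylor_const_ge1[OF q] by (simp add: c_def)
  show ?case
  proof (cases "k = 0")
    case True
    have "(\<integral>x. \<bar>u 1 x\<bar> powr q \<partial>M) \<le> A powr q" using dA[of 0] by (simp add: uS u0)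
    also have "\<dots> \<le> (3 * c * 1) powr (q/2) * A powr q"
    proof -
      have "1 \<le> (3 * c * 1) powr (q/2)" using c q by (intro ge_one_powr_ge_zero) auto
      thus ?thesis by (simp add: mult_le_cancel_right1)
    qed
    finally show ?thesis using True by (simp add: c_def)
  next
    case False
    \<comment> \<open>Chosen so that \<open>a = sqrt z * A\<close> has \<open>a powr q\<close> equal
      to the bound of the induction hypothesis; since \<open>k \<ge> 1\<close> here,
      \<open>z \<ge> 1\<close> and nonnegative powers of \<open>z\<close> dominate 1.\<close>
    define z where "z = 3 * c * real k"
    have z: "1 \<le> z" using c False unfolding z_def
      by (metis One_nat_def Suc_leI mult_ge1_I numeral_le_one_iff of_nat_1 of_nat_mono one_le_numeral neq0_conv mult_le_cancel_left1 order_trans of_nat_le_iff)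
    define a where "a = sqrt z * A"
    have a: "0 < a" using z A by (simp add: a_def)
    have aq: "a powr s = z powr (s/2) * A powr s" for s
      using z A by (simp add: a_def powr_mult powr_half_sqrt[symmetric] powr_powr)
    let ?v = "\<lambda>x. u k (G x)"
    have v_int: "integrable M (\<lambda>x. \<bar>?v x\<bar> powr q)" using integrable_G[OF u_int] .
    have v_le: "(\<integral>x. \<bar>?v x\<bar> powr q \<partial>M) \<le> a powr q"
      using Suc integral_G[of "\<lambda>x. \<bar>u k x\<bar> powr q"] by (simp add: aq z_def c_def)
    have i1: "integrable M (\<lambda>x. (sgn (?v x) * \<bar>?v x\<bar> powr (q - 1)) * d k x)"
    proof (rule Bochner_Integration.integrable_bound)
      show "integrable M (\<lambda>x. \<bar>?v x\<bar> powr (q - 1) * \<bar>d k x\<bar> powr 1)"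
        using v_int d_int q by (intro integrable_powr_mult) auto
    qed (auto simp: abs_mult abs_sgn_eq)
    have z1: "(\<integral>x. (sgn (?v x) * \<bar>?v x\<bar> powr (q - 1)) * d k x \<partial>M) = 0"
    proof -
      have "(\<integral>x. d k x * (sgn (?v x) * \<bar>?v x\<bar> powr (q - 1)) \<partial>M) = 0"
        using d_diff[of k] i1 unfolding reverse_diff_def
        by (auto dest!: bspec[of _ _ "\<lambda>y. sgn (u k y) * \<bar>u k y\<bar> powr (q - 1)"] simp: mult.commute)
      thus ?thesis by (simp add: mult.commute)
    qed
    have i2: "integrable M (\<lambda>x. \<bar>?v x\<bar> powr (q - 2) * \<bar>d k x\<bar> powr 2)"
      using v_int d_int q by (intro integrable_powr_mult) auto
    have z2: "(\<integral>x. \<bar>?v x\<bar> powr (q - 2) * \<bar>d k x\<bar> powr 2 \<partial>M) \<le> 2 * a powr (q - 2) * A powr 2"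
    proof -
      \<comment> \<open>Dividing by the bounds \<open>a\<close> and \<open>A\<close> first makes
        both terms of the crude product inequality integrate to at most 1, which replaces the
        Hoelder inequality.\<close>
      have pw: "\<bar>?v x\<bar> powr (q - 2) * \<bar>d k x\<bar> powr 2
         \<le> a powr (q - 2) * A powr 2 * (\<bar>?v x\<bar> powr q / a powr q + \<bar>d k x\<bar> powr q / A powr q)" for x
      proof -
        have "(\<bar>?v x\<bar> / a) powr (q - 2) * (\<bar>d k x\<bar> / A) powr 2
          \<le> (\<bar>?v x\<bar> / a) powr (q - 2 + 2) + (\<bar>d k x\<bar> / A) powr (q - 2 + 2)"
          using a A q by (intro powr_mult_le_add) auto
        hence "(\<bar>?v x\<bar> powr (q - 2) * \<bar>d k x\<bar> powr 2) / (a powr (q - 2) * A powr 2)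
           \<le> \<bar>?v x\<bar> powr q / a powr q + \<bar>d k x\<bar> powr q / A powr q"
          using a A by (simp add: powr_divide)
        thus ?thesis using a A by (subst (asm) pos_divide_le_eq) (auto simp: mult.commute)
      qed
      have "(\<integral>x. \<bar>?v x\<bar> powr (q - 2) * \<bar>d k x\<bar> powr 2 \<partial>M) \<le>
        (\<integral>x. a powr (q - 2) * A powr 2 * (\<bar>?v x\<bar> powr q / a powr q + \<bar>d k x\<bar> powr q / A powr q) \<partial>M)"
        using i2 v_int d_int pw by (intro integral_mono) auto
      also have "\<dots> = a powr (q - 2) * A powr 2 * ((\<integral>x. \<bar>?v x\<bar> powr q \<partial>M) / a powr q + (\<integral>x. \<bar>d k x\<bar> powr q \<partial>M) / A powr q)"
        using v_int d_int by simp
      also have "\<dots> \<le> a powr (q - 2) * A powr 2 * (1 + 1)"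
        using v_le dA[of k] a A by (intro mult_left_mono add_mono) auto
      finally show ?thesis by simp
    qed
    have "(\<integral>x. \<bar>u (Suc k) x\<bar> powr q \<partial>M) \<le> (\<integral>x. \<bar>?v x\<bar> powr q + q * ((sgn (?v x) * \<bar>?v x\<bar> powr (q - 1)) * d k x)
       + c * (\<bar>?v x\<bar> powr (q - 2) * \<bar>d k x\<bar> powr 2 + \<bar>d k x\<bar> powr q) \<partial>M)"
    proof (rule integral_mono)
      show "\<bar>u (Suc k) x\<bar> powr q \<le> \<bar>?v x\<bar> powr q + q * ((sgn (?v x) * \<bar>?v x\<bar> powr (q - 1)) * d k x)
       + c * (\<bar>?v x\<bar> powr (q - 2) * \<bar>d k x\<bar> powr 2 + \<bar>d k x\<bar> powr q)" for x
        using abs_powr_add_le_taylor[OF q, of "?v x" "d k x"] by (simp add: uS c_def add.commute mult.assoc)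
    qed (use v_int i1 i2 d_int u_int in auto)
    also have "\<dots> = (\<integral>x. \<bar>?v x\<bar> powr q \<partial>M) + c * ((\<integral>x. \<bar>?v x\<bar> powr (q - 2) * \<bar>d k x\<bar> powr 2 \<partial>M) + (\<integral>x. \<bar>d k x\<bar> powr q \<partial>M))"
      using v_int i1 i2 d_int z1 by simp
    also have "\<dots> \<le> a powr q + c * (2 * a powr (q - 2) * A powr 2 + A powr q)"
      using v_le z2 dA[of k] c by (intro add_mono mult_left_mono) auto
    also have "\<dots> = A powr q * (z powr (q/2) + c * (2 * z powr (q/2 - 1) + 1))"
    proof -
      have e: "A powr (q - 2) * A powr 2 = A powr q" by (subst powr_add[symmetric]) simp
      have "a powr (q - 2) * A powr 2 = z powr (q/2 - 1) * A powr q"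
        unfolding aq mult.assoc e by (simp add: diff_divide_distrib)
      thus ?thesis unfolding aq[of q] by (simp add: algebra_simps)
    qed
    also have "\<dots> \<le> A powr q * (z powr (q/2) * (1 + (q/2) * (1/k)))"
    proof -
      have "1 \<le> z powr (q/2 - 1)" using z q by (intro ge_one_powr_ge_zero) auto
      \<comment> \<open>Origin of the factor 3 in \<open>z\<close>: the 2 from the mixed term and
        the 1 from \<open>\<bar>d k\<bar> powr q\<close> merge, and \<open>3 * c / z = 1 / k\<close>
        leaves the relative increment that Bernoulli's inequality absorbs.\<close>
      hence "c * (2 * z powr (q/2 - 1) + 1) \<le> c * (3 * z powr (q/2 - 1))" using c by (intro mult_left_mono) auto
      also have "\<dots> = z powr (q/2) * (1/k)"
        using z False c by (simp add: powr_diff z_def)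
      also have "\<dots> \<le> z powr (q/2) * ((q/2) * (1/k))"
        using q False by (intro mult_left_mono) (auto simp: field_simps)
      finally show ?thesis by (intro mult_left_mono) (auto simp: algebra_simps)
    qed
    also have "\<dots> \<le> A powr q * (z powr (q/2) * (1 + 1/k) powr (q/2))"
      using q by (intro mult_left_mono powr_bernoulli) auto
    also have "\<dots> = (3 * c * (Suc k)) powr (q/2) * A powr q"
    proof -
      have "z * (1 + 1/k) = 3 * c * Suc k" using False by (simp add: z_def field_simps)
      moreover have "z powr (q/2) * (1 + 1/k) powr (q/2) = (z * (1 + 1/k)) powr (q/2)"
        using z by (subst powr_mult) auto
      ultimately show ?thesis by simp
    qed
    finally show ?thesis by (simp add: c_def)
  qed
qed

text \<open>Doob's inequality by a potential function in place of stopping times: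
  \<open>\<Phi> k = m powr q - e * \<bar>u\<bar> * m powr (q - 1)\<close> has nonpositive integral
  for every \<open>k\<close>. Unwinding the recursion, \<open>m k\<close> is the maximum of
  \<open>\<bar>u j\<bar>\<close> at the point \<open>(G ^^ (k - j)) x\<close> over
  \<open>j \<le> k\<close>.\<close>

lemma reverse_martingale_maximal:
  fixes m :: "nat \<Rightarrow> 'a \<Rightarrow> real"
  assumes m0: "\<And>x. m 0 x = 0" and mS: "\<And>k x. m (Suc k) x = max \<bar>u (Suc k) x\<bar> (m k (G x))"
  shows "integrable M (\<lambda>x. m k x powr q) \<and> (\<integral>x. m k x powr q \<partial>M) \<le> 4 powr q * (\<integral>x. \<bar>u k x\<bar> powr q \<partial>M)"
proof -
  have m_meas [measurable]: "m k \<in> borel_measurable M" for k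
  proof (induction k)
    case (Suc k)
    have "m (Suc k) = (\<lambda>x. max \<bar>u (Suc k) x\<bar> (m k (G x)))" using mS by auto
    thus ?case using Suc by simp
  next
    case 0
    have "m 0 = (\<lambda>x. 0)" using m0 by auto
    thus ?case by simp
  qed
  have m_nonneg: "0 \<le> m k x" for k x by (cases k) (auto simp: m0 mS)
  have um: "\<bar>u k x\<bar> \<le> m k x" for k x by (cases k) (auto simp: m0 mS u0)
  have m_int: "integrable M (\<lambda>x. m k x powr q)" for k
  proof (induction k)
    case (Suc k)
    show ?case
    proof (rule Bochner_Integration.integrable_bound)
      show "integrable M (\<lambda>x. \<bar>u (Suc k) x\<bar> powr q + m k (G x) powr q)"
        using u_int integrable_G[OF Suc] by auto
    qed (auto simp: mS max_def)
  qed (simp add: m0)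
  have int1: "integrable M (\<lambda>x. \<bar>u k x\<bar> * m k x powr (q - 1))" for k
    using integrable_powr_mult[of "u k" "m k" 1 "q - 1"] u_int m_int m_nonneg q by (simp add: add.commute)
  define e where "e = q / (q - 1)"
  have e: "0 < e" "e \<le> 2" using q by (auto simp: e_def field_simps)
  \<comment> \<open>With \<open>e = q / (q - 1)\<close> the map sending \<open>m\<close> to
    \<open>m powr q - e * s * m powr (q - 1)\<close> is smallest at \<open>m = s\<close>. Hence
    raising the maximum to the new value of \<open>\<bar>u\<bar>\<close> does not increase the
    potential.\<close>
  have young: "s powr q - e * s * s powr (q - 1) \<le> m powr q - e * s * m powr (q - 1)" if "0 \<le> s" "0 \<le> m" for s m :: real
  proof (cases "s = 0 \<or> m = 0")
    case True
    have "1 \<le> e" using q by (simp add: e_def)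
    hence "s powr q \<le> e * s powr q" by (simp add: mult_le_cancel_right1)
    moreover have "s * s powr (q - 1) = s powr q" using that by (cases "s = 0") (auto simp: powr_diff)
    ultimately show ?thesis using True q by (auto simp: mult.assoc)
  next
    case False
    hence sm: "0 < s" "0 < m" using that by auto
    have "(s powr q) powr (1/q) * (m powr q) powr ((q-1)/q) \<le> 1/q * s powr q + (q-1)/q * m powr q"
      using sm q by (intro Youngs_inequality_0) (auto simp: field_simps)
    hence "s * m powr (q - 1) \<le> 1/q * s powr q + (q-1)/q * m powr q"
      using sm q by (simp add: powr_powr)
    hence "e * (s * m powr (q - 1)) \<le> e * (1/q * s powr q + (q-1)/q * m powr q)" using e by (intro mult_left_mono) auto
    also have "\<dots> = s powr q / (q - 1) + m powr q" using q by (simp add: e_def field_simps)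
    also have "s powr q / (q - 1) = e * s * s powr (q - 1) - s powr q"
      using sm q by (simp add: e_def powr_diff field_simps)
    finally show ?thesis by simp
  qed
  define \<Phi> where "\<Phi> k x = m k x powr q - e * \<bar>u k x\<bar> * m k x powr (q - 1)" for k x
  have \<Phi>_int: "integrable M (\<Phi> k)" for k
    unfolding \<Phi>_def using m_int int1[of k] by (auto simp: mult.assoc)
  have \<Phi>_le: "(\<integral>x. \<Phi> k x \<partial>M) \<le> 0" for k
  proof (induction k)
    case 0 thus ?case by (simp add: \<Phi>_def m0)
  next
    case (Suc k)
    let ?s = "\<lambda>x. d k x * (sgn (u k (G x)) * m k (G x) powr (q - 1))"
    have pw: "\<Phi> (Suc k) x \<le> \<Phi> k (G x) - e * ?s x" for x
    proof -
      have "\<Phi> (Suc k) x \<le> m k (G x) powr q - e * \<bar>u (Suc k) x\<bar> * m k (G x) powr (q - 1)"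
        using young[of "\<bar>u (Suc k) x\<bar>" "m k (G x)"] m_nonneg by (auto simp: \<Phi>_def mS max_def)
      \<comment> \<open>Supporting line of the absolute value; its slope depends on
        \<open>G x\<close> only, so the increment integrates to zero against the weight.\<close>
      moreover have "\<bar>u k (G x)\<bar> + sgn (u k (G x)) * d k x \<le> \<bar>u (Suc k) x\<bar>"
        unfolding uS by (auto simp: sgn_if)
      hence "e * m k (G x) powr (q - 1) * (\<bar>u k (G x)\<bar> + sgn (u k (G x)) * d k x) \<le> e * m k (G x) powr (q - 1) * \<bar>u (Suc k) x\<bar>"
        using e by (intro mult_left_mono) auto
      ultimately show ?thesis by (simp add: \<Phi>_def algebra_simps)
    qed
    have s_int: "integrable M ?s"
    proof (rule Bochner_Integration.integrable_bound)
      show "integrable M (\<lambda>x. \<bar>d k x\<bar> powr 1 * \<bar>m k (G x)\<bar> powr (q - 1))"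
        using d_int q integrable_G[OF m_int] m_nonneg by (intro integrable_powr_mult) auto
    qed (auto simp: abs_mult abs_sgn_eq m_nonneg)
    have "(\<integral>x. ?s x \<partial>M) = 0"
      using d_diff[of k] s_int unfolding reverse_diff_def
      by (auto dest!: bspec[of _ _ "\<lambda>y. sgn (u k y) * m k y powr (q - 1)"])
    moreover have "(\<integral>x. \<Phi> (Suc k) x \<partial>M) \<le> (\<integral>x. \<Phi> k (G x) - e * ?s x \<partial>M)"
      using \<Phi>_int integrable_G[OF \<Phi>_int] s_int pw by (intro integral_mono) auto
    ultimately have "(\<integral>x. \<Phi> (Suc k) x \<partial>M) \<le> (\<integral>x. \<Phi> k (G x) \<partial>M)"
      using integrable_G[OF \<Phi>_int] s_int by simp
    also have "\<dots> = (\<integral>x. \<Phi> k x \<partial>M)" using \<Phi>_int by (intro integral_G) auto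
    finally show ?case using Suc by simp
  qed
  \<comment> \<open>The threshold 4 leaves half of \<open>m powr q\<close> on the right; it can be
    moved to the left because \<open>m powr q\<close> is already known to be integrable.\<close>
  have pw: "e * (\<bar>u k x\<bar> * m k x powr (q - 1)) \<le> m k x powr q / 2 + 4 powr q / 2 * \<bar>u k x\<bar> powr q" for x
  proof (cases "4 * \<bar>u k x\<bar> \<le> m k x")
    case True
    have "\<bar>u k x\<bar> * m k x powr (q - 1) \<le> m k x / 4 * m k x powr (q - 1)"
      using True by (intro mult_right_mono) auto
    also have "\<dots> = m k x powr q / 4" using m_nonneg[of k x] by (cases "m k x = 0") (auto simp: powr_diff)
    finally have "e * (\<bar>u k x\<bar> * m k x powr (q - 1)) \<le> 2 * (m k x powr q / 4)"
      using e by (intro mult_mono) auto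
    thus ?thesis by (simp add: add_increasing2)
  next
    case False
    have "\<bar>u k x\<bar> * m k x powr (q - 1) \<le> \<bar>u k x\<bar> * (4 * \<bar>u k x\<bar>) powr (q - 1)"
      using False m_nonneg q by (intro mult_left_mono powr_mono2) auto
    also have "\<dots> = 4 powr q / 4 * \<bar>u k x\<bar> powr q" by (cases "u k x = 0") (auto simp: powr_diff powr_mult)
    finally have *: "\<bar>u k x\<bar> * m k x powr (q - 1) \<le> 4 powr q / 4 * \<bar>u k x\<bar> powr q" .
    have "e * (\<bar>u k x\<bar> * m k x powr (q - 1)) \<le> 2 * (\<bar>u k x\<bar> * m k x powr (q - 1))"
      using e by (intro mult_right_mono) auto
    also have "\<dots> \<le> 4 powr q / 2 * \<bar>u k x\<bar> powr q" using * by simp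
    finally show ?thesis by (simp add: add_increasing)
  qed
  have "(\<integral>x. m k x powr q \<partial>M) = (\<integral>x. \<Phi> k x \<partial>M) + (\<integral>x. e * (\<bar>u k x\<bar> * m k x powr (q - 1)) \<partial>M)"
    using m_int int1[of k] by (simp add: \<Phi>_def mult.assoc)
  also have "\<dots> \<le> 0 + (\<integral>x. m k x powr q / 2 + 4 powr q / 2 * \<bar>u k x\<bar> powr q \<partial>M)"
    using \<Phi>_le pw int1[of k] m_int u_int by (intro add_mono integral_mono) auto
  also have "\<dots> = (\<integral>x. m k x powr q \<partial>M) / 2 + 4 powr q / 2 * (\<integral>x. \<bar>u k x\<bar> powr q \<partial>M)"
    using m_int u_int by simp
  finally show ?thesis using m_int by simp
qed

end

end

lemma abs_integral_le:
  fixes f g :: "'a \<Rightarrow> real"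
  assumes "f \<in> borel_measurable M" "integrable M g" "AE x in M. \<bar>f x\<bar> \<le> g x"
  shows "integrable M f" "\<bar>\<integral>x. f x \<partial>M\<bar> \<le> (\<integral>x. g x \<partial>M)"
proof -
  show i: "integrable M f"
    using assms by (intro Bochner_Integration.integrable_bound[OF assms(2,1)]) auto
  have "\<bar>\<integral>x. f x \<partial>M\<bar> \<le> (\<integral>x. \<bar>f x\<bar> \<partial>M)" by (rule integral_abs_bound)
  also have "\<dots> \<le> (\<integral>x. g x \<partial>M)" using i assms by (intro integral_mono_AE) auto
  finally show "\<bar>\<integral>x. f x \<partial>M\<bar> \<le> (\<integral>x. g x \<partial>M)" .
qed

section \<open>The transfer operator of a Gibbs--Markov map\<close>

lemma gp_eSuc: "0 < \<theta> \<Longrightarrow> gp \<theta> (eSuc s) 0 = \<theta> * gp \<theta> s 0"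
  by (cases s) (simp_all add: gp_def eSuc_enat powr_add add.commute)

lemma gp_nonneg: "0 \<le> gp \<theta> s k"
  by (auto simp: gp_def split: enat.split)

lemma gp_le_one: "0 < \<theta> \<Longrightarrow> \<theta> < 1 \<Longrightarrow> gp \<theta> s 0 \<le> 1"
  by (auto simp: gp_def powr_realpow power_le_one split: enat.split)

lemma sep_time_eSuc:
  assumes "a \<in> P" "x \<in> a" "y \<in> a"
  shows "sep_time P G x y = eSuc (sep_time P G (G x) (G y))"
proof -
  let ?Q = "\<lambda>n. \<not> (\<exists>a\<in>P. (G ^^ n) x \<in> a \<and> (G ^^ n) y \<in> a)"
  let ?R = "\<lambda>n. \<not> (\<exists>a\<in>P. (G ^^ n) (G x) \<in> a \<and> (G ^^ n) (G y) \<in> a)"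
  have Q0: "\<not> ?Q 0" using assms by auto
  have S: "?Q (Suc n) = ?R n" for n by (simp add: funpow_swap1)
  have ex: "(\<exists>n. ?Q n) = (\<exists>n. ?R n)" using Q0 S by (metis not0_implies_Suc)
  show ?thesis
  proof (cases "\<exists>n. ?Q n")
    case True
    then obtain n where n: "?Q n" ..
    have "(LEAST n. ?Q n) = Suc (LEAST n. ?Q (Suc n))" by (rule Least_Suc[OF n Q0])
    hence "(LEAST n. ?Q n) = Suc (LEAST n. ?R n)" unfolding S .
    moreover have "\<exists>n. ?R n" using True ex by (simp only:)
    ultimately show ?thesis unfolding sep_time_def using True by (simp only: if_True eSuc_enat)
  next
    case False
    hence "\<not> (\<exists>n. ?R n)" using ex by (simp only: not_not simp_thms)
    thus ?thesis unfolding sep_time_def using False by (simp only: if_False eSuc_infinity)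
  qed
qed

locale gm_system = mpt M G for M :: "'b measure" and G :: "'b \<Rightarrow> 'b" +
  fixes P :: "'b set set" and g :: "'b \<Rightarrow> real" and \<theta> Cd c0 :: real
  assumes erg: "\<And>A. A \<in> sets M \<Longrightarrow> G -` A \<inter> space M = A \<Longrightarrow> measure M A = 0 \<or> measure M A = 1"
    and P_count: "countable P" and P_sets: "\<And>a. a \<in> P \<Longrightarrow> a \<in> sets M" and P_disj: "disjoint P"
    and P_pos: "\<And>a. a \<in> P \<Longrightarrow> 0 < measure M a" and P_cover: "emeasure M (space M - \<Union>P) = 0"
    and G_inj: "\<And>a. a \<in> P \<Longrightarrow> inj_on G a"
    and G_img: "\<And>a A. a \<in> P \<Longrightarrow> A \<in> sets M \<Longrightarrow> A \<subseteq> a \<Longrightarrow> G ` A \<in> sets M"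
    and markov: "\<And>a. a \<in> P \<Longrightarrow> \<exists>Q\<subseteq>P. emeasure M (G ` a - \<Union>Q) = 0 \<and> emeasure M (\<Union>Q - G ` a) = 0"
    and c0: "0 < c0" and big: "\<And>a. a \<in> P \<Longrightarrow> c0 \<le> measure M (G ` a)"
    and \<theta>: "0 < \<theta>" "\<theta> < 1" and Cd: "0 \<le> Cd"
    and g_meas [measurable]: "g \<in> borel_measurable M" and g_pos: "\<And>x. x \<in> space M \<Longrightarrow> 0 < g x"
    and jac: "\<And>a A. a \<in> P \<Longrightarrow> A \<in> sets M \<Longrightarrow> A \<subseteq> a \<Longrightarrow>
        emeasure M A = (\<integral>\<^sup>+ z\<in>G ` A. ennreal (g (the_inv_into a G z)) \<partial>M)"
    and dist: "\<And>a x y. a \<in> P \<Longrightarrow> x \<in> a \<Longrightarrow> y \<in> a \<Longrightarrow>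
        \<bar>ln (g x) - ln (g y)\<bar> \<le> Cd * gp \<theta> (sep_time P G x y) 0"
begin

section \<open>Separation metric, inverse branches and change of variables\<close>

definition rho :: "'b \<Rightarrow> 'b \<Rightarrow> real" where "rho x y = gp \<theta> (sep_time P G x y) 0"

lemma rho_nonneg: "0 \<le> rho x y" by (simp add: rho_def gp_nonneg)
lemma rho_le_one: "rho x y \<le> 1" using \<theta> by (simp add: rho_def gp_le_one)
lemma rho_step: "a \<in> P \<Longrightarrow> x \<in> a \<Longrightarrow> y \<in> a \<Longrightarrow> rho x y = \<theta> * rho (G x) (G y)"
  unfolding rho_def by (subst sep_time_eSuc[of a]) (use \<theta> in \<open>auto simp: gp_eSuc\<close>)

lemma P_sub: "a \<in> P \<Longrightarrow> a \<subseteq> space M" using P_sets sets.sets_into_space by blast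
lemma P_ne: "a \<in> P \<Longrightarrow> a \<noteq> {}" using P_pos by force
lemma P_eq: "a \<in> P \<Longrightarrow> b \<in> P \<Longrightarrow> x \<in> a \<Longrightarrow> x \<in> b \<Longrightarrow> a = b"
  using P_disj by (auto simp: disjoint_def)
lemma UP_sets [measurable]: "\<Union>P \<in> sets M" using P_count P_sets by (intro sets.countable_Union) auto
lemma AE_UP: "AE x in M. x \<in> \<Union>P" using P_cover by (intro AE_I[of _ _ "space M - \<Union>P"]) auto
lemma Ga_sets [measurable]: "a \<in> P \<Longrightarrow> G ` a \<in> sets M" using G_img P_sets by auto

text \<open>Inverse branch of \<open>G\<close> on \<open>a\<close>; off \<open>G ` a\<close> it takes an arbitrary value in \<open>a\<close>, which the weight \<open>jw a\<close>
  below annihilates.\<close>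

definition br :: "'b set \<Rightarrow> 'b \<Rightarrow> 'b" where
  "br a z = (if z \<in> G ` a then the_inv_into a G z else (SOME x. x \<in> a))"

lemma br_in: "a \<in> P \<Longrightarrow> br a z \<in> a"
  using G_inj P_ne by (auto simp: br_def the_inv_into_f_f some_in_eq)
lemma br_space: "a \<in> P \<Longrightarrow> br a z \<in> space M" using br_in P_sub by blast
lemma G_br: "a \<in> P \<Longrightarrow> z \<in> G ` a \<Longrightarrow> G (br a z) = z"
  using G_inj by (auto simp: br_def the_inv_into_f_f)
lemma br_G: "a \<in> P \<Longrightarrow> x \<in> a \<Longrightarrow> br a (G x) = x"
  using G_inj by (auto simp: br_def the_inv_into_f_f)

lemma br_meas [measurable]: assumes a: "a \<in> P" shows "br a \<in> measurable M M"
proof (rule measurableI)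
  fix B assume B: "B \<in> sets M"
  have [measurable]: "G ` (a \<inter> B) \<in> sets M" using a B P_sets by (intro G_img[of a]) auto
  have [measurable]: "G ` a \<in> sets M" using a by simp
  have "br a -` B \<inter> space M = G ` (a \<inter> B) \<union> (if (SOME x. x \<in> a) \<in> B then space M - G ` a else {})"
  proof (rule set_eqI)
    fix z
    show "z \<in> br a -` B \<inter> space M \<longleftrightarrow> z \<in> G ` (a \<inter> B) \<union> (if (SOME x. x \<in> a) \<in> B then space M - G ` a else {})"
    proof (cases "z \<in> G ` a")
      case True
      then obtain x where x: "x \<in> a" "z = G x" by auto
      have "z \<in> space M" using True Ga_sets[OF a] sets.sets_into_space by blast
      moreover have "z \<in> G ` (a \<inter> B) \<longleftrightarrow> x \<in> B" using x G_inj[OF a] by (auto dest: inj_onD)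
      ultimately show ?thesis using True br_G[OF a x(1)] x(2) by simp
    next
      case False
      hence "z \<notin> G ` (a \<inter> B)" by blast
      thus ?thesis using False by (simp add: br_def)
    qed
  qed
  thus "br a -` B \<inter> space M \<in> sets M" by auto
qed (use br_space a in auto)

definition jw :: "'b set \<Rightarrow> 'b \<Rightarrow> real" where "jw a z = indicator (G ` a) z * g (br a z)"

lemma jw_meas [measurable]: "a \<in> P \<Longrightarrow> jw a \<in> borel_measurable M"
  unfolding jw_def by measurable

lemma jw_nonneg: "a \<in> P \<Longrightarrow> 0 \<le> jw a z"
  using g_pos[OF br_space] by (auto simp: jw_def indicator_def less_imp_le)

text \<open>The Jacobian formula on subsets of \<open>a\<close>, stated as an equality of measures;
  integrals and integrability over a branch then both follow from the rules for densities and image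
  measures.\<close>

lemma branch_measure: assumes a: "a \<in> P"
  shows "distr (density M (\<lambda>z. ennreal (jw a z))) M (br a) = density M (\<lambda>x. ennreal (indicator a x))"
proof (rule measure_eqI)
  fix B assume "B \<in> sets (distr (density M (\<lambda>z. ennreal (jw a z))) M (br a))"
  hence B [measurable]: "B \<in> sets M" by simp
  have [measurable]: "a \<in> sets M" "br a \<in> measurable M M" using a P_sets by auto
  have [measurable]: "jw a \<in> borel_measurable M" using a by simp
  have "emeasure (distr (density M (\<lambda>z. ennreal (jw a z))) M (br a)) B
      = (\<integral>\<^sup>+ z. ennreal (jw a z) * indicator (br a -` B \<inter> space M) z \<partial>M)"
    by (subst emeasure_distr) (auto simp: emeasure_density)
  also have "\<dots> = (\<integral>\<^sup>+ z\<in>G ` (a \<inter> B). ennreal (g (the_inv_into a G z)) \<partial>M)"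
  proof (rule nn_integral_cong)
    fix z assume z: "z \<in> space M"
    show "ennreal (jw a z) * indicator (br a -` B \<inter> space M) z
      = ennreal (g (the_inv_into a G z)) * indicator (G ` (a \<inter> B)) z"
    proof (cases "z \<in> G ` a")
      case True
      then obtain x where x: "x \<in> a" "z = G x" by auto
      have "z \<in> G ` (a \<inter> B) \<longleftrightarrow> x \<in> B" using x G_inj[OF a] by (auto dest: inj_onD)
      thus ?thesis using True x z br_G[OF a] G_inj[OF a]
        by (auto simp: jw_def the_inv_into_f_f split: split_indicator)
    next
      case False
      hence "z \<notin> G ` (a \<inter> B)" by blast
      thus ?thesis using False by (simp add: jw_def)
    qed
  qed
  also have "\<dots> = emeasure M (a \<inter> B)" using a by (intro jac[symmetric]) auto
  also have "\<dots> = emeasure (density M (\<lambda>x. ennreal (indicator a x))) B"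
    by (subst emeasure_density) (auto simp: ennreal_indicator nn_integral_indicator[symmetric] indicator_inter_arith
        simp del: nn_integral_indicator)
  finally show "emeasure (distr (density M (\<lambda>z. ennreal (jw a z))) M (br a)) B = emeasure (density M (\<lambda>x. ennreal (indicator a x))) B" .
qed auto

lemma branch_integral:
  fixes v :: "'b \<Rightarrow> real"
  assumes a: "a \<in> P" and [measurable]: "v \<in> borel_measurable M"
  shows "(\<integral>z. jw a z * v (br a z) \<partial>M) = (\<integral>x. indicator a x * v x \<partial>M)"
    and "integrable M (\<lambda>z. jw a z * v (br a z)) \<longleftrightarrow> integrable M (\<lambda>x. indicator a x * v x)"
proof -
  have [measurable]: "a \<in> sets M" "br a \<in> measurable M M" using a P_sets by auto
  have [measurable]: "jw a \<in> borel_measurable M" using a by simp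
  have nn: "AE z in M. 0 \<le> jw a z" using jw_nonneg[OF a] by auto
  have "(\<integral>z. jw a z * v (br a z) \<partial>M) = integral\<^sup>L (density M (\<lambda>z. ennreal (jw a z))) (\<lambda>z. v (br a z))"
    using nn by (subst integral_density) auto
  also have "\<dots> = integral\<^sup>L (distr (density M (\<lambda>z. ennreal (jw a z))) M (br a)) v"
    by (subst integral_distr) auto
  also have "\<dots> = (\<integral>x. indicator a x * v x \<partial>M)"
    unfolding branch_measure[OF a] by (subst integral_density) auto
  finally show "(\<integral>z. jw a z * v (br a z) \<partial>M) = (\<integral>x. indicator a x * v x \<partial>M)" .
  have "integrable M (\<lambda>z. jw a z * v (br a z)) \<longleftrightarrow> integrable (density M (\<lambda>z. ennreal (jw a z))) (\<lambda>z. v (br a z))"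
    using nn by (subst integrable_density) auto
  also have "\<dots> \<longleftrightarrow> integrable (distr (density M (\<lambda>z. ennreal (jw a z))) M (br a)) v"
    by (subst integrable_distr_eq) auto
  also have "\<dots> \<longleftrightarrow> integrable M (\<lambda>x. indicator a x * v x)"
    unfolding branch_measure[OF a] by (subst integrable_density) auto
  finally show "integrable M (\<lambda>z. jw a z * v (br a z)) \<longleftrightarrow> integrable M (\<lambda>x. indicator a x * v x)" .
qed

section \<open>The transfer operator and its duality\<close>

abbreviation "CP \<equiv> count_space P"

lemma psf: "pair_sigma_finite CP M"
  using sigma_finite_measure_count_space_countable[OF P_count] sigma_finite_measure_axioms
  by (rule pair_sigma_finite.intro)

text \<open>At most one partition element contains \<open>x\<close>, so the sum over the partition
  has one term. Sums over branches are integrals over counting measure, which makes Fubini and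
  domination available for them.\<close>

lemma one_point:
  fixes c :: real
  shows "integrable CP (\<lambda>a. indicator a x * c)"
    and "(\<integral>a. indicator a x * c \<partial>CP) = indicator (\<Union>P) x * c"
    and "(\<integral>\<^sup>+a. ennreal (norm (indicator a x * c)) \<partial>CP) \<le> ennreal \<bar>c\<bar>"
proof -
  have *: "(\<integral>\<^sup>+a. ennreal (norm (indicator a x * c)) \<partial>CP) \<le> ennreal \<bar>c\<bar>"
  proof (cases "x \<in> \<Union>P")
    case True
    then obtain a0 where a0: "a0 \<in> P" "x \<in> a0" by auto
    have ne: "x \<notin> a" if "a \<in> P" "a \<noteq> a0" for a using P_eq a0 that by blast
    have "(\<integral>\<^sup>+a. ennreal (norm (indicator a x * c)) \<partial>CP) = (\<Sum>a\<in>{a0}. ennreal (norm (indicator a x * c)))"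
      using a0 ne by (intro nn_integral_count_space') (auto simp: indicator_def)
    thus ?thesis using a0 by simp
  next
    case False
    have "(\<integral>\<^sup>+a. ennreal (norm (indicator a x * c)) \<partial>CP) = (\<Sum>a\<in>{}. ennreal (norm (indicator a x * c)))"
      using False by (intro nn_integral_count_space') (auto simp: indicator_def)
    thus ?thesis by simp
  qed
  thus "(\<integral>\<^sup>+a. ennreal (norm (indicator a x * c)) \<partial>CP) \<le> ennreal \<bar>c\<bar>" .
  have "(\<integral>\<^sup>+a. ennreal (norm (indicator a x * c)) \<partial>CP) < \<infinity>" by (rule le_less_trans[OF *]) simp
  thus "integrable CP (\<lambda>a. indicator a x * c)" unfolding integrable_iff_bounded by simp
  show "(\<integral>a. indicator a x * c \<partial>CP) = indicator (\<Union>P) x * c"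
  proof (cases "x \<in> \<Union>P \<and> c \<noteq> 0")
    case True
    then obtain a0 where a0: "a0 \<in> P" "x \<in> a0" by auto
    have ne: "x \<notin> a" if "a \<in> P" "a \<noteq> a0" for a using P_eq a0 that by blast
    have "indicator a x * c \<noteq> 0 \<longleftrightarrow> a = a0" if "a \<in> P" for a
      using True a0 ne[OF that] by (cases "a = a0") simp_all
    hence eq: "{a \<in> P. indicator a x * c \<noteq> 0} = {a0}" using a0(1) by blast
    have "(\<integral>a. indicator a x * c \<partial>CP) = (\<Sum>a | a \<in> P \<and> indicator a x * c \<noteq> 0. indicator a x * c)"
      by (rule lebesgue_integral_count_space_finite_support, unfold eq) simp
    also have "\<dots> = indicator a0 x * c" unfolding eq
      by (simp only: sum.insert_if finite.emptyI empty_iff if_False sum.empty add_0_right)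
    finally show ?thesis using True a0 by simp
  next
    case False
    hence "indicator a x * c = 0" if "a \<in> P" for a using that by (auto simp: indicator_def)
    hence "(\<integral>a. indicator a x * c \<partial>CP) = (\<integral>a. 0 \<partial>CP)"
      by (intro Bochner_Integration.integral_cong) auto
    thus ?thesis using False by auto
  qed
qed

lemma partition_product:
  fixes w :: "'b \<Rightarrow> real"
  assumes w: "integrable M w"
  shows "integrable (CP \<Otimes>\<^sub>M M) (\<lambda>(a, x). indicator a x * w x)"
proof -
  interpret Q: pair_sigma_finite CP M by (rule psf)
  have wm [measurable]: "w \<in> borel_measurable M" using w by auto
  have m [measurable]: "(\<lambda>(a, x). indicator a x * w x) \<in> borel_measurable (CP \<Otimes>\<^sub>M M)"
    using P_count P_sets by (intro measurable_pair_measure_countable1) auto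
  have "(\<integral>\<^sup>+ p. ennreal (norm (case p of (a, x) \<Rightarrow> indicator a x * w x)) \<partial>(CP \<Otimes>\<^sub>M M))
    = (\<integral>\<^sup>+ x. (\<integral>\<^sup>+ a. ennreal (norm (indicator a x * w x)) \<partial>CP) \<partial>M)"
    by (subst Q.nn_integral_snd[symmetric]) auto
  also have "\<dots> \<le> (\<integral>\<^sup>+ x. ennreal \<bar>w x\<bar> \<partial>M)" by (intro nn_integral_mono one_point)
  also have "\<dots> < \<infinity>" using w by (auto simp: integrable_iff_bounded)
  finally show ?thesis using m by (auto simp: integrable_iff_bounded)
qed

lemma partition_sum:
  fixes w :: "'b \<Rightarrow> real"
  assumes w: "integrable M w"
  shows "integrable CP (\<lambda>a. \<integral>x. indicator a x * w x \<partial>M)"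
    and "(\<integral>a. (\<integral>x. indicator a x * w x \<partial>M) \<partial>CP) = (\<integral>x. w x \<partial>M)"
proof -
  interpret Q: pair_sigma_finite CP M by (rule psf)
  show "integrable CP (\<lambda>a. \<integral>x. indicator a x * w x \<partial>M)"
    using Q.integrable_fst[OF partition_product[OF w]] by simp
  have "(\<integral>a. (\<integral>x. indicator a x * w x \<partial>M) \<partial>CP) = (\<integral>x. (\<integral>a. indicator a x * w x \<partial>CP) \<partial>M)"
    using Q.Fubini_integral[OF partition_product[OF w]] by simp
  also have "\<dots> = (\<integral>x. w x \<partial>M)"
    using w AE_UP unfolding one_point by (intro integral_cong_AE) auto
  finally show "(\<integral>a. (\<integral>x. indicator a x * w x \<partial>M) \<partial>CP) = (\<integral>x. w x \<partial>M)" .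
qed

text \<open>The transfer operator with respect to the invariant measure. As an integral over
  counting measure it has value 0 wherever the series over branches is not absolutely
  summable.\<close>

definition L :: "('b \<Rightarrow> real) \<Rightarrow> 'b \<Rightarrow> real" where
  "L \<phi> z = (\<integral>a. jw a z * \<phi> (br a z) \<partial>CP)"

lemma L_product_meas:
  assumes [measurable]: "\<phi> \<in> borel_measurable M" "\<psi> \<in> borel_measurable M"
  shows "(\<lambda>(a, z). jw a z * \<phi> (br a z) * \<psi> z) \<in> borel_measurable (CP \<Otimes>\<^sub>M M)"
proof (rule measurable_pair_measure_countable1[OF P_count])
  fix a assume "a \<in> P"
  hence [measurable]: "jw a \<in> borel_measurable M" "br a \<in> measurable M M" by simp_all
  show "(\<lambda>z. case (a, z) of (a, z) \<Rightarrow> jw a z * \<phi> (br a z) * \<psi> z) \<in> borel_measurable M" by simp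
qed

lemma L_meas:
  assumes [measurable]: "\<phi> \<in> borel_measurable M"
  shows "L \<phi> \<in> borel_measurable M"
proof -
  have m: "(\<lambda>(a, z). jw a z * \<phi> (br a z) * 1) \<in> borel_measurable (CP \<Otimes>\<^sub>M M)"
    by (rule L_product_meas) auto
  have m2: "(\<lambda>(z, a). jw a z * \<phi> (br a z)) \<in> borel_measurable (M \<Otimes>\<^sub>M CP)"
    using measurable_compose[OF measurable_pair_swap' m] by (simp add: split_beta')
  have "(\<lambda>z. \<integral>a. jw a z * \<phi> (br a z) \<partial>CP) \<in> borel_measurable M"
    by (rule sigma_finite_measure.borel_measurable_lebesgue_integral
        [OF sigma_finite_measure_count_space_countable[OF P_count] m2])
  thus ?thesis unfolding L_def[abs_def] .
qed

text \<open>Fubini on partition times space, with the change of variables on each branch. The test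
  function is bounded only almost everywhere, because \<open>near_invariance\<close> takes the
  function itself as a test.\<close>

lemma L_dual:
  assumes \<phi>: "integrable M \<phi>" and \<psi> [measurable]: "\<psi> \<in> borel_measurable M" and B: "AE x in M. \<bar>\<psi> x\<bar> \<le> B"
  shows "(\<integral>z. L \<phi> z * \<psi> z \<partial>M) = (\<integral>x. \<phi> x * \<psi> (G x) \<partial>M)" and "integrable M (\<lambda>z. L \<phi> z * \<psi> z)"
proof -
  interpret Q: pair_sigma_finite CP M by (rule psf)
  have [measurable]: "\<phi> \<in> borel_measurable M" using \<phi> by auto
  define w where "w x = \<phi> x * \<psi> (G x)" for x
  have w_meas [measurable]: "w \<in> borel_measurable M" unfolding w_def by measurable
  have w: "integrable M w"
  proof (rule Bochner_Integration.integrable_bound[OF integrable_mult_right[OF \<phi>, of B] w_meas])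
    show "AE x in M. norm (w x) \<le> norm (B * \<phi> x)"
      using AE_G[OF B]
    proof eventually_elim
      case (elim x)
      hence "\<bar>\<phi> x\<bar> * \<bar>\<psi> (G x)\<bar> \<le> \<bar>\<phi> x\<bar> * B" "0 \<le> B" by (auto intro: mult_left_mono)
      thus ?case by (simp add: w_def abs_mult mult.commute)
    qed
  qed
  have eq: "jw a z * \<phi> (br a z) * \<psi> z = jw a z * w (br a z)" if "a \<in> P" for a z
    using that G_br[OF that, of z] by (auto simp: w_def jw_def indicator_def)
  have aw: "integrable M (\<lambda>x. indicator a x * w x)" if "a \<in> P" for a
    using integrable_mult_indicator[OF P_sets[OF that] w] by simp
  have f2: "integrable (CP \<Otimes>\<^sub>M M) (\<lambda>(a, z). jw a z * \<phi> (br a z) * \<psi> z)"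
  proof (rule Q.Fubini_integrable)
    show "(\<lambda>(a, z). jw a z * \<phi> (br a z) * \<psi> z) \<in> borel_measurable (CP \<Otimes>\<^sub>M M)" by (rule L_product_meas) auto
    have "(\<integral>z. norm (jw a z * \<phi> (br a z) * \<psi> z) \<partial>M) = (\<integral>x. indicator a x * \<bar>w x\<bar> \<partial>M)" if a: "a \<in> P" for a
      using branch_integral(1)[OF a, of "\<lambda>x. \<bar>w x\<bar>"] jw_nonneg[OF a] by (simp add: eq[OF a] abs_mult)
    hence "integrable CP (\<lambda>a. \<integral>z. norm (jw a z * \<phi> (br a z) * \<psi> z) \<partial>M) \<longleftrightarrow> integrable CP (\<lambda>a. \<integral>x. indicator a x * \<bar>w x\<bar> \<partial>M)"
      by (intro Bochner_Integration.integrable_cong) auto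
    thus "integrable CP (\<lambda>a. \<integral>z. norm (case (a, z) of (a, z) \<Rightarrow> jw a z * \<phi> (br a z) * \<psi> z) \<partial>M)"
      using partition_sum(1)[of "\<lambda>x. \<bar>w x\<bar>"] w by auto
    have "integrable M (\<lambda>z. jw a z * \<phi> (br a z) * \<psi> z)" if a: "a \<in> P" for a
      using branch_integral(2)[OF a w_meas] aw[OF a] by (simp add: eq[OF a])
    thus "AE a in CP. integrable M (\<lambda>z. case (a, z) of (a, z) \<Rightarrow> jw a z * \<phi> (br a z) * \<psi> z)"
      by (auto simp: AE_count_space)
  qed
  have Leq: "L \<phi> z * \<psi> z = (\<integral>a. jw a z * \<phi> (br a z) * \<psi> z \<partial>CP)" for z
    by (simp add: L_def)
  show "integrable M (\<lambda>z. L \<phi> z * \<psi> z)" unfolding Leq using Q.integrable_snd[OF f2] by simp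
  have "(\<integral>z. L \<phi> z * \<psi> z \<partial>M) = (\<integral>a. (\<integral>z. jw a z * \<phi> (br a z) * \<psi> z \<partial>M) \<partial>CP)"
    unfolding Leq using Q.Fubini_integral[OF f2] by simp
  also have "\<dots> = (\<integral>a. (\<integral>x. indicator a x * w x \<partial>M) \<partial>CP)"
    by (rule Bochner_Integration.integral_cong[OF refl]) (simp add: eq branch_integral(1))
  also have "\<dots> = (\<integral>x. w x \<partial>M)" by (rule partition_sum(2)[OF w])
  finally show "(\<integral>z. L \<phi> z * \<psi> z \<partial>M) = (\<integral>x. \<phi> x * \<psi> (G x) \<partial>M)" by (simp add: w_def)
qed

text \<open>Test the duality against the sign of \<open>L 1 - 1\<close>: invariance of the measure
  turns the result into \<open>\<integral>\<bar>L 1 - 1\<bar> = 0\<close>.\<close>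

lemma L_one: "AE z in M. L (\<lambda>_. 1) z = 1"
proof -
  define \<psi> where "\<psi> z = sgn (L (\<lambda>_. 1) z - 1)" for z
  have L1 [measurable]: "L (\<lambda>_. 1) \<in> borel_measurable M" by (rule L_meas) simp
  have [measurable]: "\<psi> \<in> borel_measurable M" unfolding \<psi>_def by measurable
  have b: "\<bar>\<psi> z\<bar> \<le> 1" for z by (simp add: \<psi>_def abs_sgn_eq)
  have "AE z in M. \<bar>\<psi> z\<bar> \<le> 1" using b by simp
  note d = L_dual[of "\<lambda>_. 1" \<psi> 1, OF _ _ this]
  have i: "integrable M \<psi>" using b by (intro integrable_const_bound[of _ 1]) auto
  have "(\<integral>z. L (\<lambda>_. 1) z * \<psi> z \<partial>M) = (\<integral>z. \<psi> z \<partial>M)"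
    using d(1) integral_G[of \<psi>] by simp
  hence "(\<integral>z. \<bar>L (\<lambda>_. 1) z - 1\<bar> \<partial>M) = 0"
    using d(2) i unfolding \<psi>_def[abs_def] by (simp add: abs_sgn left_diff_distrib)
  moreover have "integrable M (\<lambda>z. \<bar>L (\<lambda>_. 1) z - 1\<bar>)"
    using L_dual(2)[of "\<lambda>_. 1" "\<lambda>_. 1" 1] by simp
  ultimately have "AE z in M. \<bar>L (\<lambda>_. 1) z - 1\<bar> = 0" by (subst (asm) integral_nonneg_eq_0_iff_AE) auto
  thus ?thesis by auto
qed

section \<open>Bounded distortion\<close>

definition "K1 = Cd * exp Cd"
definition "K2 = exp Cd / c0"

lemma K1: "0 \<le> K1" using Cd by (simp add: K1_def)
lemma K2: "0 < K2" using c0 by (simp add: K2_def)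

text \<open>The bound on the logarithms becomes a relative Lipschitz bound through \<open>\<bar>1 -
  exp u\<bar> \<le> \<bar>u\<bar> * exp \<bar>u\<bar>\<close>, where
  \<open>\<bar>u\<bar> \<le> Cd\<close> since \<open>rho \<le> 1\<close>.\<close>

lemma g_diff:
  assumes a: "a \<in> P" "x \<in> a" "y \<in> a"
  shows "\<bar>g x - g y\<bar> \<le> K1 * g x * rho x y" and "g x \<le> exp Cd * g y"
proof -
  have xy: "0 < g x" "0 < g y" using a(2,3) P_sub[OF a(1)] by (auto intro: g_pos)
  define u where "u = ln (g y) - ln (g x)"
  have u: "\<bar>u\<bar> \<le> Cd * rho x y" using dist[OF a] by (simp add: u_def rho_def)
  have u2: "\<bar>u\<bar> \<le> Cd" using u rho_le_one[of x y] Cd mult_left_mono[of "rho x y" 1 Cd] by linarith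
  have gy: "g y = g x * exp u" using xy by (simp add: u_def exp_diff)
  have "\<bar>1 - exp u\<bar> \<le> \<bar>u\<bar> * exp \<bar>u\<bar>"
  proof (cases "0 \<le> u")
    case True
    have "1 - u \<le> exp (-u)" using exp_ge_add_one_self[of "-u"] by simp
    hence "exp u * (1 - u) \<le> exp u * exp (-u)" by (intro mult_left_mono) auto
    hence "exp u - 1 \<le> u * exp u" by (simp add: exp_minus algebra_simps)
    thus ?thesis using True by auto
  next
    case False
    have "1 - exp u \<le> - u" using exp_ge_add_one_self[of u] by linarith
    also have "\<dots> \<le> - u * exp (-u)" using False by (simp add: mult_le_cancel_left1)
    finally show ?thesis using False by auto
  qed
  also have "\<dots> \<le> (Cd * rho x y) * exp Cd"
    using u u2 Cd rho_nonneg by (intro mult_mono) auto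
  finally have "g x * \<bar>1 - exp u\<bar> \<le> g x * (Cd * rho x y * exp Cd)" using xy by (intro mult_left_mono) auto
  moreover have "\<bar>g x - g y\<bar> = g x * \<bar>1 - exp u\<bar>" using xy unfolding gy
    by (metis abs_mult abs_of_pos mult.right_neutral right_diff_distrib)
  ultimately show "\<bar>g x - g y\<bar> \<le> K1 * g x * rho x y" by (simp add: K1_def algebra_simps)
  have "g x = g y * exp (- u)" by (simp add: gy exp_minus)
  also have "\<dots> \<le> g y * exp Cd" using xy u2 by (intro mult_left_mono) auto
  finally show "g x \<le> exp Cd * g y" by (simp add: mult.commute)
qed

text \<open>The measure of \<open>a\<close> is the integral of the inverse Jacobian over
  \<open>G\<close> a\<open>; distortion makes that Jacobian comparable to\<close>g
  x\<open>, and big images bound the measure of\<close>G \<open>a\<close> below by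
  \<open>c0\<close>.\<close>

lemma g_le: assumes a: "a \<in> P" "x \<in> a" shows "g x \<le> K2 * measure M a"
proof -
  have "measure M a = (\<integral>x. indicator a x * 1 \<partial>M)" using a P_sets by simp
  also have "\<dots> = (\<integral>z. jw a z \<partial>M)" using branch_integral(1)[OF a(1), of "\<lambda>_. 1"] by simp
  finally have 1: "measure M a = (\<integral>z. jw a z \<partial>M)" .
  have i: "integrable M (jw a)" using branch_integral(2)[OF a(1), of "\<lambda>_. 1"] a P_sets
    by (simp add: integrable_real_indicator less_top[symmetric])
  have "(g x / exp Cd) * measure M (G ` a) = (\<integral>z. indicator (G ` a) z * (g x / exp Cd) \<partial>M)"
    using a by simp
  also have "\<dots> \<le> (\<integral>z. jw a z \<partial>M)"
  proof (rule integral_mono)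
    show "integrable M (\<lambda>z. indicator (G ` a) z * (g x / exp Cd))"
      using a by (intro integrable_mult_left) (simp add: integrable_real_indicator less_top[symmetric])
    show "indicator (G ` a) z * (g x / exp Cd) \<le> jw a z" for z
      using g_diff(2)[OF a(1,2) br_in[OF a(1)], of z] by (auto simp: jw_def indicator_def field_simps)
  qed (rule i)
  finally have 2: "g x / exp Cd * measure M (G ` a) \<le> measure M a" using 1 by simp
  have "0 < g x" using a(2) P_sub[OF a(1)] by (auto intro: g_pos)
  hence "g x / exp Cd * c0 \<le> g x / exp Cd * measure M (G ` a)" using big[OF a(1)] by (intro mult_left_mono) auto
  thus ?thesis using 2 c0 by (simp add: K2_def field_simps)
qed

end

text \<open>The set of points that visit \<open>B\<close> infinitely often is strictly invariant, as
  the definition of ergodicity demands. Each tail set \<open>U k\<close> contains a preimage of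
  \<open>B\<close>, so the intersection has measure at least that of \<open>B\<close>, hence
  1.\<close>

lemma (in mpt) ergodic_hits:
  assumes erg: "\<And>A. A \<in> sets M \<Longrightarrow> G -` A \<inter> space M = A \<Longrightarrow> measure M A = 0 \<or> measure M A = 1"
    and B [measurable]: "B \<in> sets M" and pos: "0 < measure M B"
  shows "AE x in M. \<exists>n. (G ^^ n) x \<in> B"
proof -
  define U where "U k = (\<Union>n\<in>{k..}. (G ^^ n) -` B \<inter> space M)" for k
  have U [measurable]: "U k \<in> sets M" for k unfolding U_def by measurable
  define A where "A = (\<Inter>k. U k)"
  have A [measurable]: "A \<in> sets M" unfolding A_def by measurable
  have inU: "x \<in> U k \<longleftrightarrow> x \<in> space M \<and> (\<exists>n\<ge>k. (G ^^ n) x \<in> B)" for x k by (auto simp: U_def)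
  have inv: "G -` A \<inter> space M = A"
  proof (rule set_eqI)
    fix x
    have shift: "(\<exists>n\<ge>k. (G ^^ n) (G x) \<in> B) \<longleftrightarrow> (\<exists>n\<ge>Suc k. (G ^^ n) x \<in> B)" for k
    proof
      assume "\<exists>n\<ge>k. (G ^^ n) (G x) \<in> B"
      then obtain n where "n \<ge> k" "(G ^^ n) (G x) \<in> B" by blast
      hence "Suc n \<ge> Suc k \<and> (G ^^ Suc n) x \<in> B" by (simp add: funpow_swap1)
      thus "\<exists>n\<ge>Suc k. (G ^^ n) x \<in> B" by blast
    next
      assume "\<exists>n\<ge>Suc k. (G ^^ n) x \<in> B"
      then obtain n where n: "n \<ge> Suc k" "(G ^^ n) x \<in> B" by blast
      then obtain n' where "n = Suc n'" by (cases n) auto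
      hence "n' \<ge> k \<and> (G ^^ n') (G x) \<in> B" using n by (simp add: funpow_swap1)
      thus "\<exists>n\<ge>k. (G ^^ n) (G x) \<in> B" by blast
    qed
    have "x \<in> space M \<Longrightarrow> G x \<in> space M" using G_meas by (rule measurable_space)
    hence "x \<in> G -` A \<inter> space M \<longleftrightarrow> x \<in> space M \<and> (\<forall>k. \<exists>n\<ge>Suc k. (G ^^ n) x \<in> B)"
      by (auto simp: A_def inU shift)
    also have "\<dots> \<longleftrightarrow> x \<in> A" by (auto simp: A_def inU) (meson Suc_leD)
    finally show "x \<in> G -` A \<inter> space M \<longleftrightarrow> x \<in> A" .
  qed
  have "measure M B \<le> measure M (U k)" for k
  proof -
    interpret Gk: mpt M "G ^^ k" by (rule mpt_Gn)
    have "measure M B = measure (distr M M (G ^^ k)) B" by (simp only: Gk.G_inv)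
    also have "\<dots> = measure M ((G ^^ k) -` B \<inter> space M)" by (rule measure_distr) auto
    also have "\<dots> \<le> measure M (U k)" by (intro finite_measure_mono U) (auto simp: U_def)
    finally show ?thesis .
  qed
  moreover have "(\<lambda>k. measure M (U k)) \<longlonglongrightarrow> measure M A"
    unfolding A_def by (rule finite_Lim_measure_decseq) (auto simp: decseq_def inU, meson order_trans)
  ultimately have "measure M B \<le> measure M A" by (intro LIMSEQ_le_const) auto
  hence "measure M A = 1" using erg[OF A inv] pos by linarith
  hence "AE x in M. x \<in> A" by (simp add: prob_eq_1)
  thus ?thesis by eventually_elim (auto simp: A_def inU)
qed

context gm_system
begin

section \<open>Cylinders, and a set of full measure on which all relations hold pointwise\<close>

primrec Cyl :: "'b set set \<Rightarrow> nat \<Rightarrow> 'b set set" where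
  "Cyl Q 0 = {space M}"
| "Cyl Q (Suc n) = (\<lambda>(a, c). a \<inter> (G -` c \<inter> space M)) ` (Q \<times> Cyl Q n)"

lemma Cyl_sets: "Q \<subseteq> P \<Longrightarrow> C \<in> Cyl Q n \<Longrightarrow> C \<in> sets M"
proof (induction n arbitrary: C)
  case (Suc n)
  then obtain a c where "C = a \<inter> (G -` c \<inter> space M)" "a \<in> Q" "c \<in> Cyl Q n" by auto
  thus ?case using Suc P_sets by auto
qed simp

lemma Cyl_countable: "countable Q \<Longrightarrow> countable (Cyl Q n)" by (induction n) auto
lemma Cyl_finite: "finite Q \<Longrightarrow> finite (Cyl Q n)" by (induction n) auto
lemma Cyl_mono: "Q \<subseteq> Q' \<Longrightarrow> Cyl Q n \<subseteq> Cyl Q' n" by (induction n) auto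

lemma Cyl_Suc_sub: "C \<in> Cyl Q (Suc n) \<Longrightarrow> \<exists>a\<in>Q. C \<subseteq> a" by auto

lemma Cyl_rho: "Q \<subseteq> P \<Longrightarrow> C \<in> Cyl Q n \<Longrightarrow> x \<in> C \<Longrightarrow> y \<in> C \<Longrightarrow> rho x y \<le> \<theta> ^ n"
proof (induction n arbitrary: C x y)
  case 0 thus ?case by (simp add: rho_le_one)
next
  case (Suc n)
  then obtain a c where c: "C = a \<inter> (G -` c \<inter> space M)" "a \<in> Q" "c \<in> Cyl Q n" by auto
  have "rho x y = \<theta> * rho (G x) (G y)" using c Suc by (intro rho_step[of a]) auto
  also have "\<dots> \<le> \<theta> * \<theta> ^ n" using Suc.IH[OF Suc.prems(1) c(3), of "G x" "G y"] Suc.prems c \<theta>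
    by (intro mult_left_mono) auto
  finally show ?case by simp
qed

definition Qm :: "'b set \<Rightarrow> 'b set set" where
  "Qm a = (SOME Q. Q \<subseteq> P \<and> emeasure M (G ` a - \<Union>Q) = 0 \<and> emeasure M (\<Union>Q - G ` a) = 0)"

lemma Qm: assumes "a \<in> P"
  shows "Qm a \<subseteq> P" "emeasure M (G ` a - \<Union>(Qm a)) = 0" "emeasure M (\<Union>(Qm a) - G ` a) = 0"
proof -
  have "Qm a \<subseteq> P \<and> emeasure M (G ` a - \<Union>(Qm a)) = 0 \<and> emeasure M (\<Union>(Qm a) - G ` a) = 0"
    unfolding Qm_def by (rule someI_ex) (use markov[OF assms] in blast)
  thus "Qm a \<subseteq> P" "emeasure M (G ` a - \<Union>(Qm a)) = 0" "emeasure M (\<Union>(Qm a) - G ` a) = 0" by simp_all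
qed

text \<open>Every relation assumed only modulo null sets is violated inside \<open>N0\<close>. Its saturation under images and
  preimages is still null, so pointwise arguments can be run on the complement \<open>\<Omega>\<close>.\<close>

definition N0 :: "'b set" where
  "N0 = (space M - \<Union>P) \<union> (\<Union>a\<in>P. (G ` a - \<Union>(Qm a)) \<union> (\<Union>(Qm a) - G ` a))
      \<union> {z \<in> space M. L (\<lambda>_. 1) z \<noteq> 1} \<union> (\<Union>C\<in>{C\<in>(\<Union>n. Cyl P n). emeasure M C = 0}. C)"

definition sat :: "'b set \<Rightarrow> 'b set" where
  "sat A = A \<union> (G -` A \<inter> space M) \<union> (\<Union>a\<in>P. G ` (A \<inter> a))"

lemma N0_null: "N0 \<in> null_sets M"
proof -
  have 1: "space M - \<Union>P \<in> null_sets M" using P_cover by (intro null_setsI) auto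
  have 2: "(\<Union>a\<in>P. (G ` a - \<Union>(Qm a)) \<union> (\<Union>(Qm a) - G ` a)) \<in> null_sets M"
  proof (intro null_sets_UN' P_count null_sets.Un)
    fix a assume a: "a \<in> P"
    have [measurable]: "\<Union>(Qm a) \<in> sets M" using Qm(1)[OF a] P_count P_sets
      by (intro sets.countable_Union) (auto intro: countable_subset)
    have [measurable]: "G ` a \<in> sets M" using a by simp
    show "G ` a - \<Union>(Qm a) \<in> null_sets M" using Qm(2)[OF a] by (intro null_setsI) auto
    show "\<Union>(Qm a) - G ` a \<in> null_sets M" using Qm(3)[OF a] by (intro null_setsI) auto
  qed
  have 3: "{z \<in> space M. L (\<lambda>_. 1) z \<noteq> 1} \<in> null_sets M"
  proof -
    have [measurable]: "L (\<lambda>_. 1) \<in> borel_measurable M" by (rule L_meas) simp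
    have "{z \<in> space M. L (\<lambda>_. 1) z \<noteq> 1} \<in> sets M" by measurable
    thus ?thesis using L_one by (subst (asm) AE_iff_null) auto
  qed
  have 4: "(\<Union>C\<in>{C\<in>(\<Union>n. Cyl P n). emeasure M C = 0}. C) \<in> null_sets M"
  proof (rule null_sets_UN')
    have "countable (\<Union>n. Cyl P n)" using Cyl_countable[OF P_count] by auto
    thus "countable {C\<in>(\<Union>n. Cyl P n). emeasure M C = 0}" by (rule countable_subset[rotated]) auto
    fix C assume "C \<in> {C\<in>(\<Union>n. Cyl P n). emeasure M C = 0}"
    thus "C \<in> null_sets M" using Cyl_sets[of P C] by (auto intro!: null_setsI)
  qed
  show ?thesis unfolding N0_def using 1 2 3 4 by (intro null_sets.Un)
qed

text \<open>The change of variables gives integral zero to the weight of the branch over the image,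
  and that weight is positive there.\<close>

lemma G_image_null: assumes a: "a \<in> P" and A: "A \<in> null_sets M" shows "G ` (A \<inter> a) \<in> null_sets M"
proof -
  have [measurable]: "A \<in> sets M" "a \<in> sets M" using A a P_sets by auto
  have m [measurable]: "G ` (A \<inter> a) \<in> sets M" using a by (intro G_img[of a]) auto
  have jm [measurable]: "jw a \<in> borel_measurable M" "br a \<in> measurable M M" using a by auto
  have z: "AE x in M. indicator a x * indicator A x = (0::real)"
    using AE_not_in[OF A] by eventually_elim simp
  have "(\<integral>x. indicator a x * indicator A x \<partial>M) = (\<integral>x. (0::real) \<partial>M)" using z by (intro integral_cong_AE) auto
  hence 0: "(\<integral>z. jw a z * indicator A (br a z) \<partial>M) = 0" using branch_integral(1)[OF a, of "indicator A"] by simp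
  have "integrable M (\<lambda>x. indicator a x * indicator A x :: real)"
    by (intro integrable_const_bound[of _ 1]) (auto simp: indicator_def)
  hence i: "integrable M (\<lambda>z. jw a z * indicator A (br a z))" using branch_integral(2)[OF a, of "indicator A"] by simp
  have "AE z in M. jw a z * indicator A (br a z) = 0"
    using 0 integral_nonneg_eq_0_iff_AE[OF i] jw_nonneg[OF a] by auto
  hence "AE z in M. z \<notin> G ` (A \<inter> a)"
  proof eventually_elim
    case (elim z)
    show ?case
    proof
      assume "z \<in> G ` (A \<inter> a)"
      then obtain x where x: "x \<in> A" "x \<in> a" "z = G x" by auto
      have "0 < g x" using x P_sub[OF a] by (auto intro: g_pos)
      thus False using elim x br_G[OF a x(2)] by (auto simp: jw_def indicator_def)
    qed
  qed
  thus ?thesis using m by (simp add: AE_iff_null_sets[OF m])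
qed

lemma sat_null: assumes A: "A \<in> null_sets M" shows "sat A \<in> null_sets M"
proof -
  have "G -` A \<inter> space M \<in> null_sets M"
  proof (rule null_setsI)
    have "emeasure M (G -` A \<inter> space M) = emeasure (distr M M G) A" using A by (subst emeasure_distr) auto
    thus "emeasure M (G -` A \<inter> space M) = 0" using A unfolding G_inv by auto
  qed (use A in auto)
  moreover have "(\<Union>a\<in>P. G ` (A \<inter> a)) \<in> null_sets M" using G_image_null A by (intro null_sets_UN' P_count) auto
  ultimately show ?thesis unfolding sat_def using A by (intro null_sets.Un)
qed

definition \<Omega> :: "'b set" where "\<Omega> = space M - (\<Union>k. (sat ^^ k) N0)"

lemma \<Omega>_null: "(\<Union>k. (sat ^^ k) N0) \<in> null_sets M"
proof (intro null_sets_UN)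
  show "(sat ^^ k) N0 \<in> null_sets M" for k by (induction k) (auto intro: N0_null sat_null)
qed

lemma \<Omega>_sets [measurable]: "\<Omega> \<in> sets M" unfolding \<Omega>_def using null_setsD2[OF \<Omega>_null] by (rule sets.compl_sets)
lemma AE_\<Omega>: "AE x in M. x \<in> \<Omega>"
  using AE_not_in[OF \<Omega>_null] AE_space by eventually_elim (simp add: \<Omega>_def)
lemma \<Omega>_space: "x \<in> \<Omega> \<Longrightarrow> x \<in> space M" by (simp add: \<Omega>_def)
lemma \<Omega>_N0: assumes "x \<in> \<Omega>" shows "x \<notin> N0"
proof
  assume "x \<in> N0"
  hence "x \<in> (sat ^^ 0) N0" by simp
  thus False using assms unfolding \<Omega>_def by blast
qed

lemma \<Omega>_G: assumes x: "x \<in> \<Omega>" shows "G x \<in> \<Omega>"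
proof -
  have "G x \<in> space M" using \<Omega>_space[OF x] by (rule measurable_space[OF G_meas])
  moreover have "G x \<notin> (sat ^^ k) N0" for k
  proof
    assume "G x \<in> (sat ^^ k) N0"
    hence "x \<in> (sat ^^ Suc k) N0" using \<Omega>_space[OF x] by (simp add: sat_def)
    thus False using x unfolding \<Omega>_def by blast
  qed
  ultimately show ?thesis by (simp add: \<Omega>_def)
qed

lemma \<Omega>_br: assumes z: "z \<in> \<Omega>" and a: "a \<in> P" "z \<in> G ` a" shows "br a z \<in> \<Omega>"
proof -
  have "br a z \<notin> (sat ^^ k) N0" for k
  proof
    assume "br a z \<in> (sat ^^ k) N0"
    hence "G (br a z) \<in> G ` ((sat ^^ k) N0 \<inter> a)" using br_in[OF a(1), of z] by blast
    hence "z \<in> (sat ^^ Suc k) N0" using G_br[OF a] a by (auto simp: sat_def)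
    thus False using z unfolding \<Omega>_def by blast
  qed
  thus ?thesis using br_space[OF a(1)] by (simp add: \<Omega>_def)
qed

lemma \<Omega>_P: assumes "x \<in> \<Omega>" shows "\<exists>a\<in>P. x \<in> a"
proof -
  have "x \<notin> space M - \<Union>P" using \<Omega>_N0[OF assms] unfolding N0_def by blast
  thus ?thesis using \<Omega>_space[OF assms] by blast
qed

text \<open>Inside \<open>\<Omega>\<close> the image of \<open>a\<close> coincides with a union of
  partition elements. Two points of one element therefore have the same inverse branches, and the
  series for \<open>L\<close> at these points can be compared term by term.\<close>

lemma \<Omega>_markov: assumes "x \<in> \<Omega>" "y \<in> \<Omega>" "b \<in> P" "x \<in> b" "y \<in> b" "a \<in> P" shows "x \<in> G ` a \<longleftrightarrow> y \<in> G ` a"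
proof -
  have *: "z \<in> G ` a \<longleftrightarrow> b \<in> Qm a" if z: "z \<in> \<Omega>" "z \<in> b" for z
  proof -
    have "z \<in> G ` a \<longleftrightarrow> z \<in> \<Union>(Qm a)" using \<Omega>_N0[OF z(1)] assms(6) unfolding N0_def by blast
    also have "\<dots> \<longleftrightarrow> b \<in> Qm a"
    proof
      assume "z \<in> \<Union>(Qm a)"
      then obtain q where q: "q \<in> Qm a" "z \<in> q" by blast
      have "q \<in> P" using Qm(1)[OF assms(6)] q(1) by (rule subsetD)
      hence "q = b" using assms(3) q(2) z(2) by (rule P_eq)
      thus "b \<in> Qm a" using q(1) by simp
    qed (use z(2) in blast)
    finally show ?thesis .
  qed
  show ?thesis using *[of x] *[of y] assms by simp
qed

lemma \<Omega>_L1: assumes "z \<in> \<Omega>" shows "L (\<lambda>_. 1) z = 1"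
proof -
  have "z \<notin> {z \<in> space M. L (\<lambda>_. 1) z \<noteq> 1}" using \<Omega>_N0[OF assms] unfolding N0_def by blast
  thus ?thesis using \<Omega>_space[OF assms] by blast
qed

lemma \<Omega>_Cyl_pos: assumes "x \<in> \<Omega>" "C \<in> Cyl P n" "x \<in> C" shows "0 < measure M C"
proof -
  have "emeasure M C \<noteq> 0" using \<Omega>_N0[OF assms(1)] assms(2,3) unfolding N0_def by blast
  thus ?thesis by (simp add: emeasure_eq_measure zero_less_measure_iff)
qed

lemma \<Omega>_Cyl: "x \<in> \<Omega> \<Longrightarrow> \<exists>C\<in>Cyl P n. x \<in> C"
proof (induction n arbitrary: x)
  case 0 thus ?case by (simp add: \<Omega>_space)
next
  case (Suc n)
  obtain a where a: "a \<in> P" "x \<in> a" using \<Omega>_P[OF Suc.prems] by blast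
  obtain C where "C \<in> Cyl P n" "G x \<in> C" using Suc.IH[OF \<Omega>_G[OF Suc.prems]] by blast
  hence "a \<inter> (G -` C \<inter> space M) \<in> Cyl P (Suc n)" "x \<in> a \<inter> (G -` C \<inter> space M)"
    using a \<Omega>_space[OF Suc.prems] by auto
  thus ?case by (rule bexI[rotated])
qed

text \<open>Small balls of the separation metric are cylinders, of which there are countably many,
  so each superlevel set within \<open>\<Omega>\<close> is a countable union of cylinders cut by
  \<open>\<Omega>\<close>. The constant may vary with the partition element; the lemma supplies
  measurability for functions defined through leaf representatives.\<close>

lemma lipschitz_measurable:
  fixes \<phi> :: "'b \<Rightarrow> real"
  assumes lip: "\<And>a x y. a \<in> P \<Longrightarrow> x \<in> a \<Longrightarrow> y \<in> a \<Longrightarrow> x \<in> \<Omega> \<Longrightarrow> y \<in> \<Omega> \<Longrightarrow> \<bar>\<phi> x - \<phi> y\<bar> \<le> b a * rho x y"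
  shows "(\<lambda>x. indicator \<Omega> x * \<phi> x) \<in> borel_measurable M"
proof -
  have S: "{x \<in> \<Omega>. c < \<phi> x} \<in> sets M" for c
  proof -
    let ?\<C> = "{C \<in> (\<Union>n. Cyl P n). \<forall>y\<in>C \<inter> \<Omega>. c < \<phi> y}"
    have "{x \<in> \<Omega>. c < \<phi> x} = \<Omega> \<inter> \<Union>?\<C>"
    proof (intro equalityI subsetI)
      fix x assume "x \<in> {x \<in> \<Omega>. c < \<phi> x}"
      hence x: "x \<in> \<Omega>" "c < \<phi> x" by auto
      obtain a where a: "a \<in> P" "x \<in> a" using \<Omega>_P[OF x(1)] by blast
      define e where "e = (\<phi> x - c) / (\<bar>b a\<bar> + 1)"
      have e: "0 < e" using x by (simp add: e_def)
      obtain n where n: "\<theta> ^ n < e" using real_arch_pow_inv[OF e \<theta>(2)] by blast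
      obtain C where C: "C \<in> Cyl P (Suc n)" "x \<in> C" using \<Omega>_Cyl[OF x(1)] by blast
      obtain a' where a': "a' \<in> P" "C \<subseteq> a'" using Cyl_Suc_sub[OF C(1)] by blast
      have aa: "a' = a" using P_eq[OF a'(1) a(1), of x] a a' C by blast
      have "c < \<phi> y" if y: "y \<in> C" "y \<in> \<Omega>" for y
      proof -
        have "\<bar>\<phi> x - \<phi> y\<bar> \<le> b a * rho x y" using lip[OF a(1), of x y] a(2) a' aa y x by blast
        also have "\<dots> \<le> (\<bar>b a\<bar> + 1) * rho x y" using rho_nonneg by (intro mult_right_mono) auto
        also have "\<dots> \<le> (\<bar>b a\<bar> + 1) * \<theta> ^ n"
        proof -
          have "rho x y \<le> \<theta> ^ Suc n" using Cyl_rho[OF _ C(1) C(2) y(1)] by simp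
          also have "\<dots> \<le> \<theta> ^ n" using \<theta> by (simp add: mult_left_le_one_le)
          finally show ?thesis by (intro mult_left_mono) auto
        qed
        also have "\<dots> < (\<bar>b a\<bar> + 1) * e" using n by (intro mult_strict_left_mono) auto
        also have "\<dots> = \<phi> x - c" by (simp add: e_def)
        finally show ?thesis by linarith
      qed
      thus "x \<in> \<Omega> \<inter> \<Union>?\<C>" using C x(1) by blast
    qed auto
    moreover have "\<Union>?\<C> \<in> sets M"
    proof (rule sets.countable_Union)
      have "countable (\<Union>n. Cyl P n)" using Cyl_countable[OF P_count] by auto
      thus "countable ?\<C>" by (rule countable_subset[rotated]) auto
      show "?\<C> \<subseteq> sets M" using Cyl_sets[of P] by auto
    qed
    ultimately show ?thesis by auto
  qed
  show ?thesis
  proof (rule borel_measurableI_greater)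
    fix c :: real
    have "{x \<in> space M. c < indicator \<Omega> x * \<phi> x} = {x \<in> \<Omega>. c < \<phi> x} \<union> (if c < 0 then space M - \<Omega> else {})"
      using \<Omega>_space by (auto simp: indicator_def split: if_splits)
    thus "{x \<in> space M. c < indicator \<Omega> x * \<phi> x} \<in> sets M" using S by auto
  qed
qed

section \<open>Lipschitz classes and the Lasota-Yorke inequality\<close>

definition reg :: "real \<Rightarrow> real \<Rightarrow> ('b \<Rightarrow> real) \<Rightarrow> bool" where
  "reg D B \<phi> \<longleftrightarrow> \<phi> \<in> borel_measurable M \<and> (\<forall>x\<in>\<Omega>. \<bar>\<phi> x\<bar> \<le> B) \<and>
     (\<forall>a\<in>P. \<forall>x\<in>\<Omega> \<inter> a. \<forall>y\<in>\<Omega> \<inter> a. \<bar>\<phi> x - \<phi> y\<bar> \<le> D * rho x y)"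

lemma regD: "reg D B \<phi> \<Longrightarrow> \<phi> \<in> borel_measurable M"
  "reg D B \<phi> \<Longrightarrow> x \<in> \<Omega> \<Longrightarrow> \<bar>\<phi> x\<bar> \<le> B"
  "reg D B \<phi> \<Longrightarrow> a \<in> P \<Longrightarrow> x \<in> \<Omega> \<Longrightarrow> x \<in> a \<Longrightarrow> y \<in> \<Omega> \<Longrightarrow> y \<in> a \<Longrightarrow> \<bar>\<phi> x - \<phi> y\<bar> \<le> D * rho x y"
  unfolding reg_def by blast+

lemma jw_sum: assumes "z \<in> \<Omega>" shows "integrable CP (\<lambda>a. jw a z)" "(\<integral>a. jw a z \<partial>CP) = 1"
proof -
  show 1: "(\<integral>a. jw a z \<partial>CP) = 1" using \<Omega>_L1[OF assms] by (simp add: L_def)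
  \<comment> \<open>A non-integrable function has Bochner integral 0, so the value 1 forces
    integrability.\<close>
  show "integrable CP (\<lambda>a. jw a z)" using 1 not_integrable_integral_eq by fastforce
qed

lemma L_bounded:
  assumes z: "z \<in> \<Omega>" and B: "\<And>x. x \<in> \<Omega> \<Longrightarrow> \<bar>\<phi> x\<bar> \<le> B"
  shows "integrable CP (\<lambda>a. jw a z * \<phi> (br a z))" "\<bar>L \<phi> z\<bar> \<le> B"
proof -
  have pw: "AE a in CP. \<bar>jw a z * \<phi> (br a z)\<bar> \<le> jw a z * B"
  proof (simp add: AE_count_space, intro ballI)
    fix a assume a: "a \<in> P"
    show "\<bar>jw a z * \<phi> (br a z)\<bar> \<le> jw a z * B"
    proof (cases "z \<in> G ` a")
      case True
      show ?thesis using B[OF \<Omega>_br[OF z a True]] jw_nonneg[OF a] by (simp add: abs_mult mult_left_mono)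
    qed (simp add: jw_def)
  qed
  have i: "integrable CP (\<lambda>a. jw a z * B)" using jw_sum[OF z] by auto
  show "integrable CP (\<lambda>a. jw a z * \<phi> (br a z))" using abs_integral_le(1)[OF _ i pw] by simp
  show "\<bar>L \<phi> z\<bar> \<le> B" using abs_integral_le(2)[OF _ i pw] jw_sum[OF z] by (simp add: L_def)
qed

lemma L_sum:
  assumes z: "z \<in> \<Omega>" and "\<And>k x. k \<in> I \<Longrightarrow> x \<in> \<Omega> \<Longrightarrow> \<bar>\<phi> k x\<bar> \<le> B"
  shows "L (\<lambda>x. \<Sum>k\<in>I. \<phi> k x) z = (\<Sum>k\<in>I. L (\<phi> k) z)"
  unfolding L_def sum_distrib_left
  by (rule Bochner_Integration.integral_sum) (rule L_bounded(1)[OF z assms(2)])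

lemma L_scale: "L (\<lambda>x. c * \<phi> x) z = c * L \<phi> z"
  unfolding L_def by (simp add: mult.left_commute)

text \<open>The inverse branch contracts \<open>rho\<close> by \<theta>, which accounts for
  \<open>D\<close>, while the distortion of the weight accounts for \<open>K1 * B\<close>. The
  hypotheses concern one branch only, so that the lemma serves both the uniform class
  \<open>reg\<close> and the weighted class \<open>wreg\<close>.\<close>

lemma L_difference:
  assumes b: "b \<in> P" "x \<in> \<Omega>" "x \<in> b" "y \<in> \<Omega>" "y \<in> b" and a: "a \<in> P"
    and \<phi>: "\<And>x y. x \<in> \<Omega> \<Longrightarrow> x \<in> a \<Longrightarrow> y \<in> \<Omega> \<Longrightarrow> y \<in> a \<Longrightarrow> \<bar>\<phi> x - \<phi> y\<bar> \<le> D * rho x y"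
    and B: "\<And>x. x \<in> \<Omega> \<Longrightarrow> x \<in> a \<Longrightarrow> \<bar>\<phi> x\<bar> \<le> B"
  shows "\<bar>jw a x * \<phi> (br a x) - jw a y * \<phi> (br a y)\<bar> \<le> jw a x * (\<theta> * (D + K1 * B) * rho x y)"
proof (cases "x \<in> G ` a")
  case False
  hence "y \<notin> G ` a" using \<Omega>_markov b a by blast
  thus ?thesis using False by (simp add: jw_def)
next
  case True
  hence y: "y \<in> G ` a" using \<Omega>_markov b a by blast
  define x' y' where "x' = br a x" "y' = br a y"
  have x': "x' \<in> \<Omega>" "x' \<in> a" "y' \<in> \<Omega>" "y' \<in> a" unfolding x'_y'_def
    using \<Omega>_br b a True y br_in by auto
  have r: "rho x' y' = \<theta> * rho x y" using rho_step[OF a x'(2,4)] G_br[OF a] True y by (simp add: x'_y'_def)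
  have g: "0 < g x'" using x'(2) P_sub[OF a] by (auto intro: g_pos)
  have "\<bar>g x' * \<phi> x' - g y' * \<phi> y'\<bar> = \<bar>g x' * (\<phi> x' - \<phi> y') + (g x' - g y') * \<phi> y'\<bar>" by (simp add: algebra_simps)
  also have "\<dots> \<le> g x' * \<bar>\<phi> x' - \<phi> y'\<bar> + \<bar>g x' - g y'\<bar> * \<bar>\<phi> y'\<bar>"
    using g by (simp add: abs_mult order_trans[OF abs_triangle_ineq])
  also have "\<dots> \<le> g x' * (D * rho x' y') + (K1 * g x' * rho x' y') * B"
    using g x' \<phi>[OF x'] g_diff(1)[OF a x'(2,4)] B[OF x'(3,4)] K1 rho_nonneg[of x' y']
    by (intro add_mono mult_left_mono mult_mono) auto
  also have "\<dots> = g x' * (\<theta> * (D + K1 * B) * rho x y)" unfolding r by (simp add: algebra_simps)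
  finally show ?thesis using True y by (simp add: jw_def x'_y'_def)
qed

text \<open>Lasota-Yorke inequality: the Lipschitz constant shrinks by \<theta> up to a multiple of
  the sup norm, since the weights of the branches sum to 1.\<close>

lemma L_reg:
  assumes "reg D B \<phi>" "0 \<le> B"
  shows "reg (\<theta> * (D + K1 * B)) B (L \<phi>)"
  unfolding reg_def
proof (intro conjI ballI)
  show "L \<phi> \<in> borel_measurable M" using regD(1)[OF assms(1)] by (rule L_meas)
  show "\<bar>L \<phi> x\<bar> \<le> B" if "x \<in> \<Omega>" for x using L_bounded(2)[OF that regD(2)[OF assms(1)]] .
  fix b x y assume b: "b \<in> P" and x: "x \<in> \<Omega> \<inter> b" and y: "y \<in> \<Omega> \<inter> b"
  have i: "integrable CP (\<lambda>a. jw a x * \<phi> (br a x))" "integrable CP (\<lambda>a. jw a y * \<phi> (br a y))"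
    using L_bounded(1)[OF _ regD(2)[OF assms(1)]] x y by auto
  have "\<bar>L \<phi> x - L \<phi> y\<bar> = \<bar>\<integral>a. jw a x * \<phi> (br a x) - jw a y * \<phi> (br a y) \<partial>CP\<bar>"
    using i by (simp add: L_def)
  also have "\<dots> \<le> (\<integral>a. jw a x * (\<theta> * (D + K1 * B) * rho x y) \<partial>CP)"
  proof (rule abs_integral_le(2))
    show "AE a in CP. \<bar>jw a x * \<phi> (br a x) - jw a y * \<phi> (br a y)\<bar> \<le> jw a x * (\<theta> * (D + K1 * B) * rho x y)"
      using L_difference[OF b _ _ _ _ _ regD(3)[OF assms(1)] regD(2)[OF assms(1)]] x y
      by (auto simp: AE_count_space)
    show "integrable CP (\<lambda>a. jw a x * (\<theta> * (D + K1 * B) * rho x y))" using jw_sum(1)[of x] x by simp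
  qed simp
  also have "\<dots> = \<theta> * (D + K1 * B) * rho x y" using jw_sum[of x] x by simp
  finally show "\<bar>L \<phi> x - L \<phi> y\<bar> \<le> \<theta> * (D + K1 * B) * rho x y" .
qed

text \<open>The weight \<open>b\<close> may be unbounded over the partition. Induced observables are
  of this kind, being of the size of the return time.\<close>

definition wreg :: "('b set \<Rightarrow> real) \<Rightarrow> ('b \<Rightarrow> real) \<Rightarrow> bool" where
  "wreg b \<phi> \<longleftrightarrow> (\<forall>a\<in>P. \<forall>x\<in>\<Omega> \<inter> a. \<bar>\<phi> x\<bar> \<le> b a \<and> (\<forall>y\<in>\<Omega> \<inter> a. \<bar>\<phi> x - \<phi> y\<bar> \<le> b a * rho x y))"

text \<open>One application of \<open>L\<close> turns an unbounded observable into a bounded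
  Lipschitz one: the weight of branch \<open>a\<close> is at most \<open>K2 * measure M a\<close>,
  and \<open>measure M a * b a\<close> is summable.\<close>

lemma L_wreg:
  assumes w: "wreg b \<phi>" and m: "\<phi> \<in> borel_measurable M" and b0: "\<And>a. a \<in> P \<Longrightarrow> 0 \<le> b a"
    and bi: "integrable CP (\<lambda>a. measure M a * b a)"
  defines "B \<equiv> K2 * (\<integral>a. measure M a * b a \<partial>CP)"
  shows "reg ((1 + K1) * B) ((1 + K1) * B) (L \<phi>)"
proof -
  have B0: "0 \<le> B" unfolding B_def using K2 b0 by (intro mult_nonneg_nonneg integral_nonneg_AE) (auto simp: AE_count_space)
  have jw_le: "jw a x \<le> K2 * measure M a" if "a \<in> P" for a x
    using g_le[OF that br_in[OF that]] K2 by (auto simp: jw_def indicator_def)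
  have bnd: "\<bar>jw a x * \<phi> (br a x)\<bar> \<le> K2 * (measure M a * b a)" if x: "x \<in> \<Omega>" and a: "a \<in> P" for a x
  proof (cases "x \<in> G ` a")
    case True
    have "\<bar>\<phi> (br a x)\<bar> \<le> b a" using w \<Omega>_br[OF x a True] br_in[OF a] a unfolding wreg_def by blast
    hence "jw a x * \<bar>\<phi> (br a x)\<bar> \<le> (K2 * measure M a) * b a"
      using jw_le[OF a] jw_nonneg[OF a] K2 by (intro mult_mono) auto
    thus ?thesis using jw_nonneg[OF a, of x] by (simp add: abs_mult mult.assoc)
  next
    case False thus ?thesis using K2 b0[OF a] by (simp add: jw_def)
  qed
  have i: "integrable CP (\<lambda>a. jw a x * \<phi> (br a x))" and le: "\<bar>L \<phi> x\<bar> \<le> B" if x: "x \<in> \<Omega>" for x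
  proof -
    have "AE a in CP. \<bar>jw a x * \<phi> (br a x)\<bar> \<le> K2 * (measure M a * b a)" using bnd[OF x] by (simp add: AE_count_space)
    note * = abs_integral_le[OF _ integrable_mult_right[OF bi] this]
    show "integrable CP (\<lambda>a. jw a x * \<phi> (br a x))" using *(1) by simp
    show "\<bar>L \<phi> x\<bar> \<le> B" using *(2) by (simp add: L_def B_def)
  qed
  show ?thesis unfolding reg_def
  proof (intro conjI ballI)
    show "L \<phi> \<in> borel_measurable M" using m by (rule L_meas)
    show "\<bar>L \<phi> x\<bar> \<le> (1 + K1) * B" if "x \<in> \<Omega>" for x
      using le[OF that] K1 B0 by (simp add: distrib_right add_increasing2)
    fix c x y assume c: "c \<in> P" and x: "x \<in> \<Omega> \<inter> c" and y: "y \<in> \<Omega> \<inter> c"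
    have "\<bar>L \<phi> x - L \<phi> y\<bar> = \<bar>\<integral>a. jw a x * \<phi> (br a x) - jw a y * \<phi> (br a y) \<partial>CP\<bar>"
      using i x y by (simp add: L_def)
    also have "\<dots> \<le> (\<integral>a. ((1 + K1) * rho x y * K2) * (measure M a * b a) \<partial>CP)"
    proof (rule abs_integral_le(2))
      have "\<bar>jw a x * \<phi> (br a x) - jw a y * \<phi> (br a y)\<bar> \<le> ((1 + K1) * rho x y * K2) * (measure M a * b a)" if a: "a \<in> P" for a
      proof -
        have "\<bar>jw a x * \<phi> (br a x) - jw a y * \<phi> (br a y)\<bar> \<le> jw a x * (\<theta> * (b a + K1 * b a) * rho x y)"
          using w a unfolding wreg_def by (intro L_difference[OF c _ _ _ _ a]) (use x y in auto)
        also have "\<dots> \<le> (K2 * measure M a) * (1 * (b a + K1 * b a) * rho x y)"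
          using jw_le[OF a] jw_nonneg[OF a] K2 \<theta> rho_nonneg b0[OF a] K1
          by (intro mult_mono mult_nonneg_nonneg add_nonneg_nonneg) auto
        finally show ?thesis by (simp add: algebra_simps)
      qed
      thus "AE a in CP. \<bar>jw a x * \<phi> (br a x) - jw a y * \<phi> (br a y)\<bar> \<le> ((1 + K1) * rho x y * K2) * (measure M a * b a)"
        by (simp add: AE_count_space)
      show "integrable CP (\<lambda>a. ((1 + K1) * rho x y * K2) * (measure M a * b a))" using bi by simp
    qed simp
    also have "\<dots> = (1 + K1) * B * rho x y" by (simp add: B_def)
    finally show "\<bar>L \<phi> x - L \<phi> y\<bar> \<le> (1 + K1) * B * rho x y" .
  qed
qed

lemma reg_sum:
  assumes "\<And>k. k \<in> I \<Longrightarrow> reg D B (\<phi> k)"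
  shows "reg (real (card I) * D) (real (card I) * B) (\<lambda>x. \<Sum>k\<in>I. \<phi> k x)"
  unfolding reg_def
proof (intro conjI ballI)
  show "(\<lambda>x. \<Sum>k\<in>I. \<phi> k x) \<in> borel_measurable M" using regD(1)[OF assms] by simp
  show "\<bar>\<Sum>k\<in>I. \<phi> k x\<bar> \<le> real (card I) * B" if "x \<in> \<Omega>" for x
  proof -
    have "\<bar>\<Sum>k\<in>I. \<phi> k x\<bar> \<le> (\<Sum>k\<in>I. \<bar>\<phi> k x\<bar>)" by (rule sum_abs)
    also have "\<dots> \<le> real (card I) * B" by (rule sum_bounded_above) (rule regD(2)[OF assms that])
    finally show ?thesis .
  qed
  fix a x y assume a: "a \<in> P" and x: "x \<in> \<Omega> \<inter> a" and y: "y \<in> \<Omega> \<inter> a"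
  have "\<bar>(\<Sum>k\<in>I. \<phi> k x) - (\<Sum>k\<in>I. \<phi> k y)\<bar> \<le> (\<Sum>k\<in>I. \<bar>\<phi> k x - \<phi> k y\<bar>)"
    unfolding sum_subtractf[symmetric] by (rule sum_abs)
  also have "\<dots> \<le> real (card I) * (D * rho x y)"
    by (rule sum_bounded_above) (use regD(3)[OF assms a] x y in auto)
  finally show "\<bar>(\<Sum>k\<in>I. \<phi> k x) - (\<Sum>k\<in>I. \<phi> k y)\<bar> \<le> real (card I) * D * rho x y" by simp
qed

text \<open>Sum of the geometric series of sup-norm contributions when the Lasota-Yorke inequality
  is iterated.\<close>

definition "E1 = K1 / (1 - \<theta>)"

lemma E1: "0 \<le> E1" using K1 \<theta> by (simp add: E1_def)

lemma reg_mono: assumes "reg D B \<phi>" "D \<le> D'" "B \<le> B'" shows "reg D' B' \<phi>"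
  unfolding reg_def
proof (intro conjI ballI)
  show "\<phi> \<in> borel_measurable M" using regD(1)[OF assms(1)] .
  show "\<bar>\<phi> x\<bar> \<le> B'" if "x \<in> \<Omega>" for x using regD(2)[OF assms(1) that] assms(3) by linarith
  fix a x y assume a: "a \<in> P" and x: "x \<in> \<Omega> \<inter> a" and y: "y \<in> \<Omega> \<inter> a"
  have "\<bar>\<phi> x - \<phi> y\<bar> \<le> D * rho x y" using regD(3)[OF assms(1) a] x y by blast
  also have "\<dots> \<le> D' * rho x y" using assms(2) rho_nonneg by (rule mult_right_mono)
  finally show "\<bar>\<phi> x - \<phi> y\<bar> \<le> D' * rho x y" .
qed

lemma Lpow_reg:
  assumes "reg D B w" "0 \<le> B" "0 \<le> D"
  shows "reg (D + E1 * B) B ((L ^^ k) w)"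
proof (induction k)
  case 0 thus ?case using reg_mono[OF assms(1), of "D + E1 * B" B] E1 assms by simp
next
  case (Suc k)
  \<comment> \<open>The constant reproduces itself: \<open>K1 = (1 - \<theta>) * E1\<close> gives
    \<open>\<theta> * (E1 + K1) = (1 - (1 - \<theta>)\<^sup>2) * E1\<close>.\<close>
  have "\<theta> * (D + E1 * B + K1 * B) \<le> D + E1 * B"
  proof -
    have "K1 = (1 - \<theta>) * E1" using \<theta> by (simp add: E1_def)
    hence "\<theta> * (D + E1 * B + K1 * B) = \<theta> * D + (1 - (1 - \<theta>)\<^sup>2) * (E1 * B)"
      by (simp only:) (simp add: power2_eq_square algebra_simps)
    also have "\<dots> \<le> 1 * D + 1 * (E1 * B)"
      using \<theta> assms E1 by (intro add_mono mult_right_mono) auto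
    finally show ?thesis by simp
  qed
  thus ?case using reg_mono[OF L_reg[OF Suc assms(2)], of "D + E1 * B" B] by simp
qed

section \<open>Sums of iterates of the transfer operator\<close>

definition S :: "('b \<Rightarrow> real) \<Rightarrow> nat \<Rightarrow> 'b \<Rightarrow> real" where
  "S w n x = (\<Sum>k<n. (L ^^ k) w x)"

text \<open>Telescoping. The defect \<open>w - (L ^^ n) w\<close> is bounded whatever
  \<open>n\<close> is; every uniform estimate on \<open>S w n\<close> starts from this fact.\<close>

lemma L_S:
  assumes "reg D B w" "0 \<le> B" "0 \<le> D" "x \<in> \<Omega>"
  shows "L (S w n) x = (\<Sum>k=1..n. (L ^^ k) w x)" "S w n x = L (S w n) x + (w x - (L ^^ n) w x)"
proof -
  have "L (S w n) x = (\<Sum>k<n. L ((L ^^ k) w) x)"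
    unfolding S_def by (rule L_sum[OF assms(4)]) (rule regD(2)[OF Lpow_reg[OF assms(1-3)]])
  also have "\<dots> = (\<Sum>k<n. (L ^^ Suc k) w x)" by simp
  finally have 1: "L (S w n) x = (\<Sum>k<n. (L ^^ Suc k) w x)" .
  also have "\<dots> = (\<Sum>k=1..n. (L ^^ k) w x)"
    by (rule sum.reindex_bij_witness[of _ "\<lambda>k. k - 1" Suc]) auto
  finally show "L (S w n) x = (\<Sum>k=1..n. (L ^^ k) w x)" .
  have "(\<Sum>k<n. (L ^^ Suc k) w x) - (\<Sum>k<n. (L ^^ k) w x) = (L ^^ n) w x - (L ^^ 0) w x"
    unfolding sum_subtractf[symmetric] by (rule sum_lessThan_telescope)
  thus "S w n x = L (S w n) x + (w x - (L ^^ n) w x)" unfolding 1 by (simp add: S_def)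
qed

lemma reg_integrable: assumes "reg D B \<phi>" shows "integrable M \<phi>"
  using AE_\<Omega> regD(1)[OF assms]
  by (intro integrable_const_bound[of _ B]) (auto elim!: eventually_mono dest: regD(2)[OF assms])

lemma S_mean_zero:
  assumes "reg D B w" "0 \<le> B" "0 \<le> D" "(\<integral>x. w x \<partial>M) = 0"
  shows "(\<integral>x. S w n x \<partial>M) = 0"
proof -
  have "(\<integral>x. (L ^^ k) w x \<partial>M) = 0" for k
  proof (induction k)
    case (Suc k)
    show ?case using L_dual(1)[of "(L ^^ k) w" "\<lambda>_. 1" 1] reg_integrable[OF Lpow_reg[OF assms(1-3)]] Suc by simp
  qed (use assms in simp)
  thus ?thesis unfolding S_def using reg_integrable[OF Lpow_reg[OF assms(1-3)]] by simp
qed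

text \<open>The discarded mass is wanted in two forms: as the measure of a complement, which
  controls the points outside the cylinders, and as a tail sum, which controls the discarded
  branches in the series for \<open>L\<close>.\<close>

lemma finite_approx:
  assumes e: "0 < e"
  shows "\<exists>P0\<subseteq>P. finite P0 \<and> measure M (space M - \<Union>P0) \<le> e
     \<and> integrable CP (\<lambda>a. if a \<in> P0 then 0 else measure M a) \<and> (\<integral>a. (if a \<in> P0 then 0 else measure M a) \<partial>CP) \<le> e"
proof -
  have Pne: "P \<noteq> {}" using P_cover emeasure_space_1 by auto
  define Q where "Q n = from_nat_into P ` {..n}" for n :: nat
  have QP: "Q n \<subseteq> P" for n using Pne from_nat_into[OF Pne] by (auto simp: Q_def)
  have Qs: "\<Union>(Q n) \<in> sets M" for n using QP P_sets by (intro sets.finite_Union) (auto simp: Q_def)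
  have "(\<lambda>n. measure M (\<Union>(Q n))) \<longlonglongrightarrow> measure M (\<Union>n. \<Union>(Q n))"
    by (rule finite_Lim_measure_incseq) (use Qs in \<open>auto simp: incseq_def Q_def intro: order_trans\<close>)
  moreover have "(\<Union>n. \<Union>(Q n)) = \<Union>P"
  proof -
    have "(\<Union>n. Q n) = range (from_nat_into P)" by (auto simp: Q_def)
    hence "(\<Union>n. Q n) = P" using range_from_nat_into[OF Pne P_count] by simp
    moreover have "(\<Union>n. \<Union>(Q n)) = \<Union>(\<Union>n. Q n)" by blast
    ultimately show ?thesis by simp
  qed
  moreover have "measure M (\<Union>P) = 1" using AE_UP by (simp add: prob_eq_1)
  ultimately have "(\<lambda>n. measure M (\<Union>(Q n))) \<longlonglongrightarrow> 1" by simp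
  hence "eventually (\<lambda>n. 1 - e < measure M (\<Union>(Q n))) sequentially" using e by (intro order_tendstoD) auto
  then obtain n where n: "1 - e < measure M (\<Union>(Q n))" by (auto simp: eventually_sequentially)
  let ?c = "space M - \<Union>(Q n)"
  have c [measurable]: "?c \<in> sets M" using Qs by auto
  have ce: "measure M ?c \<le> e" using n prob_compl[OF Qs] by simp
  have ic: "integrable M (\<lambda>x. indicator ?c x :: real)" by (simp add: integrable_real_indicator less_top[symmetric])
  have eq: "(\<integral>x. indicator a x * indicator ?c x \<partial>M) = (if a \<in> Q n then 0 else measure M a)" if a: "a \<in> P" for a
  proof (cases "a \<in> Q n")
    case True
    hence z: "(\<lambda>x. indicator a x * indicator ?c x) = (\<lambda>x. 0::real)"
      by (auto simp: fun_eq_iff split: split_indicator)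
    show ?thesis unfolding z using True by simp
  next
    case False
    have "x \<notin> q" if "q \<in> Q n" "x \<in> a" for q x
      using P_eq[of q a x] subsetD[OF QP that(1)] a that False by metis
    hence z: "(\<lambda>x. indicator a x * indicator ?c x) = (indicator a :: _ \<Rightarrow> real)"
      using P_sub[OF a] by (auto simp: fun_eq_iff split: split_indicator)
    show ?thesis unfolding z using False P_sets[OF a] by simp
  qed
  have "integrable CP (\<lambda>a. if a \<in> Q n then 0 else measure M a) = integrable CP (\<lambda>a. \<integral>x. indicator a x * (indicator ?c x :: real) \<partial>M)"
    using eq by (intro Bochner_Integration.integrable_cong) auto
  moreover have "(\<integral>a. (if a \<in> Q n then 0 else measure M a) \<partial>CP) = (\<integral>a. (\<integral>x. indicator a x * (indicator ?c x :: real) \<partial>M) \<partial>CP)"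
    using eq by (intro Bochner_Integration.integral_cong) auto
  ultimately have "integrable CP (\<lambda>a. if a \<in> Q n then 0 else measure M a)" "(\<integral>a. (if a \<in> Q n then 0 else measure M a) \<partial>CP) = measure M ?c"
    using partition_sum[OF ic] by auto
  moreover have "finite (Q n)" by (simp add: Q_def)
  ultimately show ?thesis using QP[of n] ce by (intro exI[of _ "Q n"]) simp
qed

text \<open>Union bound over the \<open>m\<close> steps, each of which leaves the finite alphabet
  with the same probability by invariance.\<close>

lemma Cyl_complement:
  assumes P0: "P0 \<subseteq> P" "finite P0"
  shows "measure M (space M - \<Union>(Cyl P0 m)) \<le> m * measure M (space M - \<Union>P0)"
proof (induction m)
  case (Suc m)
  have s [measurable]: "\<Union>(Cyl P0 k) \<in> sets M" for k
    using Cyl_sets[OF P0(1)] Cyl_finite[OF P0(2)] by (intro sets.finite_Union) auto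
  have s0 [measurable]: "\<Union>P0 \<in> sets M" using P0 P_sets by (intro sets.finite_Union) auto
  let ?A = "space M - \<Union>(Cyl P0 m)"
  have "space M - \<Union>(Cyl P0 (Suc m)) \<subseteq> (space M - \<Union>P0) \<union> (G -` ?A \<inter> space M)"
    using measurable_space[OF G_meas] by auto
  hence "measure M (space M - \<Union>(Cyl P0 (Suc m))) \<le> measure M ((space M - \<Union>P0) \<union> (G -` ?A \<inter> space M))"
    by (intro finite_measure_mono) auto
  also have "\<dots> \<le> measure M (space M - \<Union>P0) + measure M (G -` ?A \<inter> space M)"
    by (intro measure_Un_le) auto
  also have "measure M (G -` ?A \<inter> space M) = measure (distr M M G) ?A" by (subst measure_distr) auto
  finally show ?case using Suc unfolding G_inv by (simp add: algebra_simps)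
qed simp

text \<open>Ergodicity gives for each pair of sets some time at which the first meets a preimage of
  the second with positive measure; finiteness of the family makes time and measure uniform.\<close>

lemma uniform_hits:
  assumes fin: "finite \<C>" and \<C>: "\<And>C. C \<in> \<C> \<Longrightarrow> C \<in> sets M \<and> 0 < measure M C"
  shows "\<exists>n0 \<delta>. 0 < \<delta> \<and> (\<forall>C\<in>\<C>. \<forall>C'\<in>\<C>. \<exists>n\<le>n0. \<delta> \<le> measure M (C \<inter> ((G ^^ n) -` C' \<inter> space M)))"
proof -
  let ?I = "\<lambda>C C' n. C \<inter> ((G ^^ n) -` C' \<inter> space M)"
  have "\<exists>n. 0 < measure M (?I C C' n)" if C: "C \<in> \<C>" "C' \<in> \<C>" for C C'
  proof (rule ccontr)
    assume "\<not> ?thesis"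
    hence 0: "measure M (?I C C' n) = 0" for n using measure_nonneg[of M] by (metis less_eq_real_def)
    have [measurable]: "C \<in> sets M" "C' \<in> sets M" using \<C> C by auto
    have "?I C C' n \<in> null_sets M" for n using 0[of n] by (intro null_setsI) (auto simp: emeasure_eq_measure)
    hence "AE x in M. x \<notin> ?I C C' n" for n by (rule AE_not_in)
    hence "AE x in M. \<forall>n. x \<notin> ?I C C' n" unfolding AE_all_countable by blast
    moreover have "AE x in M. \<exists>n. (G ^^ n) x \<in> C'" using \<C>[OF C(2)] by (intro ergodic_hits erg) auto
    ultimately have "AE x in M. x \<notin> C" using AE_space by eventually_elim blast
    hence "measure M C = 0" by (subst (asm) AE_iff_null_sets[symmetric]) (auto simp: null_sets_def measure_def)
    thus False using \<C>[OF C(1)] by simp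
  qed
  then obtain N where N: "\<And>C C'. C \<in> \<C> \<Longrightarrow> C' \<in> \<C> \<Longrightarrow> 0 < measure M (?I C C' (N C C'))" by metis
  define n0 where "n0 = Max (insert 0 ((\<lambda>(C, C'). N C C') ` (\<C> \<times> \<C>)))"
  define \<delta> where "\<delta> = Min (insert 1 ((\<lambda>(C, C'). measure M (?I C C' (N C C'))) ` (\<C> \<times> \<C>)))"
  have "0 < \<delta>" unfolding \<delta>_def using fin N by (subst Min_gr_iff) auto
  moreover have "N C C' \<le> n0 \<and> \<delta> \<le> measure M (?I C C' (N C C'))" if "C \<in> \<C>" "C' \<in> \<C>" for C C'
    unfolding n0_def \<delta>_def using fin that by (auto intro!: Max_ge Min_le)
  ultimately show ?thesis by blast
qed

text \<open>Expanding the square and applying duality gives \<open>\<integral>(\<phi> \<circ> G -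
  \<phi>)\<^sup>2 = 2 * \<integral>(\<phi> - L \<phi>) * \<phi>\<close>; Cauchy-Schwarz over
  \<open>n\<close> steps costs \<open>n\<^sup>2\<close>. It matters that the bound is linear and not
  quadratic in the sup norm \<open>B\<close>: its square root can then be absorbed.\<close>

lemma near_invariance:
  assumes r: "reg D B \<phi>" "0 \<le> B" and \<rho>: "\<And>x. x \<in> \<Omega> \<Longrightarrow> \<bar>\<phi> x - L \<phi> x\<bar> \<le> e" and e: "0 \<le> e"
  shows "integrable M (\<lambda>x. (\<phi> ((G ^^ n) x) - \<phi> x)\<^sup>2)" "(\<integral>x. (\<phi> ((G ^^ n) x) - \<phi> x)\<^sup>2 \<partial>M) \<le> 2 * real n ^ 2 * e * B"
proof -
  have m [measurable]: "\<phi> \<in> borel_measurable M" using regD(1)[OF r(1)] .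
  have Lm [measurable]: "L \<phi> \<in> borel_measurable M" by (rule L_meas) simp
  have b: "AE x in M. \<bar>\<phi> x\<bar> \<le> B" using AE_\<Omega> by eventually_elim (rule regD(2)[OF r(1)])
  have bn: "AE x in M. \<bar>\<phi> ((G ^^ k) x)\<bar> \<le> B" for k using mpt.AE_G[OF mpt_Gn b] .
  have ib: "integrable M f" if "f \<in> borel_measurable M" "AE x in M. \<bar>f x\<bar> \<le> c" for f :: "'b \<Rightarrow> real" and c
    using that by (intro integrable_const_bound[of _ c]) auto
  have sq: "integrable M (\<lambda>x. (\<phi> ((G ^^ k) x) - \<phi> ((G ^^ l) x))\<^sup>2)" for k l
  proof (rule ib)
    show "AE x in M. \<bar>(\<phi> ((G ^^ k) x) - \<phi> ((G ^^ l) x))\<^sup>2\<bar> \<le> (2 * B)\<^sup>2"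
      using bn[of k] bn[of l]
    proof eventually_elim
      case (elim x)
      hence "\<bar>\<phi> ((G ^^ k) x) - \<phi> ((G ^^ l) x)\<bar> \<le> \<bar>2 * B\<bar>" by linarith
      thus ?case by (simp only: abs_le_square_iff abs_of_nonneg zero_le_power2)
    qed
  qed simp
  show "integrable M (\<lambda>x. (\<phi> ((G ^^ n) x) - \<phi> x)\<^sup>2)" using sq[of n 0] by simp
  have i1: "integrable M (\<lambda>x. (\<phi> x)\<^sup>2)"
  proof (rule ib)
    show "AE x in M. \<bar>(\<phi> x)\<^sup>2\<bar> \<le> B\<^sup>2" using b
    proof eventually_elim
      case (elim x)
      hence "\<bar>\<phi> x\<bar> \<le> \<bar>B\<bar>" by linarith
      thus ?case by (simp only: abs_le_square_iff abs_of_nonneg zero_le_power2)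
    qed
  qed simp
  have i2: "integrable M (\<lambda>x. (\<phi> (G x))\<^sup>2)" using integrable_G[OF i1] .
  have i3: "integrable M (\<lambda>x. \<phi> x * \<phi> (G x))"
  proof (rule ib)
    show "AE x in M. \<bar>\<phi> x * \<phi> (G x)\<bar> \<le> B * B" using b bn[of 1]
      by eventually_elim (auto simp: abs_mult intro!: mult_mono)
  qed simp
  note d = L_dual[OF reg_integrable[OF r(1)] m b]
  have "(\<integral>x. (\<phi> (G x) - \<phi> x)\<^sup>2 \<partial>M) = (\<integral>x. (\<phi> (G x))\<^sup>2 + (\<phi> x)\<^sup>2 - 2 * (\<phi> x * \<phi> (G x)) \<partial>M)"
    by (simp add: power2_diff mult.commute mult.left_commute)
  also have "\<dots> = (\<integral>x. (\<phi> (G x))\<^sup>2 \<partial>M) + (\<integral>x. (\<phi> x)\<^sup>2 \<partial>M) - 2 * (\<integral>x. \<phi> x * \<phi> (G x) \<partial>M)"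
    using i1 i2 i3 by simp
  also have "(\<integral>x. (\<phi> (G x))\<^sup>2 \<partial>M) = (\<integral>x. (\<phi> x)\<^sup>2 \<partial>M)" by (rule integral_G) simp
  also have "(\<integral>x. \<phi> x * \<phi> (G x) \<partial>M) = (\<integral>x. L \<phi> x * \<phi> x \<partial>M)" using d(1) by simp
  also have "(\<integral>x. (\<phi> x)\<^sup>2 \<partial>M) + (\<integral>x. (\<phi> x)\<^sup>2 \<partial>M) - 2 * (\<integral>x. L \<phi> x * \<phi> x \<partial>M) = 2 * (\<integral>x. (\<phi> x - L \<phi> x) * \<phi> x \<partial>M)"
    using i1 d(2) by (simp add: left_diff_distrib power2_eq_square)
  also have "\<dots> \<le> 2 * (e * B)"
  proof -
    have "\<bar>\<integral>x. (\<phi> x - L \<phi> x) * \<phi> x \<partial>M\<bar> \<le> (\<integral>x. e * B \<partial>M)"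
    proof (rule abs_integral_le(2))
      show "AE x in M. \<bar>(\<phi> x - L \<phi> x) * \<phi> x\<bar> \<le> e * B"
        using AE_\<Omega> by eventually_elim (auto simp: abs_mult intro!: mult_mono \<rho> regD(2)[OF r(1)] e)
    qed auto
    thus ?thesis by (simp add: prob_space)
  qed
  finally have one: "(\<integral>x. (\<phi> (G x) - \<phi> x)\<^sup>2 \<partial>M) \<le> 2 * (e * B)" .
  have step: "(\<integral>x. (\<phi> ((G ^^ Suc j) x) - \<phi> ((G ^^ j) x))\<^sup>2 \<partial>M) = (\<integral>x. (\<phi> (G x) - \<phi> x)\<^sup>2 \<partial>M)" for j
    using mpt.integral_G[OF mpt_Gn[of j], of "\<lambda>x. (\<phi> (G x) - \<phi> x)\<^sup>2"] by simp
  have "(\<integral>x. (\<phi> ((G ^^ n) x) - \<phi> x)\<^sup>2 \<partial>M) \<le> (\<integral>x. (\<Sum>j<n. (\<phi> ((G ^^ Suc j) x) - \<phi> ((G ^^ j) x))\<^sup>2) * real n \<partial>M)"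
  proof (rule integral_mono)
    fix x
    have "\<phi> ((G ^^ n) x) - \<phi> x = (\<Sum>j<n. \<phi> ((G ^^ Suc j) x) - \<phi> ((G ^^ j) x))"
      using sum_lessThan_telescope[of "\<lambda>j. \<phi> ((G ^^ j) x)" n] by simp
    also have "\<dots>\<^sup>2 \<le> (\<Sum>j<n. (\<phi> ((G ^^ Suc j) x) - \<phi> ((G ^^ j) x))\<^sup>2) * real (card {..<n})"
      by (rule sum_squared_le_sum_of_squares)
    finally show "(\<phi> ((G ^^ n) x) - \<phi> x)\<^sup>2 \<le> (\<Sum>j<n. (\<phi> ((G ^^ Suc j) x) - \<phi> ((G ^^ j) x))\<^sup>2) * real n" by simp
  qed (use sq[of n 0] sq in \<open>auto simp del: funpow.simps\<close>)
  also have "\<dots> = (\<Sum>j<n. (\<integral>x. (\<phi> ((G ^^ Suc j) x) - \<phi> ((G ^^ j) x))\<^sup>2 \<partial>M)) * real n"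
    using sq by (simp del: funpow.simps)
  also have "\<dots> = real n * (\<integral>x. (\<phi> (G x) - \<phi> x)\<^sup>2 \<partial>M) * real n" unfolding step by simp
  also have "\<dots> \<le> real n * (2 * (e * B)) * real n" using one by (intro mult_right_mono mult_left_mono) auto
  finally show "(\<integral>x. (\<phi> ((G ^^ n) x) - \<phi> x)\<^sup>2 \<partial>M) \<le> 2 * real n ^ 2 * e * B" by (simp add: power2_eq_square algebra_simps)
qed

end

lemma sqrt_le_linear: "0 \<le> z \<Longrightarrow> 0 < \<kappa> \<Longrightarrow> sqrt z \<le> \<kappa> * z + 1 / \<kappa>"
proof -
  assume z: "0 \<le> z" and k: "0 < \<kappa>"
  have "sqrt ((\<kappa> * z) * (1 / \<kappa>)) \<le> (\<kappa> * z + 1 / \<kappa>) / 2" using z k by (intro arith_geo_mean_sqrt) auto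
  hence "sqrt z \<le> (\<kappa> * z + 1 / \<kappa>) / 2" using k by simp
  also have "\<dots> \<le> \<kappa> * z + 1 / \<kappa>"
  proof -
    have "y / 2 \<le> y" if "0 \<le> y" for y :: real using that by simp
    moreover have "0 \<le> \<kappa> * z + 1 / \<kappa>" using z k by simp
    ultimately show ?thesis .
  qed
  finally show ?thesis .
qed

context gm_system
begin

lemma \<Omega>_nonempty: "\<Omega> \<noteq> {}"
proof
  assume "\<Omega> = {}"
  hence "AE x in M. False" using AE_\<Omega> by simp
  thus False by simp
qed

text \<open>A finite Lipschitz constant known in advance, however large, is driven to the fixed
  point of \<open>D \<mapsto> \<theta> * D + E\<close>. This frees the Lipschitz constant of
  \<open>S w n\<close> from its dependence on \<open>n\<close>.\<close>

lemma reg_contract: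
  assumes \<phi>: "reg D0 B \<phi>" and D0: "0 \<le> D0"
    and step: "\<And>D. 0 \<le> D \<Longrightarrow> reg D B \<phi> \<Longrightarrow> reg (\<theta> * D + E) B \<phi>" and E: "0 \<le> E"
  shows "reg (E / (1 - \<theta>)) B \<phi>"
proof -
  define D where "D = E / (1 - \<theta>)"
  have DE: "0 \<le> D" "\<theta> * D + E = D" using E \<theta> by (auto simp: D_def field_simps)
  have k: "reg (\<theta> ^ k * D0 + D) B \<phi>" for k
  proof (induction k)
    case 0 thus ?case using reg_mono[OF \<phi>, of "D0 + D" B] DE by simp
  next
    case (Suc k)
    have "reg (\<theta> * (\<theta> ^ k * D0 + D) + E) B \<phi>" using \<theta> D0 DE by (intro step Suc) auto
    moreover have "\<theta> * (\<theta> ^ k * D0 + D) + E = \<theta> ^ Suc k * D0 + (\<theta> * D + E)" by (simp add: algebra_simps)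
    ultimately show ?case unfolding DE(2) by simp
  qed
  show ?thesis unfolding reg_def D_def[symmetric]
  proof (intro conjI ballI)
    show "\<phi> \<in> borel_measurable M" "\<And>x. x \<in> \<Omega> \<Longrightarrow> \<bar>\<phi> x\<bar> \<le> B" using regD(1,2)[OF \<phi>] by auto
    fix a x y assume a: "a \<in> P" and x: "x \<in> \<Omega> \<inter> a" and y: "y \<in> \<Omega> \<inter> a"
    have "(\<lambda>k. (\<theta> ^ k * D0 + D) * rho x y) \<longlonglongrightarrow> (0 * D0 + D) * rho x y"
      using \<theta> by (intro tendsto_intros LIMSEQ_power_zero) auto
    moreover have "\<bar>\<phi> x - \<phi> y\<bar> \<le> (\<theta> ^ k * D0 + D) * rho x y" for k using regD(3)[OF k a] x y by blast
    ultimately show "\<bar>\<phi> x - \<phi> y\<bar> \<le> D * rho x y" by (intro LIMSEQ_le_const) auto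
  qed
qed

text \<open>Without mixing the sums \<open>S w n\<close> need not converge, but they stay bounded: a function
  \<open>\<phi> = S w n\<close> satisfies \<open>\<phi> - L \<phi> = O(1)\<close>, hence is nearly invariant in \<open>L\<^sup>2\<close>, and ergodicity links
  the finitely many cylinders that carry most of the mass.\<close>

lemma transfer_sums_bounded: "\<exists>K>0. \<forall>w n. reg 1 1 w \<longrightarrow> (\<integral>x. w x \<partial>M) = 0 \<longrightarrow> (\<forall>x\<in>\<Omega>. \<bar>S w n x\<bar> \<le> K)"
proof -
  \<comment> \<open>Depth of the cylinders, large enough for the oscillation of \<phi> within them
    to contribute at most \<open>s / 8\<close>.\<close>
  obtain m0 where m0: "\<theta> ^ m0 < 1 / (16 * (E1 + 1))" using real_arch_pow_inv[of "1 / (16 * (E1 + 1))" \<theta>] E1 \<theta> by auto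
  define m where "m = Suc m0"
  have m1: "1 \<le> m" by (simp add: m_def)
  have m: "2 * \<theta> ^ m * E1 \<le> 1/8"
  proof -
    have "\<theta> ^ m \<le> \<theta> ^ m0" using \<theta> by (simp add: m_def mult_left_le_one_le)
    hence "\<theta> ^ m \<le> 1 / (16 * (E1 + 1))" using m0 by linarith
    hence "2 * \<theta> ^ m * E1 \<le> 2 * (1 / (16 * (E1 + 1))) * (E1 + 1)" using E1 \<theta> by (intro mult_mono mult_left_mono) auto
    also have "\<dots> = 1/8" using E1 by (simp add: field_simps)
    finally show ?thesis .
  qed
  \<comment> \<open>Mass allowed outside the finite alphabet: the losses it causes,
    \<open>2 * s * m * e\<close> in the mean and \<open>s * K2 * e\<close> in each of
    \<open>m\<close> backward steps, add up to \<open>s / 8\<close>.\<close>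
  define e where "e = 1 / (8 * m * (2 + K2))"
  have e: "0 < e" using m1 K2 by (simp add: e_def)
  have e2: "m * e * (2 + K2) = 1/8" using m1 K2 by (simp add: e_def)
  obtain P0 where P0: "P0 \<subseteq> P" "finite P0" "measure M (space M - \<Union>P0) \<le> e"
      "integrable CP (\<lambda>a. if a \<in> P0 then 0 else measure M a)" "(\<integral>a. (if a \<in> P0 then 0 else measure M a) \<partial>CP) \<le> e"
    using finite_approx[OF e] by blast
  have compl: "measure M (space M - \<Union>(Cyl P0 m)) \<le> m * e"
    using Cyl_complement[OF P0(1,2), of m] mult_left_mono[OF P0(3), of "real m"] by linarith
  \<comment> \<open>Null cylinders are dropped because hitting times need positive measure; points
    of \<open>\<Omega>\<close> lie in none of them.\<close>
  define \<C> where "\<C> = {C \<in> Cyl P0 m. 0 < measure M C}"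
  have \<C>: "finite \<C>" "\<And>C. C \<in> \<C> \<Longrightarrow> C \<in> sets M \<and> 0 < measure M C"
    using Cyl_finite[OF P0(2)] Cyl_sets[OF P0(1)] by (auto simp: \<C>_def)
  obtain n0 :: nat and \<delta> where \<delta>: "0 < \<delta>"
    and hit: "\<And>C C'. C \<in> \<C> \<Longrightarrow> C' \<in> \<C> \<Longrightarrow> \<exists>n\<le>n0. \<delta> \<le> measure M (C \<inter> ((G ^^ n) -` C' \<inter> space M))"
    using uniform_hits[OF \<C>] by blast
  define A where "A j = {x \<in> \<Omega>. x \<in> \<Union>(Cyl P0 j)}" for j
  define Dr where "Dr = 2 + E1"
  \<comment> \<open>Makes \<open>\<kappa> * (4 * n0\<^sup>2) / \<delta> \<le> 1/4\<close>, so that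
    the square root of the variance bound costs at most \<open>s / 4\<close>.\<close>
  define \<kappa> where "\<kappa> = \<delta> / (16 * real n0 ^ 2 + 16)"
  have \<kappa>: "0 < \<kappa>" using \<delta> by (simp add: \<kappa>_def add_nonneg_pos)
  \<comment> \<open>The terms proportional to \<open>s\<close> total
    \<open>s/8 + s/4 + s/8 = s/2\<close>; moving them to the left gives the factor 2, and the
    bracket collects the terms free of \<open>s\<close>.\<close>
  define K where "K = 2 * (2 * \<theta> ^ m * Dr / (1 - \<theta>) + \<kappa> / \<delta> + 1 / \<kappa> + 2 * m)"
  have K: "0 < K"
  proof -
    have "0 \<le> 2 * \<theta> ^ m * Dr / (1 - \<theta>)" "0 \<le> real (2 * m)" using \<theta> E1 by (simp_all add: Dr_def)
    moreover have "0 < \<kappa> / \<delta>" "0 < 1 / \<kappa>" using \<kappa> \<delta> by auto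
    ultimately show ?thesis unfolding K_def
      by (intro mult_pos_pos add_pos_nonneg[OF add_pos_pos[OF add_nonneg_pos]]) simp_all
  qed
  have "\<bar>S w n x\<bar> \<le> K" if w: "reg 1 1 w" and w0: "(\<integral>x. w x \<partial>M) = 0" and x: "x \<in> \<Omega>" for w n x
  proof -
    define \<phi> where "\<phi> = S w n"
    have eq: "\<phi> z = L \<phi> z + (w z - (L ^^ n) w z)" if "z \<in> \<Omega>" for z
      unfolding \<phi>_def by (rule L_S(2)[OF w _ _ that]) auto
    have Ln: "reg (1 + E1) 1 ((L ^^ n) w)" using Lpow_reg[OF w, of n] by simp
    have \<rho>2: "\<bar>\<phi> z - L \<phi> z\<bar> \<le> 2" if z: "z \<in> \<Omega>" for z
      using eq[OF z] regD(2)[OF w z] regD(2)[OF Ln z] by linarith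
    have reg0: "reg (real n * (1 + E1)) (real n) \<phi>"
      unfolding \<phi>_def S_def[abs_def] using reg_sum[of "{..<n}" "1 + E1" 1 "\<lambda>k. (L ^^ k) w"] Lpow_reg[OF w] by simp
    \<comment> \<open>The quantity to be bounded. It is finite by the crude bound \<open>n\<close>,
      and this allows terms in \<open>s\<close> to be absorbed at the end.\<close>
    define s where "s = (SUP z\<in>\<Omega>. \<bar>\<phi> z\<bar>)"
    have bdd: "bdd_above ((\<lambda>z. \<bar>\<phi> z\<bar>) ` \<Omega>)" using regD(2)[OF reg0] by (intro bdd_aboveI[of _ "real n"]) auto
    have s: "\<bar>\<phi> z\<bar> \<le> s" if "z \<in> \<Omega>" for z unfolding s_def using that bdd by (rule cSUP_upper)
    have s0: "0 \<le> s" using s[OF x] by linarith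
    have reg1: "reg (real n * (1 + E1)) s \<phi>" using reg0 s unfolding reg_def by blast
    define D where "D = (K1 * s + Dr) / (1 - \<theta>)"
    have reg\<phi>: "reg D s \<phi>" unfolding D_def
    proof (rule reg_contract[OF reg1])
      show "0 \<le> real n * (1 + E1)" "0 \<le> K1 * s + Dr" using E1 K1 s0 by (auto simp: Dr_def)
      fix D assume D: "0 \<le> D" and r: "reg D s \<phi>"
      show "reg (\<theta> * D + (K1 * s + Dr)) s \<phi>" unfolding reg_def
      proof (intro conjI ballI)
        show "\<phi> \<in> borel_measurable M" using regD(1)[OF reg0] .
        show "\<bar>\<phi> z\<bar> \<le> s" if "z \<in> \<Omega>" for z using s[OF that] .
        fix a y z assume a: "a \<in> P" and y: "y \<in> \<Omega> \<inter> a" and z: "z \<in> \<Omega> \<inter> a"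
        have "\<bar>L \<phi> y - L \<phi> z\<bar> \<le> \<theta> * (D + K1 * s) * rho y z" using regD(3)[OF L_reg[OF r s0] a] y z by blast
        also have "\<dots> \<le> (\<theta> * D + K1 * s) * rho y z"
          using \<theta> K1 s0 mult_right_mono[of \<theta> 1 "K1 * s"] rho_nonneg
          by (intro mult_right_mono) (auto simp: distrib_left)
        finally have 1: "\<bar>L \<phi> y - L \<phi> z\<bar> \<le> (\<theta> * D + K1 * s) * rho y z" .
        have 2: "\<bar>w y - w z\<bar> \<le> 1 * rho y z" using regD(3)[OF w a] y z by blast
        have 3: "\<bar>(L ^^ n) w y - (L ^^ n) w z\<bar> \<le> (1 + E1) * rho y z" using regD(3)[OF Ln a] y z by blast
        have "\<phi> y - \<phi> z = (L \<phi> y - L \<phi> z) + (w y - w z) - ((L ^^ n) w y - (L ^^ n) w z)"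
          using eq[of y] eq[of z] y z by simp
        hence "\<bar>\<phi> y - \<phi> z\<bar> \<le> (\<theta> * D + K1 * s) * rho y z + 1 * rho y z + (1 + E1) * rho y z"
          using 1 2 3 by linarith
        thus "\<bar>\<phi> y - \<phi> z\<bar> \<le> (\<theta> * D + (K1 * s + Dr)) * rho y z" by (simp add: Dr_def algebra_simps)
      qed
    qed
    \<comment> \<open>Chebyshev threshold: if the squared jump exceeded \<open>v\<close> on a set of
      measure \<delta>, its integral would be at least \<open>4 * n0\<^sup>2 * s + 1\<close>,
      against \<open>near_invariance\<close>.\<close>
    define v where "v = (4 * real n0 ^ 2 * s + 1) / \<delta>"
    define osc where "osc = 2 * (D * \<theta> ^ m) + sqrt v"
    have D0: "0 \<le> D" using K1 s0 E1 \<theta> by (simp add: D_def Dr_def)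
    \<comment> \<open>Any two points are joined by a chain: from \<open>y\<close> to some
      \<open>x'\<close> in its cylinder, from \<open>x'\<close> to its iterate in the cylinder of
      \<open>z\<close>, and from there to \<open>z\<close>. The two moves inside cylinders cost
      \<open>D * \<theta> ^ m\<close> each, the dynamical one \<open>sqrt v\<close>.\<close>
    have osc: "\<bar>\<phi> y - \<phi> z\<bar> \<le> osc" if y: "y \<in> A m" and z: "z \<in> A m" for y z
    proof -
      obtain C where C: "C \<in> Cyl P0 m" "y \<in> C" using y by (auto simp: A_def)
      obtain C' where C': "C' \<in> Cyl P0 m" "z \<in> C'" using z by (auto simp: A_def)
      have yz: "y \<in> \<Omega>" "z \<in> \<Omega>" using y z by (auto simp: A_def)
      have "C \<in> \<C>" "C' \<in> \<C>" using C C' \<Omega>_Cyl_pos yz subsetD[OF Cyl_mono[OF P0(1)]] unfolding \<C>_def by blast+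
      then obtain k where k: "k \<le> n0" "\<delta> \<le> measure M (C \<inter> ((G ^^ k) -` C' \<inter> space M))" using hit by blast
      let ?I = "C \<inter> ((G ^^ k) -` C' \<inter> space M)"
      have [measurable]: "C \<in> sets M" "C' \<in> sets M" using Cyl_sets[OF P0(1)] C C' by auto
      have ni: "integrable M (\<lambda>x. (\<phi> ((G ^^ k) x) - \<phi> x)\<^sup>2)" "(\<integral>x. (\<phi> ((G ^^ k) x) - \<phi> x)\<^sup>2 \<partial>M) \<le> 2 * real k ^ 2 * 2 * s"
        using near_invariance[OF reg\<phi> s0, of 2 k] \<rho>2 by auto
      have "\<exists>x'\<in>\<Omega> \<inter> ?I. (\<phi> ((G ^^ k) x') - \<phi> x')\<^sup>2 \<le> v"
      proof (rule ccontr)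
        assume "\<not> ?thesis"
        hence gt: "v < (\<phi> ((G ^^ k) x') - \<phi> x')\<^sup>2" if "x' \<in> \<Omega>" "x' \<in> ?I" for x' using that by force
        have v0: "0 \<le> v" using s0 \<delta> by (simp add: v_def)
        have "v * \<delta> \<le> v * measure M ?I" using k v0 by (intro mult_left_mono) auto
        also have "\<dots> = (\<integral>x. indicator ?I x * v \<partial>M)" by simp
        also have "\<dots> \<le> (\<integral>x. (\<phi> ((G ^^ k) x) - \<phi> x)\<^sup>2 \<partial>M)"
        proof (rule integral_mono_AE)
          show "integrable M (\<lambda>x. indicator ?I x * v)" by (intro integrable_mult_left) (simp add: integrable_real_indicator less_top[symmetric])
          show "AE x in M. indicator ?I x * v \<le> (\<phi> ((G ^^ k) x) - \<phi> x)\<^sup>2"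
            using AE_\<Omega> by eventually_elim (use gt in \<open>auto simp: indicator_def less_imp_le\<close>)
        qed (rule ni)
        also have "\<dots> \<le> 2 * real k ^ 2 * 2 * s" by (rule ni)
        also have "\<dots> \<le> 4 * real n0 ^ 2 * s" using k(1) s0 by (simp add: mult_right_mono)
        finally show False using \<delta> by (simp add: v_def)
      qed
      then obtain x' where x': "x' \<in> \<Omega>" "x' \<in> C" "(G ^^ k) x' \<in> C'" "(\<phi> ((G ^^ k) x') - \<phi> x')\<^sup>2 \<le> v" by blast
      have Gx': "(G ^^ k) x' \<in> \<Omega>" using x'(1) by (induction k) (auto intro: \<Omega>_G)
      have near: "\<bar>\<phi> p - \<phi> q\<bar> \<le> D * \<theta> ^ m" if "c \<in> Cyl P0 m" "p \<in> c" "q \<in> c" "p \<in> \<Omega>" "q \<in> \<Omega>" for c p q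
      proof -
        obtain a where a: "a \<in> P0" "c \<subseteq> a" using Cyl_Suc_sub[of c P0 m0] \<open>c \<in> Cyl P0 m\<close> unfolding m_def by blast
        have "\<bar>\<phi> p - \<phi> q\<bar> \<le> D * rho p q" using a P0(1) that by (intro regD(3)[OF reg\<phi>, of a]) auto
        also have "\<dots> \<le> D * \<theta> ^ m" using Cyl_rho[OF P0(1) that(1-3)] D0 by (rule mult_left_mono)
        finally show ?thesis .
      qed
      have "\<bar>\<phi> ((G ^^ k) x') - \<phi> x'\<bar> \<le> sqrt v" using x'(4) by (metis real_sqrt_abs real_sqrt_le_iff)
      thus ?thesis using near[OF C(1) C(2) x'(2) yz(1) x'(1)] near[OF C'(1) x'(3) C'(2) Gx' yz(2)]
        unfolding osc_def by linarith
    qed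
    have osc0: "0 \<le> osc" using D0 \<theta> s0 \<delta> by (simp add: osc_def v_def)
    \<comment> \<open>The zero mean converts oscillation into size: \<open>\<phi> y\<close> is the
      average of \<open>\<phi> y - \<phi> x\<close>, where points outside the cylinders are counted
      with the trivial bound \<open>2 * s\<close>.\<close>
    have Am: "\<bar>\<phi> y\<bar> \<le> osc + 2 * s * (m * e)" if y: "y \<in> A m" for y
    proof -
      have s' [measurable]: "\<Union>(Cyl P0 m) \<in> sets M"
        using Cyl_sets[OF P0(1)] Cyl_finite[OF P0(2)] by (intro sets.finite_Union) auto
      have i: "integrable M \<phi>" by (rule reg_integrable[OF reg0])
      have "(\<integral>x. \<phi> x \<partial>M) = 0" unfolding \<phi>_def by (rule S_mean_zero[OF w _ _ w0]) auto
      hence "\<phi> y = (\<integral>x. \<phi> y - \<phi> x \<partial>M)" using i by (simp add: prob_space)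
      moreover have "\<bar>\<integral>x. \<phi> y - \<phi> x \<partial>M\<bar> \<le> (\<integral>x. osc + 2 * s * indicator (space M - \<Union>(Cyl P0 m)) x \<partial>M)"
      proof (rule abs_integral_le(2))
        show "AE x in M. \<bar>\<phi> y - \<phi> x\<bar> \<le> osc + 2 * s * indicator (space M - \<Union>(Cyl P0 m)) x"
          using AE_\<Omega>
        proof eventually_elim
          case (elim x)
          show ?case
          proof (cases "x \<in> A m")
            case True thus ?thesis using osc[OF y True] s0 by (simp add: indicator_def)
          next
            case False
            have "\<bar>\<phi> y - \<phi> x\<bar> \<le> 2 * s" using s[OF elim] s[of y] y by (simp add: A_def)
            moreover have "x \<in> space M - \<Union>(Cyl P0 m)" using False elim \<Omega>_space[OF elim] by (auto simp: A_def)
            ultimately show ?thesis using osc0 by simp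
          qed
        qed
      qed (use i in \<open>auto intro!: integrable_real_mult_indicator simp: integrable_real_indicator less_top[symmetric]\<close>)
      moreover have "(\<integral>x. osc + 2 * s * indicator (space M - \<Union>(Cyl P0 m)) x \<partial>M) = osc + 2 * s * measure M (space M - \<Union>(Cyl P0 m))"
        by (subst Bochner_Integration.integral_add) (auto simp: prob_space integrable_real_indicator less_top[symmetric])
      moreover have "2 * s * measure M (space M - \<Union>(Cyl P0 m)) \<le> 2 * s * (m * e)" using compl s0 by (intro mult_left_mono) auto
      ultimately show ?thesis by linarith
    qed
    \<comment> \<open>One application of \<open>L\<close> trades a level of cylinders: branches in
      the finite alphabet lead from \<open>A j\<close> into \<open>A (Suc j)\<close>, the others
      carry total weight at most \<open>K2 * e\<close>, and \<open>\<phi> - L \<phi>\<close> is at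
      most 2.\<close>
    have step: "\<bar>\<phi> y\<bar> \<le> t + (s * K2 * e + 2)" if t: "\<And>z. z \<in> A (Suc j) \<Longrightarrow> \<bar>\<phi> z\<bar> \<le> t" and t0: "0 \<le> t" and y: "y \<in> A j" for j t y
    proof -
      have y': "y \<in> \<Omega>" using y by (simp add: A_def)
      obtain c where c: "c \<in> Cyl P0 j" "y \<in> c" using y by (auto simp: A_def)
      let ?b = "\<lambda>a. jw a y * t + (s * K2) * (if a \<in> P0 then 0 else measure M a)"
      have "\<bar>L \<phi> y\<bar> \<le> (\<integral>a. ?b a \<partial>CP)"
        unfolding L_def
      proof (rule abs_integral_le(2))
        show "integrable CP ?b" using jw_sum(1)[OF y'] P0(4) by auto
        have "\<bar>jw a y * \<phi> (br a y)\<bar> \<le> ?b a" if a: "a \<in> P" for a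
        proof (cases "y \<in> G ` a")
          case False thus ?thesis using s0 K2 by (simp add: jw_def)
        next
          case True
          have b\<Omega>: "br a y \<in> \<Omega>" by (rule \<Omega>_br[OF y' a True])
          show ?thesis
          proof (cases "a \<in> P0")
            case P0': True
            have "a \<inter> (G -` c \<inter> space M) \<in> Cyl P0 (Suc j)" using P0' c by auto
            moreover have "br a y \<in> a \<inter> (G -` c \<inter> space M)" using br_in[OF a] br_space[OF a] G_br[OF a True] c by auto
            ultimately have "br a y \<in> A (Suc j)" using b\<Omega> unfolding A_def by blast
            hence "jw a y * \<bar>\<phi> (br a y)\<bar> \<le> jw a y * t" using jw_nonneg[OF a] by (intro mult_left_mono t) auto
            thus ?thesis using P0' jw_nonneg[OF a, of y] by (simp add: abs_mult)
          next
            case nP0: False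
            have "jw a y * \<bar>\<phi> (br a y)\<bar> \<le> (K2 * measure M a) * s"
              using g_le[OF a br_in[OF a], of y] K2 jw_nonneg[OF a] s[OF b\<Omega>] s0 True
              by (intro mult_mono) (auto simp: jw_def)
            moreover have "0 \<le> jw a y * t" using jw_nonneg[OF a] t0 by simp
            ultimately show ?thesis using nP0 jw_nonneg[OF a, of y] by (simp add: abs_mult algebra_simps)
          qed
        qed
        thus "AE a in CP. \<bar>jw a y * \<phi> (br a y)\<bar> \<le> ?b a" by (simp add: AE_count_space)
      qed simp
      also have "\<dots> = t + (s * K2) * (\<integral>a. (if a \<in> P0 then 0 else measure M a) \<partial>CP)"
        using jw_sum[OF y'] P0(4) by simp
      also have "\<dots> \<le> t + (s * K2) * e" using P0(5) s0 K2 by (intro add_left_mono mult_left_mono) auto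
      finally show ?thesis using \<rho>2[OF y'] by linarith
    qed
    have "\<bar>\<phi> y\<bar> \<le> (osc + 2 * s * (m * e)) + j * (s * K2 * e + 2)" if "j \<le> m" "y \<in> A (m - j)" for j y
      using that
    proof (induction j arbitrary: y)
      case 0 thus ?case using Am by simp
    next
      case (Suc j)
      have "0 \<le> s * K2 * e" using s0 K2 e by simp
      hence "0 \<le> (osc + 2 * s * (m * e)) + j * (s * K2 * e + 2)" using osc0 s0 e K2 by (intro add_nonneg_nonneg mult_nonneg_nonneg) auto
      moreover have "Suc (m - Suc j) = m - j" using Suc.prems by simp
      ultimately have "\<bar>\<phi> y\<bar> \<le> ((osc + 2 * s * (m * e)) + j * (s * K2 * e + 2)) + (s * K2 * e + 2)"
        using Suc by (intro step[of "m - Suc j"]) auto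
      thus ?case by (simp add: algebra_simps)
    qed
    \<comment> \<open>The case \<open>j = m\<close>: cylinders of length 0 are the whole space, so
      \<open>A 0\<close> is all of \<open>\<Omega>\<close>.\<close>
    hence "\<bar>\<phi> y\<bar> \<le> (osc + 2 * s * (m * e)) + m * (s * K2 * e + 2)" if "y \<in> \<Omega>" for y
      using that \<Omega>_space[OF that] by (simp add: A_def)
    hence "s \<le> (osc + 2 * s * (m * e)) + m * (s * K2 * e + 2)"
      unfolding s_def by (intro cSUP_least \<Omega>_nonempty) auto
    also have "\<dots> = osc + s * (m * e * (2 + K2)) + 2 * m" by (simp add: algebra_simps)
    also have "\<dots> = osc + s / 8 + 2 * m" unfolding e2 by simp
    also have "osc \<le> 2 * \<theta> ^ m * Dr / (1 - \<theta>) + s / 8 + (s / 4 + \<kappa> / \<delta> + 1 / \<kappa>)"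
    proof -
      have "2 * (D * \<theta> ^ m) = (2 * \<theta> ^ m * E1) * s + 2 * \<theta> ^ m * Dr / (1 - \<theta>)"
        by (simp add: D_def E1_def add_divide_distrib algebra_simps)
      also have "\<dots> \<le> 1/8 * s + 2 * \<theta> ^ m * Dr / (1 - \<theta>)" using m s0 by (intro add_right_mono mult_right_mono) auto
      finally have 1: "2 * (D * \<theta> ^ m) \<le> s / 8 + 2 * \<theta> ^ m * Dr / (1 - \<theta>)" by simp
      have "sqrt v \<le> \<kappa> * v + 1 / \<kappa>" using \<kappa> s0 \<delta> by (intro sqrt_le_linear) (auto simp: v_def)
      also have "\<kappa> * v = (\<kappa> * (4 * real n0 ^ 2) / \<delta>) * s + \<kappa> / \<delta>" by (simp add: v_def field_simps add_divide_distrib)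
      also have "\<dots> \<le> 1/4 * s + \<kappa> / \<delta>"
      proof -
        have "\<kappa> * (4 * real n0 ^ 2) / \<delta> = (4 * real n0 ^ 2) / (16 * real n0 ^ 2 + 16)" using \<delta> by (simp add: \<kappa>_def)
        also have "\<dots> \<le> 1/4" by (subst pos_divide_le_eq) (auto simp: add_nonneg_pos)
        finally show ?thesis using s0 by (intro add_right_mono mult_right_mono) auto
      qed
      finally show ?thesis using 1 unfolding osc_def by simp
    qed
    finally have "s \<le> K" unfolding K_def by simp
    thus ?thesis using s[OF x] unfolding \<phi>_def by simp
  qed
  thus ?thesis using K by blast
qed

section \<open>Rescaling, and the martingale-coboundary decomposition\<close>

lemma Lpow_scale: "(L ^^ k) (\<lambda>x. c * w x) x = c * (L ^^ k) w x"
proof (induction k arbitrary: x)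
  case (Suc k)
  have "(L ^^ k) (\<lambda>x. c * w x) = (\<lambda>x. c * (L ^^ k) w x)" using Suc by auto
  thus ?case by (simp add: L_scale)
qed simp

lemma reg_scale: assumes "reg D B \<phi>" "0 \<le> c" shows "reg (c * D) (c * B) (\<lambda>x. c * \<phi> x)"
  unfolding reg_def
proof (intro conjI ballI)
  have [measurable]: "\<phi> \<in> borel_measurable M" using regD(1)[OF assms(1)] .
  show "(\<lambda>x. c * \<phi> x) \<in> borel_measurable M" by measurable
  show "\<bar>c * \<phi> x\<bar> \<le> c * B" if "x \<in> \<Omega>" for x
    using regD(2)[OF assms(1) that] assms(2) by (simp add: abs_mult mult_left_mono)
  fix a x y assume a: "a \<in> P" and x: "x \<in> \<Omega> \<inter> a" and y: "y \<in> \<Omega> \<inter> a"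
  have "\<bar>\<phi> x - \<phi> y\<bar> \<le> D * rho x y" using regD(3)[OF assms(1) a] x y by blast
  hence "c * \<bar>\<phi> x - \<phi> y\<bar> \<le> c * (D * rho x y)" using assms(2) by (rule mult_left_mono)
  moreover have "\<bar>c * \<phi> x - c * \<phi> y\<bar> = c * \<bar>\<phi> x - \<phi> y\<bar>"
    using assms(2) by (simp add: right_diff_distrib[symmetric] abs_mult)
  ultimately show "\<bar>c * \<phi> x - c * \<phi> y\<bar> \<le> c * D * rho x y" by (simp add: mult.assoc)
qed

lemma transfer_sums_bounded_scaled:
  "\<exists>K>0. \<forall>D w n. 0 < D \<longrightarrow> reg D D w \<longrightarrow> (\<integral>x. w x \<partial>M) = 0 \<longrightarrow> (\<forall>x\<in>\<Omega>. \<bar>S w n x\<bar> \<le> K * D)"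
proof -
  obtain K where K: "K > 0" "\<And>w n x. reg 1 1 w \<Longrightarrow> (\<integral>x. w x \<partial>M) = 0 \<Longrightarrow> x \<in> \<Omega> \<Longrightarrow> \<bar>S w n x\<bar> \<le> K"
    using transfer_sums_bounded by blast
  have "\<bar>S w n x\<bar> \<le> K * D" if D: "0 < D" and w: "reg D D w" and w0: "(\<integral>x. w x \<partial>M) = 0" and x: "x \<in> \<Omega>" for D w n x
  proof -
    have "reg 1 1 (\<lambda>x. 1/D * w x)" using reg_scale[OF w, of "1/D"] D by simp
    hence "\<bar>S (\<lambda>x. 1/D * w x) n x\<bar> \<le> K" using w0 by (intro K(2) x) auto
    moreover have "S (\<lambda>x. 1/D * w x) n x = 1/D * S w n x"
      unfolding S_def Lpow_scale sum_distrib_left ..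
    ultimately have "\<bar>1/D * S w n x\<bar> \<le> K" by simp
    thus ?thesis using D by (simp add: abs_mult field_simps)
  qed
  thus ?thesis using K(1) by blast
qed

text \<open>Bounded test functions suffice: an arbitrary one is cut off at level \<open>k\<close>,
  and the integrable product dominates.\<close>

lemma reverse_diffI:
  assumes d: "integrable M d"
    and 0: "\<And>\<psi> B. \<psi> \<in> borel_measurable M \<Longrightarrow> (\<And>x. \<bar>\<psi> x\<bar> \<le> B) \<Longrightarrow> (\<integral>x. d x * \<psi> (G x) \<partial>M) = 0"
  shows "reverse_diff d"
  unfolding reverse_diff_def
proof (intro ballI impI)
  fix \<psi> :: "'b \<Rightarrow> real" assume [measurable]: "\<psi> \<in> borel_measurable M" and i: "integrable M (\<lambda>x. d x * \<psi> (G x))"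
  have [measurable]: "d \<in> borel_measurable M" using d by auto
  define \<psi>k where "\<psi>k k x = (if \<bar>\<psi> x\<bar> \<le> real k then \<psi> x else 0)" for k x
  have [measurable]: "\<psi>k k \<in> borel_measurable M" for k unfolding \<psi>k_def by measurable
  have "(\<lambda>k. \<integral>x. d x * \<psi>k k (G x) \<partial>M) \<longlonglongrightarrow> (\<integral>x. d x * \<psi> (G x) \<partial>M)"
  proof (rule integral_dominated_convergence[where w="\<lambda>x. \<bar>d x * \<psi> (G x)\<bar>"])
    show "AE x in M. (\<lambda>k. d x * \<psi>k k (G x)) \<longlonglongrightarrow> d x * \<psi> (G x)"
    proof (rule AE_I2)
      fix x
      obtain N :: nat where N: "\<bar>\<psi> (G x)\<bar> \<le> real N" using real_arch_simple by blast
      have "\<forall>\<^sub>F k in sequentially. d x * \<psi>k k (G x) = d x * \<psi> (G x)"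
        using eventually_ge_at_top[of N] by eventually_elim (use N in \<open>auto simp: \<psi>k_def\<close>)
      thus "(\<lambda>k. d x * \<psi>k k (G x)) \<longlonglongrightarrow> d x * \<psi> (G x)" by (rule tendsto_eventually)
    qed
    show "AE x in M. norm (d x * \<psi>k k (G x)) \<le> \<bar>d x * \<psi> (G x)\<bar>" for k by (auto simp: \<psi>k_def)
  qed (use i in auto)
  moreover have "(\<integral>x. d x * \<psi>k k (G x) \<partial>M) = 0" for k by (rule 0[of _ "real k"]) (auto simp: \<psi>k_def)
  ultimately show "(\<integral>x. d x * \<psi> (G x) \<partial>M) = 0" using LIMSEQ_unique[OF tendsto_const] by fastforce
qed

text \<open>An approximate solution \<xi> of the Poisson equation for \<open>w = L \<phi>\<close>,
  the Cesaro mean of the sums \<open>S w n\<close>, leaves the remainder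
  \<open>r = L (S w N) / N\<close>. By construction \<open>L\<close> annihilates \<open>d\<close>,
  which by duality makes \<open>d\<close> a reverse difference. The constant depends on the weight
  \<open>b\<close> alone, so it serves all observables and all \<open>N\<close> at once.\<close>

theorem martingale_coboundary:
  assumes b0: "\<And>a. a \<in> P \<Longrightarrow> 0 \<le> b a" and bi: "integrable CP (\<lambda>a. measure M a * b a)"
  shows "\<exists>K>0. \<forall>\<phi> N. integrable M \<phi> \<longrightarrow> wreg b \<phi> \<longrightarrow> (\<integral>x. \<phi> x \<partial>M) = 0 \<longrightarrow> 0 < N \<longrightarrow>
    (\<exists>d \<xi> r. d \<in> borel_measurable M \<and> reverse_diff d \<and>
      (\<forall>x\<in>\<Omega>. \<phi> x = d x - \<xi> x + \<xi> (G x) + r (G x) \<and> \<bar>\<xi> x\<bar> \<le> K \<and> \<bar>r x\<bar> \<le> K / real N))"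
proof -
  obtain K where K: "K > 0" "\<And>D w n x. 0 < D \<Longrightarrow> reg D D w \<Longrightarrow> (\<integral>x. w x \<partial>M) = 0 \<Longrightarrow> x \<in> \<Omega> \<Longrightarrow> \<bar>S w n x\<bar> \<le> K * D"
    using transfer_sums_bounded_scaled by blast
  define D where "D = (1 + K1) * (K2 * (\<integral>a. measure M a * b a \<partial>CP)) + 1"
  have "0 \<le> (1 + K1) * (K2 * (\<integral>a. measure M a * b a \<partial>CP))"
    using K1 K2 b0 by (intro mult_nonneg_nonneg integral_nonneg_AE) (auto simp: AE_count_space)
  hence D: "0 < D" by (simp add: D_def)
  have "\<exists>d \<xi> r. d \<in> borel_measurable M \<and> reverse_diff d \<and>
      (\<forall>x\<in>\<Omega>. \<phi> x = d x - \<xi> x + \<xi> (G x) + r (G x) \<and> \<bar>\<xi> x\<bar> \<le> K * D \<and> \<bar>r x\<bar> \<le> (K * D) / real N)"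
    if \<phi>: "integrable M \<phi>" and wr: "wreg b \<phi>" and \<phi>0: "(\<integral>x. \<phi> x \<partial>M) = 0" and N: "0 < N" for \<phi> N
  proof -
    have [measurable]: "\<phi> \<in> borel_measurable M" using \<phi> by auto
    define w where "w = L \<phi>"
    have w: "reg D D w" unfolding w_def
      by (rule reg_mono[OF L_wreg[OF wr _ b0 bi]]) (auto simp: D_def)
    have w0: "(\<integral>x. w x \<partial>M) = 0" using L_dual(1)[OF \<phi>, of "\<lambda>_. 1" 1] \<phi>0 by (simp add: w_def)
    note Lk = Lpow_reg[OF w less_imp_le[OF D] less_imp_le[OF D]]
    have Lk_b: "\<bar>(L ^^ k) w x\<bar> \<le> D" if "x \<in> \<Omega>" for k x using regD(2)[OF Lk that] .
    have [measurable]: "(L ^^ k) w \<in> borel_measurable M" for k using regD(1)[OF Lk] .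
    have [measurable]: "w \<in> borel_measurable M" using regD(1)[OF w] .
    have S_meas [measurable]: "S w n \<in> borel_measurable M" for n unfolding S_def[abs_def] by measurable
    have [measurable]: "L (S w n) \<in> borel_measurable M" for n by (rule L_meas) simp
    define \<xi> where "\<xi> x = (1 / real N) * (\<Sum>n=1..N. S w n x)" for x
    define r where "r x = (1 / real N) * L (S w N) x" for x
    define d where "d x = \<phi> x + \<xi> x - \<xi> (G x) - r (G x)" for x
    have [measurable]: "\<xi> \<in> borel_measurable M" "r \<in> borel_measurable M" unfolding \<xi>_def r_def by measurable
    have [measurable]: "d \<in> borel_measurable M" unfolding d_def by measurable
    have Sb: "\<bar>S w n x\<bar> \<le> K * D" if "x \<in> \<Omega>" for n x using K(2)[OF D w w0 that] .
    have \<xi>_b: "\<bar>\<xi> x\<bar> \<le> K * D" if x: "x \<in> \<Omega>" for x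
    proof -
      have "\<bar>\<Sum>n=1..N. S w n x\<bar> \<le> (\<Sum>n=1..N. \<bar>S w n x\<bar>)" by (rule sum_abs)
      also have "\<dots> \<le> real (card {1..N}) * (K * D)" by (rule sum_bounded_above) (rule Sb[OF x])
      finally show ?thesis using N by (simp add: \<xi>_def abs_mult field_simps)
    qed
    have r_b: "\<bar>r x\<bar> \<le> (K * D) / real N" if x: "x \<in> \<Omega>" for x
      using L_bounded(2)[OF x Sb] N by (simp add: r_def abs_mult divide_right_mono)
    \<comment> \<open>Averaging the telescoped identity over \<open>n = 1..N\<close> leaves the mean
      of \<open>(L ^^ n) w\<close>, and this sum is exactly \<open>L (S w N)\<close>.\<close>
    have L\<xi>: "w x + L \<xi> x - \<xi> x - r x = 0" if x: "x \<in> \<Omega>" for x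
    proof -
      have "L \<xi> x = (1 / real N) * (\<Sum>n=1..N. L (S w n) x)"
        unfolding \<xi>_def[abs_def] L_scale by (subst L_sum[OF x, where B="K * D"]) (auto simp: Sb)
      also have "(\<Sum>n=1..N. L (S w n) x) = (\<Sum>n=1..N. S w n x - w x + (L ^^ n) w x)"
        by (intro sum.cong refl) (use L_S(2)[OF w less_imp_le[OF D] less_imp_le[OF D] x] in \<open>simp add: algebra_simps\<close>)
      also have "\<dots> = (\<Sum>n=1..N. S w n x) - real N * w x + L (S w N) x"
        unfolding L_S(1)[OF w less_imp_le[OF D] less_imp_le[OF D] x] by (simp add: sum.distrib sum_subtractf)
      finally have e: "L \<xi> x = (1 / real N) * ((\<Sum>n=1..N. S w n x) - real N * w x + L (S w N) x)" .
      show ?thesis unfolding e \<xi>_def[of x] r_def using N by (simp add: field_simps)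
    qed
    have AEb: "AE x in M. \<bar>\<xi> x\<bar> \<le> K * D" using AE_\<Omega> by eventually_elim (rule \<xi>_b)
    have AEr: "AE x in M. \<bar>r x\<bar> \<le> K * D / real N" using AE_\<Omega> by eventually_elim (rule r_b)
    have i\<xi>: "integrable M \<xi>" "integrable M r"
      by (rule integrable_const_bound[of _ "K * D"], use AEb in simp_all)
        (rule integrable_const_bound[of _ "K * D / real N"], use AEr in simp_all)
    have "reverse_diff d"
    proof (rule reverse_diffI)
      show "integrable M d" unfolding d_def using \<phi> i\<xi> integrable_G[OF i\<xi>(1)] integrable_G[OF i\<xi>(2)] by auto
      fix \<psi> :: "'b \<Rightarrow> real" and B assume [measurable]: "\<psi> \<in> borel_measurable M" and B: "\<And>x. \<bar>\<psi> x\<bar> \<le> B"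
      have AEB: "AE x in M. \<bar>\<psi> x\<bar> \<le> B" using B by simp
      have im: "integrable M (\<lambda>x. f x * \<psi> x)" if "integrable M f" for f :: "'b \<Rightarrow> real"
      proof (rule Bochner_Integration.integrable_bound)
        show "integrable M (\<lambda>x. B * f x)" using that by simp
        show "AE x in M. norm (f x * \<psi> x) \<le> norm (B * f x)"
        proof (rule AE_I2)
          fix x
          have "\<bar>f x\<bar> * \<bar>\<psi> x\<bar> \<le> \<bar>f x\<bar> * \<bar>B\<bar>" using B[of x] by (intro mult_left_mono) auto
          thus "norm (f x * \<psi> x) \<le> norm (B * f x)" by (simp add: abs_mult mult.commute)
        qed
      qed (use that in auto)
      have imG: "integrable M (\<lambda>x. f x * \<psi> (G x))" if "integrable M f" for f :: "'b \<Rightarrow> real"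
      proof (rule Bochner_Integration.integrable_bound)
        show "integrable M (\<lambda>x. B * f x)" using that by simp
        show "AE x in M. norm (f x * \<psi> (G x)) \<le> norm (B * f x)"
        proof (rule AE_I2)
          fix x
          have "\<bar>f x\<bar> * \<bar>\<psi> (G x)\<bar> \<le> \<bar>f x\<bar> * \<bar>B\<bar>" using B[of "G x"] by (intro mult_left_mono) auto
          thus "norm (f x * \<psi> (G x)) \<le> norm (B * f x)" by (simp add: abs_mult mult.commute)
        qed
      qed (use that in auto)
      have "(\<integral>x. d x * \<psi> (G x) \<partial>M) = (\<integral>x. \<phi> x * \<psi> (G x) + \<xi> x * \<psi> (G x) - \<xi> (G x) * \<psi> (G x) - r (G x) * \<psi> (G x) \<partial>M)"
        by (simp add: d_def algebra_simps)
      also have "\<dots> = (\<integral>x. \<phi> x * \<psi> (G x) \<partial>M) + (\<integral>x. \<xi> x * \<psi> (G x) \<partial>M) - (\<integral>x. \<xi> (G x) * \<psi> (G x) \<partial>M) - (\<integral>x. r (G x) * \<psi> (G x) \<partial>M)"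
        using imG[OF \<phi>] imG[OF i\<xi>(1)] integrable_G[OF im[OF i\<xi>(1)]] integrable_G[OF im[OF i\<xi>(2)]] by simp
      also have "\<dots> = (\<integral>x. w x * \<psi> x \<partial>M) + (\<integral>x. L \<xi> x * \<psi> x \<partial>M) - (\<integral>x. \<xi> x * \<psi> x \<partial>M) - (\<integral>x. r x * \<psi> x \<partial>M)"
        using L_dual(1)[OF \<phi> _ AEB] L_dual(1)[OF i\<xi>(1) _ AEB] integral_G[of "\<lambda>x. \<xi> x * \<psi> x"] integral_G[of "\<lambda>x. r x * \<psi> x"]
        by (simp add: w_def)
      also have "\<dots> = (\<integral>x. (w x + L \<xi> x - \<xi> x - r x) * \<psi> x \<partial>M)"
        using L_dual(2)[OF \<phi> _ AEB] L_dual(2)[OF i\<xi>(1) _ AEB] im[OF i\<xi>(1)] im[OF i\<xi>(2)]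
        by (simp add: left_diff_distrib distrib_right w_def)
      also have "\<dots> = (\<integral>x. 0 \<partial>M)"
      proof (rule integral_cong_AE)
        have [measurable]: "L \<xi> \<in> borel_measurable M" by (rule L_meas) simp
        show "(\<lambda>x. (w x + L \<xi> x - \<xi> x - r x) * \<psi> x) \<in> borel_measurable M" by measurable
        show "AE x in M. (w x + L \<xi> x - \<xi> x - r x) * \<psi> x = 0" using AE_\<Omega> by eventually_elim (simp add: L\<xi>)
      qed simp
      finally show "(\<integral>x. d x * \<psi> (G x) \<partial>M) = 0" by simp
    qed
    moreover have "\<forall>x\<in>\<Omega>. \<phi> x = d x - \<xi> x + \<xi> (G x) + r (G x) \<and> \<bar>\<xi> x\<bar> \<le> K * D \<and> \<bar>r x\<bar> \<le> (K * D) / real N"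
      using \<xi>_b r_b by (simp add: d_def)
    ultimately show ?thesis using \<open>d \<in> borel_measurable M\<close> by blast
  qed
  thus ?thesis using K(1) D by (intro exI[of _ "K * D"]) (simp only: mult_pos_pos simp_thms, blast)
qed

end

section \<open>Suspension semiflows\<close>

text \<open>The mean of \<tau> divides both the tower measure and the total height of the
  suspension; here it cancels.\<close>

lemma ennreal_divide_divide_cancel:
  fixes a c :: ennreal
  assumes "c \<noteq> 0" "c \<noteq> \<infinity>" "0 < r"
  shows "(a / c) / (ennreal r / c) = a / ennreal r"
proof -
  obtain c' where c': "c = ennreal c'" "0 < c'"
    using assms(1,2) by (cases c) (auto simp: ennreal_eq_0_iff less_le)
  show ?thesis
  proof (cases a)
    case (real a')
    thus ?thesis using c' assms(3) by (simp add: divide_ennreal)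
  next
    case top
    thus ?thesis using c' assms(3) by (simp add: divide_ennreal ennreal_top_divide)
  qed
qed

locale semiflow =
  fixes T :: "real \<Rightarrow> 'm::metric_space \<Rightarrow> 'm"
  assumes T_0: "T 0 x = x"
    and T_add: "0 \<le> s \<Longrightarrow> 0 \<le> t \<Longrightarrow> T (s + t) x = T s (T t x)"
    and T_meas: "(\<lambda>(t, x). T t x) \<in> measurable (restrict_space (borel \<Otimes>\<^sub>M borel) ({0..} \<times> UNIV)) borel"
begin

lemma Tp_meas [measurable]: "(\<lambda>(t, x). T (max 0 t) x) \<in> measurable (borel \<Otimes>\<^sub>M borel) borel"
proof -
  have "(\<lambda>p::real \<times> 'm. (max 0 (fst p), snd p)) \<in> measurable (borel \<Otimes>\<^sub>M borel) (restrict_space (borel \<Otimes>\<^sub>M borel) ({0..} \<times> UNIV))"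
    by (rule measurable_restrict_space2) (auto simp: space_pair_measure)
  from measurable_compose[OF this T_meas] show ?thesis by (simp add: split_beta')
qed

lemma Tp_comp [measurable (raw)]:
  assumes [measurable]: "a \<in> borel_measurable M" "b \<in> measurable M borel"
  shows "(\<lambda>z. T (max 0 (a z)) (b z)) \<in> measurable M borel"
  using measurable_compose[of "\<lambda>z. (a z, b z)", OF _ Tp_meas] by simp

text \<open>\<open>T\<close> is only controlled for nonnegative times, whence \<open>max 0 r\<close>.\<close>

definition J :: "('m \<Rightarrow> real) \<Rightarrow> 'm \<Rightarrow> real \<Rightarrow> real" where
  "J u x s = (\<integral>r. indicator {0..s} r * u (T (max 0 r) x) \<partial>lborel)"

definition obs :: "('m \<Rightarrow> real) \<Rightarrow> bool" where
  "obs u \<longleftrightarrow> u \<in> borel_measurable borel \<and> (\<forall>x. \<bar>u x\<bar> \<le> 1)"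

lemma obsD: "obs u \<Longrightarrow> u \<in> borel_measurable borel" "obs u \<Longrightarrow> \<bar>u x\<bar> \<le> 1"
  by (auto simp: obs_def)

lemma obs_integrable:
  assumes u: "obs u" and [measurable]: "w \<in> borel_measurable borel" and B: "\<And>r. r \<in> {a..b} \<Longrightarrow> \<bar>w r\<bar> \<le> B"
  shows "integrable lborel (\<lambda>r. indicator {a..b} r * (w r * u (T (max 0 r) x)))"
proof (rule Bochner_Integration.integrable_bound)
  have [measurable]: "u \<in> borel_measurable borel" using obsD(1)[OF u] .
  show "integrable lborel (\<lambda>r. indicator {a..b} r * B)" by (intro integrable_mult_left integrable_real_indicator) (auto simp: emeasure_lborel_Icc_eq)
  show "(\<lambda>r. indicator {a..b} r * (w r * u (T (max 0 r) x))) \<in> borel_measurable lborel" by measurable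
  have "\<bar>w r * u (T (max 0 r) x)\<bar> \<le> \<bar>B\<bar>" if "r \<in> {a..b}" for r
    unfolding abs_mult using B[OF that] obsD(2)[OF u, of "T (max 0 r) x"]
    by (metis abs_ge_zero abs_of_nonneg mult_left_le order_trans)
  thus "AE r in lborel. norm (indicator {a..b} r * (w r * u (T (max 0 r) x))) \<le> norm (indicator {a..b} r * B)"
    by (auto simp: indicator_def)
qed

lemma obs_integrable1: "obs u \<Longrightarrow> integrable lborel (\<lambda>r. indicator {a..b} r * u (T (max 0 r) x))"
  using obs_integrable[of u "\<lambda>_. 1" a b 1 x] by simp

lemma indicator_split:
  fixes a b c :: real
  assumes "a \<le> b" "b \<le> c"
  shows "AE r in lborel. indicator {a..c} r * (k r :: real) = indicator {a..b} r * k r + indicator {b..c} r * k r"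
  using AE_lborel_singleton[of b] by eventually_elim (use assms in \<open>auto simp: indicator_def\<close>)

lemma integral_split:
  fixes k :: "real \<Rightarrow> real"
  assumes "a \<le> b" "b \<le> c" "integrable lborel (\<lambda>r. indicator {a..b} r * k r)" "integrable lborel (\<lambda>r. indicator {b..c} r * k r)"
    "k \<in> borel_measurable borel"
  shows "(\<integral>r. indicator {a..c} r * k r \<partial>lborel) = (\<integral>r. indicator {a..b} r * k r \<partial>lborel) + (\<integral>r. indicator {b..c} r * k r \<partial>lborel)"
proof -
  have [measurable]: "k \<in> borel_measurable borel" by fact
  have "(\<integral>r. indicator {a..c} r * k r \<partial>lborel) = (\<integral>r. indicator {a..b} r * k r + indicator {b..c} r * k r \<partial>lborel)"
    by (rule integral_cong_AE) (use indicator_split[OF assms(1,2)] in auto)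
  thus ?thesis using assms by simp
qed

lemma integral_shift:
  fixes k :: "real \<Rightarrow> real"
  shows "(\<integral>r. indicator {s..s + t} r * k r \<partial>lborel) = (\<integral>r. indicator {0..t} r * k (s + r) \<partial>lborel)"
  using lborel_integral_real_affine[of 1 "\<lambda>r. indicator {s..s + t} r * k r" s]
  by (simp add: indicator_def if_distrib cong: if_cong)

lemma obs_path_meas: "obs u \<Longrightarrow> (\<lambda>r. u (T (max 0 r) x)) \<in> borel_measurable borel"
  using obsD(1)[of u] by simp

lemma J_add:
  assumes u: "obs u" and s: "0 \<le> s" and t: "0 \<le> t"
  shows "J u x (s + t) = J u x s + J u (T s x) t"
proof -
  have "J u x (s + t) = J u x s + (\<integral>r. indicator {s..s + t} r * u (T (max 0 r) x) \<partial>lborel)"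
    unfolding J_def using s t obs_integrable1[OF u] obs_path_meas[OF u] by (intro integral_split) auto
  also have "(\<integral>r. indicator {s..s + t} r * u (T (max 0 r) x) \<partial>lborel) = (\<integral>r. indicator {0..t} r * u (T (max 0 (s + r)) x) \<partial>lborel)"
    by (rule integral_shift)
  also have "\<dots> = J u (T s x) t" unfolding J_def
    by (rule Bochner_Integration.integral_cong) (use s T_add[OF _ s] in \<open>auto simp: indicator_def max_def add.commute\<close>)
  finally show ?thesis .
qed

lemma J_0: "J u x 0 = 0"
proof -
  have "AE r in lborel. indicator {0..0} r * u (T (max 0 r) x) = 0"
    using AE_lborel_singleton[of "0::real"] by eventually_elim (simp add: indicator_def)
  thus ?thesis unfolding J_def by (rule integral_eq_zero_AE)
qed

lemma J_bound: assumes "obs u" "0 \<le> s" shows "\<bar>J u x s\<bar> \<le> s"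
proof -
  have "\<bar>J u x s\<bar> \<le> (\<integral>r. indicator {0..s} r * 1 \<partial>lborel)"
    unfolding J_def
  proof (rule abs_integral_le(2))
    show "AE r in lborel. \<bar>indicator {0..s} r * u (T (max 0 r) x)\<bar> \<le> indicator {0..s} r * 1"
      using obsD(2)[OF assms(1)] by (auto simp: indicator_def)
    show "(\<lambda>r. indicator {0..s} r * u (T (max 0 r) x)) \<in> borel_measurable lborel"
      using obs_integrable1[OF assms(1)] by (rule borel_measurable_integrable)
    show "integrable lborel (\<lambda>r. indicator {0..s} r * 1 :: real)"
      by (intro integrable_mult_left integrable_real_indicator) (auto simp: emeasure_lborel_Icc_eq)
  qed
  thus ?thesis using assms by simp
qed

lemma J_lip: assumes u: "obs u" and "0 \<le> s" "0 \<le> t" shows "\<bar>J u x s - J u x t\<bar> \<le> \<bar>s - t\<bar>"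
proof -
  have *: "\<bar>J u x (a + b) - J u x a\<bar> \<le> b" if "0 \<le> a" "0 \<le> b" for a b
    using J_add[OF u that] J_bound[OF u that(2), of "T a x"] by simp
  show ?thesis
  proof (cases "s \<le> t")
    case True thus ?thesis using *[of s "t - s"] assms by simp
  next
    case False thus ?thesis using *[of t "s - t"] assms by simp
  qed
qed

lemma J_meas [measurable (raw)]:
  assumes u: "obs u" and [measurable]: "a \<in> borel_measurable M" "b \<in> measurable M borel"
  shows "(\<lambda>z. J u (b z) (a z)) \<in> borel_measurable M"
proof -
  have [measurable]: "u \<in> borel_measurable borel" using obsD(1)[OF u] .
  have "(\<lambda>p. indicator {0..a (fst p)} (snd p) * u (T (max 0 (snd p)) (b (fst p)))) \<in> borel_measurable (M \<Otimes>\<^sub>M lborel)"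
    unfolding indicator_def of_bool_def atLeastAtMost_iff by measurable
  hence "(\<lambda>z. \<integral>r. indicator {0..a z} r * u (T (max 0 r) (b z)) \<partial>lborel) \<in> borel_measurable M"
    by (intro lborel.borel_measurable_lebesgue_integral) (simp add: split_beta')
  thus ?thesis unfolding J_def[abs_def] .
qed

lemma J_uminus: "J (\<lambda>x. - u x) x s = - J u x s" by (simp add: J_def)

end

section \<open>The suspension measure as an integral over the base\<close>

locale induced_flow = semiflow T for T :: "real \<Rightarrow> 'm::metric_space \<Rightarrow> 'm" +
  fixes X Y :: "'m set" and h :: "'m \<Rightarrow> real" and \<tau> :: "'m \<Rightarrow> nat" and \<mu>Y :: "'m measure"
  assumes sets_XY: "X \<in> sets borel" "Y \<in> sets borel" "Y \<subseteq> X"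
    and h_pos: "\<And>x. x \<in> X \<Longrightarrow> 0 < h x"
    and h_meas: "h \<in> borel_measurable (restrict_space borel X)"
    and f_X: "\<And>x. x \<in> X \<Longrightarrow> fmap T h x \<in> X"
    and \<tau>_pos: "\<And>y. y \<in> Y \<Longrightarrow> 1 \<le> \<tau> y"
    and \<tau>_meas: "\<tau> \<in> measurable (restrict_space borel Y) (count_space UNIV)"
    and F_Y: "\<And>y. y \<in> Y \<Longrightarrow> Fmap T h \<tau> y \<in> Y"
    and \<mu>Y_prob: "prob_space \<mu>Y"
    and \<mu>Y_sets: "sets \<mu>Y = sets (restrict_space borel Y)"
    and \<tau>_int: "integrable \<mu>Y (\<lambda>y. real (\<tau> y))"
    and H_int: "integrable \<mu>Y (Hfun T h \<tau>)"
    and H_inf: "(INF y\<in>Y. Hfun T h \<tau> y) > 0"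
begin

abbreviation "f \<equiv> fmap T h"
abbreviation "F \<equiv> Fmap T h \<tau>"
abbreviation "H \<equiv> Hfun T h \<tau>"
abbreviation "\<mu>X \<equiv> tower_measure X \<mu>Y f \<tau>"
abbreviation "\<mu>M \<equiv> suspension_measure \<mu>X T h"
abbreviation "BX \<equiv> restrict_space borel X"

sublocale Y: prob_space \<mu>Y by (rule \<mu>Y_prob)

lemma space_\<mu>Y: "space \<mu>Y = Y"
  using sets_eq_imp_space_eq[OF \<mu>Y_sets] by (simp add: space_restrict_space)

lemma space_BX: "space BX = X" by (simp add: space_restrict_space)

lemma X_id [measurable]: "(\<lambda>x. x) \<in> measurable BX borel" by (rule measurable_restrict_space1) simp
lemma Y_X [measurable]: "(\<lambda>y. y) \<in> measurable \<mu>Y BX"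
  unfolding measurable_cong_sets[OF \<mu>Y_sets refl]
  using sets_XY by (intro measurable_restrict_space2 measurable_restrict_space1) (auto simp: space_restrict_space)
lemma Y_id [measurable]: "(\<lambda>y. y) \<in> measurable \<mu>Y borel" using measurable_compose[OF Y_X X_id] .
lemma \<tau>_meas' [measurable]: "\<tau> \<in> measurable \<mu>Y (count_space UNIV)"
  using \<tau>_meas by (simp add: measurable_cong_sets[OF \<mu>Y_sets refl])
lemma h_meas' [measurable]: "h \<in> borel_measurable BX" by (rule h_meas)

lemma f_meas [measurable]: "f \<in> measurable BX BX"
proof -
  have 1: "(\<lambda>x. T (max 0 (h x)) x) \<in> measurable BX borel" by (rule Tp_comp) auto
  have "f \<in> measurable BX borel \<longleftrightarrow> (\<lambda>x. T (max 0 (h x)) x) \<in> measurable BX borel"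
    by (rule measurable_cong) (simp add: space_BX fmap_def max_absorb2 h_pos less_imp_le)
  thus ?thesis using 1 f_X by (intro measurable_restrict_space2) (auto simp: space_BX)
qed

lemma fl_meas [measurable]: "(\<lambda>y. (f ^^ l) y) \<in> measurable \<mu>Y BX"
  by (induction l) (auto intro: measurable_compose[OF _ f_meas])

lemma fl_X: "y \<in> Y \<Longrightarrow> (f ^^ l) y \<in> X" using sets_XY(3) f_X by (induction l) auto

definition "h0 = (INF y\<in>Y. H y)"

lemma h0: "0 < h0" using H_inf by (simp add: h0_def)

lemma H_nonneg: "y \<in> Y \<Longrightarrow> 0 \<le> H y"
  unfolding Hfun_def using fl_X h_pos by (intro sum_nonneg) (auto intro: less_imp_le)

lemma H_ge: "y \<in> Y \<Longrightarrow> h0 \<le> H y"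
  unfolding h0_def using H_nonneg by (intro cINF_lower bdd_belowI2[of _ 0]) auto

lemma H_meas [measurable]: "H \<in> borel_measurable \<mu>Y" using H_int by auto

lemma integral_H_pos: "0 < (\<integral>y. H y \<partial>\<mu>Y)"
proof -
  have "(\<integral>y. h0 \<partial>\<mu>Y) \<le> (\<integral>y. H y \<partial>\<mu>Y)" using H_ge H_int by (intro integral_mono) (auto simp: space_\<mu>Y)
  thus ?thesis using h0 by (simp add: Y.prob_space)
qed

lemma T_partial:
  assumes "y \<in> Y" shows "T (\<Sum>l<n. h ((f ^^ l) y)) y = (f ^^ n) y"
proof (induction n)
  case (Suc n)
  have nn: "0 \<le> (\<Sum>l<n. h ((f ^^ l) y))" "0 \<le> h ((f ^^ n) y)"
    using h_pos[OF fl_X[OF assms]] by (auto intro!: sum_nonneg simp: less_imp_le)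
  have "T (\<Sum>l<Suc n. h ((f ^^ l) y)) y = T (h ((f ^^ n) y)) (T (\<Sum>l<n. h ((f ^^ l) y)) y)"
    using T_add[OF nn(2,1), of y] by (simp add: add.commute)
  thus ?case using Suc by (simp add: fmap_def[of T h "(f ^^ n) y"])
qed (simp add: T_0)

lemma T_H: "y \<in> Y \<Longrightarrow> T (H y) y = F y"
  using T_partial[of y "\<tau> y"] by (simp add: Hfun_def Fmap_def)

text \<open>\<open>measure_of\<close> returns the prescribed values only for a countably additive
  set function. Additivity is obtained by exhibiting the values as the image of a density on the
  product of \<open>\<mu>Y\<close> with counting measure.\<close>

lemma \<mu>X_eq:
  shows "sets \<mu>X = sets BX" (is ?s)
    and "\<And>g. g \<in> borel_measurable BX \<Longrightarrow>
      (\<integral>\<^sup>+x. g x \<partial>\<mu>X) = (\<integral>\<^sup>+y. (\<Sum>l<\<tau> y. g ((f ^^ l) y)) \<partial>\<mu>Y) / (\<integral>\<^sup>+ y. ennreal (real (\<tau> y)) \<partial>\<mu>Y)"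
proof -
  let ?c = "\<integral>\<^sup>+ y. ennreal (real (\<tau> y)) \<partial>\<mu>Y"
  let ?C = "count_space (UNIV :: nat set)"
  interpret C: sigma_finite_measure ?C by (rule sigma_finite_measure_count_space_countable) auto
  have [measurable]: "(\<lambda>p. (f ^^ snd p) (fst p)) \<in> measurable (\<mu>Y \<Otimes>\<^sub>M ?C) BX"
  proof (rule measurable_compose_countable'[where f="\<lambda>l p. (f ^^ l) (fst p)" and g=snd and I=UNIV])
    show "(\<lambda>p. (f ^^ i) (fst p)) \<in> measurable (\<mu>Y \<Otimes>\<^sub>M ?C) BX" for i
      by (rule measurable_compose[OF measurable_fst fl_meas])
  qed auto
  define k :: "'m \<times> nat \<Rightarrow> ennreal" where "k p = indicator {p. snd p < \<tau> (fst p)} p / ?c" for p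
  have [measurable]: "Measurable.pred (\<mu>Y \<Otimes>\<^sub>M ?C) (\<lambda>p. snd p < \<tau> (fst p))"
    by (rule measurable_compose_countable[where g=snd and f="\<lambda>l p. l < \<tau> (fst p)"]) measurable
  have k [measurable]: "k \<in> borel_measurable (\<mu>Y \<Otimes>\<^sub>M ?C)"
    unfolding k_def indicator_def of_bool_def mem_Collect_eq by measurable
  define \<nu> where "\<nu> = distr (density (\<mu>Y \<Otimes>\<^sub>M ?C) k) BX (\<lambda>p. (f ^^ snd p) (fst p))"
  have int: "(\<integral>\<^sup>+x. g x \<partial>\<nu>) = (\<integral>\<^sup>+y. (\<Sum>l<\<tau> y. g ((f ^^ l) y)) \<partial>\<mu>Y) / ?c" if [measurable]: "g \<in> borel_measurable BX" for g
  proof -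
    have "(\<integral>\<^sup>+x. g x \<partial>\<nu>) = (\<integral>\<^sup>+p. k p * g ((f ^^ snd p) (fst p)) \<partial>(\<mu>Y \<Otimes>\<^sub>M ?C))"
      unfolding \<nu>_def by (subst nn_integral_distr) (auto simp: nn_integral_density)
    also have "\<dots> = (\<integral>\<^sup>+y. (\<integral>\<^sup>+l. k (y, l) * g ((f ^^ l) y) \<partial>?C) \<partial>\<mu>Y)"
      by (subst C.nn_integral_fst[symmetric]) auto
    also have "\<dots> = (\<integral>\<^sup>+y. (\<Sum>l<\<tau> y. g ((f ^^ l) y)) / ?c \<partial>\<mu>Y)"
    proof (rule nn_integral_cong)
      fix y
      have "(\<integral>\<^sup>+l. k (y, l) * g ((f ^^ l) y) \<partial>?C) = (\<Sum>l<\<tau> y. k (y, l) * g ((f ^^ l) y))"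
        by (rule nn_integral_count_space') (auto simp: k_def)
      also have "\<dots> = (\<Sum>l<\<tau> y. g ((f ^^ l) y) * (1 / ?c))"
        by (intro sum.cong) (auto simp: k_def mult.commute)
      also have "\<dots> = (\<Sum>l<\<tau> y. g ((f ^^ l) y)) * (1 / ?c)" by (rule sum_distrib_right[symmetric])
      finally show "(\<integral>\<^sup>+l. k (y, l) * g ((f ^^ l) y) \<partial>?C) = (\<Sum>l<\<tau> y. g ((f ^^ l) y)) / ?c" by (simp add: ennreal_times_divide)
    qed
    also have "\<dots> = (\<integral>\<^sup>+y. (\<Sum>l<\<tau> y. g ((f ^^ l) y)) \<partial>\<mu>Y) / ?c"
    proof (rule nn_integral_divide)
      have "(\<lambda>y. \<Sum>l<\<tau> y. g ((f ^^ l) y)) = (\<lambda>y. (\<lambda>n. \<Sum>l<n. g ((f ^^ l) y)) (\<tau> y))" by simp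
      show "(\<lambda>y. \<Sum>l<\<tau> y. g ((f ^^ l) y)) \<in> borel_measurable \<mu>Y"
        by (rule measurable_compose_countable[where f="\<lambda>n y. \<Sum>l<n. g ((f ^^ l) y)" and g=\<tau>]) auto
    qed
    finally show ?thesis .
  qed
  have s: "sets \<nu> = sets BX" "space \<nu> = X" by (auto simp: \<nu>_def space_BX)
  have "\<mu>X = measure_of (space \<nu>) (sets \<nu>) (emeasure \<nu>)"
    unfolding tower_measure_def s
  proof (rule measure_of_eq)
    show "sets BX \<subseteq> Pow X" using sets.space_closed[of BX] by (simp add: space_BX)
    fix A assume "A \<in> sigma_sets X (sets BX)"
    hence A: "A \<in> sets BX" using sets.sigma_sets_eq[of BX] by (simp add: space_BX)
    have "emeasure \<nu> A = (\<integral>\<^sup>+x. indicator A x \<partial>\<nu>)" using A s by simp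
    also have "\<dots> = (\<integral>\<^sup>+y. (\<Sum>l<\<tau> y. indicator A ((f ^^ l) y)) \<partial>\<mu>Y) / ?c" using A by (intro int) auto
    also have "(\<lambda>y. \<Sum>l<\<tau> y. indicator A ((f ^^ l) y) :: ennreal) = (\<lambda>y. ennreal (\<Sum>l<\<tau> y. indicator A ((f ^^ l) y)))"
      by (auto simp: sum_ennreal[symmetric] ennreal_indicator)
    finally show "(\<integral>\<^sup>+y. ennreal (\<Sum>l<\<tau> y. indicator A ((f ^^ l) y)) \<partial>\<mu>Y) / ?c = emeasure \<nu> A" by simp
  qed
  hence eq: "\<mu>X = \<nu>" by (simp add: measure_of_of_measure)
  show ?s unfolding eq by (rule s)
  show "\<And>g. g \<in> borel_measurable BX \<Longrightarrow>
      (\<integral>\<^sup>+x. g x \<partial>\<mu>X) = (\<integral>\<^sup>+y. (\<Sum>l<\<tau> y. g ((f ^^ l) y)) \<partial>\<mu>Y) / ?c" unfolding eq by (rule int)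
qed

lemma \<mu>M_eq0:
  shows "sets \<mu>M = sets borel" (is ?s)
    and "\<And>Z. Z \<in> borel_measurable borel \<Longrightarrow>
      (\<integral>\<^sup>+x. Z x \<partial>\<mu>M) = (\<integral>\<^sup>+x. (\<integral>\<^sup>+u. indicator {0..h x} u * Z (T (max 0 u) x) \<partial>lborel) \<partial>\<mu>X) / (\<integral>\<^sup>+ x. ennreal (h x) \<partial>\<mu>X)"
proof -
  let ?c = "\<integral>\<^sup>+ x. ennreal (h x) \<partial>\<mu>X"
  have mX: "measurable \<mu>X N = measurable BX N" for N :: "'z measure" by (rule measurable_cong_sets[OF \<mu>X_eq(1) refl])
  have [measurable]: "(\<lambda>x. x) \<in> measurable \<mu>X borel" by (simp add: mX measurable_cong_sets[OF \<mu>X_eq(1) refl])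
  have [measurable]: "h \<in> borel_measurable \<mu>X" by (simp add: measurable_cong_sets[OF \<mu>X_eq(1) refl])
  define k :: "'m \<times> real \<Rightarrow> ennreal" where "k p = indicator {p. 0 \<le> snd p \<and> snd p \<le> h (fst p)} p / ?c" for p
  have k [measurable]: "k \<in> borel_measurable (\<mu>X \<Otimes>\<^sub>M lborel)"
    unfolding k_def indicator_def of_bool_def mem_Collect_eq by measurable
  have t [measurable]: "(\<lambda>p. T (max 0 (snd p)) (fst p)) \<in> measurable (\<mu>X \<Otimes>\<^sub>M lborel) borel"
    by (rule Tp_comp) measurable
  define \<nu> where "\<nu> = distr (density (\<mu>X \<Otimes>\<^sub>M lborel) k) borel (\<lambda>p. T (max 0 (snd p)) (fst p))"
  have int: "(\<integral>\<^sup>+x. Z x \<partial>\<nu>) = (\<integral>\<^sup>+x. (\<integral>\<^sup>+u. indicator {0..h x} u * Z (T (max 0 u) x) \<partial>lborel) \<partial>\<mu>X) / ?c"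
    if [measurable]: "Z \<in> borel_measurable borel" for Z
  proof -
    have "(\<integral>\<^sup>+x. Z x \<partial>\<nu>) = (\<integral>\<^sup>+p. k p * Z (T (max 0 (snd p)) (fst p)) \<partial>(\<mu>X \<Otimes>\<^sub>M lborel))"
      unfolding \<nu>_def by (subst nn_integral_distr) (auto simp: nn_integral_density)
    also have "\<dots> = (\<integral>\<^sup>+x. (\<integral>\<^sup>+u. k (x, u) * Z (T (max 0 u) x) \<partial>lborel) \<partial>\<mu>X)"
      by (subst lborel.nn_integral_fst[symmetric]) auto
    also have "\<dots> = (\<integral>\<^sup>+x. (\<integral>\<^sup>+u. indicator {0..h x} u * Z (T (max 0 u) x) \<partial>lborel) / ?c \<partial>\<mu>X)"
    proof (rule nn_integral_cong)
      fix x assume x: "x \<in> space \<mu>X"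
      have [measurable]: "(\<lambda>u. T (max 0 u) x) \<in> measurable lborel borel" by (rule Tp_comp) auto
      have "(\<integral>\<^sup>+u. k (x, u) * Z (T (max 0 u) x) \<partial>lborel) = (\<integral>\<^sup>+u. indicator {0..h x} u * Z (T (max 0 u) x) / ?c \<partial>lborel)"
        by (intro nn_integral_cong) (auto simp: k_def indicator_def ennreal_times_divide mult.commute)
      also have "\<dots> = (\<integral>\<^sup>+u. indicator {0..h x} u * Z (T (max 0 u) x) \<partial>lborel) / ?c" by (rule nn_integral_divide) measurable
      finally show "(\<integral>\<^sup>+u. k (x, u) * Z (T (max 0 u) x) \<partial>lborel) = (\<integral>\<^sup>+u. indicator {0..h x} u * Z (T (max 0 u) x) \<partial>lborel) / ?c" .
    qed
    also have "\<dots> = (\<integral>\<^sup>+x. (\<integral>\<^sup>+u. indicator {0..h x} u * Z (T (max 0 u) x) \<partial>lborel) \<partial>\<mu>X) / ?c"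
    proof (rule nn_integral_divide)
      have [measurable]: "(\<lambda>p. indicator {0..h (fst p)} (snd p) :: ennreal) \<in> borel_measurable (\<mu>X \<Otimes>\<^sub>M lborel)"
        unfolding indicator_def of_bool_def atLeastAtMost_iff by measurable
      have "(\<lambda>p. indicator {0..h (fst p)} (snd p) * Z (T (max 0 (snd p)) (fst p))) \<in> borel_measurable (\<mu>X \<Otimes>\<^sub>M lborel)"
        by measurable
      thus "(\<lambda>x. \<integral>\<^sup>+u. indicator {0..h x} u * Z (T (max 0 u) x) \<partial>lborel) \<in> borel_measurable \<mu>X"
        by (intro lborel.borel_measurable_nn_integral) (simp add: split_beta')
    qed
    finally show ?thesis .
  qed
  have s: "sets \<nu> = sets borel" "space \<nu> = UNIV" by (auto simp: \<nu>_def)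
  have "\<mu>M = measure_of (space \<nu>) (sets \<nu>) (emeasure \<nu>)"
    unfolding suspension_measure_def s
  proof (rule measure_of_eq)
    fix A :: "'m set" assume "A \<in> sigma_sets UNIV (sets borel)"
    hence A: "A \<in> sets borel" using sets.sigma_sets_eq[of "borel :: 'm measure"] by simp
    have "emeasure \<nu> A = (\<integral>\<^sup>+x. indicator A x \<partial>\<nu>)" using A s by simp
    also have "\<dots> = (\<integral>\<^sup>+x. (\<integral>\<^sup>+u. indicator {0..h x} u * indicator A (T (max 0 u) x) \<partial>lborel) \<partial>\<mu>X) / ?c" using A by (intro int) auto
    also have "(\<integral>\<^sup>+x. (\<integral>\<^sup>+u. indicator {0..h x} u * indicator A (T (max 0 u) x) \<partial>lborel) \<partial>\<mu>X)
       = (\<integral>\<^sup>+x. (\<integral>\<^sup>+u. indicator {0..h x} u * indicator A (T u x) \<partial>lborel) \<partial>\<mu>X)"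
      by (intro nn_integral_cong) (auto simp: indicator_def max_def)
    finally show "(\<integral>\<^sup>+x. (\<integral>\<^sup>+u. indicator {0..h x} u * indicator A (T u x) \<partial>lborel) \<partial>\<mu>X) / ?c = emeasure \<nu> A" by simp
  qed simp
  hence eq: "\<mu>M = \<nu>" by (simp add: measure_of_of_measure)
  show ?s unfolding eq by (rule s)
  show "\<And>Z. Z \<in> borel_measurable borel \<Longrightarrow>
      (\<integral>\<^sup>+x. Z x \<partial>\<mu>M) = (\<integral>\<^sup>+x. (\<integral>\<^sup>+u. indicator {0..h x} u * Z (T (max 0 u) x) \<partial>lborel) \<partial>\<mu>X) / ?c" unfolding eq by (rule int)
qed

text \<open>The flow segments above consecutive points of the \<open>f\<close>-orbit of
  \<open>y\<close> concatenate to one segment of the flow orbit of \<open>y\<close>; overlaps are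
  single times.\<close>

lemma nn_integral_partial:
  assumes y: "y \<in> Y" and [measurable]: "Z \<in> borel_measurable borel"
  shows "(\<Sum>l<n. \<integral>\<^sup>+u. indicator {0..h ((f ^^ l) y)} u * Z (T (max 0 u) ((f ^^ l) y)) \<partial>lborel)
    = (\<integral>\<^sup>+u. indicator {0..(\<Sum>l<n. h ((f ^^ l) y))} u * Z (T (max 0 u) y) \<partial>lborel)"
proof (induction n)
  case 0
  have "(\<integral>\<^sup>+u. indicator {0..0} u * Z (T (max 0 u) y) \<partial>lborel) = (\<integral>\<^sup>+u. 0 \<partial>(lborel :: real measure))"
    by (rule nn_integral_cong_AE, use AE_lborel_singleton[of "0::real"] in eventually_elim) (simp add: indicator_def)
  thus ?case by simp
next
  case (Suc n)
  let ?s = "\<Sum>l<n. h ((f ^^ l) y)" and ?t = "h ((f ^^ n) y)"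
  have s: "0 \<le> ?s" "0 \<le> ?t" using h_pos[OF fl_X[OF y]] by (auto intro!: sum_nonneg simp: less_imp_le)
  have [measurable]: "(\<lambda>u. Z (T (max 0 u) x)) \<in> borel_measurable borel" for x by measurable
  have "(\<integral>\<^sup>+u. indicator {?s..?s + ?t} u * Z (T (max 0 u) y) \<partial>lborel)
     = (\<integral>\<^sup>+u. indicator {?s..?s + ?t} (?s + 1 * u) * Z (T (max 0 (?s + 1 * u)) y) \<partial>lborel)"
    by (subst nn_integral_real_affine[where c=1 and t="?s"]) auto
  also have "\<dots> = (\<integral>\<^sup>+u. indicator {0..?t} u * Z (T (max 0 u) ((f ^^ n) y)) \<partial>lborel)"
  proof (rule nn_integral_cong)
    fix u :: real
    have "0 \<le> u \<Longrightarrow> T (?s + u) y = T u ((f ^^ n) y)" using T_add[of u ?s y] T_partial[OF y, of n] s by (simp add: add.commute)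
    thus "indicator {?s..?s + ?t} (?s + 1 * u) * Z (T (max 0 (?s + 1 * u)) y) = indicator {0..?t} u * Z (T (max 0 u) ((f ^^ n) y))"
      using s by (auto simp: indicator_def max_def)
  qed
  finally have A: "(\<integral>\<^sup>+u. indicator {0..?t} u * Z (T (max 0 u) ((f ^^ n) y)) \<partial>lborel)
     = (\<integral>\<^sup>+u. indicator {?s..?s + ?t} u * Z (T (max 0 u) y) \<partial>lborel)" by simp
  have "(\<integral>\<^sup>+u. indicator {0..?s + ?t} u * Z (T (max 0 u) y) \<partial>lborel)
     = (\<integral>\<^sup>+u. indicator {0..?s} u * Z (T (max 0 u) y) + indicator {?s..?s + ?t} u * Z (T (max 0 u) y) \<partial>lborel)"
    by (rule nn_integral_cong_AE, use AE_lborel_singleton[of ?s] in eventually_elim) (use s in \<open>auto simp: indicator_def\<close>)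
  also have "\<dots> = (\<integral>\<^sup>+u. indicator {0..?s} u * Z (T (max 0 u) y) \<partial>lborel) + (\<integral>\<^sup>+u. indicator {?s..?s + ?t} u * Z (T (max 0 u) y) \<partial>lborel)"
    by (rule nn_integral_add) auto
  finally show ?case using Suc A by simp
qed

text \<open>Collapsing the two-stage construction: the flow is a suspension over \<open>F\<close>
  with roof \<open>H\<close>. The weight \<open>H\<close> in the inner integral is what later costs
  integrability.\<close>

theorem nn_integral_\<mu>M:
  assumes [measurable]: "Z \<in> borel_measurable borel"
  shows "(\<integral>\<^sup>+x. Z x \<partial>\<mu>M) = (\<integral>\<^sup>+y. (\<integral>\<^sup>+u. indicator {0..H y} u * Z (T (max 0 u) y) \<partial>lborel) \<partial>\<mu>Y) / ennreal (\<integral>y. H y \<partial>\<mu>Y)"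
proof -
  let ?c = "\<integral>\<^sup>+ y. ennreal (real (\<tau> y)) \<partial>\<mu>Y"
  let ?K = "\<lambda>x. \<integral>\<^sup>+u. indicator {0..h x} u * Z (T (max 0 u) x) \<partial>lborel"
  have c: "?c \<noteq> 0" "?c \<noteq> \<infinity>"
  proof -
    have "(\<integral>\<^sup>+ y. 1 \<partial>\<mu>Y) \<le> ?c" using \<tau>_pos by (intro nn_integral_mono) (auto simp: space_\<mu>Y)
    thus "?c \<noteq> 0" using Y.emeasure_space_1 by auto
    show "?c \<noteq> \<infinity>" using \<tau>_int by (auto simp: integrable_iff_bounded)
  qed
  have [measurable]: "?K \<in> borel_measurable BX"
  proof -
    have [measurable]: "(\<lambda>p. indicator {0..h (fst p)} (snd p) :: ennreal) \<in> borel_measurable (BX \<Otimes>\<^sub>M lborel)"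
      unfolding indicator_def of_bool_def atLeastAtMost_iff by measurable
    have "(\<lambda>p. indicator {0..h (fst p)} (snd p) * Z (T (max 0 (snd p)) (fst p))) \<in> borel_measurable (BX \<Otimes>\<^sub>M lborel)"
      by measurable
    thus ?thesis by (intro lborel.borel_measurable_nn_integral) (simp add: split_beta')
  qed
  have hc: "(\<integral>\<^sup>+x. ennreal (h x) \<partial>\<mu>X) = ennreal (\<integral>y. H y \<partial>\<mu>Y) / ?c"
  proof -
    have "(\<integral>\<^sup>+x. ennreal (h x) \<partial>\<mu>X) = (\<integral>\<^sup>+y. (\<Sum>l<\<tau> y. ennreal (h ((f ^^ l) y))) \<partial>\<mu>Y) / ?c" by (rule \<mu>X_eq(2)) measurable
    also have "(\<integral>\<^sup>+y. (\<Sum>l<\<tau> y. ennreal (h ((f ^^ l) y))) \<partial>\<mu>Y) = (\<integral>\<^sup>+y. ennreal (H y) \<partial>\<mu>Y)"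
      using h_pos[OF fl_X] by (intro nn_integral_cong) (simp add: Hfun_def sum_ennreal less_imp_le space_\<mu>Y)
    also have "\<dots> = ennreal (\<integral>y. H y \<partial>\<mu>Y)" using H_nonneg by (intro nn_integral_eq_integral H_int) (auto simp: space_\<mu>Y)
    finally show ?thesis .
  qed
  have "(\<integral>\<^sup>+x. Z x \<partial>\<mu>M) = (\<integral>\<^sup>+x. ?K x \<partial>\<mu>X) / (\<integral>\<^sup>+x. ennreal (h x) \<partial>\<mu>X)" by (rule \<mu>M_eq0(2)) simp
  also have "(\<integral>\<^sup>+x. ?K x \<partial>\<mu>X) = (\<integral>\<^sup>+y. (\<Sum>l<\<tau> y. ?K ((f ^^ l) y)) \<partial>\<mu>Y) / ?c" by (rule \<mu>X_eq(2)) simp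
  also have "(\<integral>\<^sup>+y. (\<Sum>l<\<tau> y. ?K ((f ^^ l) y)) \<partial>\<mu>Y) = (\<integral>\<^sup>+y. (\<integral>\<^sup>+u. indicator {0..H y} u * Z (T (max 0 u) y) \<partial>lborel) \<partial>\<mu>Y)"
    by (intro nn_integral_cong) (simp add: space_\<mu>Y nn_integral_partial Hfun_def)
  finally show ?thesis unfolding hc ennreal_divide_divide_cancel[OF c integral_H_pos] .
qed

end

section \<open>Maximal inequalities for single and iterated sums\<close>

lemma powr_tangent:
  fixes s m r :: real
  assumes r: "1 \<le> r" and s: "0 \<le> s" and m: "0 \<le> m"
  shows "r * s * m powr (r - 1) \<le> (r - 1) * m powr r + s powr r"
proof (cases "s = 0 \<or> m = 0")
  case True thus ?thesis using r by auto
next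
  case False
  hence sm: "0 < s" "0 < m" using s m by auto
  have "(s powr r) powr (1/r) * (m powr r) powr ((r-1)/r) \<le> 1/r * s powr r + (r-1)/r * m powr r"
    using sm r by (intro Youngs_inequality_0) (auto simp: field_simps)
  hence "s * m powr (r - 1) \<le> 1/r * s powr r + (r-1)/r * m powr r" using sm r by (simp add: powr_powr)
  hence "r * (s * m powr (r - 1)) \<le> r * (1/r * s powr r + (r-1)/r * m powr r)" using r by (intro mult_left_mono) auto
  also have "\<dots> = s powr r + (r - 1) * m powr r" using r by (simp add: distrib_left)
  finally show ?thesis by (simp add: mult.assoc)
qed

text \<open>Jensen's inequality: the tangent of the power function at the mean \<open>m\<close>,
  summed over the terms.\<close>

lemma sum_powr_le:
  fixes x :: "nat \<Rightarrow> real"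
  assumes r: "1 \<le> r" and x: "\<And>j. 0 \<le> x j"
  shows "(\<Sum>j<N. x j) powr r \<le> real N powr (r - 1) * (\<Sum>j<N. x j powr r)"
proof (cases "N = 0")
  case False
  define m where "m = (\<Sum>j<N. x j) / N"
  have m: "0 \<le> m" using x by (simp add: m_def sum_nonneg)
  have mm: "m * m powr (r - 1) = m powr r" using m r by (cases "m = 0") (auto simp: powr_diff)
  have "(\<Sum>j<N. r * x j * m powr (r - 1)) \<le> (\<Sum>j<N. (r - 1) * m powr r + x j powr r)"
    by (intro sum_mono powr_tangent r x m)
  also have "(\<Sum>j<N. r * x j * m powr (r - 1)) = r * (\<Sum>j<N. x j) * m powr (r - 1)"
    by (simp add: sum_distrib_left sum_distrib_right)
  also have "(\<Sum>j<N. x j) = N * m" using False by (simp add: m_def)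
  also have "r * (N * m) * m powr (r - 1) = r * N * m powr r" using mm by (simp add: mult.assoc)
  also have "(\<Sum>j<N. (r - 1) * m powr r + x j powr r) = N * ((r - 1) * m powr r) + (\<Sum>j<N. x j powr r)" by (simp add: sum.distrib)
  finally have "N * m powr r \<le> (\<Sum>j<N. x j powr r)" by (simp add: algebra_simps)
  hence "real N powr (r - 1) * (N * m powr r) \<le> real N powr (r - 1) * (\<Sum>j<N. x j powr r)" by (intro mult_left_mono) auto
  moreover have "real N powr (r - 1) * (N * m powr r) = (N * m) powr r"
    using False m by (simp add: powr_mult powr_diff)
  moreover have "N * m = (\<Sum>j<N. x j)" using False by (simp add: m_def)
  ultimately show ?thesis by simp
qed simp

text \<open>\<open>R\<close> bounds the \<open>r\<close>-th moment and not its root, so growth rates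
  appear as \<open>N powr (p/2)\<close>. Nonnegativity is required everywhere, which keeps
  \<open>powr\<close> free of absolute values.\<close>

definition lp_bounded :: "'a measure \<Rightarrow> real \<Rightarrow> ('a \<Rightarrow> real) \<Rightarrow> real \<Rightarrow> bool" where
  "lp_bounded M r g R \<longleftrightarrow> g \<in> borel_measurable M \<and> (\<forall>x. 0 \<le> g x) \<and>
     integrable M (\<lambda>x. g x powr r) \<and> (\<integral>x. g x powr r \<partial>M) \<le> R"

lemma lp_boundedD:
  assumes "lp_bounded M r g R"
  shows "g \<in> borel_measurable M" "0 \<le> g x" "integrable M (\<lambda>x. g x powr r)" "(\<integral>x. g x powr r \<partial>M) \<le> R"
  using assms by (auto simp: lp_bounded_def)

lemma lp_bounded_add:
  assumes "lp_bounded M r g R" "lp_bounded M r k Q" "0 \<le> r"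
  shows "lp_bounded M r (\<lambda>x. g x + k x) (2 powr r * (R + Q))"
proof -
  note g = lp_boundedD[OF assms(1)] and k = lp_boundedD[OF assms(2)]
  have [measurable]: "g \<in> borel_measurable M" "k \<in> borel_measurable M" using g(1) k(1) by auto
  have i: "integrable M (\<lambda>x. 2 powr r * (g x powr r + k x powr r))" using g(3) k(3) by auto
  have le: "(g x + k x) powr r \<le> 2 powr r * (g x powr r + k x powr r)" for x using g(2) k(2) assms(3) by (intro powr_add_le)
  have j: "integrable M (\<lambda>x. (g x + k x) powr r)"
    by (rule Bochner_Integration.integrable_bound[OF i]) (use le in auto)
  have "(\<integral>x. (g x + k x) powr r \<partial>M) \<le> (\<integral>x. 2 powr r * (g x powr r + k x powr r) \<partial>M)" by (rule integral_mono[OF j i le])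
  also have "\<dots> = 2 powr r * ((\<integral>x. g x powr r \<partial>M) + (\<integral>x. k x powr r \<partial>M))" using g(3) k(3) by simp
  also have "\<dots> \<le> 2 powr r * (R + Q)" using g(4) k(4) by (intro mult_left_mono add_mono) auto
  finally show ?thesis using j g(2) k(2) by (simp add: lp_bounded_def add_nonneg_nonneg)
qed

lemma lp_bounded_scale:
  assumes "lp_bounded M r g R" "0 \<le> c"
  shows "lp_bounded M r (\<lambda>x. c * g x) (c powr r * R)"
proof -
  note g = lp_boundedD[OF assms(1)]
  have [measurable]: "g \<in> borel_measurable M" using g(1) .
  have eq: "(c * g x) powr r = c powr r * g x powr r" for x using assms(2) g(2) by (simp add: powr_mult)
  show ?thesis unfolding lp_bounded_def eq using g assms(2) by (auto intro: mult_left_mono)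
qed

lemma lp_bounded_mono: "lp_bounded M r g R \<Longrightarrow> R \<le> R' \<Longrightarrow> lp_bounded M r g R'"
  by (auto simp: lp_bounded_def)

lemma lp_bounded_const: "prob_space M \<Longrightarrow> 0 \<le> c \<Longrightarrow> lp_bounded M r (\<lambda>_. c) (c powr r)"
proof -
  assume "prob_space M" and c: "0 \<le> c"
  then interpret prob_space M by simp
  show ?thesis using c by (auto simp: lp_bounded_def prob_space)
qed

lemma lp_bounded_lower:
  assumes "prob_space M" "lp_bounded M p g R" "0 \<le> r" "r \<le> p"
  shows "lp_bounded M r g (1 + R)"
proof -
  interpret prob_space M by fact
  note g = lp_boundedD[OF assms(2)]
  have [measurable]: "g \<in> borel_measurable M" using g(1) .
  have le: "g x powr r \<le> 1 + g x powr p" for x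
  proof (cases "g x \<le> 1")
    case True
    have "g x powr r \<le> 1 powr r" using True g(2) assms by (intro powr_mono2) auto
    thus ?thesis by (simp add: add_increasing2)
  next
    case False
    have "g x powr r \<le> g x powr p" using False assms by (intro powr_mono) auto
    thus ?thesis by simp
  qed
  have i: "integrable M (\<lambda>x. 1 + g x powr p)" using g(3) by auto
  have j: "integrable M (\<lambda>x. g x powr r)"
    by (rule Bochner_Integration.integrable_bound[OF i]) (use le in auto)
  have "(\<integral>x. g x powr r \<partial>M) \<le> (\<integral>x. 1 + g x powr p \<partial>M)" by (rule integral_mono[OF j i le])
  also have "\<dots> \<le> 1 + R" using g(3,4) by (simp add: prob_space)
  finally show ?thesis using j g by (simp add: lp_bounded_def)
qed

lemma lp_bounded_square:
  assumes "lp_bounded M p g R" shows "lp_bounded M (p / 2) (\<lambda>x. (g x)\<^sup>2) R"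
proof -
  note g = lp_boundedD[OF assms]
  have eq: "((g x)\<^sup>2) powr (p / 2) = g x powr p" for x
  proof (cases "g x = 0")
    case False
    hence "(g x)\<^sup>2 = g x powr 2" using g(2)[of x] by (simp add: powr_numeral)
    thus ?thesis by (simp only: powr_powr) simp
  qed simp
  have [measurable]: "g \<in> borel_measurable M" using g(1) .
  show ?thesis unfolding lp_bounded_def eq using g by auto
qed

lemma lp_bounded_distr:
  assumes W: "W \<in> measurable N M'" and g: "lp_bounded (distr N M' W) r g R"
  shows "lp_bounded N r (\<lambda>y. g (W y)) R"
proof -
  note g = lp_boundedD[OF g]
  have gm [measurable]: "g \<in> borel_measurable M'" using g(1) by simp
  have gr: "(\<lambda>x. g x powr r) \<in> borel_measurable M'" by measurable
  have "integrable N (\<lambda>y. g (W y) powr r)" using g(3) integrable_distr_eq[OF W gr] by simp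
  moreover have "(\<integral>y. g (W y) powr r \<partial>N) = (\<integral>x. g x powr r \<partial>distr N M' W)" using integral_distr[OF W gr] by simp
  ultimately show ?thesis using g(2,4) measurable_compose[OF W gm] by (simp add: lp_bounded_def)
qed

section \<open>Maxima of Birkhoff sums and of iterated sums\<close>

context mpt
begin

text \<open>Linear growth with no cancellation, by Jensen and invariance. It is good enough for
  error terms of iterated sums, whose order is \<open>N\<close> as well.\<close>

lemma lp_bounded_birkhoff:
  assumes g: "lp_bounded M r g R" and r: "1 \<le> r"
  shows "lp_bounded M r (\<lambda>x. \<Sum>j<N. g ((G ^^ j) x)) (real N powr r * R)"
proof -
  note g = lp_boundedD[OF g]
  have [measurable]: "g \<in> borel_measurable M" using g(1) .
  have gi: "integrable M (\<lambda>x. g ((G ^^ j) x) powr r)" for j using mpt.integrable_G[OF mpt_Gn g(3)] .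
  have ge: "(\<integral>x. g ((G ^^ j) x) powr r \<partial>M) = (\<integral>x. g x powr r \<partial>M)" for j
    using mpt.integral_G[OF mpt_Gn, of "\<lambda>x. g x powr r" j] by simp
  let ?S = "\<lambda>x. \<Sum>j<N. g ((G ^^ j) x)"
  have le: "?S x powr r \<le> real N powr (r - 1) * (\<Sum>j<N. g ((G ^^ j) x) powr r)" for x using g(2) by (intro sum_powr_le r)
  have i: "integrable M (\<lambda>x. real N powr (r - 1) * (\<Sum>j<N. g ((G ^^ j) x) powr r))" using gi by auto
  have j: "integrable M (\<lambda>x. ?S x powr r)"
    by (rule Bochner_Integration.integrable_bound[OF i]) (use le in \<open>auto intro: order_trans[OF _ abs_ge_self]\<close>)
  have "(\<integral>x. ?S x powr r \<partial>M) \<le> (\<integral>x. real N powr (r - 1) * (\<Sum>j<N. g ((G ^^ j) x) powr r) \<partial>M)" by (rule integral_mono[OF j i le])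
  also have "\<dots> = real N powr (r - 1) * (N * (\<integral>x. g x powr r \<partial>M))" using gi by (simp add: ge)
  also have "\<dots> \<le> real N powr (r - 1) * (N * R)" using g(4) by (intro mult_left_mono) auto
  also have "\<dots> = real N powr r * R" by (cases "N = 0") (auto simp: powr_diff)
  finally have "(\<integral>x. ?S x powr r \<partial>M) \<le> real N powr r * R" .
  moreover have "?S \<in> borel_measurable M" by measurable
  ultimately show ?thesis using j g(2) by (simp add: lp_bounded_def sum_nonneg)
qed

definition bs :: "('a \<Rightarrow> real) \<Rightarrow> nat \<Rightarrow> 'a \<Rightarrow> real" where
  "bs d n x = (\<Sum>j<n. d ((G ^^ j) x))"

lemma bs_0: "bs d 0 x = 0" by (simp add: bs_def)

lemma bs_Suc: "bs d (Suc n) x = d x + bs d n (G x)"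
  unfolding bs_def sum.lessThan_Suc_shift by (simp add: funpow_swap1)

lemma bs_add: "bs d (m + n) x = bs d m x + bs d n ((G ^^ m) x)"
proof (induction m arbitrary: x)
  case (Suc m)
  show ?case using Suc[of "G x"] by (simp add: bs_Suc funpow_swap1)
qed (simp add: bs_0)

lemma maximal_sequence:
  fixes u :: "nat \<Rightarrow> 'a \<Rightarrow> real"
  assumes u0: "\<And>x. u 0 x = 0"
  shows "\<exists>m. (\<forall>x. m 0 x = (0::real)) \<and> (\<forall>k x. m (Suc k) x = max \<bar>u (Suc k) x\<bar> (m k (G x))) \<and>
     (\<forall>k j x. j \<le> k \<longrightarrow> \<bar>u j ((G ^^ (k - j)) x)\<bar> \<le> m k x) \<and> (\<forall>k x. 0 \<le> m k x)"
proof -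
  define m where "m = rec_nat (\<lambda>x. 0::real) (\<lambda>k mk x. max \<bar>u (Suc k) x\<bar> (mk (G x)))"
  have m0: "m 0 x = 0" and mS: "m (Suc k) x = max \<bar>u (Suc k) x\<bar> (m k (G x))" for k x by (simp_all add: m_def)
  have le: "\<bar>u j ((G ^^ (k - j)) x)\<bar> \<le> m k x" if "j \<le> k" for k j x
    using that
  proof (induction k arbitrary: x)
    case (Suc k)
    show ?case
    proof (cases "j = Suc k")
      case False
      hence "j \<le> k" using Suc.prems by simp
      moreover have "(G ^^ (Suc k - j)) x = (G ^^ (k - j)) (G x)" using \<open>j \<le> k\<close> by (simp add: Suc_diff_le funpow_swap1)
      ultimately show ?thesis using Suc.IH[of "G x"] by (simp add: mS max.coboundedI2)
    qed (simp add: mS)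
  qed (simp add: u0 m0)
  have "0 \<le> m k x" for k x by (cases k) (auto simp: m0 mS)
  thus ?thesis using m0 mS le by (intro exI[of _ m]) simp
qed

text \<open>The maximum runs over the sums that end at time \<open>N\<close>, as reversed time
  dictates; a sum from time 0 is the difference of two of these.\<close>

theorem birkhoff_max:
  assumes q: "2 \<le> q" and A: "0 < A" and d: "d \<in> borel_measurable M" "integrable M (\<lambda>x. \<bar>d x\<bar> powr q)"
    "(\<integral>x. \<bar>d x\<bar> powr q \<partial>M) \<le> A powr q" "reverse_diff d"
  shows "\<And>k. lp_bounded M q (\<lambda>x. \<bar>bs d k x\<bar>) ((3 * taylor_const q * k) powr (q / 2) * A powr q)"
    and "\<exists>m. lp_bounded M q m (4 powr q * ((3 * taylor_const q * N) powr (q / 2) * A powr q)) \<and>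
       (\<forall>x. \<forall>j\<le>N. \<bar>bs d j ((G ^^ (N - j)) x)\<bar> \<le> m x)"
proof -
  note ctx = q A bs_0[of d] bs_Suc[of d] d(1,2,4)
  show 1: "lp_bounded M q (\<lambda>x. \<bar>bs d k x\<bar>) ((3 * taylor_const q * k) powr (q / 2) * A powr q)" for k
    using reverse_martingale_moment[where u="bs d" and d="\<lambda>_. d", OF ctx d(3), of k]
      u_int[where u="bs d" and d="\<lambda>_. d", OF ctx, of k] u_meas[where u="bs d" and d="\<lambda>_. d", OF ctx, of k]
    by (simp add: lp_bounded_def)
  obtain m where m: "\<And>x. m 0 x = (0::real)" "\<And>k x. m (Suc k) x = max \<bar>bs d (Suc k) x\<bar> (m k (G x))"
    "\<And>k j x. j \<le> k \<Longrightarrow> \<bar>bs d j ((G ^^ (k - j)) x)\<bar> \<le> m k x" "\<And>k x. 0 \<le> m k x"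
    using maximal_sequence[of "bs d", OF bs_0] by blast
  have mx: "integrable M (\<lambda>x. m N x powr q)" "(\<integral>x. m N x powr q \<partial>M) \<le> 4 powr q * (\<integral>x. \<bar>bs d N x\<bar> powr q \<partial>M)"
    using reverse_martingale_maximal[where u="bs d" and d="\<lambda>_. d", OF ctx m(1,2), of N] by auto
  have mm: "m k \<in> borel_measurable M" for k
  proof (induction k)
    case (Suc k)
    have [measurable]: "bs d (Suc k) \<in> borel_measurable M" by (rule u_meas[where u="bs d" and d="\<lambda>_. d", OF ctx])
    have "m (Suc k) = (\<lambda>x. max \<bar>bs d (Suc k) x\<bar> (m k (G x)))" using m(2) by auto
    thus ?case using Suc by simp
  next
    case 0
    have "m 0 = (\<lambda>x. 0)" using m(1) by auto
    thus ?case by simp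
  qed
  have "4 powr q * (\<integral>x. \<bar>bs d N x\<bar> powr q \<partial>M) \<le> 4 powr q * ((3 * taylor_const q * N) powr (q / 2) * A powr q)"
    using lp_boundedD(4)[OF 1[of N]] by (intro mult_left_mono) auto
  hence "lp_bounded M q (m N) (4 powr q * ((3 * taylor_const q * N) powr (q / 2) * A powr q))"
    using order_trans[OF mx(2)] mx(1) mm m(4) by (simp add: lp_bounded_def)
  thus "\<exists>m. lp_bounded M q m (4 powr q * ((3 * taylor_const q * N) powr (q / 2) * A powr q)) \<and>
       (\<forall>x. \<forall>j\<le>N. \<bar>bs d j ((G ^^ (N - j)) x)\<bar> \<le> m x)"
    using m(3) by blast
qed

text \<open>Chen's relation for iterated sums: the cross term pairs the sum before time
  \<open>n\<close> with the sum after it.\<close>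

lemma iterated_sum_split:
  assumes "n \<le> N"
  shows "(\<Sum>j<N. bs d j x * d' ((G ^^ j) x)) = (\<Sum>j<n. bs d j x * d' ((G ^^ j) x))
     + bs d n x * bs d' (N - n) ((G ^^ n) x) + (\<Sum>j<N - n. bs d j ((G ^^ n) x) * d' ((G ^^ j) ((G ^^ n) x)))"
proof -
  have "(\<Sum>j<n + k. bs d j x * d' ((G ^^ j) x)) = (\<Sum>j<n. bs d j x * d' ((G ^^ j) x))
     + bs d n x * bs d' k ((G ^^ n) x) + (\<Sum>j<k. bs d j ((G ^^ n) x) * d' ((G ^^ j) ((G ^^ n) x)))" for k
  proof (induction k)
    case (Suc k)
    have "(G ^^ (n + k)) x = (G ^^ k) ((G ^^ n) x)" by (metis add.commute comp_apply funpow_add)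
    thus ?case using Suc bs_add[of d n k x] by (simp add: bs_def algebra_simps)
  qed (simp add: bs_0)
  from this[of "N - n"] show ?thesis using assms by simp
qed

text \<open>Adding points at the beginning of the orbit, the iterated sum grows by
  \<open>d x * bs d' k (G x)\<close>. The second factor depends on \<open>G x\<close>, so this is
  again a reverse difference, now in \<open>L\<^sup>r\<close> with \<open>r = p / 2\<close> and of
  norm \<open>O(sqrt k)\<close>. The martingale inequalities apply with exponent \<open>r\<close>,
  and Chen's relation turns final segments into initial ones.\<close>

theorem iterated_max:
  assumes p: "4 \<le> p" and A: "0 < A"
  shows "\<exists>K\<ge>0. \<forall>d d' N. d \<in> borel_measurable M \<longrightarrow> d' \<in> borel_measurable M \<longrightarrow>
     integrable M (\<lambda>x. \<bar>d x\<bar> powr p) \<longrightarrow> integrable M (\<lambda>x. \<bar>d' x\<bar> powr p) \<longrightarrow>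
     (\<integral>x. \<bar>d x\<bar> powr p \<partial>M) \<le> A powr p \<longrightarrow> (\<integral>x. \<bar>d' x\<bar> powr p \<partial>M) \<le> A powr p \<longrightarrow>
     reverse_diff d \<longrightarrow> reverse_diff d' \<longrightarrow> 0 < N \<longrightarrow>
     (\<exists>g. lp_bounded M (p / 2) g (K * real N powr (p / 2)) \<and>
       (\<forall>x. \<forall>n\<le>N. \<bar>\<Sum>j<n. bs d j x * d' ((G ^^ j) x)\<bar> \<le> g x))"
proof -
  define c where "c = 3 * taylor_const p"
  define r where "r = p / 2"
  define cr where "cr = 3 * taylor_const r"
  have c: "1 \<le> c" using taylor_const_ge1[of p] p by (simp add: c_def)
  have cr: "1 \<le> cr" using taylor_const_ge1[of r] p by (simp add: cr_def r_def)
  have r: "2 \<le> r" using p by (simp add: r_def)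
  define k1 where "k1 = 4 powr p * (c powr (p / 2) * A powr p)"
  define k2 where "k2 = 4 powr r * (cr powr (r / 2) * (2 * A * (sqrt c * A)) powr r)"
  define K where "K = 2 powr r * (2 powr r * k2 + 2 powr r * (k1 + k1))"
  have K0: "0 \<le> K" unfolding K_def k1_def k2_def by (intro mult_nonneg_nonneg add_nonneg_nonneg) auto
  have "\<exists>g. lp_bounded M r g (K * real N powr r) \<and> (\<forall>x. \<forall>n\<le>N. \<bar>\<Sum>j<n. bs d j x * d' ((G ^^ j) x)\<bar> \<le> g x)"
    if d: "d \<in> borel_measurable M" and d': "d' \<in> borel_measurable M"
      and i: "integrable M (\<lambda>x. \<bar>d x\<bar> powr p)" and i': "integrable M (\<lambda>x. \<bar>d' x\<bar> powr p)"
      and le: "(\<integral>x. \<bar>d x\<bar> powr p \<partial>M) \<le> A powr p" and le': "(\<integral>x. \<bar>d' x\<bar> powr p \<partial>M) \<le> A powr p"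
      and rd: "reverse_diff d" and rd': "reverse_diff d'" and N: "0 < N" for d d' N
  proof -
    have p2: "2 \<le> p" using p by simp
    have [measurable]: "d \<in> borel_measurable M" "d' \<in> borel_measurable M" by fact+
    note S = birkhoff_max[OF p2 A d i le rd] and S' = birkhoff_max[OF p2 A d' i' le' rd']
    obtain m where m: "lp_bounded M p m (4 powr p * ((3 * taylor_const p * N) powr (p / 2) * A powr p))"
      and ml: "\<And>x j. j \<le> N \<Longrightarrow> \<bar>bs d j ((G ^^ (N - j)) x)\<bar> \<le> m x" using S(2)[of N] by blast
    obtain m' where m': "lp_bounded M p m' (4 powr p * ((3 * taylor_const p * N) powr (p / 2) * A powr p))"
      and ml': "\<And>x j. j \<le> N \<Longrightarrow> \<bar>bs d' j ((G ^^ (N - j)) x)\<bar> \<le> m' x" using S'(2)[of N] by blast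
    have k1N: "4 powr p * ((3 * taylor_const p * N) powr (p / 2) * A powr p) = k1 * real N powr r"
      using c by (simp add: k1_def c_def[symmetric] powr_mult r_def)
    \<comment> \<open>Bound in \<open>L\<^sup>p\<close> for all sums of at most \<open>N\<close>
      terms of \<open>d'\<close>; with \<open>A\<close> for \<open>d\<close> it normalises the
      product before the crude inequality is used.\<close>
    define B where "B = sqrt c * A * sqrt (real N)"
    have B: "0 < B" using c A N by (simp add: B_def)
    have Bp: "B powr p = (c * N) powr (p / 2) * A powr p"
      using c A N by (simp add: B_def powr_mult powr_half_sqrt[symmetric] powr_powr)
    \<comment> \<open>Cut off at \<open>k = N\<close> so that a single bound, depending on
      \<open>N\<close>, holds for every index, as the moment inequality requires.\<close>
    define D where "D k x = (if k < N then d x * bs d' k (G x) else 0)" for k x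
    define w where "w = rec_nat (\<lambda>x. 0::real) (\<lambda>k wk x. D k x + wk (G x))"
    have w0: "w 0 x = 0" and wS: "w (Suc k) x = D k x + w k (G x)" for k x by (simp_all add: w_def)
    have bs'm [measurable]: "bs d' k \<in> borel_measurable M" for k unfolding bs_def[abs_def] by measurable
    have Dm [measurable]: "D k \<in> borel_measurable M" for k unfolding D_def by measurable
    have pw: "\<bar>D k x\<bar> powr r \<le> (A * B) powr r * (\<bar>d x\<bar> powr p / A powr p + (if k < N then \<bar>bs d' k (G x)\<bar> powr p / B powr p else 0))" for k x
    proof (cases "k < N")
      case True
      have "(\<bar>d x\<bar> / A) powr r * (\<bar>bs d' k (G x)\<bar> / B) powr r \<le> (\<bar>d x\<bar> / A) powr (r + r) + (\<bar>bs d' k (G x)\<bar> / B) powr (r + r)"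
        using A B r by (intro powr_mult_le_add) auto
      hence "\<bar>D k x\<bar> powr r / (A * B) powr r \<le> \<bar>d x\<bar> powr p / A powr p + \<bar>bs d' k (G x)\<bar> powr p / B powr p"
        using A B True by (simp add: powr_divide powr_mult D_def abs_mult r_def)
      thus ?thesis using A B True by (subst (asm) pos_divide_le_eq) (auto simp: mult.commute)
    next
      case False thus ?thesis using r by (simp add: D_def)
    qed
    have Si: "integrable M (\<lambda>x. \<bar>bs d' k (G x)\<bar> powr p)" for k using integrable_G[OF lp_boundedD(3)[OF S'(1)]] .
    have rhs_i: "integrable M (\<lambda>x. (A * B) powr r * (\<bar>d x\<bar> powr p / A powr p + (if k < N then \<bar>bs d' k (G x)\<bar> powr p / B powr p else 0)))" for k
      using i Si by (cases "k < N") auto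
    have Di: "integrable M (\<lambda>x. \<bar>D k x\<bar> powr r)" for k
      by (rule Bochner_Integration.integrable_bound[OF rhs_i[of k]]) (use pw in \<open>auto intro!: order_trans[OF _ abs_ge_self]\<close>)
    have Dle: "(\<integral>x. \<bar>D k x\<bar> powr r \<partial>M) \<le> (2 * (A * B)) powr r" for k
    proof -
      have "(\<integral>x. \<bar>D k x\<bar> powr r \<partial>M) \<le> (\<integral>x. (A * B) powr r * (\<bar>d x\<bar> powr p / A powr p + (if k < N then \<bar>bs d' k (G x)\<bar> powr p / B powr p else 0)) \<partial>M)"
        by (rule integral_mono[OF Di rhs_i pw])
      also have "\<dots> \<le> (A * B) powr r * (1 + 1)"
      proof (cases "k < N")
        case True
        have "(\<integral>x. \<bar>bs d' k (G x)\<bar> powr p \<partial>M) = (\<integral>x. \<bar>bs d' k x\<bar> powr p \<partial>M)" by (rule integral_G) measurable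
        also have "\<dots> \<le> (c * k) powr (p / 2) * A powr p" using lp_boundedD(4)[OF S'(1)[of k]] by (simp add: c_def)
        also have "\<dots> \<le> B powr p" unfolding Bp using True c p by (intro mult_right_mono powr_mono2 mult_left_mono) auto
        finally have "(\<integral>x. \<bar>bs d' k (G x)\<bar> powr p \<partial>M) / B powr p \<le> 1" using B by simp
        moreover have "(\<integral>x. \<bar>d x\<bar> powr p \<partial>M) / A powr p \<le> 1" using le A by simp
        ultimately show ?thesis using True i Si[of k] by (simp add: mult_left_mono)
      next
        case False
        have "(\<integral>x. \<bar>d x\<bar> powr p \<partial>M) / A powr p \<le> 1" using le A by simp
        thus ?thesis using False i mult_left_mono[of "(\<integral>x. \<bar>d x\<bar> powr p \<partial>M) / A powr p" 2 "(A * B) powr r"] by simp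
      qed
      also have "\<dots> \<le> (A * B) powr r * 2 powr r"
      proof -
        have "(2::real) powr 1 \<le> 2 powr r" using r by (intro powr_mono) auto
        thus ?thesis by (intro mult_left_mono) auto
      qed
      also have "\<dots> = (2 * (A * B)) powr r" using A B by (simp add: powr_mult mult.commute)
      finally show ?thesis .
    qed
    have Drd: "reverse_diff (D k)" for k unfolding reverse_diff_def
    proof (intro ballI impI)
      fix \<psi> :: "'a \<Rightarrow> real" assume [measurable]: "\<psi> \<in> borel_measurable M" and ii: "integrable M (\<lambda>x. D k x * \<psi> (G x))"
      show "(\<integral>x. D k x * \<psi> (G x) \<partial>M) = 0"
      proof (cases "k < N")
        case True
        have "integrable M (\<lambda>x. d x * (bs d' k (G x) * \<psi> (G x)))" using ii True by (simp add: D_def mult.assoc)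
        hence "(\<integral>x. d x * (bs d' k (G x) * \<psi> (G x)) \<partial>M) = 0"
          using rd[unfolded reverse_diff_def, rule_format, of "\<lambda>z. bs d' k z * \<psi> z"] by simp
        thus ?thesis using True by (simp add: D_def mult.assoc)
      qed (simp add: D_def)
    qed
    have AB: "0 < 2 * (A * B)" using A B by simp
    note ctx = r AB w0 wS Dm Di Drd
    obtain mm where mm: "\<And>x. mm 0 x = (0::real)" "\<And>k x. mm (Suc k) x = max \<bar>w (Suc k) x\<bar> (mm k (G x))"
      "\<And>k j x. j \<le> k \<Longrightarrow> \<bar>w j ((G ^^ (k - j)) x)\<bar> \<le> mm k x" "\<And>k x. 0 \<le> mm k x"
      using maximal_sequence[of w, OF w0] by blast
    have mx: "integrable M (\<lambda>x. mm N x powr r)" "(\<integral>x. mm N x powr r \<partial>M) \<le> 4 powr r * (\<integral>x. \<bar>w N x\<bar> powr r \<partial>M)"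
      using reverse_martingale_maximal[where u=w and d=D, OF ctx mm(1,2), of N] by auto
    have wm [measurable]: "w k \<in> borel_measurable M" for k by (rule u_meas[where u=w and d=D, OF ctx])
    have mmm: "mm k \<in> borel_measurable M" for k
    proof (induction k)
      case (Suc k)
      have "mm (Suc k) = (\<lambda>x. max \<bar>w (Suc k) x\<bar> (mm k (G x)))" using mm(2) by auto
      thus ?case using Suc by simp
    next
      case 0
      have "mm 0 = (\<lambda>x. 0)" using mm(1) by auto
      thus ?case by simp
    qed
    have mmb: "lp_bounded M r (mm N) (k2 * real N powr r)"
    proof -
      have "(\<integral>x. \<bar>w N x\<bar> powr r \<partial>M) \<le> (cr * N) powr (r / 2) * (2 * (A * B)) powr r"
        using reverse_martingale_moment[where u=w and d=D, OF ctx Dle, of N] by (simp add: cr_def)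
      hence "4 powr r * (\<integral>x. \<bar>w N x\<bar> powr r \<partial>M) \<le> 4 powr r * ((cr * N) powr (r / 2) * (2 * (A * B)) powr r)" by (intro mult_left_mono) auto
      also have "\<dots> = k2 * real N powr r"
      proof -
        have "2 * (A * B) = (2 * A * (sqrt c * A)) * sqrt (real N)" by (simp add: B_def)
        hence "(2 * (A * B)) powr r = (2 * A * (sqrt c * A)) powr r * real N powr (r / 2)"
          using A c by (simp add: powr_mult powr_half_sqrt[symmetric] powr_powr)
        moreover have "(cr * N) powr (r / 2) = cr powr (r / 2) * real N powr (r / 2)" using cr by (simp add: powr_mult)
        moreover have "real N powr (r / 2) * real N powr (r / 2) = real N powr r" by (simp add: powr_add[symmetric])
        ultimately show ?thesis by (simp add: k2_def mult_ac)
      qed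
      finally show ?thesis using order_trans[OF mx(2)] mx(1) mmm mm(4) by (simp add: lp_bounded_def)
    qed
    have w_eq: "w k x = (\<Sum>j<k. bs d j x * d' ((G ^^ j) x))" if "k \<le> N" for k x
      using that
    proof (induction k arbitrary: x)
      case (Suc k)
      have "(\<Sum>j<Suc k. bs d j x * d' ((G ^^ j) x)) = (\<Sum>j<k. bs d (Suc j) x * d' ((G ^^ j) (G x)))"
        unfolding sum.lessThan_Suc_shift by (simp add: bs_0 funpow_swap1)
      also have "\<dots> = d x * bs d' k (G x) + (\<Sum>j<k. bs d j (G x) * d' ((G ^^ j) (G x)))"
        by (simp add: bs_Suc bs_def[of d'] sum_distrib_left sum.distrib[symmetric] algebra_simps)
      finally show ?case using Suc.IH[of "G x"] Suc.prems by (simp add: wS D_def)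
    qed (simp add: w0)
    define g where "g x = 2 * mm N x + ((m x)\<^sup>2 + (m' x)\<^sup>2)" for x
    have "lp_bounded M r g (2 powr r * (2 powr r * (k2 * real N powr r) + 2 powr r * (k1 * real N powr r + k1 * real N powr r)))"
      unfolding g_def using r lp_bounded_square[OF m] lp_bounded_square[OF m']
      by (intro lp_bounded_add lp_bounded_scale[OF mmb]) (auto simp: k1N r_def)
    hence gb: "lp_bounded M r g (K * real N powr r)" by (simp add: K_def algebra_simps)
    have "\<bar>\<Sum>j<n. bs d j x * d' ((G ^^ j) x)\<bar> \<le> g x" if n: "n \<le> N" for n x
    proof -
      have 1: "\<bar>w N x\<bar> \<le> mm N x" using mm(3)[of N N x] by simp
      have 2: "\<bar>w (N - n) ((G ^^ n) x)\<bar> \<le> mm N x" using mm(3)[of "N - n" N x] n by simp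
      have 3: "\<bar>bs d' (N - n) ((G ^^ n) x)\<bar> \<le> m' x" using ml'[of "N - n" x] n by simp
      have "bs d N x = bs d n x + bs d (N - n) ((G ^^ n) x)" using bs_add[of d n "N - n" x] n by simp
      moreover have "\<bar>bs d N x\<bar> \<le> m x" "\<bar>bs d (N - n) ((G ^^ n) x)\<bar> \<le> m x" using ml[of N x] ml[of "N - n" x] n by auto
      ultimately have 4: "\<bar>bs d n x\<bar> \<le> 2 * m x" by linarith
      have "\<bar>bs d n x * bs d' (N - n) ((G ^^ n) x)\<bar> \<le> (2 * m x) * m' x"
        unfolding abs_mult using 3 4 by (intro mult_mono) auto
      also have "\<dots> \<le> (m x)\<^sup>2 + (m' x)\<^sup>2" using sum_squares_bound[of "m x" "m' x"] by simp
      finally have 5: "\<bar>bs d n x * bs d' (N - n) ((G ^^ n) x)\<bar> \<le> (m x)\<^sup>2 + (m' x)\<^sup>2" .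
      have "w N x = (\<Sum>j<n. bs d j x * d' ((G ^^ j) x)) + bs d n x * bs d' (N - n) ((G ^^ n) x) + w (N - n) ((G ^^ n) x)"
        using iterated_sum_split[OF n, of d x d'] w_eq[of N x] w_eq[of "N - n" "(G ^^ n) x"] by simp
      thus ?thesis using 1 2 5 unfolding g_def by linarith
    qed
    thus ?thesis using gb by blast
  qed
  thus ?thesis using K0 unfolding r_def by blast
qed

end

section \<open>Geometric convergence, the maximal ergodic theorem and asymptotically periodic
  orbits\<close>

lemma geometric_cauchy_limit:
  fixes a :: "nat \<Rightarrow> real"
  assumes q: "0 \<le> q" "q < 1" and a: "\<And>n. \<bar>a (Suc n) - a n\<bar> \<le> c * q ^ n"
  shows "\<exists>l. \<forall>n. \<bar>a n - l\<bar> \<le> c * q ^ n / (1 - q)"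
proof -
  define d where "d n = a (Suc n) - a n" for n
  have sq: "summable (\<lambda>n. c * q ^ n)" using q by (intro summable_mult summable_geometric) auto
  have sd: "summable d" using a by (intro summable_comparison_test'[OF sq, of 0]) (auto simp: d_def)
  have "\<bar>a n - (a 0 + suminf d)\<bar> \<le> c * q ^ n / (1 - q)" for n
  proof -
    have t: "a n = a 0 + (\<Sum>k<n. d k)" using sum_lessThan_telescope[of a n] by (simp add: d_def)
    have dn: "\<bar>d (k + n)\<bar> \<le> (c * q ^ n) * q ^ k" for k using a[of "k + n"] by (simp add: d_def power_add mult_ac)
    have s: "summable (\<lambda>k. (c * q ^ n) * q ^ k)" using q by (intro summable_mult summable_geometric) auto
    have sabs: "summable (\<lambda>k. \<bar>d (k + n)\<bar>)" by (rule summable_comparison_test'[OF s, of 0]) (simp add: dn)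
    have "suminf d = (\<Sum>k. d (k + n)) + (\<Sum>k<n. d k)" using suminf_split_initial_segment[OF sd, of n] by simp
    hence "\<bar>a n - (a 0 + suminf d)\<bar> = \<bar>\<Sum>k. d (k + n)\<bar>" using t by simp
    also have "\<dots> \<le> (\<Sum>k. \<bar>d (k + n)\<bar>)" by (rule summable_rabs[OF sabs])
    also have "\<dots> \<le> (\<Sum>k. (c * q ^ n) * q ^ k)" by (rule suminf_le[OF dn sabs s])
    also have "\<dots> = c * q ^ n / (1 - q)" using q by (simp add: suminf_mult suminf_geometric)
    finally show ?thesis .
  qed
  thus ?thesis by blast
qed

text \<open>Garsia's argument: where the running maximum \<open>m\<close> of the partial sums is
  positive, \<open>m - m \<circ> G \<le> \<phi>\<close>, and the left side has mean zero. When
  almost every orbit has some positive partial sum, these sets exhaust the space.\<close>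

lemma (in mpt) maximal_ergodic:
  fixes \<phi> :: "'a \<Rightarrow> real"
  assumes \<phi>: "integrable M \<phi>" and pos: "AE x in M. \<exists>n. 0 < (\<Sum>j<n. \<phi> ((G ^^ j) x))"
  shows "0 \<le> (\<integral>x. \<phi> x \<partial>M)"
proof -
  have [measurable]: "\<phi> \<in> borel_measurable M" using \<phi> by auto
  define m where "m = rec_nat (\<lambda>x. 0) (\<lambda>n mn x. max 0 (\<phi> x + mn (G x)))"
  have m0: "m 0 x = 0" and mS: "m (Suc n) x = max 0 (\<phi> x + m n (G x))" for n x by (simp_all add: m_def)
  have m_meas [measurable]: "m n \<in> borel_measurable M" for n
  proof (induction n)
    case (Suc n)
    have "m (Suc n) = (\<lambda>x. max 0 (\<phi> x + m n (G x)))" using mS by auto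
    thus ?case using Suc by simp
  next
    case 0
    have "m 0 = (\<lambda>x. 0)" using m0 by auto
    thus ?case by simp
  qed
  have m_nonneg: "0 \<le> m n x" for n x by (cases n) (auto simp: m0 mS)
  have m_mono: "m n x \<le> m (Suc n) x" for n x
  proof (induction n arbitrary: x)
    case (Suc n)
    show ?case unfolding mS[of "Suc n"] mS[of n] using Suc[of "G x"] by (auto simp: mS)
  qed (simp add: m0 m_nonneg)
  have m_int: "integrable M (m n)" for n
  proof (induction n)
    case (Suc n)
    show ?case
    proof (rule Bochner_Integration.integrable_bound)
      show "integrable M (\<lambda>x. \<bar>\<phi> x\<bar> + m n (G x))" using \<phi> integrable_G[OF Suc] by auto
      have "\<bar>m (Suc n) x\<bar> \<le> \<bar>\<phi> x\<bar> + m n (G x)" for x using m_nonneg[of n "G x"] by (auto simp: mS)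
      thus "AE x in M. norm (m (Suc n) x) \<le> norm (\<bar>\<phi> x\<bar> + m n (G x))" using m_nonneg by (auto intro: order_trans)
    qed simp
  next
    case 0
    have "m 0 = (\<lambda>x. 0)" using m0 by auto
    thus ?case by simp
  qed
  have S_le: "(\<Sum>j<n. \<phi> ((G ^^ j) x)) \<le> m n x" for n x
  proof (induction n arbitrary: x)
    case (Suc n)
    have "(\<Sum>j<Suc n. \<phi> ((G ^^ j) x)) = \<phi> x + (\<Sum>j<n. \<phi> ((G ^^ j) (G x)))"
      unfolding sum.lessThan_Suc_shift by (simp add: funpow_swap1)
    also have "\<dots> \<le> m (Suc n) x" using Suc[of "G x"] by (simp add: mS)
    finally show ?case .
  qed (simp add: m0)
  let ?I = "\<lambda>n x. indicator {x. 0 < m (Suc n) x} x * \<phi> x"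
  have [measurable]: "?I n \<in> borel_measurable M" for n
    unfolding indicator_def of_bool_def mem_Collect_eq by measurable
  have ge: "0 \<le> (\<integral>x. ?I n x \<partial>M)" for n
  proof -
    have "0 = (\<integral>x. m (Suc n) x - m (Suc n) (G x) \<partial>M)"
      using m_int integrable_G[OF m_int] integral_G[of "m (Suc n)"] by simp
    also have "\<dots> \<le> (\<integral>x. ?I n x \<partial>M)"
    proof (rule integral_mono)
      show "integrable M (?I n)"
        using \<phi> by (rule Bochner_Integration.integrable_bound) (auto simp: indicator_def)
      show "m (Suc n) x - m (Suc n) (G x) \<le> ?I n x" for x
        using m_mono[of n "G x"] m_nonneg[of "Suc n" "G x"] m_nonneg[of "Suc n" x] mS[of n x]
        by (cases "0 < m (Suc n) x") (auto simp: indicator_def max_def split: if_splits)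
    qed (use m_int integrable_G[OF m_int] in auto)
    finally show ?thesis .
  qed
  have "(\<lambda>n. \<integral>x. ?I n x \<partial>M) \<longlonglongrightarrow> (\<integral>x. \<phi> x \<partial>M)"
  proof (rule integral_dominated_convergence[where w="\<lambda>x. \<bar>\<phi> x\<bar>"])
    show "AE x in M. (\<lambda>n. ?I n x) \<longlonglongrightarrow> \<phi> x" using pos
    proof eventually_elim
      case (elim x)
      then obtain n where n: "0 < (\<Sum>j<n. \<phi> ((G ^^ j) x))" by blast
      have "0 < m n x" using S_le[of x n] n by linarith
      moreover have "m n x \<le> m k x" if "n \<le> k" for k using that by (induction rule: dec_induct) (auto intro: order_trans m_mono)
      ultimately have "0 < m (Suc k) x" if "n \<le> k" for k using le_SucI[OF that] by (meson less_le_trans)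
      hence "\<forall>\<^sub>F k in sequentially. ?I k x = \<phi> x"
        by (intro eventually_sequentiallyI[of n]) (simp add: indicator_def)
      thus ?case by (rule tendsto_eventually)
    qed
  qed (use \<phi> in \<open>auto simp: indicator_def\<close>)
  thus ?thesis using ge by (intro LIMSEQ_le_const) auto
qed

context semiflow
begin

lemma J_diff:
  assumes u: "obs u" and s: "0 \<le> s" and b: "\<And>r. 0 \<le> r \<Longrightarrow> r \<le> s \<Longrightarrow> \<bar>u (T r x) - u (T r x')\<bar> \<le> b"
  shows "\<bar>J u x s - J u x' s\<bar> \<le> b * s"
proof -
  have "J u x s - J u x' s = (\<integral>r. indicator {0..s} r * (u (T (max 0 r) x) - u (T (max 0 r) x')) \<partial>lborel)"
    unfolding J_def using obs_integrable1[OF u] by (simp add: right_diff_distrib)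
  also have "\<bar>\<dots>\<bar> \<le> (\<integral>r. indicator {0..s} r * b \<partial>lborel)"
  proof (rule abs_integral_le(2))
    have [measurable]: "u \<in> borel_measurable borel" using obsD(1)[OF u] .
    show "(\<lambda>r. indicator {0..s} r * (u (T (max 0 r) x) - u (T (max 0 r) x'))) \<in> borel_measurable lborel" by measurable
    show "integrable lborel (\<lambda>r. indicator {0..s} r * b)"
      by (intro integrable_mult_left integrable_real_indicator) (auto simp: emeasure_lborel_Icc_eq)
    show "AE r in lborel. \<bar>indicator {0..s} r * (u (T (max 0 r) x) - u (T (max 0 r) x'))\<bar> \<le> indicator {0..s} r * b"
      using b by (auto simp: indicator_def max_def)
  qed
  finally show ?thesis using s by (simp add: mult.commute)
qed

text \<open>The integrals over successive windows of length \<delta> form a geometric Cauchy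
  sequence with limit \<open>l\<close>, whence the slope \<open>l / \<delta>\<close>. The error
  bound involves \<delta> only through \<open>K\<close>, so it is uniform over periods between
  \<open>1 / K\<close> and \<open>K\<close>.\<close>

lemma J_asymptotically_periodic:
  assumes u: "obs u" and \<delta>: "0 < \<delta>" "1 / K \<le> \<delta>" "\<delta> \<le> K" and K: "0 < K"
    and r: "0 < r" "r < 1" and c: "0 \<le> c"
    and per: "\<And>t. 0 \<le> t \<Longrightarrow> \<bar>u (T (t + \<delta>) z) - u (T t z)\<bar> \<le> c * r powr t"
  shows "\<exists>A. \<forall>s\<ge>0. \<bar>J u z s - A * s\<bar> \<le> K * c / (1 - r powr (1 / K))\<^sup>2 + 2 * K"
proof -
  define q where "q = r powr \<delta>"
  define q' where "q' = r powr (1 / K)"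
  have q: "0 \<le> q" "q < 1" "q \<le> q'" "q' < 1"
    using r \<delta> K powr_less_mono2[of \<delta> r 1] powr_less_mono2[of "1 / K" r 1]
    by (auto simp: q_def q'_def intro!: powr_mono')
  define a where "a n = J u (T (n * \<delta>) z) \<delta>" for n :: nat
  have "\<bar>a (Suc n) - a n\<bar> \<le> (\<delta> * c) * q ^ n" for n
  proof -
    have "\<bar>a (Suc n) - a n\<bar> \<le> (c * r powr (n * \<delta>)) * \<delta>"
      unfolding a_def
    proof (rule J_diff[OF u])
      fix t assume t: "0 \<le> t" "t \<le> \<delta>"
      have "T t (T (real (Suc n) * \<delta>) z) = T ((t + n * \<delta>) + \<delta>) z"
        using T_add[of t "real (Suc n) * \<delta>" z] t \<delta> by (simp add: algebra_simps)
      moreover have "T t (T (real n * \<delta>) z) = T (t + n * \<delta>) z" using T_add[of t "n * \<delta>" z] t \<delta> by simp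
      ultimately have "\<bar>u (T t (T (real (Suc n) * \<delta>) z)) - u (T t (T (real n * \<delta>) z))\<bar> \<le> c * r powr (t + n * \<delta>)"
        using per[of "t + n * \<delta>"] t \<delta> by simp
      also have "\<dots> \<le> c * r powr (n * \<delta>)" using c r t by (intro mult_left_mono powr_mono') auto
      finally show "\<bar>u (T t (T (real (Suc n) * \<delta>) z)) - u (T t (T (real n * \<delta>) z))\<bar> \<le> c * r powr (n * \<delta>)" .
    qed (use \<delta> in auto)
    also have "r powr (n * \<delta>) = q ^ n" using r by (simp add: q_def powr_powr powr_realpow[symmetric] mult.commute)
    finally show ?thesis by (simp add: algebra_simps)
  qed
  from geometric_cauchy_limit[OF q(1,2) this] obtain l where l: "\<And>n. \<bar>a n - l\<bar> \<le> (\<delta> * c) * q ^ n / (1 - q)" by blast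
  define B where "B = \<delta> * c / (1 - q)\<^sup>2"
  have Jn: "J u z (n * \<delta>) = (\<Sum>j<n. a j)" for n :: nat
  proof (induction n)
    case (Suc n)
    have "J u z (real (Suc n) * \<delta>) = J u z (n * \<delta>) + a n"
      using J_add[OF u, of "n * \<delta>" \<delta> z] \<delta> by (simp add: a_def algebra_simps)
    thus ?case using Suc by simp
  qed (simp add: J_0)
  have Jl: "\<bar>J u z (n * \<delta>) - n * l\<bar> \<le> B" for n :: nat
  proof -
    have "J u z (n * \<delta>) - n * l = (\<Sum>j<n. a j - l)" by (simp add: Jn sum_subtractf)
    also have "\<bar>\<dots>\<bar> \<le> (\<Sum>j<n. \<bar>a j - l\<bar>)" by (rule sum_abs)
    also have "\<dots> \<le> (\<Sum>j<n. (\<delta> * c) * q ^ j / (1 - q))" by (rule sum_mono) (rule l)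
    also have "\<dots> = (\<delta> * c) / (1 - q) * (\<Sum>j<n. q ^ j)" by (simp add: sum_distrib_left)
    also have "\<dots> \<le> (\<delta> * c) / (1 - q) * (1 / (1 - q))"
    proof (rule mult_left_mono)
      show "(\<Sum>j<n. q ^ j) \<le> 1 / (1 - q)" using q by (simp add: sum_gp_strict divide_right_mono)
    qed (use \<delta> c q in auto)
    finally show ?thesis by (simp add: B_def power2_eq_square)
  qed
  have l_le: "\<bar>l\<bar> \<le> \<delta>"
  proof -
    have "(\<lambda>n. \<delta> + (\<delta> * c) * q ^ n / (1 - q)) \<longlonglongrightarrow> \<delta> + (\<delta> * c) * 0 / (1 - q)"
      using q by (intro tendsto_intros LIMSEQ_power_zero) auto
    moreover have "\<bar>l\<bar> \<le> \<delta> + (\<delta> * c) * q ^ n / (1 - q)" for n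
      using l[of n] J_bound[OF u, of \<delta> "T (n * \<delta>) z"] \<delta> unfolding a_def by linarith
    ultimately show ?thesis using LIMSEQ_le_const[of "\<lambda>n. \<delta> + (\<delta> * c) * q ^ n / (1 - q)" "\<delta> + (\<delta> * c) * 0 / (1 - q)" "\<bar>l\<bar>"] by auto
  qed
  have "\<bar>J u z s - (l / \<delta>) * s\<bar> \<le> K * c / (1 - q')\<^sup>2 + 2 * K" if s: "0 \<le> s" for s
  proof -
    define n where "n = nat \<lfloor>s / \<delta>\<rfloor>"
    have n: "n * \<delta> \<le> s" "s \<le> n * \<delta> + \<delta>"
    proof -
      have "0 \<le> s / \<delta>" using s \<delta> by simp
      hence "real n \<le> s / \<delta>" "s / \<delta> \<le> real n + 1" unfolding n_def by linarith+
      thus "n * \<delta> \<le> s" "s \<le> n * \<delta> + \<delta>" using \<delta> by (simp_all add: field_simps)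
    qed
    have 1: "\<bar>J u z s - J u z (n * \<delta>)\<bar> \<le> \<delta>" using J_lip[OF u s, of "n * \<delta>" z] n \<delta> by simp
    have "(l / \<delta>) * s - n * l = l * ((s - n * \<delta>) / \<delta>)" using \<delta> by (simp add: field_simps)
    also have "\<bar>\<dots>\<bar> \<le> \<delta> * 1" unfolding abs_mult using l_le n \<delta> by (intro mult_mono) (auto simp: field_simps)
    finally have 2: "\<bar>(l / \<delta>) * s - n * l\<bar> \<le> \<delta>" by simp
    \<comment> \<open>Replaces the rate \<open>q = r powr \<delta>\<close> by
      \<open>q' = r powr (1 / K)\<close>, its largest value over the admissible periods.\<close>
    have "B \<le> K * c / (1 - q')\<^sup>2" unfolding B_def
      using q \<delta> c K by (intro frac_le mult_mono power_mono) auto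
    thus ?thesis using 1 2 Jl[of n] \<delta> by linarith
  qed
  thus ?thesis unfolding q'_def by blast
qed

end

section \<open>The hyperbolic flow\<close>

locale hyperbolic_flow = induced_flow T X Y h \<tau> \<mu>Y
  for T :: "real \<Rightarrow> 'm::metric_space \<Rightarrow> 'm" and X Y h \<tau> \<mu>Y +
  fixes Yhat :: "'m set" and W :: "'m \<Rightarrow> 'm set" and Pbar :: "'m set set set" and C \<gamma> \<eta> :: real
  assumes \<mu>Y_inv: "preserves_measure \<mu>Y (Fmap T h \<tau>)"
    and \<mu>Y_erg: "ergodic_on \<mu>Y (Fmap T h \<tau>)"
    and W_leaf: "\<And>y. y \<in> Y \<Longrightarrow> y \<in> W y \<and> W y \<subseteq> Y"
    and W_part: "\<And>y y'. y \<in> Y \<Longrightarrow> y' \<in> W y \<Longrightarrow> W y' = W y"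
    and W_F: "\<And>y. y \<in> Y \<Longrightarrow> Fmap T h \<tau> ` W y \<subseteq> W (Fmap T h \<tau> y)"
    and GM: "gibbs_markov (distr \<mu>Y (qspace W Y) W) (Fbar W (Fmap T h \<tau>)) Pbar"
    and \<mu>bar_inv: "preserves_measure (distr \<mu>Y (qspace W Y) W) (Fbar W (Fmap T h \<tau>))"
    and \<mu>bar_erg: "ergodic_on (distr \<mu>Y (qspace W Y) W) (Fbar W (Fmap T h \<tau>))"
    and Yhat: "Yhat \<subseteq> Y" "\<And>y. y \<in> Y \<Longrightarrow> \<exists>!z. z \<in> Yhat \<and> z \<in> W y"
    and const_bounds: "1 \<le> C" "0 < \<gamma>" "\<gamma> < 1" "0 < \<eta>" "\<eta> \<le> 1"
    and H_lip: "\<And>a y y'. a \<in> Pbar \<Longrightarrow> y \<in> Yhat \<Longrightarrow> y' \<in> Yhat \<Longrightarrow> W y \<in> a \<Longrightarrow> W y' \<in> a \<Longrightarrow>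
          \<bar>Hfun T h \<tau> y - Hfun T h \<tau> y'\<bar> \<le> C * (INF z\<in>{z\<in>Y. W z \<in> a}. Hfun T h \<tau> z)
             * gp \<gamma> (sep_time Pbar (Fbar W (Fmap T h \<tau>)) (W y) (W y')) 0"
    and flow_holder: "\<And>y t t'. y \<in> Yhat \<Longrightarrow> 0 \<le> t \<Longrightarrow> 0 \<le> t' \<Longrightarrow>
          dist (T t y) (T t' y) \<le> C * \<bar>t - t'\<bar> powr \<eta>"
    and stable_contr: "\<And>y y' t. y \<in> Y \<Longrightarrow> y' \<in> W y \<Longrightarrow> 0 \<le> t \<Longrightarrow>
          dist (T t y) (T t y') \<le> C * \<gamma> powr t"
    and unstable_exp: "\<And>a y y' t. a \<in> Pbar \<Longrightarrow> y \<in> Yhat \<Longrightarrow> y' \<in> Yhat \<Longrightarrow> W y \<in> a \<Longrightarrow> W y' \<in> a \<Longrightarrow>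
          0 \<le> t \<Longrightarrow> dist (T t y) (T t y') \<le>
            C * gp \<gamma> (sep_time Pbar (Fbar W (Fmap T h \<tau>)) (W y) (W y')) (Jfun T h \<tau> t y)"
begin

abbreviation "\<mu>b \<equiv> distr \<mu>Y (qspace W Y) W"
abbreviation "Fb \<equiv> Fbar W F"

sublocale YF: mpt \<mu>Y F
  using \<mu>Y_inv by unfold_locales (auto simp: preserves_measure_def)

lemma Y_erg: "A \<in> sets \<mu>Y \<Longrightarrow> F -` A \<inter> space \<mu>Y = A \<Longrightarrow> measure \<mu>Y A = 0 \<or> measure \<mu>Y A = 1"
  using \<mu>Y_erg by (auto simp: ergodic_on_def)

lemma Fn_Y: "y \<in> Y \<Longrightarrow> (F ^^ n) y \<in> Y" using F_Y by (induction n) auto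

lemma W_meas [measurable]: "W \<in> measurable \<mu>Y (qspace W Y)"
  unfolding qspace_def
proof (rule measurable_measure_of)
  show "W \<in> space \<mu>Y \<rightarrow> W ` Y" by (auto simp: space_\<mu>Y)
  fix B assume "B \<in> {B. B \<subseteq> W ` Y \<and> W -` B \<inter> Y \<in> sets borel}"
  thus "W -` B \<inter> space \<mu>Y \<in> sets \<mu>Y" unfolding \<mu>Y_sets space_\<mu>Y using sets_XY(2)
    by (subst sets_restrict_space_iff) auto
qed auto

lemma space_qspace: "space (qspace W Y) = W ` Y"
  unfolding qspace_def by (rule space_measure_of) auto

lemma space_\<mu>b: "space \<mu>b = W ` Y" by (simp add: space_qspace)

lemma W_\<mu>b [measurable]: "W \<in> measurable \<mu>Y \<mu>b" by simp

lemma AE_\<mu>b: "AE x in \<mu>b. Q x \<Longrightarrow> AE y in \<mu>Y. Q (W y)"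
  by (rule AE_distrD[OF W_meas])

text \<open>The point picked by \<open>SOME\<close> is immaterial, since \<open>F\<close> maps
  leaves into leaves and a leaf is determined by any of its points.\<close>

lemma Fb_W: assumes y: "y \<in> Y" shows "Fb (W y) = W (F y)"
proof -
  define z where "z = (SOME z. z \<in> W y)"
  have z: "z \<in> W y" unfolding z_def by (rule someI[of "\<lambda>z. z \<in> W y" y]) (use W_leaf[OF y] in blast)
  hence "F z \<in> W (F y)" using W_F[OF y] by blast
  thus ?thesis using W_part[OF F_Y[OF y]] by (simp add: Fbar_def z_def)
qed

lemma Fbn_W: "y \<in> Y \<Longrightarrow> (Fb ^^ n) (W y) = W ((F ^^ n) y)"
  by (induction n) (auto simp: Fb_W Fn_Y)

lemma gp_mono_base: "0 < a \<Longrightarrow> a \<le> b \<Longrightarrow> gp a s 0 \<le> gp b s 0"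
  by (cases s) (auto simp: gp_def intro!: powr_mono2)

text \<open>Raising the base of the separation metric only weakens the distortion condition. A
  common base above \<open>\<theta>1\<close> makes both the Jacobian and the induced observables
  Lipschitz for one metric.\<close>

lemma gm_exists:
  assumes \<theta>1: "0 < \<theta>1" "\<theta>1 < 1"
  shows "\<exists>g \<theta> Cd c0. \<theta>1 \<le> \<theta> \<and> gm_system \<mu>b Fb Pbar g \<theta> Cd c0"
proof -
  note gm = GM[unfolded gibbs_markov_def]
  have "\<exists>g \<theta> Cd. 0 < \<theta> \<and> \<theta> < 1 \<and> g \<in> borel_measurable \<mu>b \<and> (\<forall>x\<in>space \<mu>b. 0 < g x) \<and>
        (\<forall>a\<in>Pbar. \<forall>A\<in>sets \<mu>b. A \<subseteq> a \<longrightarrow>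
            emeasure \<mu>b A = (\<integral>\<^sup>+ z\<in>Fb ` A. ennreal (g (the_inv_into a Fb z)) \<partial>\<mu>b)) \<and>
        (\<forall>a\<in>Pbar. \<forall>x\<in>a. \<forall>y\<in>a. \<bar>ln (g x) - ln (g y)\<bar> \<le> Cd * gp \<theta> (sep_time Pbar Fb x y) 0)"
    using gm by (elim conjE)
  then obtain g \<theta> Cd where g: "0 < \<theta>" "\<theta> < 1" "g \<in> borel_measurable \<mu>b" "\<forall>x\<in>space \<mu>b. 0 < g x"
    and jac: "\<forall>a\<in>Pbar. \<forall>A\<in>sets \<mu>b. A \<subseteq> a \<longrightarrow>
            emeasure \<mu>b A = (\<integral>\<^sup>+ z\<in>Fb ` A. ennreal (g (the_inv_into a Fb z)) \<partial>\<mu>b)"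
    and dis: "\<forall>a\<in>Pbar. \<forall>x\<in>a. \<forall>y\<in>a. \<bar>ln (g x) - ln (g y)\<bar> \<le> Cd * gp \<theta> (sep_time Pbar Fb x y) 0"
    by (elim exE conjE)
  have "\<exists>c>0. \<forall>a\<in>Pbar. c \<le> measure \<mu>b (Fb ` a)" using gm by (elim conjE)
  then obtain c0 where c0: "0 < c0" "\<And>a. a \<in> Pbar \<Longrightarrow> c0 \<le> measure \<mu>b (Fb ` a)" by blast
  have br: "\<forall>a\<in>Pbar. inj_on Fb a \<and> (\<forall>A\<in>sets \<mu>b. A \<subseteq> a \<longrightarrow> Fb ` A \<in> sets \<mu>b) \<and>
        (\<exists>Q\<subseteq>Pbar. emeasure \<mu>b (Fb ` a - \<Union>Q) = 0 \<and> emeasure \<mu>b (\<Union>Q - Fb ` a) = 0)" using gm by (elim conjE)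
  have Pc: "prob_space \<mu>b \<and> Fb \<in> measurable \<mu>b \<mu>b \<and> countable Pbar \<and> Pbar \<subseteq> sets \<mu>b \<and> disjoint Pbar \<and>
    (\<forall>a\<in>Pbar. 0 < measure \<mu>b a) \<and> emeasure \<mu>b (space \<mu>b - \<Union>Pbar) = 0"
    using gm by (intro conjI; elim conjE)
  note P = Pc[THEN conjunct1] Pc[THEN conjunct2, THEN conjunct1] Pc[THEN conjunct2, THEN conjunct2]
  define \<theta>' where "\<theta>' = max \<theta> \<theta>1"
  have "gm_system \<mu>b Fb Pbar g \<theta>' \<bar>Cd\<bar> c0"
  proof (rule gm_system.intro)
    have "distr \<mu>b \<mu>b Fb = \<mu>b" using \<mu>bar_inv by (simp only: preserves_measure_def)
    with P(1,2) show "mpt \<mu>b Fb" by (intro mpt.intro mpt_axioms.intro)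
    show "gm_system_axioms \<mu>b Fb Pbar g \<theta>' \<bar>Cd\<bar> c0"
    proof (rule gm_system_axioms.intro)
      show "\<And>A. A \<in> sets \<mu>b \<Longrightarrow> Fb -` A \<inter> space \<mu>b = A \<Longrightarrow> measure \<mu>b A = 0 \<or> measure \<mu>b A = 1"
        using \<mu>bar_erg unfolding ergodic_on_def by blast
      show "0 < \<theta>'" "\<theta>' < 1" using g \<theta>1 by (auto simp: \<theta>'_def)
      show "\<And>a A. a \<in> Pbar \<Longrightarrow> A \<in> sets \<mu>b \<Longrightarrow> A \<subseteq> a \<Longrightarrow> Fb ` A \<in> sets \<mu>b" using br by blast
      show "\<And>a. a \<in> Pbar \<Longrightarrow> inj_on Fb a" using br by blast
      show "\<And>a A. a \<in> Pbar \<Longrightarrow> A \<in> sets \<mu>b \<Longrightarrow> A \<subseteq> a \<Longrightarrow>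
            emeasure \<mu>b A = (\<integral>\<^sup>+ z\<in>Fb ` A. ennreal (g (the_inv_into a Fb z)) \<partial>\<mu>b)" using jac by blast
      show "\<And>a. a \<in> Pbar \<Longrightarrow> \<exists>Q\<subseteq>Pbar. emeasure \<mu>b (Fb ` a - \<Union>Q) = 0 \<and> emeasure \<mu>b (\<Union>Q - Fb ` a) = 0"
        using br by blast
      fix a x y assume a: "a \<in> Pbar" "x \<in> a" "y \<in> a"
      have "\<bar>ln (g x) - ln (g y)\<bar> \<le> Cd * gp \<theta> (sep_time Pbar Fb x y) 0" using dis a by blast
      also have "\<dots> \<le> \<bar>Cd\<bar> * gp \<theta>' (sep_time Pbar Fb x y) 0"
        using g gp_nonneg gp_mono_base[of \<theta> \<theta>'] by (intro mult_mono) (auto simp: \<theta>'_def)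
      finally show "\<bar>ln (g x) - ln (g y)\<bar> \<le> \<bar>Cd\<bar> * gp \<theta>' (sep_time Pbar Fb x y) 0" .
    qed (use P g c0 in \<open>simp_all add: subset_iff\<close>)
  qed
  thus ?thesis by (intro exI[of _ g] exI[of _ \<theta>'] exI[of _ "\<bar>Cd\<bar>"] exI[of _ c0]) (simp add: \<theta>'_def)
qed

definition rep :: "'m set \<Rightarrow> 'm" where "rep x = (THE z. z \<in> Yhat \<and> z \<in> x)"

lemma rep: assumes "y \<in> Y" shows "rep (W y) \<in> Yhat" "rep (W y) \<in> W y" "rep (W y) \<in> Y" "W (rep (W y)) = W y"
proof -
  show 1: "rep (W y) \<in> Yhat" "rep (W y) \<in> W y" unfolding rep_def using theI'[OF Yhat(2)[OF assms]] by auto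
  show "rep (W y) \<in> Y" using 1 Yhat by blast
  show "W (rep (W y)) = W y" using W_part[OF assms 1(2)] .
qed

text \<open>Along representatives the return time is Lipschitz in the separation time on each
  partition element, which makes it measurable on the good set of the quotient; \<open>k\<close> is
  its pullback.\<close>

lemma Hrep_measurable:
  "\<exists>k\<in>borel_measurable \<mu>Y. AE y in \<mu>Y. k y = H (rep (W y))"
proof -
  obtain g \<theta> Cd c0 where \<gamma>\<theta>: "\<gamma> \<le> \<theta>" and gm: "gm_system \<mu>b Fb Pbar g \<theta> Cd c0"
    using gm_exists[of \<gamma>] const_bounds by blast
  interpret gm_system \<mu>b Fb Pbar g \<theta> Cd c0 by (rule gm)
  let ?b = "\<lambda>a. \<bar>C * (INF z\<in>{z\<in>Y. W z \<in> a}. H z)\<bar>"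
  have "(\<lambda>x. indicator \<Omega> x * H (rep x)) \<in> borel_measurable \<mu>b"
  proof (rule lipschitz_measurable[where b="?b"])
    fix a x y assume a: "a \<in> Pbar" "x \<in> a" "y \<in> a" and xy: "x \<in> \<Omega>" "y \<in> \<Omega>"
    obtain x' y' where x': "x' \<in> Y" "x = W x'" and y': "y' \<in> Y" "y = W y'"
      using \<Omega>_space[OF xy(1)] \<Omega>_space[OF xy(2)] by (auto simp: space_\<mu>b space_qspace)
    have "\<bar>H (rep x) - H (rep y)\<bar> \<le> C * (INF z\<in>{z\<in>Y. W z \<in> a}. H z) * gp \<gamma> (sep_time Pbar Fb x y) 0"
      using H_lip[of a "rep x" "rep y"] a rep[OF x'(1)] rep[OF y'(1)] x' y' by simp
    also have "\<dots> \<le> ?b a * rho x y" unfolding rho_def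
      using gp_nonneg gp_mono_base[of \<gamma> \<theta>] const_bounds \<gamma>\<theta> by (intro mult_mono) auto
    finally show "\<bar>H (rep x) - H (rep y)\<bar> \<le> ?b a * rho x y" .
  qed
  hence "(\<lambda>y. indicator \<Omega> (W y) * H (rep (W y))) \<in> borel_measurable \<mu>Y"
    by (rule measurable_compose[OF W_\<mu>b])
  moreover have "AE y in \<mu>Y. indicator \<Omega> (W y) * H (rep (W y)) = H (rep (W y))"
    using AE_\<mu>b[OF AE_\<Omega>] by eventually_elim simp
  ultimately show ?thesis by (intro bexI)
qed

section \<open>Observables along orbits, mean zero and absence of linear growth\<close>

definition hobs :: "('m \<Rightarrow> real) \<Rightarrow> bool" where
  "hobs u \<longleftrightarrow> obs u \<and> (\<forall>x x'. \<bar>u x - u x'\<bar> \<le> dist x x' powr \<eta>)"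

lemma hobsD: "hobs u \<Longrightarrow> obs u" "hobs u \<Longrightarrow> \<bar>u x - u x'\<bar> \<le> dist x x' powr \<eta>"
  by (auto simp: hobs_def)

lemma hobs_le: assumes "hobs u" "dist x x' \<le> c" shows "\<bar>u x - u x'\<bar> \<le> c powr \<eta>"
proof -
  have "\<bar>u x - u x'\<bar> \<le> dist x x' powr \<eta>" by (rule hobsD(2)[OF assms(1)])
  also have "\<dots> \<le> c powr \<eta>" using assms(2) const_bounds by (intro powr_mono2) auto
  finally show ?thesis .
qed

lemma hobs_uminus: "hobs u \<Longrightarrow> hobs (\<lambda>x. - u x)"
  unfolding hobs_def obs_def by (auto simp: abs_minus_commute)

abbreviation "Hs \<equiv> Hsum T h \<tau>"

lemma Hs_0: "Hs 0 y = 0" and Hs_Suc: "Hs (Suc n) y = Hs n y + H ((F ^^ n) y)"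
  by (simp_all add: Hsum_def)

lemma Hs_ge: "y \<in> Y \<Longrightarrow> n * h0 \<le> Hs n y"
proof (induction n)
  case (Suc n)
  have "h0 \<le> H ((F ^^ n) y)" using Suc.prems by (intro H_ge Fn_Y)
  thus ?case using Suc by (simp add: Hs_Suc algebra_simps)
qed (simp add: Hs_0)

lemma Hs_nonneg: "y \<in> Y \<Longrightarrow> 0 \<le> Hs n y"
  using Hs_ge[of y n] h0 by (meson mult_nonneg_nonneg of_nat_0_le_iff less_imp_le order_trans)

lemma T_Hs: "y \<in> Y \<Longrightarrow> T (Hs n y) y = (F ^^ n) y"
proof (induction n)
  case (Suc n)
  have "T (Hs (Suc n) y) y = T (H ((F ^^ n) y)) (T (Hs n y) y)"
    unfolding Hs_Suc using T_add[OF H_nonneg[OF Fn_Y[OF Suc.prems, of n]] Hs_nonneg[OF Suc.prems, of n], of y] by (simp add: add.commute)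
  thus ?case using Suc T_H[OF Fn_Y] by simp
qed (simp add: Hs_0 T_0)

lemma J_Hs: assumes "obs u" "y \<in> Y" shows "J u y (Hs n y) = (\<Sum>j<n. J u ((F ^^ j) y) (H ((F ^^ j) y)))"
proof (induction n)
  case (Suc n)
  show ?case unfolding Hs_Suc using Suc T_Hs[OF assms(2)] J_add[OF assms(1) Hs_nonneg[OF assms(2)] H_nonneg[OF Fn_Y[OF assms(2)]], of y n n]
    by simp
qed (simp add: Hs_0 J_0)

lemma U_meas: "obs u \<Longrightarrow> (\<lambda>y. J u y (H y)) \<in> borel_measurable \<mu>Y"
  by (intro J_meas) auto

lemma U_bound: "obs u \<Longrightarrow> y \<in> Y \<Longrightarrow> \<bar>J u y (H y)\<bar> \<le> H y"
  by (intro J_bound H_nonneg)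

lemma U_int: "obs u \<Longrightarrow> integrable \<mu>Y (\<lambda>y. J u y (H y))"
  using U_bound[of u] by (intro Bochner_Integration.integrable_bound[OF H_int U_meas]) (auto simp: space_\<mu>Y intro!: AE_I2 order_trans[OF _ abs_ge_self])

lemma prob_\<mu>M: "prob_space \<mu>M"
proof (rule prob_spaceI)
  have sp: "space \<mu>M = UNIV" using sets_eq_imp_space_eq[OF \<mu>M_eq0(1)] by simp
  have "emeasure \<mu>M (space \<mu>M) = (\<integral>\<^sup>+x. 1 \<partial>\<mu>M)" by simp
  also have "\<dots> = (\<integral>\<^sup>+y. (\<integral>\<^sup>+u. indicator {0..H y} u * 1 \<partial>lborel) \<partial>\<mu>Y) / ennreal (\<integral>y. H y \<partial>\<mu>Y)"
    by (rule nn_integral_\<mu>M) simp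
  also have "(\<integral>\<^sup>+y. (\<integral>\<^sup>+u. indicator {0..H y} u * 1 \<partial>lborel) \<partial>\<mu>Y) = (\<integral>\<^sup>+y. ennreal (H y) \<partial>\<mu>Y)"
    by (intro nn_integral_cong) (simp add: H_nonneg space_\<mu>Y)
  also have "\<dots> = ennreal (\<integral>y. H y \<partial>\<mu>Y)" using H_nonneg by (intro nn_integral_eq_integral H_int) (auto simp: space_\<mu>Y)
  also have "\<dots> / ennreal (\<integral>y. H y \<partial>\<mu>Y) = 1" using integral_H_pos by (intro ennreal_divide_self) auto
  finally show "emeasure \<mu>M (space \<mu>M) = 1" .
qed

text \<open>Applied to the nonnegative function \<open>1 + u\<close>, the suspension formula reads
  \<open>1 = \<integral>(H + J u) / \<integral>H\<close>.\<close>

lemma U_mean_zero: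
  assumes u: "obs u" and mean: "(\<integral>x. u x \<partial>\<mu>M) = 0"
  shows "(\<integral>y. J u y (H y) \<partial>\<mu>Y) = 0"
proof -
  interpret P: prob_space \<mu>M by (rule prob_\<mu>M)
  have [measurable]: "u \<in> borel_measurable borel" using obsD(1)[OF u] .
  have um [measurable]: "u \<in> borel_measurable \<mu>M" by (simp add: measurable_cong_sets[OF \<mu>M_eq0(1) refl])
  have ui: "integrable \<mu>M u" using obsD(2)[OF u] by (intro P.integrable_const_bound[of _ 1]) auto
  have nn: "0 \<le> 1 + u x" for x using obsD(2)[OF u, of x] by linarith
  have "(\<integral>\<^sup>+x. ennreal (1 + u x) \<partial>\<mu>M) = ennreal (\<integral>x. 1 + u x \<partial>\<mu>M)"
    using ui nn by (intro nn_integral_eq_integral) auto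
  also have "\<dots> = 1" using ui mean by (simp add: P.prob_space)
  finally have 1: "(\<integral>\<^sup>+x. ennreal (1 + u x) \<partial>\<mu>M) = 1" .
  have inner: "(\<integral>\<^sup>+r. indicator {0..H y} r * ennreal (1 + u (T (max 0 r) y)) \<partial>lborel) = ennreal (H y + J u y (H y))" if y: "y \<in> Y" for y
  proof -
    have i1: "integrable lborel (\<lambda>r. indicator {0..H y} r :: real)" by (intro integrable_real_indicator) (auto simp: emeasure_lborel_Icc_eq)
    have i: "integrable lborel (\<lambda>r. indicator {0..H y} r * (1 + u (T (max 0 r) y)))"
      using i1 obs_integrable1[OF u, of 0 "H y" y] by (simp add: distrib_left)
    have "(\<integral>\<^sup>+r. indicator {0..H y} r * ennreal (1 + u (T (max 0 r) y)) \<partial>lborel)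
      = (\<integral>\<^sup>+r. ennreal (indicator {0..H y} r * (1 + u (T (max 0 r) y))) \<partial>lborel)"
      by (intro nn_integral_cong) (simp add: indicator_def)
    also have "\<dots> = ennreal (\<integral>r. indicator {0..H y} r * (1 + u (T (max 0 r) y)) \<partial>lborel)"
      using i nn by (intro nn_integral_eq_integral) auto
    also have "(\<integral>r. indicator {0..H y} r * (1 + u (T (max 0 r) y)) \<partial>lborel) = H y + J u y (H y)"
      using i1 obs_integrable1[OF u, of 0 "H y" y] H_nonneg[OF y] by (simp add: distrib_left J_def)
    finally show ?thesis .
  qed
  have "(\<integral>\<^sup>+x. ennreal (1 + u x) \<partial>\<mu>M) = (\<integral>\<^sup>+y. (\<integral>\<^sup>+r. indicator {0..H y} r * ennreal (1 + u (T (max 0 r) y)) \<partial>lborel) \<partial>\<mu>Y) / ennreal (\<integral>y. H y \<partial>\<mu>Y)"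
    by (rule nn_integral_\<mu>M) measurable
  also have "(\<integral>\<^sup>+y. (\<integral>\<^sup>+r. indicator {0..H y} r * ennreal (1 + u (T (max 0 r) y)) \<partial>lborel) \<partial>\<mu>Y) = (\<integral>\<^sup>+y. ennreal (H y + J u y (H y)) \<partial>\<mu>Y)"
    by (intro nn_integral_cong) (simp add: inner space_\<mu>Y)
  also have "\<dots> = ennreal (\<integral>y. H y + J u y (H y) \<partial>\<mu>Y)"
    using H_int U_int[OF u] U_bound[OF u] by (intro nn_integral_eq_integral) (auto simp: space_\<mu>Y abs_le_iff intro!: AE_I2, fastforce simp: abs_le_iff)
  also have "\<dots> / ennreal (\<integral>y. H y \<partial>\<mu>Y) = ennreal ((\<integral>y. H y + J u y (H y) \<partial>\<mu>Y) / (\<integral>y. H y \<partial>\<mu>Y))"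
  proof (rule divide_ennreal)
    have "0 \<le> H y + J u y (H y)" if "y \<in> Y" for y using U_bound[OF u that] by linarith
    thus "0 \<le> (\<integral>y. H y + J u y (H y) \<partial>\<mu>Y)" by (intro integral_nonneg_AE AE_I2) (simp add: space_\<mu>Y)
  qed (rule integral_H_pos)
  finally have "(\<integral>y. H y + J u y (H y) \<partial>\<mu>Y) / (\<integral>y. H y \<partial>\<mu>Y) = 1" using 1 by (metis ennreal_eq_1)
  hence "(\<integral>y. H y + J u y (H y) \<partial>\<mu>Y) = (\<integral>y. H y \<partial>\<mu>Y)" using integral_H_pos by simp
  thus ?thesis using H_int U_int[OF u] by simp
qed

text \<open>Linear growth at rate \<open>e\<close> is an invariant property, since a return changes
  the integral by a bounded amount. If it held almost everywhere, the induced observable minus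
  \<open>e / 2 * H\<close> would have eventually positive sums, although its mean is
  negative.\<close>

lemma no_linear_growth:
  assumes u: "obs u" and mean: "(\<integral>x. u x \<partial>\<mu>M) = 0" and e: "0 < e"
  shows "AE y in \<mu>Y. \<not> (\<exists>c. \<forall>s\<ge>0. e * s - c \<le> J u y s)"
proof -
  define Q where "Q y \<longleftrightarrow> (\<exists>c. \<forall>s\<ge>0. e * s - c \<le> J u y s)" for y
  \<comment> \<open>Integer times and constants make the condition countable, hence measurable; the
    Lipschitz bound in time recovers real times.\<close>
  have Q_nat: "Q y \<longleftrightarrow> (\<exists>c::nat. \<forall>s::nat. e * s - c \<le> J u y s)" for y
  proof
    assume "Q y"
    then obtain c where c: "\<And>s. 0 \<le> s \<Longrightarrow> e * s - c \<le> J u y s" unfolding Q_def by blast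
    obtain n :: nat where "c \<le> n" using real_arch_simple by blast
    hence "e * s - n \<le> J u y s" for s :: nat using c[of "real s"] by simp
    thus "\<exists>c::nat. \<forall>s::nat. e * s - c \<le> J u y s" by blast
  next
    assume "\<exists>c::nat. \<forall>s::nat. e * s - c \<le> J u y s"
    then obtain c :: nat where c: "\<And>s::nat. e * s - c \<le> J u y s" by blast
    have "e * s - (c + e + 1) \<le> J u y s" if s: "0 \<le> s" for s
    proof -
      define n where "n = nat \<lfloor>s\<rfloor>"
      have n: "real n \<le> s" "s \<le> n + 1" unfolding n_def using s by linarith+
      have "e * s \<le> e * (n + 1)" using n e by (intro mult_left_mono) auto
      thus ?thesis using c[of n] J_lip[OF u s, of n y] n by (simp add: algebra_simps)
    qed
    thus "Q y" unfolding Q_def by blast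
  qed
  have inv: "Q (F y) \<longleftrightarrow> Q y" if y: "y \<in> Y" for y
  proof
    note Hn = H_nonneg[OF y]
    assume "Q y"
    then obtain c where c: "\<And>s. 0 \<le> s \<Longrightarrow> e * s - c \<le> J u y s" unfolding Q_def by blast
    have "e * s - (c + H y) \<le> J u (F y) s" if s: "0 \<le> s" for s
    proof -
      have "0 \<le> e * H y" using e Hn by simp
      thus ?thesis using c[of "H y + s"] J_add[OF u Hn s, of y] T_H[OF y] J_bound[OF u Hn, of y] Hn s by (simp add: distrib_left)
    qed
    thus "Q (F y)" unfolding Q_def by blast
  next
    note Hn = H_nonneg[OF y]
    assume "Q (F y)"
    then obtain c where c: "\<And>s. 0 \<le> s \<Longrightarrow> e * s - c \<le> J u (F y) s" unfolding Q_def by blast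
    have "e * s - (\<bar>c\<bar> + H y + e * H y) \<le> J u y s" if s: "0 \<le> s" for s
    proof (cases "H y \<le> s")
      case True
      thus ?thesis using c[of "s - H y"] J_add[OF u Hn, of "s - H y" y] T_H[OF y] J_bound[OF u Hn, of y] by (simp add: right_diff_distrib)
    next
      case False
      have "e * s \<le> e * H y" using False e by (intro mult_left_mono) auto
      thus ?thesis using J_bound[OF u s, of y] False by linarith
    qed
    thus "Q y" unfolding Q_def by blast
  qed
  define E where "E = {y \<in> space \<mu>Y. Q y}"
  have [measurable]: "(\<lambda>y. J u y s) \<in> borel_measurable \<mu>Y" for s by (intro J_meas u) auto
  have E: "E \<in> sets \<mu>Y" unfolding E_def Q_nat by measurable
  have "F -` E \<inter> space \<mu>Y = E" using F_Y inv by (auto simp: E_def space_\<mu>Y)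
  hence "measure \<mu>Y E = 0 \<or> measure \<mu>Y E = 1" using Y_erg[OF E] by blast
  moreover have "measure \<mu>Y E \<noteq> 1"
  proof
    assume "measure \<mu>Y E = 1"
    hence AQ: "AE y in \<mu>Y. y \<in> E" using E by (simp add: Y.prob_eq_1)
    define \<phi> where "\<phi> y = J u y (H y) - e / 2 * H y" for y
    have \<phi>: "integrable \<mu>Y \<phi>" unfolding \<phi>_def using U_int[OF u] H_int by auto
    have "AE y in \<mu>Y. \<exists>n. 0 < (\<Sum>j<n. \<phi> ((F ^^ j) y))"
      using AQ
    proof eventually_elim
      case (elim y)
      hence y: "y \<in> Y" and "Q y" by (auto simp: E_def space_\<mu>Y)
      then obtain c where c: "\<And>s. 0 \<le> s \<Longrightarrow> e * s - c \<le> J u y s" unfolding Q_def by blast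
      have eq: "(\<Sum>j<n. \<phi> ((F ^^ j) y)) = J u y (Hs n y) - e / 2 * Hs n y" for n
        unfolding J_Hs[OF u y] by (simp add: \<phi>_def sum_subtractf Hsum_def sum_distrib_left)
      obtain n :: nat where n: "c < n * (e / 2 * h0)" using ex_less_of_nat_mult[of "e / 2 * h0" c] e h0 by auto
      have "e / 2 * (n * h0) \<le> e / 2 * Hs n y" using Hs_ge[OF y, of n] e by (intro mult_left_mono) auto
      hence "c < e / 2 * Hs n y" using n by (simp add: algebra_simps)
      hence "0 < J u y (Hs n y) - e / 2 * Hs n y" using c[OF Hs_nonneg[OF y, of n]] by simp
      thus ?case unfolding eq by blast
    qed
    from YF.maximal_ergodic[OF \<phi> this] have "0 \<le> (\<integral>y. \<phi> y \<partial>\<mu>Y)" .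
    also have "(\<integral>y. \<phi> y \<partial>\<mu>Y) = - (e / 2 * (\<integral>y. H y \<partial>\<mu>Y))"
      unfolding \<phi>_def using U_int[OF u] H_int U_mean_zero[OF u mean] by simp
    finally show False using e integral_H_pos by (simp add: mult_le_0_iff)
  qed
  ultimately have "E \<in> null_sets \<mu>Y" using E by (auto simp: null_sets_def Y.emeasure_eq_measure)
  from AE_not_in[OF this] AE_space show ?thesis by eventually_elim (simp add: E_def Q_def)
qed

text \<open>Flow \<open>y\<close> and its representative for the same long time: both are then on
  orbits issuing from one leaf, that of \<open>F y\<close>, but at instants differing by the gap of
  the return times. Two uses of stable contraction, one before and one after the return, give the
  factor 2.\<close>

lemma orbit_period:
  assumes y: "y \<in> Y" and t: "0 \<le> t"
  shows "dist (T (t + \<bar>H y - H (rep (W y))\<bar>) (F y)) (T t (F y)) \<le> 2 * C * \<gamma> powr t"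
proof -
  define y' where "y' = rep (W y)"
  have y': "y' \<in> Y" "y' \<in> W y" using rep[OF y] by (auto simp: y'_def)
  have Fy': "F y' \<in> W (F y)" using W_F[OF y] y' by blast
  note nn = H_nonneg[OF y] H_nonneg[OF y'(1)]
  have TF: "T s (F z) = T (s + H z) z" if "z \<in> Y" "0 \<le> s" for s z
    using T_add[OF that(2) H_nonneg[OF that(1)], of z] T_H[OF that(1)] by simp
  have le: "C * \<gamma> powr s \<le> C * \<gamma> powr t" if "t \<le> s" for s using that const_bounds by (intro mult_left_mono powr_mono') auto
  define s where "s = t + max (H y) (H y')"
  have d1: "dist (T s y) (T s y') \<le> C * \<gamma> powr t"
  proof -
    have "t \<le> s" using nn by (simp add: s_def le_max_iff_disj)
    thus ?thesis using stable_contr[OF y y'(2), of s] le[of s] t by linarith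
  qed
  have d2: "dist (T r (F y)) (T r (F y')) \<le> C * \<gamma> powr t" if "t \<le> r" for r
    using stable_contr[OF F_Y[OF y] Fy', of r] le[OF that] t that by linarith
  show ?thesis
  proof (cases "H y' \<le> H y")
    case True
    have "T t (F y) = T s y" using TF[OF y t] True by (simp add: s_def)
    moreover have "T (t + (H y - H y')) (F y') = T s y'" using TF[OF y'(1), of "t + (H y - H y')"] True t by (simp add: s_def)
    ultimately show ?thesis
      using d1 d2[of "t + (H y - H y')"] True dist_triangle[of "T (t + (H y - H y')) (F y)" "T t (F y)" "T s y'"]
      unfolding y'_def[symmetric] by (simp add: dist_commute)
  next
    case False
    have "T (t + (H y' - H y)) (F y) = T s y" using TF[OF y, of "t + (H y' - H y)"] False t by (simp add: s_def)
    moreover have "T t (F y') = T s y'" using TF[OF y'(1) t] False by (simp add: s_def)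
    ultimately show ?thesis
      using d1 d2[of t] False dist_triangle[of "T s y" "T t (F y)" "T s y'"]
      unfolding y'_def[symmetric] by (simp add: dist_commute)
  qed
qed

text \<open>Two points of a leaf with different return times have \<open>F\<close>-images on a common leaf, so the orbit of the
  image is asymptotic to a time shift of itself; the orbit integrals then grow linearly up to a bounded error,
  and ergodicity together with the mean zero condition forces the slope to vanish.\<close>

theorem bounded_if_not_leafwise_constant:
  assumes nc: "\<not> (AE y in \<mu>Y. H y = H (rep (W y)))"
  shows "\<exists>B. \<forall>u. hobs u \<longrightarrow> (\<integral>x. u x \<partial>\<mu>M) = 0 \<longrightarrow> (AE y in \<mu>Y. \<forall>s\<ge>0. \<bar>J u y s\<bar> \<le> B)"
proof -
  obtain k where k [measurable]: "k \<in> borel_measurable \<mu>Y" and kH: "AE y in \<mu>Y. k y = H (rep (W y))"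
    using Hrep_measurable by blast
  \<comment> \<open>Points whose gap lies in a compact range; if the gap does not vanish almost
    surely, one of these sets has positive measure.\<close>
  define D where "D n = {y \<in> space \<mu>Y. 1 / real (Suc n) \<le> \<bar>H y - k y\<bar> \<and> \<bar>H y - k y\<bar> \<le> real (Suc n)}" for n :: nat
  have D [measurable]: "D n \<in> sets \<mu>Y" for n unfolding D_def by measurable
  have "\<exists>n. 0 < measure \<mu>Y (D n)"
  proof (rule ccontr)
    assume "\<not> ?thesis"
    hence "measure \<mu>Y (D n) = 0" for n using measure_nonneg[of \<mu>Y] by (metis less_eq_real_def)
    hence "D n \<in> null_sets \<mu>Y" for n by (intro null_setsI) (auto simp: Y.emeasure_eq_measure)
    hence "AE y in \<mu>Y. y \<notin> D n" for n by (rule AE_not_in)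
    hence "AE y in \<mu>Y. \<forall>n. y \<notin> D n" unfolding AE_all_countable by blast
    with kH AE_space have "AE y in \<mu>Y. H y = H (rep (W y))"
    proof eventually_elim
      case (elim y)
      show ?case
      proof (rule ccontr)
        assume "H y \<noteq> H (rep (W y))"
        hence pos: "0 < \<bar>H y - k y\<bar>" using elim by simp
        obtain n1 :: nat where n1: "1 / \<bar>H y - k y\<bar> \<le> n1" using real_arch_simple by blast
        obtain n2 :: nat where n2: "\<bar>H y - k y\<bar> \<le> n2" using real_arch_simple by blast
        define n where "n = max n1 n2"
        have "1 / real (Suc n) \<le> \<bar>H y - k y\<bar>"
        proof -
          have "1 / \<bar>H y - k y\<bar> \<le> real (Suc n)" using n1 by (simp add: n_def)
          thus ?thesis using pos by (simp add: field_simps)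
        qed
        moreover have "\<bar>H y - k y\<bar> \<le> real (Suc n)" using n2 by (simp add: n_def)
        ultimately have "y \<in> D n" using elim by (simp add: D_def)
        thus False using elim by blast
      qed
    qed
    thus False using nc by blast
  qed
  then obtain n where n: "0 < measure \<mu>Y (D n)" by blast
  define K where "K = real (Suc n)"
  define r where "r = \<gamma> powr \<eta>"
  define c where "c = (2 * C) powr \<eta>"
  have K: "0 < K" by (simp add: K_def)
  have r: "0 < r" "r < 1" using const_bounds powr_less_mono2[of \<eta> \<gamma> 1] by (auto simp: r_def)
  have c: "0 \<le> c" by (simp add: c_def)
  define B where "B = K * c / (1 - r powr (1 / K))\<^sup>2 + 2 * K"
  have "AE y in \<mu>Y. \<forall>s\<ge>0. \<bar>J u y s\<bar> \<le> 2 * B + 3"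
    if u: "hobs u" and mean: "(\<integral>x. u x \<partial>\<mu>M) = 0" for u
  proof -
    have ou: "obs u" "obs (\<lambda>x. - u x)" using hobsD(1)[OF u] hobsD(1)[OF hobs_uminus[OF u]] by auto
    have meanm: "(\<integral>x. - u x \<partial>\<mu>M) = 0" using mean by simp
    have ng: "AE y in \<mu>Y. \<forall>j. \<not> (\<exists>c. \<forall>s\<ge>0. 1 / real (Suc j) * s - c \<le> J u y s) \<and> \<not> (\<exists>c. \<forall>s\<ge>0. 1 / real (Suc j) * s - c \<le> J (\<lambda>x. - u x) y s)"
      unfolding AE_all_countable
    proof
      fix j
      have "0 < 1 / real (Suc j)" by simp
      from no_linear_growth[OF ou(1) mean this] no_linear_growth[OF ou(2) meanm this]
      show "AE y in \<mu>Y. \<not> (\<exists>c. \<forall>s\<ge>0. 1 / real (Suc j) * s - c \<le> J u y s) \<and> \<not> (\<exists>c. \<forall>s\<ge>0. 1 / real (Suc j) * s - c \<le> J (\<lambda>x. - u x) y s)"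
        by eventually_elim (rule conjI)
    qed
    \<comment> \<open>Boundedness at integer times only, to keep the set measurable.\<close>
    define Bd where "Bd b = {y \<in> space \<mu>Y. \<forall>s::nat. \<bar>J u y s\<bar> \<le> b}" for b
    have [measurable]: "(\<lambda>y. J u y s) \<in> borel_measurable \<mu>Y" for s by (intro J_meas ou) auto
    have Bd [measurable]: "Bd b \<in> sets \<mu>Y" for b unfolding Bd_def by measurable
    have DB: "AE y in \<mu>Y. y \<in> D n \<longrightarrow> F y \<in> Bd B"
      using kH AE_space YF.AE_G[OF ng]
    proof eventually_elim
      case (elim y)
      show ?case
      proof
      assume yD: "y \<in> D n"
      have y: "y \<in> Y" using elim by (simp add: space_\<mu>Y)
      define \<delta> where "\<delta> = \<bar>H y - H (rep (W y))\<bar>"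
      have \<delta>: "1 / K \<le> \<delta>" "\<delta> \<le> K" using elim(1) yD by (auto simp: \<delta>_def D_def K_def)
      have \<delta>0: "0 < \<delta>" using \<delta>(1) K by (meson less_le_trans zero_less_divide_1_iff)
      have "\<bar>u (T (t + \<delta>) (F y)) - u (T t (F y))\<bar> \<le> c * r powr t" if t: "0 \<le> t" for t
      proof -
        have "\<bar>u (T (t + \<delta>) (F y)) - u (T t (F y))\<bar> \<le> (2 * C * \<gamma> powr t) powr \<eta>"
          unfolding \<delta>_def by (rule hobs_le[OF u orbit_period[OF y t]])
        also have "\<dots> = c * r powr t" using const_bounds by (simp add: c_def r_def powr_mult powr_powr mult.commute)
        finally show ?thesis .
      qed
      from J_asymptotically_periodic[OF ou(1) \<delta>0 \<delta> K r c this]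
      obtain A where A: "\<And>s. 0 \<le> s \<Longrightarrow> \<bar>J u (F y) s - A * s\<bar> \<le> B" unfolding B_def by blast
      have "A = 0"
      proof (rule ccontr)
        assume "A \<noteq> 0"
        then obtain j where j: "1 / real (Suc j) < \<bar>A\<bar>" using nat_approx_posE[of "\<bar>A\<bar>"] by auto
        show False
        proof (cases "0 < A")
          case True
          have "1 / real (Suc j) * s - B \<le> J u (F y) s" if s: "0 \<le> s" for s
          proof -
            have "1 / real (Suc j) * s \<le> A * s" using j True s by (intro mult_right_mono) auto
            thus ?thesis using A[OF s] by linarith
          qed
          thus False using elim(3) by blast
        next
          case False
          have "1 / real (Suc j) * s - B \<le> J (\<lambda>x. - u x) (F y) s" if s: "0 \<le> s" for s
          proof -
            have "1 / real (Suc j) * s \<le> (- A) * s" using j False s by (intro mult_right_mono) auto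
            thus ?thesis using A[OF s] by (simp add: J_uminus)
          qed
          thus False using elim(3) by blast
        qed
      qed
      thus "F y \<in> Bd B" using A F_Y[OF y] by (simp add: Bd_def space_\<mu>Y)
      qed
    qed
    have pos: "0 < measure \<mu>Y (Bd B)"
    proof -
      have "measure \<mu>Y (D n) \<le> measure \<mu>Y (F -` Bd B \<inter> space \<mu>Y)"
        using DB AE_space by (intro Y.finite_measure_mono_AE) (auto elim!: eventually_elim2)
      also have "\<dots> = measure (distr \<mu>Y \<mu>Y F) (Bd B)" by (subst measure_distr) auto
      finally show ?thesis using n unfolding YF.G_inv by simp
    qed
    have B0: "0 \<le> B" unfolding B_def using K c by simp
    let ?b = "2 * B + 2"
    \<comment> \<open>Once orbit integrals are bounded from some return on, they stay bounded from
      each later return, as differences of two such integrals; passing from integer to real times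
      adds 1 to each.\<close>
    have pers: "(F ^^ (j + i)) y \<in> Bd ?b" if y: "y \<in> Y" and "(F ^^ j) y \<in> Bd B" for y j i
    proof -
      define z where "z = (F ^^ j) y"
      have z: "z \<in> Y" "\<And>s::nat. \<bar>J u z s\<bar> \<le> B" using that Fn_Y[OF y] by (auto simp: z_def Bd_def)
      have zr: "\<bar>J u z s\<bar> \<le> B + 1" if s: "0 \<le> s" for s
      proof -
        define m where "m = nat \<lfloor>s\<rfloor>"
        have m: "real m \<le> s" "s \<le> m + 1" unfolding m_def using s by linarith+
        show ?thesis using J_lip[OF ou(1) s, of m z] m z(2)[of m] by linarith
      qed
      have "\<bar>J u ((F ^^ i) z) s\<bar> \<le> ?b" for s :: nat
        using J_add[OF ou(1) Hs_nonneg[OF z(1), of i], of s z] T_Hs[OF z(1), of i] zr[OF Hs_nonneg[OF z(1), of i]]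
          zr[of "Hs i z + s"] Hs_nonneg[OF z(1), of i] by simp
      moreover have "(F ^^ (j + i)) y = (F ^^ i) z" unfolding z_def by (metis add.commute comp_apply funpow_add)
      ultimately show ?thesis using Fn_Y[OF z(1)] by (simp add: Bd_def space_\<mu>Y)
    qed
    \<comment> \<open>Points that have met \<open>Bd B\<close> within \<open>m\<close> returns;
      \<open>F ^^ m\<close> maps them into \<open>Bd ?b\<close>. Invariance bounds their measure by
      that of \<open>Bd ?b\<close>, while ergodicity makes it tend to 1.\<close>
    define Vs where "Vs m = (\<Union>j\<le>m. (F ^^ j) -` Bd B \<inter> space \<mu>Y)" for m
    have Vs [measurable]: "Vs m \<in> sets \<mu>Y" for m unfolding Vs_def by measurable
    have "measure \<mu>Y (Vs m) \<le> measure \<mu>Y (Bd ?b)" for m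
    proof -
      interpret Fm: mpt \<mu>Y "F ^^ m" by (rule YF.mpt_Gn)
      have "Vs m \<subseteq> (F ^^ m) -` Bd ?b \<inter> space \<mu>Y"
      proof
        fix y assume "y \<in> Vs m"
        then obtain j where j: "j \<le> m" "(F ^^ j) y \<in> Bd B" "y \<in> Y" by (auto simp: Vs_def space_\<mu>Y)
        thus "y \<in> (F ^^ m) -` Bd ?b \<inter> space \<mu>Y" using pers[OF j(3,2), of "m - j"] by (simp add: space_\<mu>Y)
      qed
      hence "measure \<mu>Y (Vs m) \<le> measure \<mu>Y ((F ^^ m) -` Bd ?b \<inter> space \<mu>Y)" by (intro Y.finite_measure_mono) auto
      also have "\<dots> = measure (distr \<mu>Y \<mu>Y (F ^^ m)) (Bd ?b)" by (subst measure_distr) auto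
      finally show ?thesis unfolding Fm.G_inv .
    qed
    moreover have "(\<lambda>m. measure \<mu>Y (Vs m)) \<longlonglongrightarrow> measure \<mu>Y (\<Union>m. Vs m)"
    proof (rule Y.finite_Lim_measure_incseq)
      show "range Vs \<subseteq> sets \<mu>Y" using Vs by auto
      show "incseq Vs" unfolding incseq_def Vs_def by (intro allI impI UN_mono) auto
    qed
    moreover have "measure \<mu>Y (\<Union>m. Vs m) = 1"
    proof -
      have "AE y in \<mu>Y. \<exists>j. (F ^^ j) y \<in> Bd B" using Y_erg pos by (intro YF.ergodic_hits) auto
      hence "AE y in \<mu>Y. y \<in> (\<Union>m. Vs m)" using AE_space by eventually_elim (auto simp: Vs_def)
      thus ?thesis by (subst Y.prob_eq_1) auto
    qed
    ultimately have "1 \<le> measure \<mu>Y (Bd ?b)" by (intro LIMSEQ_le_const2[of "\<lambda>m. measure \<mu>Y (Vs m)" 1]) auto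
    hence "measure \<mu>Y (Bd ?b) = 1" using Y.prob_le_1[of "Bd ?b"] by linarith
    hence "AE y in \<mu>Y. y \<in> Bd ?b" by (simp add: Y.prob_eq_1)
    thus ?thesis
    proof eventually_elim
      case (elim y)
      show ?case
      proof (intro allI impI)
        fix s :: real assume s: "0 \<le> s"
        define m where "m = nat \<lfloor>s\<rfloor>"
        have m: "real m \<le> s" "s \<le> m + 1" unfolding m_def using s by linarith+
        have "\<bar>J u y m\<bar> \<le> ?b" using elim by (simp add: Bd_def)
        thus "\<bar>J u y s\<bar> \<le> 2 * B + 3" using J_lip[OF ou(1) s, of m y] m by linarith
      qed
    qed
  qed
  thus ?thesis by blast
qed

end

section \<open>Regularity of the quotient observable\<close>

lemma powr_le_one_add: "0 \<le> z \<Longrightarrow> 0 \<le> e \<Longrightarrow> e \<le> 1 \<Longrightarrow> z powr e \<le> 1 + (z::real)"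
proof -
  assume z: "0 \<le> z" and e: "0 \<le> e" "e \<le> 1"
  show ?thesis
  proof (cases "z \<le> 1")
    case True
    hence "z powr e \<le> 1 powr e" using z e by (intro powr_mono2) auto
    thus ?thesis using z by simp
  next
    case False
    hence "z powr e \<le> z powr 1" using e by (intro powr_mono) auto
    thus ?thesis using False by simp
  qed
qed

text \<open>Each of \<open>n\<close> copies of the smallest term is at most a term of the geometric
  series. It absorbs a linear factor into half of an exponential decay.\<close>

lemma nat_mult_power_le: "0 \<le> \<mu> \<Longrightarrow> \<mu> < 1 \<Longrightarrow> real n * \<mu> ^ n \<le> 1 / (1 - \<mu>)"
proof -
  assume m: "0 \<le> \<mu>" "\<mu> < 1"
  have "real n * \<mu> ^ n = (\<Sum>k<n. \<mu> ^ n)" by simp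
  also have "\<dots> \<le> (\<Sum>k<n. \<mu> ^ k)" using m by (intro sum_mono power_decreasing) auto
  also have "\<dots> \<le> 1 / (1 - \<mu>)" using m by (simp add: sum_gp_strict divide_right_mono)
  finally show ?thesis .
qed

context hyperbolic_flow
begin

section \<open>Differences of orbit integrals along a leaf\<close>

definition "q0 = \<gamma> powr \<eta>"
definition "c1 = C powr \<eta>"
text \<open>Geometric tail over unit times plus the last incomplete unit of time; the division by
  \<open>q0\<close> pays for rounding the time down.\<close>

definition "c2 = (c1 / (1 - q0) + c1) / q0"

lemma q0: "0 < q0" "q0 < 1" using const_bounds powr_less_mono2[of \<eta> \<gamma> 1] by (auto simp: q0_def)
lemma c1: "0 \<le> c1" by (simp add: c1_def)
lemma c2: "0 \<le> c2" using q0 c1 by (simp add: c2_def)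

lemma leaf_difference:
  assumes u: "hobs u" and y: "y \<in> Y" "y' \<in> W y" and s: "0 \<le> s" "0 \<le> t"
  shows "\<bar>(J u y (s + t) - J u y' (s + t)) - (J u y s - J u y' s)\<bar> \<le> c1 * q0 powr s * t"
proof -
  have o: "obs u" by (rule hobsD(1)[OF u])
  have "\<bar>J u (T s y) t - J u (T s y') t\<bar> \<le> (c1 * q0 powr s) * t"
  proof (rule J_diff[OF o s(2)])
    fix r assume r: "0 \<le> r" "r \<le> t"
    have "dist (T r (T s y)) (T r (T s y')) \<le> C * \<gamma> powr (r + s)"
      using stable_contr[OF y, of "r + s"] T_add[of r s] r s by simp
    also have "\<dots> \<le> C * \<gamma> powr s" using const_bounds r by (intro mult_left_mono powr_mono') auto
    finally have "\<bar>u (T r (T s y)) - u (T r (T s y'))\<bar> \<le> (C * \<gamma> powr s) powr \<eta>" by (rule hobs_le[OF u])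
    also have "\<dots> = c1 * q0 powr s" using const_bounds by (simp add: c1_def q0_def powr_mult powr_powr mult.commute)
    finally show "\<bar>u (T r (T s y)) - u (T r (T s y'))\<bar> \<le> c1 * q0 powr s" .
  qed
  thus ?thesis using J_add[OF o s, of y] J_add[OF o s, of y'] by simp
qed

text \<open>Orbits on one leaf approach each other exponentially, so the difference of the integrals
  is geometrically Cauchy in time.\<close>

lemma leaf_limit:
  assumes u: "hobs u" and y: "y \<in> Y" "y' \<in> W y"
  shows "\<exists>l. \<forall>s\<ge>0. \<bar>J u y s - J u y' s - l\<bar> \<le> c2 * q0 powr s"
proof -
  define a where "a n = J u y (real n) - J u y' (real n)" for n
  have "\<bar>a (Suc n) - a n\<bar> \<le> c1 * q0 ^ n" for n
    using leaf_difference[OF u y, of "real n" 1] q0 by (simp add: a_def powr_realpow add.commute)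
  from geometric_cauchy_limit[OF _ q0(2) this] obtain l where l: "\<And>n. \<bar>a n - l\<bar> \<le> c1 * q0 ^ n / (1 - q0)" using q0 by auto
  have "\<bar>J u y s - J u y' s - l\<bar> \<le> c2 * q0 powr s" if s: "0 \<le> s" for s
  proof -
    define n where "n = nat \<lfloor>s\<rfloor>"
    have n: "real n \<le> s" "s \<le> n + 1" unfolding n_def using s by linarith+
    have "\<bar>(J u y s - J u y' s) - a n\<bar> \<le> c1 * q0 powr n * (s - n)"
      using leaf_difference[OF u y, of "real n" "s - n"] n by (simp add: a_def)
    also have "\<dots> \<le> c1 * q0 powr n * 1" using n c1 by (intro mult_left_mono) auto
    finally have 1: "\<bar>(J u y s - J u y' s) - a n\<bar> \<le> c1 * q0 ^ n" using q0 by (simp add: powr_realpow)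
    have "\<bar>J u y s - J u y' s - l\<bar> \<le> (c1 / (1 - q0) + c1) * q0 ^ n" using 1 l[of n] by (simp add: algebra_simps)
    also have "\<dots> \<le> (c1 / (1 - q0) + c1) * (q0 powr s / q0)"
    proof (rule mult_left_mono)
      have "q0 ^ n = q0 powr n" using q0 by (simp add: powr_realpow)
      also have "\<dots> \<le> q0 powr (s - 1)" using n q0 by (intro powr_mono') auto
      also have "\<dots> = q0 powr s / q0" using q0 by (simp add: powr_diff)
      finally show "q0 ^ n \<le> q0 powr s / q0" .
    qed (use c1 q0 in auto)
    also have "\<dots> = c2 * q0 powr s" by (simp add: c2_def)
    finally show ?thesis .
  qed
  thus ?thesis by blast
qed

text \<open>\<open>ld u y\<close> is the limit of the integral of \<open>u\<close> along the orbit of \<open>y\<close> minus that along the orbit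
  of the representative of its leaf.\<close>

definition ld :: "('m \<Rightarrow> real) \<Rightarrow> 'm \<Rightarrow> real" where
  "ld u y = (SOME l. \<forall>s\<ge>0. \<bar>J u y s - J u (rep (W y)) s - l\<bar> \<le> c2 * q0 powr s)"

lemma ld: "hobs u \<Longrightarrow> y \<in> Y \<Longrightarrow> 0 \<le> s \<Longrightarrow> \<bar>J u y s - J u (rep (W y)) s - ld u y\<bar> \<le> c2 * q0 powr s"
  using someI_ex[OF leaf_limit[OF _ _ rep(2)]] unfolding ld_def by blast

lemma ld_bound: "hobs u \<Longrightarrow> y \<in> Y \<Longrightarrow> \<bar>ld u y\<bar> \<le> c2"
  using ld[of u y 0] q0 by (simp add: J_0)

text \<open>A function of the leaf that is cohomologous to the induced observable \<open>\<lambda>y. J u y (H y)\<close>, with bounded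
  transfer function \<open>ld u\<close>, whenever \<open>H\<close> is constant on leaves.\<close>

definition Vh :: "('m \<Rightarrow> real) \<Rightarrow> 'm set \<Rightarrow> real" where
  "Vh u x = J u (rep x) (H (rep x)) + ld u (F (rep x))"

text \<open>Run both orbits for time \<open>H y + s\<close>. Equal return times make them restart
  together at \<open>F y\<close> and \<open>F z\<close>, which lie on one leaf and hence share a
  representative; every discrepancy is \<open>O(q0 powr s)\<close>, and \<open>s\<close> is
  arbitrary.\<close>

lemma U_Vh:
  assumes u: "hobs u" and y: "y \<in> Y" and eq: "H y = H (rep (W y))"
  shows "J u y (H y) = Vh u (W y) + ld u y - ld u (F y)"
proof -
  have o: "obs u" by (rule hobsD(1)[OF u])
  define z where "z = rep (W y)"
  have z: "z \<in> Y" "z \<in> W y" using rep[OF y] by (auto simp: z_def)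
  have "F z \<in> W (F y)" using W_F[OF y] z by blast
  hence p: "rep (W (F z)) = rep (W (F y))" using W_part[OF F_Y[OF y]] by simp
  define e where "e = \<bar>J u y (H y) - (Vh u (W y) + ld u y - ld u (F y))\<bar>"
  have "e \<le> 3 * c2 * q0 powr s" if s: "0 \<le> s" for s
  proof -
    note Hn = H_nonneg[OF y]
    have "\<bar>J u y (H y + s) - J u z (H y + s) - ld u y\<bar> \<le> c2 * q0 powr (H y + s)"
      using ld[OF u y, of "H y + s"] Hn s by (simp add: z_def)
    also have "\<dots> \<le> c2 * q0 powr s" using q0 c2 Hn by (intro mult_left_mono powr_mono') auto
    finally have 1: "\<bar>J u y (H y + s) - J u z (H y + s) - ld u y\<bar> \<le> c2 * q0 powr s" .
    have 2: "J u y (H y + s) = J u y (H y) + J u (F y) s" using J_add[OF o Hn s, of y] T_H[OF y] by simp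
    have 3: "J u z (H y + s) = J u z (H z) + J u (F z) s" using J_add[OF o Hn s, of z] T_H[OF z(1)] eq by (simp add: z_def)
    have 4: "\<bar>J u (F y) s - J u (rep (W (F y))) s - ld u (F y)\<bar> \<le> c2 * q0 powr s" by (rule ld[OF u F_Y[OF y] s])
    have 5: "\<bar>J u (F z) s - J u (rep (W (F y))) s - ld u (F z)\<bar> \<le> c2 * q0 powr s" using ld[OF u F_Y[OF z(1)] s] by (simp add: p)
    show ?thesis using 1 2 3 4 5 unfolding e_def Vh_def z_def[symmetric] by linarith
  qed
  hence le: "e \<le> 3 * c2 * q0 ^ n" for n using q0 by (simp add: powr_realpow[symmetric])
  have "(\<lambda>n. 3 * c2 * q0 ^ n) \<longlonglongrightarrow> 3 * c2 * 0" using q0 by (intro tendsto_intros LIMSEQ_power_zero) auto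
  hence "e \<le> 0" using le by (intro LIMSEQ_le_const[of "\<lambda>n. 3 * c2 * q0 ^ n"]) auto
  thus ?thesis by (simp add: e_def)
qed

text \<open>After the first return every further one takes time at least \<open>h0\<close>. The same
  count supplies the upper bound without which \<open>GREATEST\<close> would be meaningless.\<close>

lemma Jfun_le:
  assumes y: "y \<in> Y" and t: "0 \<le> t" "t \<le> H y + t'" "0 \<le> t'"
  shows "real (Jfun T h \<tau> t y) \<le> 1 + t' / h0"
proof -
  have b: "real n \<le> 1 + t' / h0" if n: "Hs n y \<le> t" for n
  proof (cases n)
    case 0 thus ?thesis using t h0 by (simp add: add_nonneg_nonneg)
  next
    case (Suc m)
    have "Hs n y = H y + Hs m (F y)" unfolding Suc Hsum_def sum.lessThan_Suc_shift by (simp add: funpow_swap1)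
    hence "m * h0 \<le> t'" using n t Hs_ge[OF F_Y[OF y], of m] by linarith
    thus ?thesis using h0 Suc by (simp add: field_simps)
  qed
  have "Hs (Jfun T h \<tau> t y) y \<le> t" unfolding Jfun_def
  proof (rule GreatestI_nat[where k=0 and b="nat \<lfloor>1 + t' / h0\<rfloor>"])
    show "Hs 0 y \<le> t" using t by (simp add: Hs_0)
    show "\<And>n. Hs n y \<le> t \<Longrightarrow> n \<le> nat \<lfloor>1 + t' / h0\<rfloor>" by (rule le_nat_floor[OF b])
  qed
  thus ?thesis by (rule b)
qed

lemma gp_enat_le:
  assumes "real k \<le> b"
  shows "gp \<gamma> (enat n) k \<le> \<gamma> powr (real n - b)"
  using const_bounds assms by (simp add: gp_def powr_mono')

text \<open>Infimum over representatives only; it is at least the infimum over the whole preimage of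
  \<open>a\<close> that the hypothesis on \<open>H\<close> uses, and it lies below every value of
  \<open>H \<circ> rep\<close> on \<open>a\<close>, which makes it summable against the measures of
  the partition elements.\<close>

definition Hq :: "'m set set \<Rightarrow> real" where "Hq a = (INF x\<in>a. H (rep x))"

lemma space_Pbar: "a \<in> Pbar \<Longrightarrow> x \<in> a \<Longrightarrow> \<exists>y\<in>Y. x = W y"
proof -
  assume a: "a \<in> Pbar" "x \<in> a"
  have "Pbar \<subseteq> sets \<mu>b" using GM[unfolded gibbs_markov_def] by (elim conjE)
  hence "a \<subseteq> space \<mu>b" using a sets.sets_into_space by blast
  thus ?thesis using a(2) unfolding space_\<mu>b by blast
qed

lemma Hq_le: assumes "a \<in> Pbar" "x \<in> a" shows "Hq a \<le> H (rep x)" "h0 \<le> Hq a"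
proof -
  have *: "h0 \<le> H (rep z)" if "z \<in> a" for z using space_Pbar[OF assms(1) that] rep(3) H_ge by blast
  show "Hq a \<le> H (rep x)" unfolding Hq_def using * assms(2) by (intro cINF_lower bdd_belowI2[of _ h0]) auto
  show "h0 \<le> Hq a" unfolding Hq_def using * assms(2) by (intro cINF_greatest) auto
qed

lemma H_rep_diff:
  assumes a: "a \<in> Pbar" "x \<in> a" "x' \<in> a"
  shows "\<bar>H (rep x) - H (rep x')\<bar> \<le> C * Hq a * gp \<gamma> (sep_time Pbar Fb x x') 0" "H (rep x) \<le> (1 + C) * Hq a"
proof -
  let ?Ha = "INF z\<in>{z\<in>Y. W z \<in> a}. H z"
  have HaH: "?Ha \<le> H (rep z)" if z: "z \<in> a" for z
  proof -
    obtain y where y: "y \<in> Y" "z = W y" using space_Pbar[OF a(1) z] by blast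
    have "rep z \<in> {z\<in>Y. W z \<in> a}" using rep[OF y(1)] y z by simp
    thus ?thesis using H_nonneg by (intro cINF_lower bdd_belowI2[of _ 0]) auto
  qed
  have Haq: "?Ha \<le> Hq a" unfolding Hq_def using HaH a by (intro cINF_greatest) auto
  have lip: "\<bar>H (rep z) - H (rep z')\<bar> \<le> C * Hq a * gp \<gamma> (sep_time Pbar Fb z z') 0" if z: "z \<in> a" "z' \<in> a" for z z'
  proof -
    obtain y where y: "y \<in> Y" "z = W y" using space_Pbar[OF a(1) z(1)] by blast
    obtain y' where y': "y' \<in> Y" "z' = W y'" using space_Pbar[OF a(1) z(2)] by blast
    have "\<bar>H (rep z) - H (rep z')\<bar> \<le> C * ?Ha * gp \<gamma> (sep_time Pbar Fb z z') 0"
      using H_lip[OF a(1), of "rep z" "rep z'"] rep[OF y(1)] rep[OF y'(1)] y y' z by simp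
    also have "\<dots> \<le> C * Hq a * gp \<gamma> (sep_time Pbar Fb z z') 0"
      using Haq const_bounds gp_nonneg by (intro mult_right_mono mult_left_mono) auto
    finally show ?thesis .
  qed
  show "\<bar>H (rep x) - H (rep x')\<bar> \<le> C * Hq a * gp \<gamma> (sep_time Pbar Fb x x') 0" by (rule lip[OF a(2,3)])
  have Hq0: "0 \<le> Hq a" using Hq_le[OF a(1,2)] h0 by linarith
  have "H (rep x) - C * Hq a \<le> H (rep z)" if z: "z \<in> a" for z
  proof -
    have "C * Hq a * gp \<gamma> (sep_time Pbar Fb x z) 0 \<le> C * Hq a * 1"
      using const_bounds Hq0 by (intro mult_left_mono gp_le_one) auto
    thus ?thesis using lip[OF a(2) z] by linarith
  qed
  hence "H (rep x) - C * Hq a \<le> Hq a" unfolding Hq_def[of a] using a by (intro cINF_greatest) (auto simp: Hq_def)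
  thus "H (rep x) \<le> (1 + C) * Hq a" by (simp add: algebra_simps)
qed

lemma sep_finite:
  assumes "a \<in> Pbar" "x \<in> a" "x' \<in> a" "x \<noteq> x'"
  shows "\<exists>n. sep_time Pbar Fb x x' = enat (Suc n) \<and> sep_time Pbar Fb (Fb x) (Fb x') = enat n"
proof -
  have fin: "\<forall>x\<in>space \<mu>b. \<forall>y\<in>space \<mu>b. x \<noteq> y \<longrightarrow> sep_time Pbar Fb x y \<noteq> \<infinity>"
    using GM[unfolded gibbs_markov_def] by (elim conjE)
  have "x \<in> space \<mu>b" "x' \<in> space \<mu>b" using space_Pbar[OF assms(1)] assms(2,3) unfolding space_\<mu>b by blast+
  hence "sep_time Pbar Fb x x' \<noteq> \<infinity>" using fin assms(4) by blast
  moreover have "sep_time Pbar Fb x x' = eSuc (sep_time Pbar Fb (Fb x) (Fb x'))" by (rule sep_time_eSuc[OF assms(1-3)])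
  ultimately show ?thesis by (cases "sep_time Pbar Fb (Fb x) (Fb x')") (auto simp: eSuc_enat)
qed

text \<open>The smallest of the decay exponents met below: \<eta> for the integral up to the first
  return, \<open>\<eta> * h0 / 2\<close> for truncating leaf limits at a time proportional to the
  separation time, and \<open>\<eta>\<^sup>2 / 4\<close> for the time mismatch, which passes through
  two Hoelder conditions and loses half of its rate twice.\<close>

definition "\<beta> = min \<eta> (min (\<eta> * h0 / 2) (\<eta>\<^sup>2 / 4))"
definition "\<theta>1 = \<gamma> powr \<beta>"

lemma \<beta>: "0 < \<beta>" using const_bounds h0 by (simp add: \<beta>_def)
lemma \<theta>1: "0 < \<theta>1" "\<theta>1 < 1" using const_bounds powr_less_mono2[of \<beta> \<gamma> 1] \<beta> by (auto simp: \<theta>1_def)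

lemma powr_le_\<theta>1: "\<beta> \<le> e \<Longrightarrow> \<gamma> powr (e * real n) \<le> \<theta>1 ^ n"
proof -
  assume e: "\<beta> \<le> e"
  have "\<gamma> powr (e * real n) \<le> \<gamma> powr (\<beta> * real n)" using const_bounds e by (intro powr_mono' mult_right_mono) auto
  also have "\<dots> = \<theta>1 ^ n" using \<theta>1(1) by (simp add: \<theta>1_def powr_powr powr_realpow[symmetric])
  finally show ?thesis .
qed

text \<open>The integral up to the first return is compared directly. The term
  \<open>ld u (F (rep x))\<close> involves all future time and is truncated at a time proportional
  to the separation time \<open>n\<close>: long enough for the tail to be exponentially small in
  \<open>n\<close>, short enough for the unstable separation to remain small. Additive constants
  become multiples of \<open>Hq a\<close> because \<open>Hq a \<ge> h0\<close>.\<close>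

theorem Vh_regular:
  "\<exists>K>0. \<forall>u a x x'. hobs u \<longrightarrow> a \<in> Pbar \<longrightarrow> x \<in> a \<longrightarrow> x' \<in> a \<longrightarrow>
     \<bar>Vh u x\<bar> \<le> K * Hq a \<and> \<bar>Vh u x - Vh u x'\<bar> \<le> K * Hq a * gp \<theta>1 (sep_time Pbar Fb x x') 0"
proof -
  \<comment> \<open>\<open>k1\<close> belongs to the integral up to the return, \<open>k3\<close> to
    the distance \<open>d\<close> of the truncated orbits, and \<open>k4\<close> to
    \<open>d powr \<eta>\<close> times the truncation time; the rest of \<open>K\<close> comes from
    the bound \<open>c2\<close> on leaf limits.\<close>
  define k3 where "k3 = C / (\<gamma>\<^sup>2 * h0) + C * (1 / h0 + C)"
  define \<mu> where "\<mu> = \<gamma> powr (\<eta>\<^sup>2 / 4)"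
  define k4 where "k4 = h0 / 2 * (1 / h0 + k3) * (1 / (1 - \<mu>))"
  define k1 where "k1 = C + (1 + C) * (c1 / q0)"
  define K where "K = (1 + C) + c2 / h0 + (k1 + 2 * c2 / h0 + 2 * c2 / (h0 * \<theta>1) + 2 * k4)"
  have \<mu>: "0 < \<mu>" "\<mu> < 1" using const_bounds powr_less_mono2[of "\<eta>\<^sup>2 / 4" \<gamma> 1] by (auto simp: \<mu>_def)
  have k3: "0 \<le> k3" using const_bounds h0 by (simp add: k3_def)
  have k4: "0 \<le> k4" using k3 h0 \<mu> by (simp add: k4_def)
  have k1: "0 \<le> k1" using const_bounds c1 q0 by (simp add: k1_def)
  have K: "0 < K" "(1 + C) + c2 / h0 \<le> K" "k1 + 2 * c2 / h0 + 2 * c2 / (h0 * \<theta>1) + 2 * k4 \<le> K"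
  proof -
    have gen: "0 < (1 + C) + x + (k1 + y + z + 2 * k4) \<and> (1 + C) + x \<le> (1 + C) + x + (k1 + y + z + 2 * k4)
        \<and> k1 + y + z + 2 * k4 \<le> (1 + C) + x + (k1 + y + z + 2 * k4)"
      if "0 \<le> x" "0 \<le> y" "0 \<le> z" for x y z using that const_bounds k1 k4 by simp
    have "0 \<le> c2 / h0" "0 \<le> 2 * c2 / h0" "0 \<le> 2 * c2 / (h0 * \<theta>1)" using c2 h0 \<theta>1 by auto
    from gen[OF this] show "0 < K" "(1 + C) + c2 / h0 \<le> K" "k1 + 2 * c2 / h0 + 2 * c2 / (h0 * \<theta>1) + 2 * k4 \<le> K"
      unfolding K_def by blast+
  qed
  have "\<bar>Vh u x\<bar> \<le> K * Hq a" "\<bar>Vh u x - Vh u x'\<bar> \<le> K * Hq a * gp \<theta>1 (sep_time Pbar Fb x x') 0"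
    if u: "hobs u" and a: "a \<in> Pbar" "x \<in> a" "x' \<in> a" for u a x x'
  proof -
    have o: "obs u" by (rule hobsD(1)[OF u])
    have Hqh: "h0 \<le> Hq a" using Hq_le(2)[OF a(1,2)] .
    have Hq0: "0 < Hq a" using Hqh h0 by linarith
    obtain w where w: "w \<in> Y" "x = W w" using space_Pbar[OF a(1,2)] by blast
    obtain w' where w': "w' \<in> Y" "x' = W w'" using space_Pbar[OF a(1,3)] by blast
    define y y' where "y = rep x" and "y' = rep x'"
    have y: "y \<in> Yhat" "y \<in> Y" "W y = x" using rep[OF w(1)] w by (auto simp: y_def)
    have y': "y' \<in> Yhat" "y' \<in> Y" "W y' = x'" using rep[OF w'(1)] w' by (auto simp: y'_def)
    note Hn = H_nonneg[OF y(2)] H_nonneg[OF y'(2)]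
    have HyC: "H y \<le> (1 + C) * Hq a" using H_rep_diff(2)[OF a] by (simp add: y_def)
    show "\<bar>Vh u x\<bar> \<le> K * Hq a"
    proof -
      have "\<bar>Vh u x\<bar> \<le> H y + c2" unfolding Vh_def y_def[symmetric]
        using U_bound[OF o y(2)] ld_bound[OF u F_Y[OF y(2)]] by linarith
      also have "\<dots> \<le> (1 + C) * Hq a + c2 / h0 * Hq a"
      proof -
        have "c2 / h0 * h0 \<le> c2 / h0 * Hq a" using Hqh c2 h0 by (intro mult_left_mono) auto
        thus ?thesis using HyC h0 by simp
      qed
      also have "\<dots> = ((1 + C) + c2 / h0) * Hq a" by (simp add: algebra_simps)
      also have "\<dots> \<le> K * Hq a" using K(2) Hq0 by (intro mult_right_mono) auto
      finally show ?thesis .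
    qed
    show "\<bar>Vh u x - Vh u x'\<bar> \<le> K * Hq a * gp \<theta>1 (sep_time Pbar Fb x x') 0"
    proof (cases "x = x'")
      case True thus ?thesis using K(1) Hq0 gp_nonneg by simp
    next
      case False
      obtain m where m: "sep_time Pbar Fb x x' = enat (Suc m)" "sep_time Pbar Fb (Fb x) (Fb x') = enat m"
        using sep_finite[OF a False] by blast
      define n where "n = Suc m"
      have mn: "sep_time Pbar Fb x x' = enat n" using m(1) by (simp add: n_def)
      have gpn: "gp \<theta>1 (sep_time Pbar Fb x x') 0 = \<theta>1 ^ n" using mn \<theta>1 by (simp add: gp_def powr_realpow)
      have Hd: "\<bar>H y - H y'\<bar> \<le> C * Hq a * \<gamma> powr n"
        using H_rep_diff(1)[OF a] mn by (simp add: y_def y'_def gp_def)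
      have un: "dist (T t y) (T t y') \<le> C * \<gamma> powr (real n - (1 + t' / h0))" if "0 \<le> t" "t \<le> H y + t'" "0 \<le> t'" for t t'
      proof -
        have "dist (T t y) (T t y') \<le> C * gp \<gamma> (enat n) (Jfun T h \<tau> t y)"
          using unstable_exp[OF a(1) y(1) y'(1), of t] y y' a that(1) mn by simp
        also have "\<dots> \<le> C * \<gamma> powr (real n - (1 + t' / h0))"
          using Jfun_le[OF y(2) that] const_bounds by (intro mult_left_mono gp_enat_le) auto
        finally show ?thesis .
      qed
      have A: "\<bar>J u y (H y) - J u y' (H y')\<bar> \<le> k1 * Hq a * \<theta>1 ^ n"
      proof -
        define l where "l = min (H y) (H y')"
        have l: "0 \<le> l" "l \<le> H y" using Hn by (auto simp: l_def)
        \<comment> \<open>Up to the earlier of the two return times at most one return is completed,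
          so the separation drops from \<open>n\<close> to at worst \<open>n - 1\<close>.\<close>
        have 1: "\<bar>J u y l - J u y' l\<bar> \<le> (c1 * \<gamma> powr (\<eta> * (real n - 1))) * l"
        proof (rule J_diff[OF o l(1)])
          fix r assume r: "0 \<le> r" "r \<le> l"
          have "dist (T r y) (T r y') \<le> C * \<gamma> powr (real n - 1)" using un[of r 0] r l by simp
          hence "\<bar>u (T r y) - u (T r y')\<bar> \<le> (C * \<gamma> powr (real n - 1)) powr \<eta>" by (rule hobs_le[OF u])
          also have "\<dots> = c1 * \<gamma> powr (\<eta> * (real n - 1))" using const_bounds by (simp add: c1_def powr_mult powr_powr mult.commute)
          finally show "\<bar>u (T r y) - u (T r y')\<bar> \<le> c1 * \<gamma> powr (\<eta> * (real n - 1))" .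
        qed
        have 2: "\<bar>J u y (H y) - J u y l\<bar> + \<bar>J u y' l - J u y' (H y')\<bar> \<le> \<bar>H y - H y'\<bar>"
          using J_lip[OF o Hn(1) l(1), of y] J_lip[OF o l(1) Hn(2), of y'] by (auto simp: l_def min_def)
        have g1: "\<gamma> powr (\<eta> * (real n - 1)) \<le> \<theta>1 ^ n / q0"
        proof -
          have "\<gamma> powr (\<eta> * (real n - 1)) = \<gamma> powr (\<eta> * real n) / q0" using const_bounds by (simp add: q0_def powr_diff right_diff_distrib)
          also have "\<dots> \<le> \<theta>1 ^ n / q0" using q0 by (intro divide_right_mono powr_le_\<theta>1) (auto simp: \<beta>_def)
          finally show ?thesis .
        qed
        have "(c1 * \<gamma> powr (\<eta> * (real n - 1))) * l \<le> (c1 * (\<theta>1 ^ n / q0)) * ((1 + C) * Hq a)"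
          using g1 c1 l HyC \<theta>1 q0 by (intro mult_mono mult_left_mono mult_nonneg_nonneg divide_nonneg_nonneg) auto
        moreover have "\<gamma> powr n \<le> \<theta>1 ^ n" using powr_le_\<theta>1[of 1 n] const_bounds by (simp add: \<beta>_def)
        hence "C * Hq a * \<gamma> powr n \<le> C * Hq a * \<theta>1 ^ n" using const_bounds Hq0 by (intro mult_left_mono) auto
        ultimately have "\<bar>J u y (H y) - J u y' (H y')\<bar> \<le> C * Hq a * \<theta>1 ^ n + (c1 * (\<theta>1 ^ n / q0)) * ((1 + C) * Hq a)"
          using 1 2 Hd by linarith
        also have "\<dots> = k1 * Hq a * \<theta>1 ^ n" by (simp add: k1_def algebra_simps)
        finally show ?thesis .
      qed
      have B: "\<bar>ld u (F y) - ld u (F y')\<bar> \<le> (2 * c2 / h0 + 2 * c2 / (h0 * \<theta>1) + 2 * k4) * Hq a * \<theta>1 ^ n"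
      \<comment> \<open>If the images separate at once then \<open>n = 1\<close>, no unstable
        estimate is available for them, and the trivial bound with one factor
        \<open>1 / \<theta>1\<close> takes over.\<close>
      proof (cases m)
        case 0
        have "\<bar>ld u (F y) - ld u (F y')\<bar> \<le> 2 * c2 * 1"
          using ld_bound[OF u F_Y[OF y(2)]] ld_bound[OF u F_Y[OF y'(2)]] by linarith
        also have "\<dots> \<le> 2 * c2 * (Hq a / h0)" using Hqh h0 c2 by (intro mult_left_mono) auto
        also have "\<dots> = 2 * c2 / (h0 * \<theta>1) * Hq a * \<theta>1 ^ n" using 0 \<theta>1 by (simp add: n_def)
        also have "\<dots> \<le> (2 * c2 / h0 + 2 * c2 / (h0 * \<theta>1) + 2 * k4) * Hq a * \<theta>1 ^ n"
          using Hq0 \<theta>1 k4 c2 h0 by (intro mult_right_mono) auto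
        finally show ?thesis .
      next
        case (Suc m')
        define z z' where "z = rep (W (F y))" and "z' = rep (W (F y'))"
        have z: "z \<in> Yhat" "z \<in> Y" "W z = Fb x" using rep[OF F_Y[OF y(2)]] Fb_W[OF y(2)] y by (auto simp: z_def)
        have z': "z' \<in> Yhat" "z' \<in> Y" "W z' = Fb x'" using rep[OF F_Y[OF y'(2)]] Fb_W[OF y'(2)] y' by (auto simp: z'_def)
        obtain b where b: "b \<in> Pbar" "Fb x \<in> b" "Fb x' \<in> b"
        proof -
          have "\<exists>b\<in>Pbar. Fb x \<in> b \<and> Fb x' \<in> b"
          proof (rule ccontr)
            assume "\<not> ?thesis"
            hence n0: "\<not> (\<exists>b\<in>Pbar. (Fb ^^ 0) (Fb x) \<in> b \<and> (Fb ^^ 0) (Fb x') \<in> b)" by simp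
            hence "sep_time Pbar Fb (Fb x) (Fb x') = 0"
              unfolding sep_time_def by (subst if_P, blast, subst Least_eq_0, blast) (simp add: zero_enat_def)
            thus False using m(2) Suc by (simp add: zero_enat_def)
          qed
          thus ?thesis using that by blast
        qed
        \<comment> \<open>Within time \<open>R\<close> after a return at most \<open>n / 2\<close>
          further returns fit, so about half of the separation survives.\<close>
        define R where "R = h0 * real n / 2"
        have R: "0 \<le> R" using h0 by (simp add: R_def)
        have Rh: "R / h0 = real n / 2" using h0 by (simp add: R_def)
        \<comment> \<open>First summand: unstable divergence at equal times. Second: the flow moved
          for the difference of the two return times, controlled by the Lipschitz bound on
          \<open>H\<close>.\<close>
        define d where "d = C * \<gamma> powr (real n / 2 - 2) + C * (C * Hq a * \<gamma> powr n) powr \<eta>"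
        have d1: "dist (T r (F y)) (T r (F y')) \<le> d" if r: "0 \<le> r" "r \<le> R" for r
        proof -
          have "T r (F y) = T (r + H y) y" using T_add[OF r(1) Hn(1), of y] T_H[OF y(2)] by simp
          moreover have "T r (F y') = T (r + H y') y'" using T_add[OF r(1) Hn(2), of y'] T_H[OF y'(2)] by simp
          moreover have "dist (T (r + H y) y) (T (r + H y) y') \<le> C * \<gamma> powr (real n / 2 - 2)"
          proof -
            have "dist (T (r + H y) y) (T (r + H y) y') \<le> C * \<gamma> powr (real n - (1 + R / h0))" using r Hn R by (intro un) auto
            also have "\<dots> \<le> C * \<gamma> powr (real n / 2 - 2)" unfolding Rh using const_bounds by (intro mult_left_mono powr_mono') auto
            finally show ?thesis .
          qed
          moreover have "dist (T (r + H y) y') (T (r + H y') y') \<le> C * (C * Hq a * \<gamma> powr n) powr \<eta>"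
          proof -
            have "dist (T (r + H y) y') (T (r + H y') y') \<le> C * \<bar>(r + H y) - (r + H y')\<bar> powr \<eta>"
              using r Hn by (intro flow_holder[OF y'(1)]) auto
            also have "\<dots> \<le> C * (C * Hq a * \<gamma> powr n) powr \<eta>" using Hd const_bounds by (intro mult_left_mono powr_mono2) auto
            finally show ?thesis .
          qed
          ultimately show ?thesis using dist_triangle[of "T (r + H y) y" "T (r + H y') y'" "T (r + H y) y'"] unfolding d_def by simp
        qed
        have d2: "dist (T r z) (T r z') \<le> d" if r: "0 \<le> r" "r \<le> R" for r
        proof -
          have "dist (T r z) (T r z') \<le> C * gp \<gamma> (enat m) (Jfun T h \<tau> r z)"
            using unstable_exp[OF b(1) z(1) z'(1), of r] z z' b r(1) m by simp
          also have "\<dots> \<le> C * \<gamma> powr (real m - (1 + R / h0))"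
            using Jfun_le[OF z(2) r(1), of R] r R H_nonneg[OF z(2)] const_bounds by (intro mult_left_mono gp_enat_le) auto
          also have "\<dots> = C * \<gamma> powr (real n / 2 - 2)" unfolding Rh by (simp add: n_def field_simps)
          also have "\<dots> \<le> d" unfolding d_def using const_bounds by simp
          finally show ?thesis .
        qed
        have J1: "\<bar>J u (F y) R - J u (F y') R\<bar> \<le> d powr \<eta> * R" using d1 by (intro J_diff[OF o R] hobs_le[OF u]) auto
        have J2: "\<bar>J u z R - J u z' R\<bar> \<le> d powr \<eta> * R" using d2 by (intro J_diff[OF o R] hobs_le[OF u]) auto
        have L1: "\<bar>J u (F y) R - J u z R - ld u (F y)\<bar> \<le> c2 * q0 powr R" using ld[OF u F_Y[OF y(2)] R] by (simp add: z_def)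
        have L2: "\<bar>J u (F y') R - J u z' R - ld u (F y')\<bar> \<le> c2 * q0 powr R" using ld[OF u F_Y[OF y'(2)] R] by (simp add: z'_def)
        have tot: "\<bar>ld u (F y) - ld u (F y')\<bar> \<le> 2 * (c2 * q0 powr R) + 2 * (d powr \<eta> * R)"
          using J1 J2 L1 L2 by linarith
        have E1: "2 * (c2 * q0 powr R) \<le> 2 * c2 / h0 * Hq a * \<theta>1 ^ n"
        proof -
          have "q0 powr R = \<gamma> powr ((\<eta> * h0 / 2) * real n)" by (simp add: q0_def R_def powr_powr mult_ac)
          also have "\<dots> \<le> \<theta>1 ^ n" by (rule powr_le_\<theta>1) (simp add: \<beta>_def)
          finally have "2 * (c2 * q0 powr R) \<le> 2 * (c2 * \<theta>1 ^ n) * 1" using c2 by (simp add: mult_left_mono)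
          also have "\<dots> \<le> 2 * (c2 * \<theta>1 ^ n) * (Hq a / h0)" using Hqh h0 c2 \<theta>1 by (intro mult_left_mono) auto
          finally show ?thesis by (simp add: field_simps)
        qed
        have E2: "2 * (d powr \<eta> * R) \<le> 2 * k4 * Hq a * \<theta>1 ^ n"
        proof -
          have dd: "d \<le> k3 * Hq a * \<gamma> powr (\<eta> / 2 * real n)"
          proof -
            have "C * \<gamma> powr (real n / 2 - 2) = C / \<gamma>\<^sup>2 * \<gamma> powr (real n / 2)" using const_bounds by (simp add: powr_diff powr_numeral)
            also have "\<dots> \<le> C / \<gamma>\<^sup>2 * (\<gamma> powr (\<eta> / 2 * real n) * (Hq a / h0))"
            proof (rule mult_left_mono)
              have "\<gamma> powr (real n / 2) * 1 \<le> \<gamma> powr (\<eta> / 2 * real n) * (Hq a / h0)"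
              proof (rule mult_mono)
                have "\<eta> / 2 * real n \<le> 1 / 2 * real n" using const_bounds by (intro mult_right_mono) auto
                thus "\<gamma> powr (real n / 2) \<le> \<gamma> powr (\<eta> / 2 * real n)" using const_bounds by (intro powr_mono') auto
              qed (use Hqh h0 in auto)
              thus "\<gamma> powr (real n / 2) \<le> \<gamma> powr (\<eta> / 2 * real n) * (Hq a / h0)" by simp
            qed (use const_bounds in auto)
            finally have 1: "C * \<gamma> powr (real n / 2 - 2) \<le> C / (\<gamma>\<^sup>2 * h0) * Hq a * \<gamma> powr (\<eta> / 2 * real n)" by (simp add: mult_ac)
            have "(C * Hq a * \<gamma> powr n) powr \<eta> = (C * Hq a) powr \<eta> * \<gamma> powr (\<eta> * real n)"
              using const_bounds Hq0 by (simp add: powr_mult powr_powr mult.commute)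
            also have "\<dots> \<le> ((1 / h0 + C) * Hq a) * \<gamma> powr (\<eta> / 2 * real n)"
            proof (rule mult_mono)
              have "(C * Hq a) powr \<eta> \<le> 1 + C * Hq a" using const_bounds Hq0 by (intro powr_le_one_add) auto
              also have "\<dots> \<le> Hq a / h0 + C * Hq a" using Hqh h0 by simp
              finally show "(C * Hq a) powr \<eta> \<le> (1 / h0 + C) * Hq a" by (simp add: algebra_simps)
              have "\<eta> / 2 * real n \<le> \<eta> * real n" using const_bounds by (intro mult_right_mono) auto
              thus "\<gamma> powr (\<eta> * real n) \<le> \<gamma> powr (\<eta> / 2 * real n)" using const_bounds by (intro powr_mono') auto
            qed (use const_bounds h0 Hq0 in auto)
            finally have "C * (C * Hq a * \<gamma> powr n) powr \<eta> \<le> C * (((1 / h0 + C) * Hq a) * \<gamma> powr (\<eta> / 2 * real n))"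
              using const_bounds by (intro mult_left_mono) auto
            thus ?thesis using 1 unfolding d_def k3_def by (simp add: algebra_simps)
          qed
          have d0: "0 \<le> d" unfolding d_def using const_bounds by simp
          have "d powr \<eta> \<le> (k3 * Hq a * \<gamma> powr (\<eta> / 2 * real n)) powr \<eta>" using dd d0 const_bounds by (intro powr_mono2) auto
          also have "\<dots> = (k3 * Hq a) powr \<eta> * \<gamma> powr (\<eta>\<^sup>2 / 2 * real n)"
            using k3 Hq0 by (simp add: powr_mult powr_powr power2_eq_square mult_ac)
          also have "\<dots> \<le> ((1 / h0 + k3) * Hq a) * \<gamma> powr (\<eta>\<^sup>2 / 2 * real n)"
          proof (rule mult_right_mono)
            have "(k3 * Hq a) powr \<eta> \<le> 1 + k3 * Hq a" using const_bounds Hq0 k3 by (intro powr_le_one_add) auto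
            also have "\<dots> \<le> Hq a / h0 + k3 * Hq a" using Hqh h0 by simp
            finally show "(k3 * Hq a) powr \<eta> \<le> (1 / h0 + k3) * Hq a" by (simp add: algebra_simps)
          qed simp
          \<comment> \<open>One factor absorbs the linear growth of \<open>R\<close> in
            \<open>n\<close>, the other provides the decay \<open>\<theta>1 ^ n\<close>.\<close>
          also have "\<gamma> powr (\<eta>\<^sup>2 / 2 * real n) = \<mu> ^ n * \<mu> ^ n"
          proof -
            have "\<mu> ^ n * \<mu> ^ n = \<mu> powr (2 * real n)" using \<mu> by (simp add: powr_realpow[symmetric] powr_add[symmetric])
            also have "\<dots> = \<gamma> powr (\<eta>\<^sup>2 / 2 * real n)" by (simp add: \<mu>_def powr_powr mult.commute)
            finally show ?thesis by simp
          qed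
          finally have "d powr \<eta> * R \<le> ((1 / h0 + k3) * Hq a) * (\<mu> ^ n * \<mu> ^ n) * R" using R by (intro mult_right_mono) auto
          also have "\<dots> = (h0 / 2 * (1 / h0 + k3)) * (real n * \<mu> ^ n) * (Hq a * \<mu> ^ n)" by (simp add: R_def mult_ac)
          also have "\<dots> \<le> (h0 / 2 * (1 / h0 + k3)) * (1 / (1 - \<mu>)) * (Hq a * \<theta>1 ^ n)"
          proof (intro mult_mono mult_left_mono)
            show "real n * \<mu> ^ n \<le> 1 / (1 - \<mu>)" using \<mu> by (intro nat_mult_power_le) auto
            have "\<mu> ^ n = \<gamma> powr (\<eta>\<^sup>2 / 4 * real n)" using \<mu> by (simp add: powr_realpow[symmetric] \<mu>_def powr_powr)
            also have "\<dots> \<le> \<theta>1 ^ n" by (rule powr_le_\<theta>1) (simp add: \<beta>_def)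
            finally show "\<mu> ^ n \<le> \<theta>1 ^ n" .
          qed (use h0 k3 \<mu> Hq0 in auto)
          also have "\<dots> = k4 * Hq a * \<theta>1 ^ n" by (simp add: k4_def)
          finally show ?thesis by simp
        qed
        have "\<bar>ld u (F y) - ld u (F y')\<bar> \<le> (2 * c2 / h0 + 2 * k4) * Hq a * \<theta>1 ^ n"
          using tot E1 E2 by (simp add: algebra_simps)
        also have "\<dots> \<le> (2 * c2 / h0 + 2 * c2 / (h0 * \<theta>1) + 2 * k4) * Hq a * \<theta>1 ^ n"
          using Hq0 \<theta>1 c2 h0 by (intro mult_right_mono) auto
        finally show ?thesis .
      qed
      have "\<bar>Vh u x - Vh u x'\<bar> \<le> k1 * Hq a * \<theta>1 ^ n + (2 * c2 / h0 + 2 * c2 / (h0 * \<theta>1) + 2 * k4) * Hq a * \<theta>1 ^ n"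
        using A B unfolding Vh_def y_def[symmetric] y'_def[symmetric] by linarith
      also have "\<dots> = (k1 + 2 * c2 / h0 + 2 * c2 / (h0 * \<theta>1) + 2 * k4) * (Hq a * \<theta>1 ^ n)" by (simp add: algebra_simps)
      also have "\<dots> \<le> K * (Hq a * \<theta>1 ^ n)" using K(3) Hq0 \<theta>1 by (intro mult_right_mono) auto
      finally show ?thesis unfolding gpn by (simp add: mult.assoc)
    qed
  qed
  thus ?thesis using K(1) by blast
qed

end

section \<open>Martingale approximation\<close>

text \<open>The coboundary telescopes to at most \<open>2 * K\<close>, and at most \<open>N\<close>
  errors of size \<open>K / N\<close> give the third \<open>K\<close>.\<close>

lemma perturbed_sum:
  fixes a b c e :: "nat \<Rightarrow> real"
  assumes eq: "\<And>j. a j = b j + (c (Suc j) - c j) + e j" and c: "\<And>j. \<bar>c j\<bar> \<le> K" and e: "\<And>j. \<bar>e j\<bar> \<le> K / real N"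
    and n: "n \<le> N" "0 < N"
  shows "\<bar>(\<Sum>j<n. a j) - (\<Sum>j<n. b j)\<bar> \<le> 3 * K"
proof -
  have K: "0 \<le> K" using c[of 0] by linarith
  have "(\<Sum>j<n. a j) - (\<Sum>j<n. b j) = (c n - c 0) + (\<Sum>j<n. e j)"
    unfolding eq by (simp add: sum.distrib sum_lessThan_telescope)
  moreover have "\<bar>\<Sum>j<n. e j\<bar> \<le> K"
  proof -
    have "\<bar>\<Sum>j<n. e j\<bar> \<le> (\<Sum>j<n. \<bar>e j\<bar>)" by (rule sum_abs)
    also have "\<dots> \<le> real (card {..<n}) * (K / real N)" by (rule sum_bounded_above) (rule e)
    also have "\<dots> \<le> real N * (K / real N)" using n K by (intro mult_right_mono) auto
    finally show ?thesis using n by simp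
  qed
  ultimately show ?thesis using c[of n] c[of 0] by linarith
qed

lemma summation_by_parts:
  fixes A c :: "nat \<Rightarrow> real"
  shows "(\<Sum>j<n. A j * (c (Suc j) - c j)) = A n * c n - A 0 * c 0 - (\<Sum>j<n. (A (Suc j) - A j) * c (Suc j))"
  by (induction n) (auto simp: algebra_simps)

text \<open>The outer coboundary is removed by summation by parts. What is left are constants times
  sums of absolute values, of order \<open>N\<close>, which is the order allowed for an iterated
  sum.\<close>

lemma perturbed_iterated_sum:
  fixes a b c e :: "nat \<Rightarrow> real"
  assumes eq: "\<And>j. a j = b j + (c (Suc j) - c j) + e j" and c: "\<And>j. \<bar>c j\<bar> \<le> K" and e: "\<And>j. \<bar>e j\<bar> \<le> K / real N"
    and eq': "\<And>j. a' j = b' j + (c' (Suc j) - c' j) + e' j" and c': "\<And>j. \<bar>c' j\<bar> \<le> K" and e': "\<And>j. \<bar>e' j\<bar> \<le> K / real N"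
    and n: "n \<le> N" "0 < N"
  shows "\<bar>\<Sum>j<n. (\<Sum>i<j. a i) * a' j\<bar> \<le> \<bar>\<Sum>j<n. (\<Sum>i<j. b i) * b' j\<bar> + (3 * K * (\<Sum>j<N. \<bar>b' j\<bar>) + 3 * K * (\<Sum>j<N. \<bar>a j\<bar>))"
proof -
  have K: "0 \<le> K" using c[of 0] by linarith
  define A where "A j = (\<Sum>i<j. a i)" for j
  define B where "B j = (\<Sum>i<j. b i)" for j
  define S where "S = (\<Sum>j<N. \<bar>a j\<bar>)"
  define S' where "S' = (\<Sum>j<N. \<bar>b' j\<bar>)"
  have AS: "\<bar>A j\<bar> \<le> S" if "j \<le> N" for j
  proof -
    have "\<bar>A j\<bar> \<le> (\<Sum>i<j. \<bar>a i\<bar>)" unfolding A_def by (rule sum_abs)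
    also have "\<dots> \<le> S" unfolding S_def using that by (intro sum_mono2) auto
    finally show ?thesis .
  qed
  have S0: "0 \<le> S" "0 \<le> S'" by (auto simp: S_def S'_def sum_nonneg)
  have AB: "\<bar>A j - B j\<bar> \<le> 3 * K" if "j \<le> N" for j
    unfolding A_def B_def by (rule perturbed_sum[where a=a and b=b and c=c and e=e and K=K and N=N, OF eq c e that n(2)])
  have "(\<Sum>j<n. A j * a' j) = (\<Sum>j<n. B j * b' j) + (\<Sum>j<n. (A j - B j) * b' j) + (\<Sum>j<n. A j * (c' (Suc j) - c' j)) + (\<Sum>j<n. A j * e' j)"
    unfolding eq' by (simp add: sum.distrib[symmetric] algebra_simps)
  moreover have "\<bar>\<Sum>j<n. (A j - B j) * b' j\<bar> \<le> 3 * K * S'"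
  proof -
    have "\<bar>\<Sum>j<n. (A j - B j) * b' j\<bar> \<le> (\<Sum>j<n. \<bar>(A j - B j) * b' j\<bar>)" by (rule sum_abs)
    also have "\<dots> \<le> (\<Sum>j<n. 3 * K * \<bar>b' j\<bar>)" unfolding abs_mult using AB n by (intro sum_mono mult_right_mono) auto
    also have "\<dots> = 3 * K * (\<Sum>j<n. \<bar>b' j\<bar>)" by (simp add: sum_distrib_left)
    also have "\<dots> \<le> 3 * K * S'" unfolding S'_def using n K by (intro mult_left_mono sum_mono2) auto
    finally show ?thesis .
  qed
  moreover have "\<bar>\<Sum>j<n. A j * (c' (Suc j) - c' j)\<bar> \<le> 2 * (K * S)"
  proof -
    have "(\<Sum>j<n. A j * (c' (Suc j) - c' j)) = A n * c' n - (\<Sum>j<n. a j * c' (Suc j))"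
      unfolding summation_by_parts by (simp add: A_def)
    moreover have "\<bar>A n * c' n\<bar> \<le> S * K" unfolding abs_mult using AS[OF n(1)] c' S0 by (intro mult_mono) auto
    moreover have "\<bar>\<Sum>j<n. a j * c' (Suc j)\<bar> \<le> K * S"
    proof -
      have "\<bar>\<Sum>j<n. a j * c' (Suc j)\<bar> \<le> (\<Sum>j<n. \<bar>a j * c' (Suc j)\<bar>)" by (rule sum_abs)
      also have "\<dots> \<le> (\<Sum>j<n. \<bar>a j\<bar> * K)" unfolding abs_mult using c' by (intro sum_mono mult_left_mono) auto
      also have "\<dots> = K * (\<Sum>j<n. \<bar>a j\<bar>)" by (simp add: sum_distrib_left mult.commute)
      also have "\<dots> \<le> K * S" unfolding S_def using n K by (intro mult_left_mono sum_mono2) auto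
      finally show ?thesis .
    qed
    ultimately show ?thesis by (simp add: mult.commute)
  qed
  moreover have "\<bar>\<Sum>j<n. A j * e' j\<bar> \<le> K * S"
  proof -
    have "\<bar>\<Sum>j<n. A j * e' j\<bar> \<le> (\<Sum>j<n. \<bar>A j * e' j\<bar>)" by (rule sum_abs)
    also have "\<dots> \<le> real (card {..<n}) * (S * (K / real N))"
      unfolding abs_mult using AS e' n S0 by (intro sum_bounded_above mult_mono) auto
    also have "\<dots> \<le> real N * (S * (K / real N))" using n K S0 by (intro mult_right_mono mult_nonneg_nonneg) auto
    finally show ?thesis using n by (simp add: mult.commute)
  qed
  ultimately show ?thesis unfolding A_def[symmetric] B_def[symmetric] S_def[symmetric] S'_def[symmetric] by (simp add: algebra_simps)
qed

context hyperbolic_flow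
begin

lemma mpt_\<mu>b: "mpt \<mu>b Fb"
proof -
  obtain g \<theta> Cd c0 where "gm_system \<mu>b Fb Pbar g \<theta> Cd c0" using gm_exists[of "1/2"] by auto
  thus ?thesis by (rule gm_system.axioms(1))
qed

sublocale YB: mpt \<mu>b Fb by (rule mpt_\<mu>b)

lemma \<gamma>_le_\<theta>1: "\<gamma> \<le> \<theta>1"
proof -
  have "\<gamma> powr 1 \<le> \<gamma> powr \<beta>" using const_bounds by (intro powr_mono') (auto simp: \<beta>_def)
  thus ?thesis using const_bounds by (simp add: \<theta>1_def)
qed

text \<open>Joins the transfer function \<open>ld u\<close> along leaves with the coboundary on the
  quotient. \<open>K\<close> and \<open>A\<close> are fixed before the observable and
  \<open>N\<close>, so the moment bounds depend on the system alone.\<close>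

theorem leafwise_constant_decomposition:
  assumes lc: "AE y in \<mu>Y. H y = H (rep (W y))" and p: "2 \<le> p" and Hp: "integrable \<mu>Y (\<lambda>y. \<bar>H y\<bar> powr p)"
  shows "\<exists>K A. 0 < A \<and> (\<forall>u N. hobs u \<longrightarrow> (\<integral>x. u x \<partial>\<mu>M) = 0 \<longrightarrow> 0 < N \<longrightarrow>
    (\<exists>d. d \<in> borel_measurable \<mu>b \<and> YB.reverse_diff d \<and> integrable \<mu>b (\<lambda>x. \<bar>d x\<bar> powr p) \<and>
       (\<integral>x. \<bar>d x\<bar> powr p \<partial>\<mu>b) \<le> A powr p \<and>
       (AE y in \<mu>Y. \<exists>c e. \<forall>j. J u ((F ^^ j) y) (H ((F ^^ j) y)) = d ((Fb ^^ j) (W y)) + (c (Suc j) - c j) + e j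
          \<and> \<bar>c j\<bar> \<le> K \<and> \<bar>e j\<bar> \<le> K / real N)))"
proof -
  obtain g \<theta> Cd c0 where t: "\<theta>1 \<le> \<theta>" and gm: "gm_system \<mu>b Fb Pbar g \<theta> Cd c0"
    using gm_exists[OF \<theta>1] by blast
  interpret gm: gm_system \<mu>b Fb Pbar g \<theta> Cd c0 by (rule gm)
  obtain K0 where K0: "0 < K0" and Vb: "\<And>u a x. hobs u \<Longrightarrow> a \<in> Pbar \<Longrightarrow> x \<in> a \<Longrightarrow> \<bar>Vh u x\<bar> \<le> K0 * Hq a"
    and Vl: "\<And>u a x x'. hobs u \<Longrightarrow> a \<in> Pbar \<Longrightarrow> x \<in> a \<Longrightarrow> x' \<in> a \<Longrightarrow> \<bar>Vh u x - Vh u x'\<bar> \<le> K0 * Hq a * gp \<theta>1 (sep_time Pbar Fb x x') 0"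
    using Vh_regular by blast
  have Hq0: "0 \<le> Hq a" if aP: "a \<in> Pbar" for a
  proof -
    obtain x where "x \<in> a" using gm.P_ne[OF aP] by blast
    from Hq_le(2)[OF aP this] show ?thesis using h0 by linarith
  qed
  \<comment> \<open>Measurable version of \<open>H\<close> on the quotient; constancy on leaves
    identifies its pullback with \<open>H\<close>, and so transports the integrability of
    \<open>H\<close>.\<close>
  define Ht where "Ht x = indicator gm.\<Omega> x * H (rep x)" for x
  have Ht_meas [measurable]: "Ht \<in> borel_measurable \<mu>b" unfolding Ht_def
  proof (rule gm.lipschitz_measurable[where b="\<lambda>a. C * Hq a"])
    fix a x y assume a: "a \<in> Pbar" "x \<in> a" "y \<in> a"
    have "\<bar>H (rep x) - H (rep y)\<bar> \<le> C * Hq a * gp \<gamma> (sep_time Pbar Fb x y) 0" by (rule H_rep_diff(1)[OF a])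
    also have "\<dots> \<le> C * Hq a * gm.rho x y" unfolding gm.rho_def
      using const_bounds \<gamma>_le_\<theta>1 t Hq0[OF a(1)] by (intro mult_left_mono gp_mono_base) auto
    finally show "\<bar>H (rep x) - H (rep y)\<bar> \<le> C * Hq a * gm.rho x y" .
  qed
  have HtW: "AE y in \<mu>Y. Ht (W y) = H y" using AE_\<mu>b[OF gm.AE_\<Omega>] lc by eventually_elim (simp add: Ht_def)
  have Ht_nonneg: "0 \<le> Ht x" for x
  proof (cases "x \<in> gm.\<Omega>")
    case True
    then obtain w where "w \<in> Y" "x = W w" using gm.\<Omega>_space[OF True] unfolding space_\<mu>b by blast
    thus ?thesis using H_nonneg[OF rep(3)] by (simp add: Ht_def)
  qed (simp add: Ht_def)
  have Ht_mY [measurable]: "(\<lambda>y. Ht (W y)) \<in> borel_measurable \<mu>Y" by (rule measurable_compose[OF W_\<mu>b Ht_meas])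
  have Ht_int: "integrable \<mu>b Ht"
  proof -
    have "integrable \<mu>Y (\<lambda>y. Ht (W y)) = integrable \<mu>Y H" using HtW by (intro integrable_cong_AE) auto
    hence "integrable \<mu>Y (\<lambda>y. Ht (W y))" using H_int by simp
    thus ?thesis using Ht_meas by (subst integrable_distr_eq[OF W_meas]) auto
  qed
  have Ht_p: "integrable \<mu>b (\<lambda>x. \<bar>Ht x\<bar> powr p)"
  proof -
    have "integrable \<mu>Y (\<lambda>y. \<bar>Ht (W y)\<bar> powr p) = integrable \<mu>Y (\<lambda>y. \<bar>H y\<bar> powr p)"
      by (rule integrable_cong_AE) (use HtW in \<open>auto elim!: eventually_mono\<close>)
    hence i: "integrable \<mu>Y (\<lambda>y. \<bar>Ht (W y)\<bar> powr p)" using Hp by simp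
    have m: "(\<lambda>x. \<bar>Ht x\<bar> powr p) \<in> borel_measurable (qspace W Y)" using Ht_meas by simp
    show ?thesis using i integrable_distr_eq[OF W_meas m] by simp
  qed
  have \<Omega>P: "\<exists>a\<in>Pbar. x \<in> a" if "x \<in> gm.\<Omega>" for x by (rule gm.\<Omega>_P[OF that])
  define b where "b a = K0 * Hq a" for a
  have b0: "0 \<le> b a" if "a \<in> Pbar" for a using Hq0[OF that] K0 by (simp add: b_def)
  have bi: "integrable (count_space Pbar) (\<lambda>a. measure \<mu>b a * b a)"
  proof (rule Bochner_Integration.integrable_bound)
    show "integrable (count_space Pbar) (\<lambda>a. K0 * (\<integral>x. indicator a x * Ht x \<partial>\<mu>b))"
      by (intro integrable_mult_right gm.partition_sum(1)[OF Ht_int])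
    have "\<bar>measure \<mu>b a * b a\<bar> \<le> \<bar>K0 * (\<integral>x. indicator a x * Ht x \<partial>\<mu>b)\<bar>" if a: "a \<in> Pbar" for a
    proof -
      have as [measurable]: "a \<in> sets \<mu>b" by (rule gm.P_sets[OF a])
      have "measure \<mu>b a * Hq a = (\<integral>x. indicator a x * Hq a \<partial>\<mu>b)" using as by simp
      also have "\<dots> \<le> (\<integral>x. indicator a x * Ht x \<partial>\<mu>b)"
      proof (rule integral_mono_AE)
        show "integrable \<mu>b (\<lambda>x. indicator a x * Hq a)"
          using as by (intro integrable_mult_left) (simp add: integrable_real_indicator less_top[symmetric] YB.emeasure_eq_measure)
        show "integrable \<mu>b (\<lambda>x. indicator a x * Ht x)" using integrable_mult_indicator[OF as Ht_int] by simp
        show "AE x in \<mu>b. indicator a x * Hq a \<le> indicator a x * Ht x"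
          using gm.AE_\<Omega> by eventually_elim (use Hq_le(1)[OF a] in \<open>auto simp: Ht_def indicator_def\<close>)
      qed
      finally have "K0 * (measure \<mu>b a * Hq a) \<le> K0 * (\<integral>x. indicator a x * Ht x \<partial>\<mu>b)" using K0 by (intro mult_left_mono) auto
      moreover have "0 \<le> measure \<mu>b a * b a" using b0[OF a] by simp
      ultimately show ?thesis by (simp add: b_def mult_ac)
    qed
    thus "AE a in count_space Pbar. norm (measure \<mu>b a * b a) \<le> norm (K0 * (\<integral>x. indicator a x * Ht x \<partial>\<mu>b))"
      by (simp only: AE_count_space real_norm_def) blast
  qed simp
  obtain K1 where K1: "0 < K1" and mc: "\<And>\<phi> N. integrable \<mu>b \<phi> \<Longrightarrow> gm.wreg b \<phi> \<Longrightarrow> (\<integral>x. \<phi> x \<partial>\<mu>b) = 0 \<Longrightarrow> 0 < N \<Longrightarrow>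
    (\<exists>d \<xi> r. d \<in> borel_measurable \<mu>b \<and> YB.reverse_diff d \<and>
      (\<forall>x\<in>gm.\<Omega>. \<phi> x = d x - \<xi> x + \<xi> (Fb x) + r (Fb x) \<and> \<bar>\<xi> x\<bar> \<le> K1 \<and> \<bar>r x\<bar> \<le> K1 / real N))"
    using gm.martingale_coboundary[OF b0 bi] by blast
  define D where "D x = K0 * Ht x + 3 * K1" for x
  have D_nonneg: "0 \<le> D x" for x using Ht_nonneg K0 K1 by (simp add: D_def)
  have D_meas [measurable]: "D \<in> borel_measurable \<mu>b" unfolding D_def by measurable
  have Dp: "integrable \<mu>b (\<lambda>x. \<bar>D x\<bar> powr p)" unfolding D_def
  proof (rule YB.integrable_powr_add)
    show "integrable \<mu>b (\<lambda>x. \<bar>K0 * Ht x\<bar> powr p)" using Ht_p K0 by (simp add: abs_mult powr_mult)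
  qed (use p in auto)
  \<comment> \<open>The function \<open>D\<close> dominates all the martingale differences and is
    built from \<open>H\<close> only; the added 1 makes \<open>A\<close> positive.\<close>
  define A where "A = ((\<integral>x. \<bar>D x\<bar> powr p \<partial>\<mu>b) + 1) powr (1 / p)"
  have A0: "0 \<le> (\<integral>x. \<bar>D x\<bar> powr p \<partial>\<mu>b)" by (intro integral_nonneg_AE) auto
  have A: "0 < A" "A powr p = (\<integral>x. \<bar>D x\<bar> powr p \<partial>\<mu>b) + 1"
  proof -
    have pos: "0 < (\<integral>x. \<bar>D x\<bar> powr p \<partial>\<mu>b) + 1" using A0 by linarith
    thus "0 < A" unfolding A_def by simp
    show "A powr p = (\<integral>x. \<bar>D x\<bar> powr p \<partial>\<mu>b) + 1" using pos p unfolding A_def by (simp only: powr_powr) simp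
  qed
  have "\<exists>d. d \<in> borel_measurable \<mu>b \<and> YB.reverse_diff d \<and> integrable \<mu>b (\<lambda>x. \<bar>d x\<bar> powr p) \<and>
       (\<integral>x. \<bar>d x\<bar> powr p \<partial>\<mu>b) \<le> A powr p \<and>
       (AE y in \<mu>Y. \<exists>c e. \<forall>j. J u ((F ^^ j) y) (H ((F ^^ j) y)) = d ((Fb ^^ j) (W y)) + (c (Suc j) - c j) + e j
          \<and> \<bar>c j\<bar> \<le> K1 + c2 \<and> \<bar>e j\<bar> \<le> (K1 + c2) / real N)"
    if u: "hobs u" and mean: "(\<integral>x. u x \<partial>\<mu>M) = 0" and N: "0 < N" for u N
  proof -
    have o: "obs u" by (rule hobsD(1)[OF u])
    define \<phi> where "\<phi> x = indicator gm.\<Omega> x * Vh u x" for x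
    have Vrho: "\<bar>Vh u x - Vh u y\<bar> \<le> b a * gm.rho x y" if a: "a \<in> Pbar" "x \<in> a" "y \<in> a" for a x y
    proof -
      have "\<bar>Vh u x - Vh u y\<bar> \<le> K0 * Hq a * gp \<theta>1 (sep_time Pbar Fb x y) 0" by (rule Vl[OF u a])
      also have "\<dots> \<le> b a * gm.rho x y" unfolding gm.rho_def b_def
        using t \<theta>1 K0 Hq0[OF a(1)] by (intro mult_left_mono gp_mono_base) auto
      finally show ?thesis .
    qed
    have \<phi>_meas [measurable]: "\<phi> \<in> borel_measurable \<mu>b" unfolding \<phi>_def
      by (rule gm.lipschitz_measurable[where b=b]) (rule Vrho)
    have \<phi>_le: "\<bar>\<phi> x\<bar> \<le> K0 * Ht x" if x: "x \<in> gm.\<Omega>" for x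
    proof -
      obtain a where a: "a \<in> Pbar" "x \<in> a" using \<Omega>P[OF x] by blast
      have "\<bar>\<phi> x\<bar> \<le> K0 * Hq a" using Vb[OF u a] x by (simp add: \<phi>_def)
      also have "\<dots> \<le> K0 * Ht x" using Hq_le(1)[OF a] x K0 by (simp add: Ht_def)
      finally show ?thesis .
    qed
    have "AE x in \<mu>b. \<bar>\<phi> x\<bar> \<le> K0 * Ht x" using gm.AE_\<Omega> by eventually_elim (rule \<phi>_le)
    from abs_integral_le(1)[OF \<phi>_meas integrable_mult_right[OF Ht_int, of K0] this]
    have \<phi>_int: "integrable \<mu>b \<phi>" .
    have wr: "gm.wreg b \<phi>" unfolding gm.wreg_def
    proof (intro ballI conjI)
      fix a x assume a: "a \<in> Pbar" and x: "x \<in> gm.\<Omega> \<inter> a"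
      show "\<bar>\<phi> x\<bar> \<le> b a" using Vb[OF u a, of x] x by (simp add: \<phi>_def b_def)
      fix y assume y: "y \<in> gm.\<Omega> \<inter> a"
      show "\<bar>\<phi> x - \<phi> y\<bar> \<le> b a * gm.rho x y" using Vrho[OF a, of x y] x y by (simp add: \<phi>_def)
    qed
    define good where "good y \<longleftrightarrow> y \<in> Y \<and> (\<forall>j. W ((F ^^ j) y) \<in> gm.\<Omega> \<and> H ((F ^^ j) y) = H (rep (W ((F ^^ j) y))))" for y
    have AEgood: "AE y in \<mu>Y. good y"
      using YF.AE_Gn[OF AE_\<mu>b[OF gm.AE_\<Omega>]] YF.AE_Gn[OF lc] AE_space
      by eventually_elim (simp add: good_def space_\<mu>Y)
    have Ueq: "J u ((F ^^ j) y) (H ((F ^^ j) y)) = \<phi> ((Fb ^^ j) (W y)) + ld u ((F ^^ j) y) - ld u ((F ^^ Suc j) y)" if y: "good y" for y j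
      using U_Vh[OF u Fn_Y, of y j] y by (simp add: good_def \<phi>_def Fbn_W)
    \<comment> \<open>The difference between the induced observable and \<phi> is a coboundary of
      \<open>ld u\<close>, which is given by choice. Instead of integrating \<open>ld u\<close>, the
      telescoped sum over \<open>n\<close> returns is bounded by \<open>2 * c2\<close>, so
      \<open>n\<close> times the mean stays bounded for all \<open>n\<close>.\<close>
    have \<phi>0: "(\<integral>x. \<phi> x \<partial>\<mu>b) = 0"
    proof -
      define k where "k y = J u y (H y) - \<phi> (W y)" for y
      have \<phi>W: "integrable \<mu>Y (\<lambda>y. \<phi> (W y))" using \<phi>_int by (subst (asm) integrable_distr_eq[OF W_meas]) auto
      have ki: "integrable \<mu>Y k" unfolding k_def using U_int[OF o] \<phi>W by auto
      have kj: "integrable \<mu>Y (\<lambda>y. k ((F ^^ j) y))" "(\<integral>y. k ((F ^^ j) y) \<partial>\<mu>Y) = (\<integral>y. k y \<partial>\<mu>Y)" for j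
        using mpt.integrable_G[OF YF.mpt_Gn ki] mpt.integral_G[OF YF.mpt_Gn borel_measurable_integrable[OF ki]] by auto
      have "real n * \<bar>\<integral>y. k y \<partial>\<mu>Y\<bar> \<le> 2 * c2" for n :: nat
      proof -
        have "(\<integral>y. (\<Sum>j<n. k ((F ^^ j) y)) \<partial>\<mu>Y) = n * (\<integral>y. k y \<partial>\<mu>Y)" using kj by simp
        moreover have "\<bar>\<integral>y. (\<Sum>j<n. k ((F ^^ j) y)) \<partial>\<mu>Y\<bar> \<le> (\<integral>y. 2 * c2 \<partial>\<mu>Y)"
        proof (rule abs_integral_le(2))
          show "(\<lambda>y. \<Sum>j<n. k ((F ^^ j) y)) \<in> borel_measurable \<mu>Y"
            using kj(1) by (intro borel_measurable_integrable) auto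
          show "AE y in \<mu>Y. \<bar>\<Sum>j<n. k ((F ^^ j) y)\<bar> \<le> 2 * c2" using AEgood
          proof eventually_elim
            case (elim y)
            hence y: "y \<in> Y" by (simp add: good_def)
            have "(\<Sum>j<n. k ((F ^^ j) y)) = (\<Sum>j<n. ld u ((F ^^ j) y) - ld u ((F ^^ Suc j) y))"
              using Ueq[OF elim] Fbn_W[OF y] by (intro sum.cong refl) (simp add: k_def)
            also have "\<dots> = ld u y - ld u ((F ^^ n) y)"
              using sum_lessThan_telescope'[of "\<lambda>j. ld u ((F ^^ j) y)" n] by simp
            finally show ?case using ld_bound[OF u y] ld_bound[OF u Fn_Y[OF y, of n]] by linarith
          qed
        qed simp
        ultimately show ?thesis by (simp add: abs_mult Y.prob_space)
      qed
      hence "\<not> 0 < \<bar>\<integral>y. k y \<partial>\<mu>Y\<bar>"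
        using ex_less_of_nat_mult[of "\<bar>\<integral>y. k y \<partial>\<mu>Y\<bar>" "2 * c2"] by (metis linorder_not_less)
      hence "(\<integral>y. \<phi> (W y) \<partial>\<mu>Y) = (\<integral>y. J u y (H y) \<partial>\<mu>Y)" unfolding k_def using U_int[OF o] \<phi>W by simp
      moreover have "(\<integral>x. \<phi> x \<partial>\<mu>b) = (\<integral>y. \<phi> (W y) \<partial>\<mu>Y)" by (rule integral_distr[OF W_meas]) (use \<phi>_meas in simp)
      ultimately show ?thesis using U_mean_zero[OF o mean] by simp
    qed
    obtain d \<xi> r where d [measurable]: "d \<in> borel_measurable \<mu>b" and rd: "YB.reverse_diff d"
      and dec: "\<And>x. x \<in> gm.\<Omega> \<Longrightarrow> \<phi> x = d x - \<xi> x + \<xi> (Fb x) + r (Fb x)"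
      and \<xi>: "\<And>x. x \<in> gm.\<Omega> \<Longrightarrow> \<bar>\<xi> x\<bar> \<le> K1" and r: "\<And>x. x \<in> gm.\<Omega> \<Longrightarrow> \<bar>r x\<bar> \<le> K1 / real N"
      using mc[OF \<phi>_int wr \<phi>0 N] by blast
    have dD: "\<bar>d x\<bar> \<le> D x" if x: "x \<in> gm.\<Omega>" for x
    proof -
      have "K1 / real N \<le> K1" using N K1 by (simp add: divide_le_eq mult_le_cancel_left1)
      thus ?thesis using dec[OF x] \<xi>[OF x] \<xi>[OF gm.\<Omega>_G[OF x]] r[OF gm.\<Omega>_G[OF x]] \<phi>_le[OF x] unfolding D_def by linarith
    qed
    have dDp: "AE x in \<mu>b. \<bar>d x\<bar> powr p \<le> \<bar>D x\<bar> powr p"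
      using gm.AE_\<Omega>
    proof eventually_elim
      case (elim x)
      show ?case using dD[OF elim] p by (intro powr_mono2) auto
    qed
    have dp: "integrable \<mu>b (\<lambda>x. \<bar>d x\<bar> powr p)"
      by (rule Bochner_Integration.integrable_bound[OF Dp]) (use dDp in auto)
    have dA: "(\<integral>x. \<bar>d x\<bar> powr p \<partial>\<mu>b) \<le> A powr p" using integral_mono_AE[OF dp Dp dDp] A(2) by linarith
    have "AE y in \<mu>Y. \<exists>c e. \<forall>j. J u ((F ^^ j) y) (H ((F ^^ j) y)) = d ((Fb ^^ j) (W y)) + (c (Suc j) - c j) + e j
          \<and> \<bar>c j\<bar> \<le> K1 + c2 \<and> \<bar>e j\<bar> \<le> (K1 + c2) / real N"
      using AEgood
    proof eventually_elim
      case (elim y)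
      hence y: "y \<in> Y" by (simp add: good_def)
      define x where "x j = (Fb ^^ j) (W y)" for j
      have x: "x j \<in> gm.\<Omega>" "x (Suc j) = Fb (x j)" for j using elim Fbn_W[OF y, of j] by (auto simp: x_def good_def)
      \<comment> \<open>The two coboundaries, from the quotient and from the leaves, become one
        sequence along the orbit.\<close>
      define c where "c j = \<xi> (x j) - ld u ((F ^^ j) y)" for j
      define e where "e j = r (x (Suc j))" for j
      have "J u ((F ^^ j) y) (H ((F ^^ j) y)) = d (x j) + (c (Suc j) - c j) + e j" for j
        using Ueq[OF elim, of j] dec[OF x(1)[of j]] x(2)[of j] by (simp add: x_def[symmetric] c_def e_def)
      moreover have "\<bar>c j\<bar> \<le> K1 + c2" for j using \<xi>[OF x(1)[of j]] ld_bound[OF u Fn_Y[OF y, of j]] unfolding c_def by linarith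
      moreover have "\<bar>e j\<bar> \<le> (K1 + c2) / real N" for j
      proof -
        have "K1 / real N \<le> (K1 + c2) / real N" using c2 by (intro divide_right_mono) auto
        thus ?thesis using r[OF x(1)[of "Suc j"]] unfolding e_def by linarith
      qed
      ultimately show ?case unfolding x_def by blast
    qed
    thus ?thesis using d rd dp dA by blast
  qed
  thus ?thesis using A(1) by blast
qed

end

section \<open>Iterated integrals along orbits\<close>

context semiflow
begin

definition Q :: "('m \<Rightarrow> real) \<Rightarrow> ('m \<Rightarrow> real) \<Rightarrow> 'm \<Rightarrow> real \<Rightarrow> real" where
  "Q u v x s = (\<integral>r. indicator {0..s} r * (J u x r * v (T (max 0 r) x)) \<partial>lborel)"

lemma J_path_meas: "obs u \<Longrightarrow> (\<lambda>r. J u x r) \<in> borel_measurable borel"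
  by (rule J_meas) auto

lemma J_abs_le: "obs u \<Longrightarrow> 0 \<le> a \<Longrightarrow> r \<in> {a..b} \<Longrightarrow> \<bar>J u x r\<bar> \<le> b"
  using J_bound[of u r x] by auto

lemma Q_integrable:
  assumes "obs u" "obs v" "0 \<le> a"
  shows "integrable lborel (\<lambda>r. indicator {a..b} r * (J u x r * v (T (max 0 r) x)))"
  by (rule obs_integrable[OF assms(2) J_path_meas[OF assms(1)]]) (rule J_abs_le[OF assms(1,3)])

lemma Q_bound: assumes "obs u" "obs v" "0 \<le> t" shows "\<bar>Q u v x t\<bar> \<le> t\<^sup>2"
proof -
  have "\<bar>Q u v x t\<bar> \<le> (\<integral>r. indicator {0..t} r * t \<partial>lborel)"
    unfolding Q_def
  proof (rule abs_integral_le(2))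
    show "(\<lambda>r. indicator {0..t} r * (J u x r * v (T (max 0 r) x))) \<in> borel_measurable lborel"
      using Q_integrable[OF assms(1,2)] by (intro borel_measurable_integrable) auto
    show "integrable lborel (\<lambda>r. indicator {0..t} r * t)"
      by (intro integrable_mult_left integrable_real_indicator) (auto simp: emeasure_lborel_Icc_eq)
    have "\<bar>J u x r * v (T (max 0 r) x)\<bar> \<le> t * 1" if "r \<in> {0..t}" for r
      unfolding abs_mult using J_abs_le[OF assms(1) _ that] obsD(2)[OF assms(2)] assms(3) by (intro mult_mono) auto
    thus "AE r in lborel. \<bar>indicator {0..t} r * (J u x r * v (T (max 0 r) x))\<bar> \<le> indicator {0..t} r * t"
      by (auto simp: indicator_def)
  qed
  thus ?thesis using assms(3) by (simp add: power2_eq_square)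
qed

text \<open>Chen's relation in continuous time, the counterpart of
  \<open>iterated_sum_split\<close>.\<close>

lemma Q_add:
  assumes u: "obs u" and v: "obs v" and s: "0 \<le> s" and t: "0 \<le> t"
  shows "Q u v x (s + t) = Q u v x s + J u x s * J v (T s x) t + Q u v (T s x) t"
proof -
  have m: "(\<lambda>r. J u x r * v (T (max 0 r) x)) \<in> borel_measurable borel"
    using J_path_meas[OF u] obs_path_meas[OF v] by (rule borel_measurable_times)
  have "Q u v x (s + t) = Q u v x s + (\<integral>r. indicator {s..s + t} r * (J u x r * v (T (max 0 r) x)) \<partial>lborel)"
    unfolding Q_def using s t by (intro integral_split Q_integrable u v m) auto
  also have "(\<integral>r. indicator {s..s + t} r * (J u x r * v (T (max 0 r) x)) \<partial>lborel)
     = (\<integral>r. indicator {0..t} r * (J u x (s + r) * v (T (max 0 (s + r)) x)) \<partial>lborel)"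
    by (rule integral_shift)
  also have "\<dots> = (\<integral>r. J u x s * (indicator {0..t} r * v (T (max 0 r) (T s x)))
      + indicator {0..t} r * (J u (T s x) r * v (T (max 0 r) (T s x))) \<partial>lborel)"
  proof (rule Bochner_Integration.integral_cong[OF refl])
    fix r :: real
    have "J u x (s + r) = J u x s + J u (T s x) r" "T (s + r) x = T r (T s x)" if "0 \<le> r"
      using J_add[OF u s that, of x] T_add[OF that s, of x] by (simp_all add: add.commute)
    thus "indicator {0..t} r * (J u x (s + r) * v (T (max 0 (s + r)) x)) =
        J u x s * (indicator {0..t} r * v (T (max 0 r) (T s x))) + indicator {0..t} r * (J u (T s x) r * v (T (max 0 r) (T s x)))"
      using s by (auto simp: indicator_def max_def algebra_simps)
  qed
  also have "\<dots> = J u x s * J v (T s x) t + Q u v (T s x) t"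
    using obs_integrable1[OF v] Q_integrable[OF u v, of 0] by (simp add: J_def[of v] Q_def)
  finally show ?thesis by simp
qed

lemma Q_0: assumes "obs u" "obs v" shows "Q u v x 0 = 0"
  using Q_bound[OF assms, of 0 x] by simp

lemma Q_meas [measurable (raw)]:
  assumes u: "obs u" and v: "obs v" and [measurable]: "b \<in> measurable M borel"
  shows "(\<lambda>z. Q u v (b z) t) \<in> borel_measurable M"
proof -
  have [measurable]: "v \<in> borel_measurable borel" using obsD(1)[OF v] .
  have [measurable]: "(\<lambda>p. J u (b (fst p)) (snd p)) \<in> borel_measurable (M \<Otimes>\<^sub>M lborel)"
    by (rule J_meas[OF u]) measurable
  have "(\<lambda>p. indicator {0..t} (snd p) * (J u (b (fst p)) (snd p) * v (T (max 0 (snd p)) (b (fst p))))) \<in> borel_measurable (M \<Otimes>\<^sub>M lborel)"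
    by measurable
  hence "(\<lambda>z. \<integral>r. indicator {0..t} r * (J u (b z) r * v (T (max 0 r) (b z))) \<partial>lborel) \<in> borel_measurable M"
    by (intro lborel.borel_measurable_lebesgue_integral) (simp add: split_beta')
  thus ?thesis unfolding Q_def[abs_def] .
qed

end

section \<open>Dominating functions for sums over returns\<close>

context hyperbolic_flow
begin

text \<open>One function dominates all \<open>n \<le> N\<close> simultaneously. If \<open>H\<close>
  is not leafwise constant a constant does; otherwise twice the maximal function of the martingale
  sums does, up to the error of the decomposition, the 2 coming from initial segments as differences
  of final ones.\<close>

theorem birkhoff_sums_dominated:
  assumes p: "2 \<le> p" and Hp: "integrable \<mu>Y (\<lambda>y. \<bar>H y\<bar> powr p)"
  shows "\<exists>K\<ge>0. \<forall>u N. hobs u \<longrightarrow> (\<integral>x. u x \<partial>\<mu>M) = 0 \<longrightarrow> 0 < N \<longrightarrow>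
     (\<exists>g. lp_bounded \<mu>Y p g (K * real N powr (p / 2)) \<and> (AE y in \<mu>Y. \<forall>n\<le>N. \<bar>J u y (Hs n y)\<bar> \<le> g y))"
proof (cases "AE y in \<mu>Y. H y = H (rep (W y))")
  case False
  obtain B where B: "\<And>u. hobs u \<Longrightarrow> (\<integral>x. u x \<partial>\<mu>M) = 0 \<Longrightarrow> (AE y in \<mu>Y. \<forall>s\<ge>0. \<bar>J u y s\<bar> \<le> B)"
    using bounded_if_not_leafwise_constant[OF False] by blast
  have "\<exists>g. lp_bounded \<mu>Y p g (\<bar>B\<bar> powr p * real N powr (p / 2)) \<and> (AE y in \<mu>Y. \<forall>n\<le>N. \<bar>J u y (Hs n y)\<bar> \<le> g y)"
    if u: "hobs u" "(\<integral>x. u x \<partial>\<mu>M) = 0" and N: "0 < N" for u N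
  proof (intro exI conjI)
    have "1 \<le> real N powr (p / 2)" using N p by (intro ge_one_powr_ge_zero) auto
    hence "\<bar>B\<bar> powr p \<le> \<bar>B\<bar> powr p * real N powr (p / 2)" by (simp add: mult_le_cancel_left1)
    thus "lp_bounded \<mu>Y p (\<lambda>_. \<bar>B\<bar>) (\<bar>B\<bar> powr p * real N powr (p / 2))"
      using lp_bounded_const[OF \<mu>Y_prob, of "\<bar>B\<bar>" p] by (auto intro: lp_bounded_mono)
    show "AE y in \<mu>Y. \<forall>n\<le>N. \<bar>J u y (Hs n y)\<bar> \<le> \<bar>B\<bar>" using B[OF u] AE_space
    proof eventually_elim
      case (elim y)
      thus ?case using Hs_nonneg[of y] by (auto simp: space_\<mu>Y intro: order_trans[OF _ abs_ge_self])
    qed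
  qed
  thus ?thesis by (intro exI[of _ "\<bar>B\<bar> powr p"]) simp
next
  case True
  obtain K A where A: "0 < A" and dec: "\<And>u N. hobs u \<Longrightarrow> (\<integral>x. u x \<partial>\<mu>M) = 0 \<Longrightarrow> 0 < N \<Longrightarrow>
    (\<exists>d. d \<in> borel_measurable \<mu>b \<and> YB.reverse_diff d \<and> integrable \<mu>b (\<lambda>x. \<bar>d x\<bar> powr p) \<and>
       (\<integral>x. \<bar>d x\<bar> powr p \<partial>\<mu>b) \<le> A powr p \<and>
       (AE y in \<mu>Y. \<exists>c e. \<forall>j. J u ((F ^^ j) y) (H ((F ^^ j) y)) = d ((Fb ^^ j) (W y)) + (c (Suc j) - c j) + e j
          \<and> \<bar>c j\<bar> \<le> K \<and> \<bar>e j\<bar> \<le> K / real N))"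
    using leafwise_constant_decomposition[OF True p Hp] by blast
  define t where "t = 3 * taylor_const p"
  have t: "1 \<le> t" using taylor_const_ge1[OF p] by (simp add: t_def)
  define k where "k = 2 powr p * (2 powr p * (4 powr p * (t powr (p / 2) * A powr p)) + (3 * \<bar>K\<bar>) powr p)"
  have "\<exists>g. lp_bounded \<mu>Y p g (k * real N powr (p / 2)) \<and> (AE y in \<mu>Y. \<forall>n\<le>N. \<bar>J u y (Hs n y)\<bar> \<le> g y)"
    if u: "hobs u" "(\<integral>x. u x \<partial>\<mu>M) = 0" and N: "0 < N" for u N
  proof -
    obtain d where d: "d \<in> borel_measurable \<mu>b" "YB.reverse_diff d" "integrable \<mu>b (\<lambda>x. \<bar>d x\<bar> powr p)"
       "(\<integral>x. \<bar>d x\<bar> powr p \<partial>\<mu>b) \<le> A powr p"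
      and seq: "AE y in \<mu>Y. \<exists>c e. \<forall>j. J u ((F ^^ j) y) (H ((F ^^ j) y)) = d ((Fb ^^ j) (W y)) + (c (Suc j) - c j) + e j
          \<and> \<bar>c j\<bar> \<le> K \<and> \<bar>e j\<bar> \<le> K / real N" using dec[OF u N] by blast
    obtain m where m: "lp_bounded \<mu>b p m (4 powr p * ((3 * taylor_const p * N) powr (p / 2) * A powr p))"
      and ml: "\<And>x j. j \<le> N \<Longrightarrow> \<bar>YB.bs d j ((Fb ^^ (N - j)) x)\<bar> \<le> m x"
      using YB.birkhoff_max(2)[OF p A d(1,3,4,2), of N] by blast
    define g where "g y = 2 * m (W y) + 3 * \<bar>K\<bar>" for y
    have "lp_bounded \<mu>Y p g (2 powr p * (2 powr p * (4 powr p * ((3 * taylor_const p * N) powr (p / 2) * A powr p)) + (3 * \<bar>K\<bar>) powr p))"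
      unfolding g_def using p lp_bounded_const[OF \<mu>Y_prob, of "3 * \<bar>K\<bar>" p]
      by (intro lp_bounded_add lp_bounded_scale lp_bounded_distr[OF W_meas m]) auto
    moreover have "2 powr p * (2 powr p * (4 powr p * ((3 * taylor_const p * N) powr (p / 2) * A powr p)) + (3 * \<bar>K\<bar>) powr p)
       \<le> k * real N powr (p / 2)"
    proof -
      have e: "(3 * taylor_const p * N) powr (p / 2) = t powr (p / 2) * real N powr (p / 2)"
        using t by (simp add: t_def[symmetric] powr_mult)
      have "1 \<le> real N powr (p / 2)" using N p by (intro ge_one_powr_ge_zero) auto
      hence "(3 * \<bar>K\<bar>) powr p \<le> (3 * \<bar>K\<bar>) powr p * real N powr (p / 2)" by (simp add: mult_le_cancel_left1)
      hence "2 powr p * (2 powr p * (4 powr p * ((3 * taylor_const p * N) powr (p / 2) * A powr p)) + (3 * \<bar>K\<bar>) powr p)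
        \<le> 2 powr p * (2 powr p * (4 powr p * ((3 * taylor_const p * N) powr (p / 2) * A powr p)) + (3 * \<bar>K\<bar>) powr p * real N powr (p / 2))"
        by (intro mult_left_mono add_left_mono) auto
      also have "\<dots> = k * real N powr (p / 2)" unfolding e k_def by (simp add: algebra_simps)
      finally show ?thesis .
    qed
    ultimately have gb: "lp_bounded \<mu>Y p g (k * real N powr (p / 2))" by (rule lp_bounded_mono)
    have "AE y in \<mu>Y. \<forall>n\<le>N. \<bar>J u y (Hs n y)\<bar> \<le> g y"
      using seq AE_space
    proof (eventually_elim, intro allI impI)
      fix y n
      assume "\<exists>c e. \<forall>j. J u ((F ^^ j) y) (H ((F ^^ j) y)) = d ((Fb ^^ j) (W y)) + (c (Suc j) - c j) + e j \<and> \<bar>c j\<bar> \<le> K \<and> \<bar>e j\<bar> \<le> K / real N"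
        and "y \<in> space \<mu>Y" and n: "n \<le> N"
      then obtain c e where ce: "\<And>j. J u ((F ^^ j) y) (H ((F ^^ j) y)) = d ((Fb ^^ j) (W y)) + (c (Suc j) - c j) + e j"
        "\<And>j. \<bar>c j\<bar> \<le> K" "\<And>j. \<bar>e j\<bar> \<le> K / real N" and y: "y \<in> Y" by (auto simp: space_\<mu>Y)
      have "\<bar>(\<Sum>j<n. J u ((F ^^ j) y) (H ((F ^^ j) y))) - (\<Sum>j<n. d ((Fb ^^ j) (W y)))\<bar> \<le> 3 * K"
        by (rule perturbed_sum[where c=c and e=e and N=N and K=K, OF ce n N])
      hence 1: "\<bar>J u y (Hs n y) - YB.bs d n (W y)\<bar> \<le> 3 * K" by (simp add: J_Hs[OF hobsD(1)[OF u(1)] y] YB.bs_def)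
      have "YB.bs d N (W y) = YB.bs d n (W y) + YB.bs d (N - n) ((Fb ^^ n) (W y))" using YB.bs_add[of d n "N - n" "W y"] n by simp
      moreover have "\<bar>YB.bs d N (W y)\<bar> \<le> m (W y)" "\<bar>YB.bs d (N - n) ((Fb ^^ n) (W y))\<bar> \<le> m (W y)"
        using ml[of N "W y"] ml[of "N - n" "W y"] n by auto
      ultimately show "\<bar>J u y (Hs n y)\<bar> \<le> g y" using 1 unfolding g_def by linarith
    qed
    thus ?thesis using gb by blast
  qed
  moreover have "0 \<le> k" unfolding k_def by (intro mult_nonneg_nonneg add_nonneg_nonneg) auto
  ultimately show ?thesis by blast
qed

lemma H_lp: "integrable \<mu>Y (\<lambda>y. \<bar>H y\<bar> powr p) \<Longrightarrow> lp_bounded \<mu>Y p (\<lambda>y. \<bar>H y\<bar>) (\<integral>y. \<bar>H y\<bar> powr p \<partial>\<mu>Y)"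
  by (auto simp: lp_bounded_def)

text \<open>If the orbit integrals are bounded, the iterated sum is at most a constant times the sum
  of the return times, already of order \<open>N\<close>. Otherwise the martingale part is handled
  by \<open>iterated_max\<close>, and the corrections grow linearly.\<close>

theorem iterated_sums_dominated:
  assumes p: "4 \<le> p" and Hp: "integrable \<mu>Y (\<lambda>y. \<bar>H y\<bar> powr p)"
  shows "\<exists>K\<ge>0. \<forall>u v N. hobs u \<longrightarrow> (\<integral>x. u x \<partial>\<mu>M) = 0 \<longrightarrow> hobs v \<longrightarrow> (\<integral>x. v x \<partial>\<mu>M) = 0 \<longrightarrow> 0 < N \<longrightarrow>
     (\<exists>g. lp_bounded \<mu>Y (p / 2) g (K * real N powr (p / 2)) \<and>
       (AE y in \<mu>Y. \<forall>n\<le>N. \<bar>\<Sum>j<n. J u y (Hs j y) * J v ((F ^^ j) y) (H ((F ^^ j) y))\<bar> \<le> g y))"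
proof -
  define r where "r = p / 2"
  have r: "2 \<le> r" "r \<le> p" using p by (auto simp: r_def)
  define RH where "RH = 1 + (\<integral>y. \<bar>H y\<bar> powr p \<partial>\<mu>Y)"
  have Hr: "lp_bounded \<mu>Y r (\<lambda>y. \<bar>H y\<bar>) RH" unfolding RH_def
    using r by (intro lp_bounded_lower[OF \<mu>Y_prob H_lp[OF Hp]]) auto
  have HS: "lp_bounded \<mu>Y r (\<lambda>y. \<Sum>j<N. \<bar>H ((F ^^ j) y)\<bar>) (real N powr r * RH)" for N
    using YF.lp_bounded_birkhoff[OF Hr] r by simp
  have RH0: "0 \<le> RH" unfolding RH_def by (intro add_nonneg_nonneg integral_nonneg_AE) auto
  show ?thesis
  proof (cases "AE y in \<mu>Y. H y = H (rep (W y))")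
    case False
    obtain B where B: "\<And>u. hobs u \<Longrightarrow> (\<integral>x. u x \<partial>\<mu>M) = 0 \<Longrightarrow> (AE y in \<mu>Y. \<forall>s\<ge>0. \<bar>J u y s\<bar> \<le> B)"
      using bounded_if_not_leafwise_constant[OF False] by blast
    have "\<exists>g. lp_bounded \<mu>Y r g ((\<bar>B\<bar> powr r * RH) * real N powr r) \<and>
       (AE y in \<mu>Y. \<forall>n\<le>N. \<bar>\<Sum>j<n. J u y (Hs j y) * J v ((F ^^ j) y) (H ((F ^^ j) y))\<bar> \<le> g y)"
      if u: "hobs u" "(\<integral>x. u x \<partial>\<mu>M) = 0" and v: "hobs v" and N: "0 < N" for u v N
    proof (intro exI conjI)
      show "lp_bounded \<mu>Y r (\<lambda>y. \<bar>B\<bar> * (\<Sum>j<N. \<bar>H ((F ^^ j) y)\<bar>)) ((\<bar>B\<bar> powr r * RH) * real N powr r)"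
        using lp_bounded_scale[OF HS[of N], of "\<bar>B\<bar>"] by (simp add: mult_ac)
      show "AE y in \<mu>Y. \<forall>n\<le>N. \<bar>\<Sum>j<n. J u y (Hs j y) * J v ((F ^^ j) y) (H ((F ^^ j) y))\<bar> \<le> \<bar>B\<bar> * (\<Sum>j<N. \<bar>H ((F ^^ j) y)\<bar>)"
        using B[OF u] AE_space
      proof (eventually_elim, intro allI impI)
        fix y n assume Jb: "\<forall>s\<ge>0. \<bar>J u y s\<bar> \<le> B" and "y \<in> space \<mu>Y" and n: "n \<le> N"
        hence y: "y \<in> Y" by (simp add: space_\<mu>Y)
        have "\<bar>\<Sum>j<n. J u y (Hs j y) * J v ((F ^^ j) y) (H ((F ^^ j) y))\<bar> \<le> (\<Sum>j<n. \<bar>J u y (Hs j y) * J v ((F ^^ j) y) (H ((F ^^ j) y))\<bar>)" by (rule sum_abs)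
        also have "\<dots> \<le> (\<Sum>j<n. \<bar>B\<bar> * \<bar>H ((F ^^ j) y)\<bar>)"
        proof (intro sum_mono, unfold abs_mult, intro mult_mono)
          fix j
          show "\<bar>J u y (Hs j y)\<bar> \<le> \<bar>B\<bar>" using Jb Hs_nonneg[OF y, of j] by (metis abs_ge_self order_trans)
          show "\<bar>J v ((F ^^ j) y) (H ((F ^^ j) y))\<bar> \<le> \<bar>H ((F ^^ j) y)\<bar>"
            using U_bound[OF hobsD(1)[OF v] Fn_Y[OF y, of j]] by linarith
        qed auto
        also have "\<dots> \<le> \<bar>B\<bar> * (\<Sum>j<N. \<bar>H ((F ^^ j) y)\<bar>)"
          unfolding sum_distrib_left using n by (intro sum_mono2) auto
        finally show "\<bar>\<Sum>j<n. J u y (Hs j y) * J v ((F ^^ j) y) (H ((F ^^ j) y))\<bar> \<le> \<bar>B\<bar> * (\<Sum>j<N. \<bar>H ((F ^^ j) y)\<bar>)" .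
      qed
    qed
    moreover have "0 \<le> \<bar>B\<bar> powr r * RH" using RH0 by simp
    ultimately show ?thesis unfolding r_def by blast
  next
    case True
    have p2: "2 \<le> p" using p by simp
    obtain K A where A: "0 < A" and dec: "\<And>u N. hobs u \<Longrightarrow> (\<integral>x. u x \<partial>\<mu>M) = 0 \<Longrightarrow> 0 < N \<Longrightarrow>
      (\<exists>d. d \<in> borel_measurable \<mu>b \<and> YB.reverse_diff d \<and> integrable \<mu>b (\<lambda>x. \<bar>d x\<bar> powr p) \<and>
         (\<integral>x. \<bar>d x\<bar> powr p \<partial>\<mu>b) \<le> A powr p \<and>
         (AE y in \<mu>Y. \<exists>c e. \<forall>j. J u ((F ^^ j) y) (H ((F ^^ j) y)) = d ((Fb ^^ j) (W y)) + (c (Suc j) - c j) + e j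
            \<and> \<bar>c j\<bar> \<le> K \<and> \<bar>e j\<bar> \<le> K / real N))"
      using leafwise_constant_decomposition[OF True p2 Hp] by blast
    obtain K2 where K2: "0 \<le> K2" and it: "\<forall>d d' N. d \<in> borel_measurable \<mu>b \<longrightarrow> d' \<in> borel_measurable \<mu>b \<longrightarrow>
       integrable \<mu>b (\<lambda>x. \<bar>d x\<bar> powr p) \<longrightarrow> integrable \<mu>b (\<lambda>x. \<bar>d' x\<bar> powr p) \<longrightarrow>
       (\<integral>x. \<bar>d x\<bar> powr p \<partial>\<mu>b) \<le> A powr p \<longrightarrow> (\<integral>x. \<bar>d' x\<bar> powr p \<partial>\<mu>b) \<le> A powr p \<longrightarrow>
       YB.reverse_diff d \<longrightarrow> YB.reverse_diff d' \<longrightarrow> 0 < N \<longrightarrow>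
       (\<exists>g. lp_bounded \<mu>b (p / 2) g (K2 * real N powr (p / 2)) \<and>
         (\<forall>x. \<forall>n\<le>N. \<bar>\<Sum>j<n. YB.bs d j x * d' ((Fb ^^ j) x)\<bar> \<le> g x))"
      using YB.iterated_max[OF p A] by (elim exE conjE)
    define RA where "RA = 1 + A powr p"
    have RA0: "0 \<le> RA" by (simp add: RA_def)
    define k where "k = 2 powr r * (K2 + 2 powr r * ((3 * \<bar>K\<bar>) powr r * RA + (3 * \<bar>K\<bar>) powr r * RH))"
    have "\<exists>g. lp_bounded \<mu>Y r g (k * real N powr r) \<and>
       (AE y in \<mu>Y. \<forall>n\<le>N. \<bar>\<Sum>j<n. J u y (Hs j y) * J v ((F ^^ j) y) (H ((F ^^ j) y))\<bar> \<le> g y)"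
      if u: "hobs u" "(\<integral>x. u x \<partial>\<mu>M) = 0" and v: "hobs v" "(\<integral>x. v x \<partial>\<mu>M) = 0" and N: "0 < N" for u v N
    proof -
      obtain d where d: "d \<in> borel_measurable \<mu>b" "YB.reverse_diff d" "integrable \<mu>b (\<lambda>x. \<bar>d x\<bar> powr p)"
         "(\<integral>x. \<bar>d x\<bar> powr p \<partial>\<mu>b) \<le> A powr p"
        and seq: "AE y in \<mu>Y. \<exists>c e. \<forall>j. J u ((F ^^ j) y) (H ((F ^^ j) y)) = d ((Fb ^^ j) (W y)) + (c (Suc j) - c j) + e j
            \<and> \<bar>c j\<bar> \<le> K \<and> \<bar>e j\<bar> \<le> K / real N" using dec[OF u N] by blast
      obtain d' where d': "d' \<in> borel_measurable \<mu>b" "YB.reverse_diff d'" "integrable \<mu>b (\<lambda>x. \<bar>d' x\<bar> powr p)"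
         "(\<integral>x. \<bar>d' x\<bar> powr p \<partial>\<mu>b) \<le> A powr p"
        and seq': "AE y in \<mu>Y. \<exists>c e. \<forall>j. J v ((F ^^ j) y) (H ((F ^^ j) y)) = d' ((Fb ^^ j) (W y)) + (c (Suc j) - c j) + e j
            \<and> \<bar>c j\<bar> \<le> K \<and> \<bar>e j\<bar> \<le> K / real N" using dec[OF v N] by blast
      obtain g0 where g0: "lp_bounded \<mu>b (p / 2) g0 (K2 * real N powr (p / 2))"
        and g0l: "\<And>x n. n \<le> N \<Longrightarrow> \<bar>\<Sum>j<n. YB.bs d j x * d' ((Fb ^^ j) x)\<bar> \<le> g0 x"
        using it[rule_format, OF d(1) d'(1) d(3) d'(3) d(4) d'(4) d(2) d'(2) N] by blast
      have [measurable]: "d' \<in> borel_measurable \<mu>b" by (rule d'(1))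
      have "lp_bounded \<mu>b p (\<lambda>x. \<bar>d' x\<bar>) (A powr p)" using d' by (auto simp: lp_bounded_def)
      hence "lp_bounded \<mu>b r (\<lambda>x. \<bar>d' x\<bar>) RA" unfolding RA_def
        using r by (intro lp_bounded_lower[of _ p]) (auto intro: YB.prob_space_axioms)
      hence "lp_bounded \<mu>b r (\<lambda>x. \<Sum>j<N. \<bar>d' ((Fb ^^ j) x)\<bar>) (real N powr r * RA)"
        using YB.lp_bounded_birkhoff[of r "\<lambda>x. \<bar>d' x\<bar>" RA N] r by simp
      hence dS: "lp_bounded \<mu>Y r (\<lambda>y. \<Sum>j<N. \<bar>d' ((Fb ^^ j) (W y))\<bar>) (real N powr r * RA)"
        by (rule lp_bounded_distr[OF W_meas])
      define g where "g y = g0 (W y) + (3 * \<bar>K\<bar> * (\<Sum>j<N. \<bar>d' ((Fb ^^ j) (W y))\<bar>) + 3 * \<bar>K\<bar> * (\<Sum>j<N. \<bar>H ((F ^^ j) y)\<bar>))" for y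
      have "lp_bounded \<mu>Y r g (2 powr r * (K2 * real N powr r + 2 powr r * ((3 * \<bar>K\<bar>) powr r * (real N powr r * RA) + (3 * \<bar>K\<bar>) powr r * (real N powr r * RH))))"
        unfolding g_def using r g0[folded r_def]
        by (intro lp_bounded_add lp_bounded_scale dS HS lp_bounded_distr[OF W_meas]) auto
      hence gb: "lp_bounded \<mu>Y r g (k * real N powr r)" by (simp add: k_def algebra_simps)
      have "AE y in \<mu>Y. \<forall>n\<le>N. \<bar>\<Sum>j<n. J u y (Hs j y) * J v ((F ^^ j) y) (H ((F ^^ j) y))\<bar> \<le> g y"
        using seq seq' AE_space
      proof (eventually_elim, intro allI impI)
        fix y n
        assume "\<exists>c e. \<forall>j. J u ((F ^^ j) y) (H ((F ^^ j) y)) = d ((Fb ^^ j) (W y)) + (c (Suc j) - c j) + e j \<and> \<bar>c j\<bar> \<le> K \<and> \<bar>e j\<bar> \<le> K / real N"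
          and "\<exists>c e. \<forall>j. J v ((F ^^ j) y) (H ((F ^^ j) y)) = d' ((Fb ^^ j) (W y)) + (c (Suc j) - c j) + e j \<and> \<bar>c j\<bar> \<le> K \<and> \<bar>e j\<bar> \<le> K / real N"
          and "y \<in> space \<mu>Y" and n: "n \<le> N"
        then obtain c e c' e' where ce: "\<And>j. J u ((F ^^ j) y) (H ((F ^^ j) y)) = d ((Fb ^^ j) (W y)) + (c (Suc j) - c j) + e j"
          "\<And>j. \<bar>c j\<bar> \<le> K" "\<And>j. \<bar>e j\<bar> \<le> K / real N"
          and ce': "\<And>j. J v ((F ^^ j) y) (H ((F ^^ j) y)) = d' ((Fb ^^ j) (W y)) + (c' (Suc j) - c' j) + e' j"
          "\<And>j. \<bar>c' j\<bar> \<le> K" "\<And>j. \<bar>e' j\<bar> \<le> K / real N" and y: "y \<in> Y" by (auto simp: space_\<mu>Y)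
        have K0: "0 \<le> K" using ce(2)[of 0] by linarith
        have "\<bar>\<Sum>j<n. (\<Sum>i<j. J u ((F ^^ i) y) (H ((F ^^ i) y))) * J v ((F ^^ j) y) (H ((F ^^ j) y))\<bar>
          \<le> \<bar>\<Sum>j<n. (\<Sum>i<j. d ((Fb ^^ i) (W y))) * d' ((Fb ^^ j) (W y))\<bar>
            + (3 * K * (\<Sum>j<N. \<bar>d' ((Fb ^^ j) (W y))\<bar>) + 3 * K * (\<Sum>j<N. \<bar>J u ((F ^^ j) y) (H ((F ^^ j) y))\<bar>))"
          by (rule perturbed_iterated_sum[where c=c and e=e and c'=c' and e'=e' and N=N and K=K, OF ce ce' n N])
        moreover have "3 * K * (\<Sum>j<N. \<bar>J u ((F ^^ j) y) (H ((F ^^ j) y))\<bar>) \<le> 3 * K * (\<Sum>j<N. \<bar>H ((F ^^ j) y)\<bar>)"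
          using U_bound[OF hobsD(1)[OF u(1)] Fn_Y[OF y]] K0
          by (intro sum_mono mult_left_mono) (auto intro: order_trans[OF _ abs_ge_self])
        moreover have "\<bar>\<Sum>j<n. (\<Sum>i<j. d ((Fb ^^ i) (W y))) * d' ((Fb ^^ j) (W y))\<bar> \<le> g0 (W y)"
          using g0l[OF n, of "W y"] by (simp add: YB.bs_def)
        ultimately show "\<bar>\<Sum>j<n. J u y (Hs j y) * J v ((F ^^ j) y) (H ((F ^^ j) y))\<bar> \<le> g y"
          using K0 by (simp add: g_def J_Hs[OF hobsD(1)[OF u(1)] y])
      qed
      thus ?thesis using gb by blast
    qed
    moreover have "0 \<le> k" unfolding k_def using K2 RA0 RH0 by (intro mult_nonneg_nonneg add_nonneg_nonneg) auto
    ultimately show ?thesis unfolding r_def by blast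
  qed
qed

section \<open>From return times to continuous time\<close>

lemma Hs_Suc_shift: "Hs (Suc n) y = H y + Hs n (F y)"
  unfolding Hsum_def sum.lessThan_Suc_shift by (simp add: funpow_swap1)

text \<open>The number of returns before time \<open>H y + t\<close> is bounded in terms of
  \<open>t\<close> alone: the first may take time \<open>H y\<close>, and each later one takes at
  least \<open>h0\<close>.\<close>

lemma return_index:
  assumes y: "y \<in> Y" and s: "0 \<le> s" "s \<le> H y + t" and t: "0 \<le> t"
  obtains n where "n \<le> Suc (nat \<lfloor>t / h0\<rfloor>)" "Hs n y \<le> s" "s \<le> Hs n y + H ((F ^^ n) y)"
proof -
  obtain k :: nat where k: "s < k * h0" using reals_Archimedean3[OF h0] by blast
  define m where "m = (LEAST m. s < Hs m y)"
  have ex: "s < Hs k y" using k Hs_ge[OF y, of k] by linarith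
  have m: "s < Hs m y" unfolding m_def by (rule LeastI[where P="\<lambda>m. s < Hs m y", OF ex])
  have "m \<noteq> 0"
  proof
    assume "m = 0"
    thus False using m s Hs_0[of y] by simp
  qed
  then obtain n where n: "m = Suc n" using not0_implies_Suc by blast
  have le: "Hs n y \<le> s" using not_less_Least[of n "\<lambda>m. s < Hs m y"] n by (simp add: m_def[symmetric] not_less)
  have "n \<le> Suc (nat \<lfloor>t / h0\<rfloor>)"
  proof (cases n)
    case (Suc i)
    have "i * h0 \<le> t" using le s(2) Hs_ge[OF F_Y[OF y], of i] unfolding Suc Hs_Suc_shift by linarith
    hence "real i \<le> t / h0" using h0 by (simp add: pos_le_divide_eq)
    hence "i \<le> nat \<lfloor>t / h0\<rfloor>" by (simp add: le_nat_floor)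
    thus ?thesis using Suc by simp
  qed simp
  thus ?thesis using that le m unfolding n Hs_Suc by (auto intro: less_imp_le)
qed

lemma number_of_returns_le:
  assumes "1 \<le> t" "0 \<le> e"
  shows "real (Suc (nat \<lfloor>t / h0\<rfloor>)) powr e \<le> (1 / h0 + 1) powr e * t powr e"
proof -
  have "real (nat \<lfloor>t / h0\<rfloor>) \<le> t / h0" using assms h0 by (intro of_nat_floor) simp
  hence "real (Suc (nat \<lfloor>t / h0\<rfloor>)) \<le> (1 / h0 + 1) * t" using assms by (simp add: algebra_simps)
  hence "real (Suc (nat \<lfloor>t / h0\<rfloor>)) powr e \<le> ((1 / h0 + 1) * t) powr e" using assms by (intro powr_mono2) auto
  thus ?thesis using h0 assms by (simp add: powr_mult)
qed

text \<open>The maximum is bounded by the \<open>p\<close>-norm of the sequence, whose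
  \<open>p\<close>-th moment grows like \<open>N \<le> N powr (p / 2)\<close>. Hence incomplete
  returns cost no more than the martingale part.\<close>

lemma return_times_dominated:
  assumes p: "2 \<le> p" and Hp: "integrable \<mu>Y (\<lambda>y. \<bar>H y\<bar> powr p)" and N: "0 < N"
  shows "\<exists>g. lp_bounded \<mu>Y p g (2 * (\<integral>y. \<bar>H y\<bar> powr p \<partial>\<mu>Y) * real N powr (p / 2)) \<and> (\<forall>y\<in>Y. \<forall>n\<le>N. H ((F ^^ n) y) \<le> g y)"
proof -
  let ?R = "\<integral>y. \<bar>H y\<bar> powr p \<partial>\<mu>Y"
  define S where "S y = (\<Sum>n<Suc N. \<bar>H ((F ^^ n) y)\<bar> powr p)" for y
  define g where "g y = S y powr (1 / p)" for y
  have S0: "0 \<le> S y" for y unfolding S_def by (intro sum_nonneg) auto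
  have gp: "g y powr p = S y" for y using S0[of y] p by (simp add: g_def powr_powr)
  have i: "integrable \<mu>Y (\<lambda>y. \<bar>H ((F ^^ n) y)\<bar> powr p)" for n using mpt.integrable_G[OF YF.mpt_Gn Hp] .
  have e: "(\<integral>y. \<bar>H ((F ^^ n) y)\<bar> powr p \<partial>\<mu>Y) = ?R" for n
    using mpt.integral_G[OF YF.mpt_Gn, of "\<lambda>y. \<bar>H y\<bar> powr p" n] by simp
  have Si: "integrable \<mu>Y S" unfolding S_def using i by auto
  have R0: "0 \<le> ?R" by (intro integral_nonneg_AE) auto
  have "(\<integral>y. S y \<partial>\<mu>Y) = real (Suc N) * ?R" unfolding S_def using i by (simp add: e algebra_simps)
  also have "\<dots> \<le> (2 * real N powr (p / 2)) * ?R"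
  proof (rule mult_right_mono[OF _ R0])
    have "real N powr 1 \<le> real N powr (p / 2)" using N p by (intro powr_mono) auto
    thus "real (Suc N) \<le> 2 * real N powr (p / 2)" using N by simp
  qed
  finally have "lp_bounded \<mu>Y p g (2 * ?R * real N powr (p / 2))"
    using Si borel_measurable_integrable[OF Si] unfolding lp_bounded_def gp by (auto simp: g_def[abs_def] mult_ac)
  moreover have "H ((F ^^ n) y) \<le> g y" if "n \<le> N" for n y
  proof -
    have "\<bar>H ((F ^^ n) y)\<bar> powr p \<le> S y" unfolding S_def using that by (intro member_le_sum) auto
    hence "(\<bar>H ((F ^^ n) y)\<bar> powr p) powr (1 / p) \<le> g y" unfolding g_def using p by (intro powr_mono2) auto
    thus ?thesis using p by (simp add: powr_powr)
  qed
  ultimately show ?thesis by blast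
qed

text \<open>The range of \<open>s\<close> extends to \<open>H y + t\<close> so that segments of
  length \<open>t\<close> starting anywhere over the first return of \<open>y\<close> are covered by
  one dominating function.\<close>

theorem flow_integrals_dominated:
  assumes p: "2 \<le> p" and Hp: "integrable \<mu>Y (\<lambda>y. \<bar>H y\<bar> powr p)"
  shows "\<exists>K\<ge>0. \<forall>u t. hobs u \<longrightarrow> (\<integral>x. u x \<partial>\<mu>M) = 0 \<longrightarrow> 1 \<le> t \<longrightarrow>
     (\<exists>g. lp_bounded \<mu>Y p g (K * t powr (p / 2)) \<and> (AE y in \<mu>Y. \<forall>s\<in>{0..H y + t}. \<bar>J u y s\<bar> \<le> g y))"
proof -
  let ?R = "\<integral>y. \<bar>H y\<bar> powr p \<partial>\<mu>Y"
  have R0: "0 \<le> ?R" by (intro integral_nonneg_AE) auto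
  obtain K where K: "0 \<le> K" and sums: "\<forall>u N. hobs u \<longrightarrow> (\<integral>x. u x \<partial>\<mu>M) = 0 \<longrightarrow> 0 < N \<longrightarrow>
     (\<exists>g. lp_bounded \<mu>Y p g (K * real N powr (p / 2)) \<and> (AE y in \<mu>Y. \<forall>n\<le>N. \<bar>J u y (Hs n y)\<bar> \<le> g y))"
    using birkhoff_sums_dominated[OF p Hp] by (elim exE conjE)
  define k where "k = 2 powr p * (K + 2 * ?R) * (1 / h0 + 1) powr (p / 2)"
  have "\<exists>g. lp_bounded \<mu>Y p g (k * t powr (p / 2)) \<and> (AE y in \<mu>Y. \<forall>s\<in>{0..H y + t}. \<bar>J u y s\<bar> \<le> g y)"
    if u: "hobs u" "(\<integral>x. u x \<partial>\<mu>M) = 0" and t: "1 \<le> t" for u t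
  proof -
    define N where "N = Suc (nat \<lfloor>t / h0\<rfloor>)"
    have N: "0 < N" by (simp add: N_def)
    obtain a where a: "lp_bounded \<mu>Y p a (K * real N powr (p / 2))" "AE y in \<mu>Y. \<forall>n\<le>N. \<bar>J u y (Hs n y)\<bar> \<le> a y"
      using sums[rule_format, OF u N] by blast
    obtain b where b: "lp_bounded \<mu>Y p b (2 * ?R * real N powr (p / 2))" "\<forall>y\<in>Y. \<forall>n\<le>N. H ((F ^^ n) y) \<le> b y"
      using return_times_dominated[OF p Hp N] by blast
    have "lp_bounded \<mu>Y p (\<lambda>y. a y + b y) (2 powr p * (K * real N powr (p / 2) + 2 * ?R * real N powr (p / 2)))"
      using p by (intro lp_bounded_add a b) auto
    moreover have "2 powr p * (K * real N powr (p / 2) + 2 * ?R * real N powr (p / 2)) \<le> k * t powr (p / 2)"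
    proof -
      have "2 powr p * (K + 2 * ?R) * real N powr (p / 2) \<le> 2 powr p * (K + 2 * ?R) * ((1 / h0 + 1) powr (p / 2) * t powr (p / 2))"
        unfolding N_def using number_of_returns_le[OF t] p K R0 by (intro mult_left_mono) auto
      thus ?thesis by (simp add: k_def algebra_simps)
    qed
    ultimately have "lp_bounded \<mu>Y p (\<lambda>y. a y + b y) (k * t powr (p / 2))" by (rule lp_bounded_mono)
    moreover have "AE y in \<mu>Y. \<forall>s\<in>{0..H y + t}. \<bar>J u y s\<bar> \<le> a y + b y"
      using a(2) AE_space
    proof (eventually_elim, intro ballI)
      fix y s assume A: "\<forall>n\<le>N. \<bar>J u y (Hs n y)\<bar> \<le> a y" and "y \<in> space \<mu>Y" and s: "s \<in> {0..H y + t}"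
      hence y: "y \<in> Y" by (simp add: space_\<mu>Y)
      obtain n where n: "n \<le> N" "Hs n y \<le> s" "s \<le> Hs n y + H ((F ^^ n) y)"
        using return_index[OF y, of s t] s t unfolding N_def by auto
      have "\<bar>J u y s - J u y (Hs n y)\<bar> \<le> H ((F ^^ n) y)"
        using J_lip[OF hobsD(1)[OF u(1)], of s "Hs n y" y] s n Hs_nonneg[OF y, of n] by auto
      moreover have "\<bar>J u y (Hs n y)\<bar> \<le> a y" "H ((F ^^ n) y) \<le> b y" using A b(2) y n(1) by auto
      ultimately show "\<bar>J u y s\<bar> \<le> a y + b y" by linarith
    qed
    ultimately show ?thesis by blast
  qed
  moreover have "0 \<le> k" unfolding k_def using K R0 by (intro mult_nonneg_nonneg add_nonneg_nonneg) auto
  ultimately show ?thesis by blast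
qed

lemma Q_Hs:
  assumes u: "obs u" and v: "obs v" and y: "y \<in> Y"
  shows "Q u v y (Hs n y) = (\<Sum>j<n. J u y (Hs j y) * J v ((F ^^ j) y) (H ((F ^^ j) y))) + (\<Sum>j<n. Q u v ((F ^^ j) y) (H ((F ^^ j) y)))"
proof (induction n)
  case (Suc n)
  show ?case unfolding Hs_Suc using Suc Q_add[OF u v Hs_nonneg[OF y, of n] H_nonneg[OF Fn_Y[OF y, of n]], of y] by (simp add: T_Hs[OF y])
qed (simp add: Hs_0 Q_0[OF u v])

text \<open>Between returns the iterated integral is corrected by its values within single returns,
  of size \<open>H\<close> squared, and by the last incomplete return through Chen's relation. The
  squares have moment exponent \<open>p / 2\<close>, and their sum is of order
  \<open>N\<close>.\<close>

theorem iterated_integrals_dominated: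
  assumes p: "4 \<le> p" and Hp: "integrable \<mu>Y (\<lambda>y. \<bar>H y\<bar> powr p)"
  shows "\<exists>K\<ge>0. \<forall>u v t. hobs u \<longrightarrow> (\<integral>x. u x \<partial>\<mu>M) = 0 \<longrightarrow> hobs v \<longrightarrow> (\<integral>x. v x \<partial>\<mu>M) = 0 \<longrightarrow> 1 \<le> t \<longrightarrow>
     (\<exists>g. lp_bounded \<mu>Y (p / 2) g (K * t powr (p / 2)) \<and> (AE y in \<mu>Y. \<forall>s\<in>{0..H y + t}. \<bar>Q u v y s\<bar> \<le> g y))"
proof -
  define r where "r = p / 2"
  have r: "2 \<le> r" using p by (simp add: r_def)
  have p2: "2 \<le> p" using p by simp
  define R where "R = (\<integral>y. \<bar>H y\<bar> powr p \<partial>\<mu>Y)"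
  have R0: "0 \<le> R" unfolding R_def by (intro integral_nonneg_AE) auto
  obtain K where K: "0 \<le> K" and sums: "\<forall>u N. hobs u \<longrightarrow> (\<integral>x. u x \<partial>\<mu>M) = 0 \<longrightarrow> 0 < N \<longrightarrow>
     (\<exists>g. lp_bounded \<mu>Y p g (K * real N powr (p / 2)) \<and> (AE y in \<mu>Y. \<forall>n\<le>N. \<bar>J u y (Hs n y)\<bar> \<le> g y))"
    using birkhoff_sums_dominated[OF p2 Hp] by (elim exE conjE)
  obtain L where L: "0 \<le> L" and isums: "\<forall>u v N. hobs u \<longrightarrow> (\<integral>x. u x \<partial>\<mu>M) = 0 \<longrightarrow> hobs v \<longrightarrow> (\<integral>x. v x \<partial>\<mu>M) = 0 \<longrightarrow> 0 < N \<longrightarrow>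
     (\<exists>g. lp_bounded \<mu>Y (p / 2) g (L * real N powr (p / 2)) \<and>
       (AE y in \<mu>Y. \<forall>n\<le>N. \<bar>\<Sum>j<n. J u y (Hs j y) * J v ((F ^^ j) y) (H ((F ^^ j) y))\<bar> \<le> g y))"
    using iterated_sums_dominated[OF p Hp] by (elim exE conjE)
  define k0 where "k0 = 2 powr r * (2 powr r * (L + R) + 2 powr r * (K + 2 powr r * (2 * R)))"
  have k0: "0 \<le> k0" unfolding k0_def using K L R0 by (intro mult_nonneg_nonneg add_nonneg_nonneg) auto
  define k where "k = k0 * (1 / h0 + 1) powr r"
  have "\<exists>g. lp_bounded \<mu>Y r g (k * t powr r) \<and> (AE y in \<mu>Y. \<forall>s\<in>{0..H y + t}. \<bar>Q u v y s\<bar> \<le> g y)"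
    if u: "hobs u" "(\<integral>x. u x \<partial>\<mu>M) = 0" and v: "hobs v" "(\<integral>x. v x \<partial>\<mu>M) = 0" and t: "1 \<le> t" for u v t
  proof -
    define N where "N = Suc (nat \<lfloor>t / h0\<rfloor>)"
    have N: "0 < N" by (simp add: N_def)
    note ob = hobsD(1)[OF u(1)] hobsD(1)[OF v(1)]
    obtain a where a: "lp_bounded \<mu>Y p a (K * real N powr (p / 2))" "AE y in \<mu>Y. \<forall>n\<le>N. \<bar>J u y (Hs n y)\<bar> \<le> a y"
      using sums[rule_format, OF u N] by blast
    obtain b where b: "lp_bounded \<mu>Y p b (2 * R * real N powr (p / 2))" "\<forall>y\<in>Y. \<forall>n\<le>N. H ((F ^^ n) y) \<le> b y"
      using return_times_dominated[OF p2 Hp N] unfolding R_def by blast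
    obtain c where c: "lp_bounded \<mu>Y (p / 2) c (L * real N powr (p / 2))"
      "AE y in \<mu>Y. \<forall>n\<le>N. \<bar>\<Sum>j<n. J u y (Hs j y) * J v ((F ^^ j) y) (H ((F ^^ j) y))\<bar> \<le> c y"
      using isums[rule_format, OF u v N] by blast
    define S where "S y = (\<Sum>j<N. \<bar>H ((F ^^ j) y)\<bar>\<^sup>2)" for y
    have S: "lp_bounded \<mu>Y r S (real N powr r * R)"
      unfolding S_def r_def R_def using p by (intro YF.lp_bounded_birkhoff lp_bounded_square H_lp Hp) auto
    define g where "g y = (c y + S y) + ((a y)\<^sup>2 + 2 * (b y)\<^sup>2)" for y
    have "lp_bounded \<mu>Y r g (2 powr r * (2 powr r * (L * real N powr r + real N powr r * R)
        + 2 powr r * (K * real N powr r + 2 powr r * (2 * R * real N powr r))))"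
      unfolding g_def using r lp_bounded_square[OF a(1)] lp_bounded_square[OF b(1)] c(1)
      by (intro lp_bounded_add lp_bounded_scale S) (auto simp: r_def)
    hence "lp_bounded \<mu>Y r g (k0 * real N powr r)" by (simp add: k0_def algebra_simps)
    moreover have "k0 * real N powr r \<le> k * t powr r"
      using mult_left_mono[OF number_of_returns_le[OF t, of r] k0] r by (simp add: N_def k_def mult.assoc)
    ultimately have "lp_bounded \<mu>Y r g (k * t powr r)" by (rule lp_bounded_mono)
    moreover have "AE y in \<mu>Y. \<forall>s\<in>{0..H y + t}. \<bar>Q u v y s\<bar> \<le> g y"
      using a(2) c(2) AE_space
    proof (eventually_elim, intro ballI)
      fix y s assume A: "\<forall>n\<le>N. \<bar>J u y (Hs n y)\<bar> \<le> a y"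
        and B: "\<forall>n\<le>N. \<bar>\<Sum>j<n. J u y (Hs j y) * J v ((F ^^ j) y) (H ((F ^^ j) y))\<bar> \<le> c y"
        and "y \<in> space \<mu>Y" and s: "s \<in> {0..H y + t}"
      hence y: "y \<in> Y" by (simp add: space_\<mu>Y)
      obtain n where n: "n \<le> N" "Hs n y \<le> s" "s \<le> Hs n y + H ((F ^^ n) y)"
        using return_index[OF y, of s t] s t unfolding N_def by auto
      define e where "e = s - Hs n y"
      have "H ((F ^^ n) y) \<le> b y" using b(2) n(1) y by blast
      hence e: "0 \<le> e" "e \<le> b y" "s = Hs n y + e" using n by (auto simp: e_def)
      have 1: "\<bar>\<Sum>j<n. Q u v ((F ^^ j) y) (H ((F ^^ j) y))\<bar> \<le> S y"
      proof -
        have "\<bar>\<Sum>j<n. Q u v ((F ^^ j) y) (H ((F ^^ j) y))\<bar> \<le> (\<Sum>j<n. \<bar>H ((F ^^ j) y)\<bar>\<^sup>2)"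
          using Q_bound[OF ob H_nonneg[OF Fn_Y[OF y]]] by (intro order_trans[OF sum_abs] sum_mono) simp
        also have "\<dots> \<le> S y" unfolding S_def using n by (intro sum_mono2) auto
        finally show ?thesis .
      qed
      have 2: "\<bar>J u y (Hs n y) * J v ((F ^^ n) y) e\<bar> \<le> (a y)\<^sup>2 + (b y)\<^sup>2"
      proof -
        have "\<bar>J u y (Hs n y) * J v ((F ^^ n) y) e\<bar> \<le> a y * b y"
          unfolding abs_mult using A n J_bound[OF ob(2) e(1), of "(F ^^ n) y"] e lp_boundedD(2)[OF a(1), of y]
          by (intro mult_mono) auto
        also have "\<dots> \<le> (a y)\<^sup>2 + (b y)\<^sup>2"
          using sum_squares_bound[of "a y" "b y"] zero_le_power2[of "a y"] zero_le_power2[of "b y"] lp_boundedD(2)[OF a(1), of y] lp_boundedD(2)[OF b(1), of y]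
            mult_nonneg_nonneg[of "a y" "b y"] by linarith
        finally show ?thesis .
      qed
      have "e\<^sup>2 \<le> (b y)\<^sup>2" using e by (intro power_mono) auto
      hence 3: "\<bar>Q u v ((F ^^ n) y) e\<bar> \<le> (b y)\<^sup>2" using Q_bound[OF ob e(1), of "(F ^^ n) y"] by linarith
      have "Q u v y s = (\<Sum>j<n. J u y (Hs j y) * J v ((F ^^ j) y) (H ((F ^^ j) y))) + (\<Sum>j<n. Q u v ((F ^^ j) y) (H ((F ^^ j) y)))
          + J u y (Hs n y) * J v ((F ^^ n) y) e + Q u v ((F ^^ n) y) e"
        unfolding e(3) Q_add[OF ob Hs_nonneg[OF y] e(1)] by (simp add: T_Hs[OF y] Q_Hs[OF ob y])
      thus "\<bar>Q u v y s\<bar> \<le> g y" using B[rule_format, OF n(1)] 1 2 3 unfolding g_def by linarith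
    qed
    ultimately show ?thesis by blast
  qed
  moreover have "0 \<le> k" unfolding k_def using k0 by simp
  ultimately show ?thesis unfolding r_def by blast
qed

text \<open>Integrating over the fibre contributes a factor \<open>H\<close>, and
  \<open>H * g powr q\<close> is split with exponents \<open>p\<close> and
  \<open>p / (p - 1)\<close>; this forces \<open>q = r * (p - 1) / p\<close>, that is
  \<open>p - 1\<close> for \<open>r = p\<close> and \<open>(p - 1) / 2\<close> for
  \<open>r = p / 2\<close>. Dividing \<open>g\<close> by its scale \<rho> beforehand keeps the
  growth rate exact.\<close>

lemma nn_integral_\<mu>M_dominated:
  assumes p: "1 < p" and Hp: "integrable \<mu>Y (\<lambda>y. \<bar>H y\<bar> powr p)" and r: "0 < r" and \<rho>: "0 < \<rho>"
    and g: "lp_bounded \<mu>Y r g (K * \<rho> powr r)" and q: "q = r * (p - 1) / p"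
    and Z [measurable]: "Z \<in> borel_measurable borel" and Z0: "\<And>x. 0 \<le> Z x"
    and le: "AE y in \<mu>Y. \<forall>s\<in>{0..H y}. Z (T s y) \<le> g y"
  shows "(\<integral>\<^sup>+x. ennreal (Z x powr q) \<partial>\<mu>M) \<le> ennreal (\<rho> powr q * (((\<integral>y. \<bar>H y\<bar> powr p \<partial>\<mu>Y) + K) / (\<integral>y. H y \<partial>\<mu>Y)))"
proof -
  let ?R = "\<integral>y. \<bar>H y\<bar> powr p \<partial>\<mu>Y" and ?h = "\<integral>y. H y \<partial>\<mu>Y"
  note g' = lp_boundedD[OF g]
  have q0: "0 \<le> q" using r p by (simp add: q)
  have young: "H y * g y powr q \<le> \<rho> powr q * (\<bar>H y\<bar> powr p + g y powr r / \<rho> powr r)" if "y \<in> Y" for y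
  proof -
    have "\<bar>H y\<bar> powr 1 * ((g y / \<rho>) powr (r / p)) powr (p - 1) \<le> \<bar>H y\<bar> powr (1 + (p - 1)) + ((g y / \<rho>) powr (r / p)) powr (1 + (p - 1))"
      using p by (intro powr_mult_le_add) auto
    hence "H y * (g y powr q / \<rho> powr q) \<le> \<bar>H y\<bar> powr p + g y powr r / \<rho> powr r"
      using p H_nonneg[OF that] g'(2)[of y] \<rho> by (simp add: powr_powr powr_divide q)
    hence "\<rho> powr q * (H y * (g y powr q / \<rho> powr q)) \<le> \<rho> powr q * (\<bar>H y\<bar> powr p + g y powr r / \<rho> powr r)"
      by (intro mult_left_mono) auto
    thus ?thesis using \<rho> by simp
  qed
  have "(\<integral>\<^sup>+y. (\<integral>\<^sup>+s. indicator {0..H y} s * ennreal (Z (T (max 0 s) y) powr q) \<partial>lborel) \<partial>\<mu>Y)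
     \<le> (\<integral>\<^sup>+y. ennreal (\<rho> powr q * (\<bar>H y\<bar> powr p + g y powr r / \<rho> powr r)) \<partial>\<mu>Y)"
  proof (rule nn_integral_mono_AE, use le AE_space in eventually_elim)
    case (elim y)
    hence y: "y \<in> Y" by (simp add: space_\<mu>Y)
    have "(\<integral>\<^sup>+s. indicator {0..H y} s * ennreal (Z (T (max 0 s) y) powr q) \<partial>lborel)
       \<le> (\<integral>\<^sup>+s. ennreal (g y powr q) * indicator {0..H y} s \<partial>lborel)"
      using elim(1) q0 Z0 by (intro nn_integral_mono) (auto simp: indicator_def intro!: ennreal_leI powr_mono2)
    also have "\<dots> = ennreal (g y powr q) * ennreal (H y)" using H_nonneg[OF y] by (simp add: nn_integral_cmult_indicator)
    also have "\<dots> = ennreal (H y * g y powr q)" using H_nonneg[OF y] by (simp add: ennreal_mult[symmetric] mult.commute)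
    also have "\<dots> \<le> ennreal (\<rho> powr q * (\<bar>H y\<bar> powr p + g y powr r / \<rho> powr r))" using young[OF y] by (rule ennreal_leI)
    finally show ?case .
  qed
  also have "\<dots> = ennreal (\<integral>y. \<rho> powr q * (\<bar>H y\<bar> powr p + g y powr r / \<rho> powr r) \<partial>\<mu>Y)"
    using Hp g'(3) by (intro nn_integral_eq_integral) auto
  also have "(\<integral>y. \<rho> powr q * (\<bar>H y\<bar> powr p + g y powr r / \<rho> powr r) \<partial>\<mu>Y) = \<rho> powr q * (?R + (\<integral>y. g y powr r \<partial>\<mu>Y) / \<rho> powr r)"
    using Hp g'(3) by simp
  also have "ennreal \<dots> \<le> ennreal (\<rho> powr q * (?R + K))"
    using g'(4) \<rho> by (intro ennreal_leI mult_left_mono add_left_mono) (auto simp: pos_divide_le_eq)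
  finally have "(\<integral>\<^sup>+x. ennreal (Z x powr q) \<partial>\<mu>M) \<le> ennreal (\<rho> powr q * (?R + K)) / ennreal ?h"
    by (subst nn_integral_\<mu>M) (auto intro: divide_right_mono_ennreal)
  also have "\<dots> = ennreal (\<rho> powr q * ((?R + K) / ?h))"
  proof -
    have "0 \<le> K * \<rho> powr r" by (intro order_trans[OF _ g'(4)] integral_nonneg_AE) auto
    hence "0 \<le> K" using \<rho> by (simp add: zero_le_mult_iff)
    moreover have "0 \<le> ?R" by (intro integral_nonneg_AE) auto
    ultimately show ?thesis using integral_H_pos by (simp add: divide_ennreal)
  qed
  finally show ?thesis .
qed

lemma nn_integral_\<mu>M_le_const:
  assumes "\<And>x. 0 \<le> Z x" "\<And>x. Z x \<le> c" "0 \<le> q"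
  shows "(\<integral>\<^sup>+x. ennreal (Z x powr q) \<partial>\<mu>M) \<le> ennreal (c powr q)"
proof -
  interpret M: prob_space \<mu>M by (rule prob_\<mu>M)
  have "(\<integral>\<^sup>+x. ennreal (Z x powr q) \<partial>\<mu>M) \<le> (\<integral>\<^sup>+x. ennreal (c powr q) \<partial>\<mu>M)"
    using assms by (intro nn_integral_mono ennreal_leI powr_mono2) auto
  thus ?thesis by (simp add: M.emeasure_space_1)
qed

text \<open>The integral from a point \<open>T s y\<close> of the suspension is the difference of
  two integrals from the base point \<open>y\<close>, both dominated by the same function.\<close>

theorem moment_bound:
  assumes p: "2 \<le> p" and Hp: "integrable \<mu>Y (\<lambda>y. \<bar>H y\<bar> powr p)"
  shows "\<exists>K>0. \<forall>u t. hobs u \<longrightarrow> (\<integral>x. u x \<partial>\<mu>M) = 0 \<longrightarrow> 0 < t \<longrightarrow>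
    (\<integral>\<^sup>+x. ennreal (\<bar>J u x t\<bar> powr (p - 1)) \<partial>\<mu>M) \<le> ennreal (sqrt t powr (p - 1) * K)"
proof -
  obtain K where K: "0 \<le> K" and dom: "\<forall>u t. hobs u \<longrightarrow> (\<integral>x. u x \<partial>\<mu>M) = 0 \<longrightarrow> 1 \<le> t \<longrightarrow>
     (\<exists>g. lp_bounded \<mu>Y p g (K * t powr (p / 2)) \<and> (AE y in \<mu>Y. \<forall>s\<in>{0..H y + t}. \<bar>J u y s\<bar> \<le> g y))"
    using flow_integrals_dominated[OF p Hp] by (elim exE conjE)
  let ?R = "\<integral>y. \<bar>H y\<bar> powr p \<partial>\<mu>Y" and ?h = "\<integral>y. H y \<partial>\<mu>Y"
  define k where "k = max 1 ((?R + 2 powr p * K) / ?h)"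
  have "(\<integral>\<^sup>+x. ennreal (\<bar>J u x t\<bar> powr (p - 1)) \<partial>\<mu>M) \<le> ennreal (sqrt t powr (p - 1) * k)"
    if u: "hobs u" "(\<integral>x. u x \<partial>\<mu>M) = 0" and t: "0 < t" for u t
  proof (cases "1 \<le> t")
    case False
    have "t * t \<le> t * 1" using t False by (intro mult_left_mono) auto
    hence "t \<le> sqrt t" by (intro real_le_rsqrt) (simp add: power2_eq_square)
    hence "\<bar>J u x t\<bar> \<le> sqrt t" for x using J_bound[OF hobsD(1)[OF u(1)], of t x] t by simp
    hence "(\<integral>\<^sup>+x. ennreal (\<bar>J u x t\<bar> powr (p - 1)) \<partial>\<mu>M) \<le> ennreal (sqrt t powr (p - 1))"
      using p by (intro nn_integral_\<mu>M_le_const) auto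
    also have "\<dots> \<le> ennreal (sqrt t powr (p - 1) * k)" by (intro ennreal_leI) (simp add: k_def mult_le_cancel_left1)
    finally show ?thesis .
  next
    case True
    note ob = hobsD(1)[OF u(1)]
    obtain g where g: "lp_bounded \<mu>Y p g (K * t powr (p / 2))" and gl: "AE y in \<mu>Y. \<forall>s\<in>{0..H y + t}. \<bar>J u y s\<bar> \<le> g y"
      using dom[rule_format, OF u True] by blast
    have tt: "t powr (p / 2) = sqrt t powr p" using t by (simp add: powr_half_sqrt[symmetric] powr_powr)
    have g2: "lp_bounded \<mu>Y p (\<lambda>y. 2 * g y) (2 powr p * K * sqrt t powr p)"
      using lp_bounded_scale[OF g, of 2] by (simp add: tt mult.assoc)
    have l: "AE y in \<mu>Y. \<forall>s\<in>{0..H y}. \<bar>J u (T s y) t\<bar> \<le> 2 * g y"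
      using gl
    proof (eventually_elim, intro ballI)
      fix y s assume A: "\<forall>s\<in>{0..H y + t}. \<bar>J u y s\<bar> \<le> g y" and s: "s \<in> {0..H y}"
      have "\<bar>J u y s\<bar> \<le> g y" "\<bar>J u y (s + t)\<bar> \<le> g y" using A s t by auto
      thus "\<bar>J u (T s y) t\<bar> \<le> 2 * g y" using J_add[OF ob, of s t y] s t by auto
    qed
    have "(\<integral>\<^sup>+x. ennreal (\<bar>J u x t\<bar> powr (p - 1)) \<partial>\<mu>M) \<le> ennreal (sqrt t powr (p - 1) * ((?R + 2 powr p * K) / ?h))"
      using p t ob by (intro nn_integral_\<mu>M_dominated[OF _ Hp _ _ g2 _ _ _ l]) auto
    also have "\<dots> \<le> ennreal (sqrt t powr (p - 1) * k)" by (intro ennreal_leI mult_left_mono) (auto simp: k_def)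
    finally show ?thesis .
  qed
  moreover have "0 < k" by (simp add: k_def)
  ultimately show ?thesis by blast
qed

text \<open>Chen's relation expresses the iterated integral from \<open>T s y\<close> through
  integrals from \<open>y\<close>; the cross term is estimated by squares, which again have exponent
  \<open>p / 2\<close>.\<close>

theorem iterated_moment_bound:
  assumes p: "4 \<le> p" and Hp: "integrable \<mu>Y (\<lambda>y. \<bar>H y\<bar> powr p)"
  shows "\<exists>K>0. \<forall>u v t. hobs u \<longrightarrow> (\<integral>x. u x \<partial>\<mu>M) = 0 \<longrightarrow> hobs v \<longrightarrow> (\<integral>x. v x \<partial>\<mu>M) = 0 \<longrightarrow> 0 < t \<longrightarrow>
    (\<integral>\<^sup>+x. ennreal (\<bar>Q u v x t\<bar> powr ((p - 1) / 2)) \<partial>\<mu>M) \<le> ennreal (t powr ((p - 1) / 2) * K)"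
proof -
  define r where "r = p / 2"
  have p2: "2 \<le> p" using p by simp
  obtain K where K: "0 \<le> K" and dom: "\<forall>u t. hobs u \<longrightarrow> (\<integral>x. u x \<partial>\<mu>M) = 0 \<longrightarrow> 1 \<le> t \<longrightarrow>
     (\<exists>g. lp_bounded \<mu>Y p g (K * t powr (p / 2)) \<and> (AE y in \<mu>Y. \<forall>s\<in>{0..H y + t}. \<bar>J u y s\<bar> \<le> g y))"
    using flow_integrals_dominated[OF p2 Hp] by (elim exE conjE)
  obtain L where L: "0 \<le> L" and idom: "\<forall>u v t. hobs u \<longrightarrow> (\<integral>x. u x \<partial>\<mu>M) = 0 \<longrightarrow> hobs v \<longrightarrow> (\<integral>x. v x \<partial>\<mu>M) = 0 \<longrightarrow> 1 \<le> t \<longrightarrow>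
     (\<exists>g. lp_bounded \<mu>Y (p / 2) g (L * t powr (p / 2)) \<and> (AE y in \<mu>Y. \<forall>s\<in>{0..H y + t}. \<bar>Q u v y s\<bar> \<le> g y))"
    using iterated_integrals_dominated[OF p Hp] by (elim exE conjE)
  let ?R = "\<integral>y. \<bar>H y\<bar> powr p \<partial>\<mu>Y" and ?h = "\<integral>y. H y \<partial>\<mu>Y"
  define k0 where "k0 = 2 powr r * (2 powr r * L + 2 powr r * (K + K))"
  define k where "k = max 1 ((?R + k0) / ?h)"
  have "(\<integral>\<^sup>+x. ennreal (\<bar>Q u v x t\<bar> powr ((p - 1) / 2)) \<partial>\<mu>M) \<le> ennreal (t powr ((p - 1) / 2) * k)"
    if u: "hobs u" "(\<integral>x. u x \<partial>\<mu>M) = 0" and v: "hobs v" "(\<integral>x. v x \<partial>\<mu>M) = 0" and t: "0 < t" for u v t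
  proof (cases "1 \<le> t")
    case False
    note ob = hobsD(1)[OF u(1)] hobsD(1)[OF v(1)]
    have "t\<^sup>2 \<le> t" using t False by (simp add: power2_eq_square mult_left_le)
    hence "\<bar>Q u v x t\<bar> \<le> t" for x using Q_bound[OF ob, of t x] t by linarith
    hence "(\<integral>\<^sup>+x. ennreal (\<bar>Q u v x t\<bar> powr ((p - 1) / 2)) \<partial>\<mu>M) \<le> ennreal (t powr ((p - 1) / 2))"
      using p by (intro nn_integral_\<mu>M_le_const) auto
    also have "\<dots> \<le> ennreal (t powr ((p - 1) / 2) * k)" by (intro ennreal_leI) (simp add: k_def mult_le_cancel_left1)
    finally show ?thesis .
  next
    case True
    note ob = hobsD(1)[OF u(1)] hobsD(1)[OF v(1)]
    obtain a where a: "lp_bounded \<mu>Y p a (K * t powr (p / 2))" and al: "AE y in \<mu>Y. \<forall>s\<in>{0..H y + t}. \<bar>J u y s\<bar> \<le> a y"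
      using dom[rule_format, OF u True] by blast
    obtain b where b: "lp_bounded \<mu>Y p b (K * t powr (p / 2))" and bl: "AE y in \<mu>Y. \<forall>s\<in>{0..H y + t}. \<bar>J v y s\<bar> \<le> b y"
      using dom[rule_format, OF v True] by blast
    obtain c where c: "lp_bounded \<mu>Y (p / 2) c (L * t powr (p / 2))" and cl: "AE y in \<mu>Y. \<forall>s\<in>{0..H y + t}. \<bar>Q u v y s\<bar> \<le> c y"
      using idom[rule_format, OF u v True] by blast
    define g where "g y = 2 * c y + ((a y)\<^sup>2 + (b y)\<^sup>2)" for y
    have "lp_bounded \<mu>Y r g (2 powr r * (2 powr r * (L * t powr r) + 2 powr r * (K * t powr r + K * t powr r)))"
      unfolding g_def using p lp_bounded_square[OF a] lp_bounded_square[OF b] c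
      by (intro lp_bounded_add lp_bounded_scale) (auto simp: r_def)
    hence g: "lp_bounded \<mu>Y r g (k0 * t powr r)" by (simp add: k0_def algebra_simps)
    have l: "AE y in \<mu>Y. \<forall>s\<in>{0..H y}. \<bar>Q u v (T s y) t\<bar> \<le> g y"
      using al bl cl
    proof (eventually_elim, intro ballI)
      fix y s assume A: "\<forall>s\<in>{0..H y + t}. \<bar>J u y s\<bar> \<le> a y" and B: "\<forall>s\<in>{0..H y + t}. \<bar>J v y s\<bar> \<le> b y"
        and Q: "\<forall>s\<in>{0..H y + t}. \<bar>Q u v y s\<bar> \<le> c y" and s: "s \<in> {0..H y}"
      have 1: "\<bar>J u y s\<bar> \<le> a y" "\<bar>J v y s\<bar> \<le> b y" "\<bar>J v y (s + t)\<bar> \<le> b y" "\<bar>Q u v y s\<bar> \<le> c y" "\<bar>Q u v y (s + t)\<bar> \<le> c y"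
        using A B Q s t by auto
      hence "\<bar>J v (T s y) t\<bar> \<le> 2 * b y" using J_add[OF ob(2), of s t y] s t by auto
      hence "\<bar>J u y s * J v (T s y) t\<bar> \<le> a y * (2 * b y)"
        unfolding abs_mult using 1 by (intro mult_mono) auto
      also have "\<dots> \<le> (a y)\<^sup>2 + (b y)\<^sup>2" using sum_squares_bound[of "a y" "b y"] by simp
      finally show "\<bar>Q u v (T s y) t\<bar> \<le> g y" using Q_add[OF ob, of s t y] 1 s t unfolding g_def by auto
    qed
    have "(\<integral>\<^sup>+x. ennreal (\<bar>Q u v x t\<bar> powr ((p - 1) / 2)) \<partial>\<mu>M) \<le> ennreal (t powr ((p - 1) / 2) * ((?R + k0) / ?h))"
      using p t ob by (intro nn_integral_\<mu>M_dominated[OF _ Hp _ _ g _ _ _ l]) (auto simp: r_def)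
    also have "\<dots> \<le> ennreal (t powr ((p - 1) / 2) * k)" by (intro ennreal_leI mult_left_mono) (auto simp: k_def)
    finally show ?thesis .
  qed
  moreover have "0 < k" by (simp add: k_def)
  ultimately show ?thesis by blast
qed

end

section \<open>Vector-valued observables\<close>

lemma borel_measurable_vecI:
  fixes f :: "'a \<Rightarrow> ('b::euclidean_space) ^ 'd"
  assumes "\<And>i. (\<lambda>x. f x $ i) \<in> borel_measurable M"
  shows "f \<in> borel_measurable M"
proof (subst borel_measurable_euclidean_space, intro ballI)
  fix b :: "'b ^ 'd" assume "b \<in> Basis"
  then obtain i c where b: "b = axis i c" by (auto simp: Basis_vec_def)
  show "(\<lambda>x. f x \<bullet> b) \<in> borel_measurable M" unfolding b inner_axis using assms[of i] by simp
qed

lemma norm_vec_le_sum: "norm (x :: ('b::real_normed_vector) ^ 'd) \<le> (\<Sum>i\<in>UNIV. norm (x $ i))"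
  unfolding norm_vec_def by (rule L2_set_le_sum) auto

text \<open>Each summand is at most the largest one, whose power is among the terms on the right; no
  convexity enters, so every \<open>q > 0\<close> is allowed.\<close>

lemma sum_powr_le_card:
  fixes a :: "'k \<Rightarrow> real"
  assumes I: "finite I" and a: "\<And>k. 0 \<le> a k" and q: "0 < q"
  shows "(\<Sum>k\<in>I. a k) powr q \<le> real (card I) powr q * (\<Sum>k\<in>I. a k powr q)"
proof (cases "I = {}")
  case False
  define m where "m = Max (a ` I)"
  have "m \<in> a ` I" unfolding m_def using I False by (intro Max_in) auto
  then obtain k where k: "k \<in> I" "m = a k" by auto
  have "(\<Sum>k\<in>I. a k) \<le> real (card I) * m" unfolding m_def using I by (intro sum_bounded_above) auto
  hence "(\<Sum>k\<in>I. a k) powr q \<le> (real (card I) * m) powr q" using q a by (intro powr_mono2 sum_nonneg) auto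
  also have "\<dots> = real (card I) powr q * m powr q" using a k by (simp add: powr_mult)
  also have "m powr q \<le> (\<Sum>k\<in>I. a k powr q)" unfolding k(2) using I k by (intro member_le_sum) auto
  finally show ?thesis by (simp add: mult_left_mono)
qed simp

text \<open>Passes from moments of scalar components to the norm of a vector or matrix; the number
  of components enters only the constant.\<close>

lemma Lq_norm_le:
  fixes g :: "'a \<Rightarrow> 'b::real_normed_vector" and c :: "'k \<Rightarrow> 'a \<Rightarrow> real" and K :: real
  assumes I: "finite I" and q: "0 < q" and pos: "0 \<le> B" "0 \<le> \<rho>" "0 \<le> K"
    and [measurable]: "\<And>k. c k \<in> borel_measurable M"
    and le: "\<And>x. norm (g x) \<le> B * (\<Sum>k\<in>I. \<bar>c k x\<bar>)"
    and c: "\<And>k. (\<integral>\<^sup>+x. ennreal (\<bar>c k x\<bar> powr q) \<partial>M) \<le> ennreal (\<rho> powr q * K)"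
  shows "Lq_norm M q g \<le> ennreal (card I * (card I * K) powr (1 / q) * \<rho> * B)"
proof -
  let ?n = "real (card I)"
  have "(\<integral>\<^sup>+x. ennreal (norm (g x) powr q) \<partial>M) \<le> (\<integral>\<^sup>+x. (\<Sum>k\<in>I. ennreal (B powr q * ?n powr q) * ennreal (\<bar>c k x\<bar> powr q)) \<partial>M)"
  proof (rule nn_integral_mono)
    fix x
    have "norm (g x) powr q \<le> (B * (\<Sum>k\<in>I. \<bar>c k x\<bar>)) powr q" using le q by (intro powr_mono2) auto
    also have "\<dots> = B powr q * (\<Sum>k\<in>I. \<bar>c k x\<bar>) powr q" using pos by (simp add: powr_mult sum_nonneg)
    also have "\<dots> \<le> B powr q * (?n powr q * (\<Sum>k\<in>I. \<bar>c k x\<bar> powr q))" using I q by (intro mult_left_mono sum_powr_le_card) auto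
    also have "\<dots> = (\<Sum>k\<in>I. B powr q * ?n powr q * \<bar>c k x\<bar> powr q)" by (simp add: sum_distrib_left mult.assoc)
    finally have "ennreal (norm (g x) powr q) \<le> ennreal (\<Sum>k\<in>I. B powr q * ?n powr q * \<bar>c k x\<bar> powr q)" by (rule ennreal_leI)
    also have "\<dots> = (\<Sum>k\<in>I. ennreal (B powr q * ?n powr q) * ennreal (\<bar>c k x\<bar> powr q))"
      by (subst sum_ennreal[symmetric]) (auto simp: ennreal_mult)
    finally show "ennreal (norm (g x) powr q) \<le> (\<Sum>k\<in>I. ennreal (B powr q * ?n powr q) * ennreal (\<bar>c k x\<bar> powr q))" .
  qed
  also have "\<dots> = (\<Sum>k\<in>I. ennreal (B powr q * ?n powr q) * (\<integral>\<^sup>+x. ennreal (\<bar>c k x\<bar> powr q) \<partial>M))"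
    by (subst nn_integral_sum) (auto simp: nn_integral_cmult)
  also have "\<dots> \<le> (\<Sum>k\<in>I. ennreal (B powr q * ?n powr q) * ennreal (\<rho> powr q * K))"
    by (intro sum_mono mult_left_mono c) auto
  also have "\<dots> = ennreal (?n * ((B powr q * ?n powr q) * (\<rho> powr q * K)))"
    using pos by (simp add: ennreal_mult ennreal_of_nat_eq_real_of_nat)
  finally have le: "(\<integral>\<^sup>+x. ennreal (norm (g x) powr q) \<partial>M) \<le> ennreal (?n * ((B powr q * ?n powr q) * (\<rho> powr q * K)))" (is "?I \<le> ennreal ?E") .
  have E0: "0 \<le> ?E" using pos by simp
  have fin: "?I \<noteq> \<infinity>" using le by (auto simp: top_unique)
  have "enn2real ?I \<le> ?E" using enn2real_mono[OF le] E0 by simp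
  hence "enn2real ?I powr (1 / q) \<le> ?E powr (1 / q)" using q by (intro powr_mono2) auto
  also have "?E = (?n * B * \<rho>) powr q * (?n * K)" using pos by (simp add: powr_mult mult_ac)
  also have "\<dots> powr (1 / q) = ?n * B * \<rho> * (?n * K) powr (1 / q)" using pos q by (simp add: powr_mult powr_powr)
  finally show ?thesis using fin by (simp add: Lq_norm_def Let_def mult_ac ennreal_leI)
qed

text \<open>The suprema in \<open>holder_norm\<close> are real-valued and meaningful only for
  bounded families; membership in \<open>C0_holder\<close> supplies the bounds.\<close>

lemma holder_norm_bounds:
  fixes v :: "'m::metric_space \<Rightarrow> real ^ 'd"
  assumes v: "v \<in> C0_holder \<eta> \<mu>" and \<eta>: "0 < \<eta>"
  shows "norm (v x) \<le> holder_norm \<eta> v" "norm (v x - v x') \<le> holder_norm \<eta> v * dist x x' powr \<eta>" "0 \<le> holder_norm \<eta> v"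
proof -
  define q where "q p = (if fst p = snd p then 0 else norm (v (fst p) - v (snd p)) / dist (fst p) (snd p) powr \<eta>)" for p
  obtain L where L: "\<And>x x'. norm (v x - v x') \<le> L * dist x x' powr \<eta>" using v by (auto simp: C0_holder_def)
  obtain B where B: "\<And>x. norm (v x) \<le> B" using v by (auto simp: C0_holder_def bounded_iff)
  have b1: "bdd_above (range (\<lambda>x. norm (v x)))" using B by (intro bdd_aboveI2) auto
  have "q p \<le> \<bar>L\<bar>" for p
  proof (cases "fst p = snd p")
    case False
    hence "norm (v (fst p) - v (snd p)) \<le> \<bar>L\<bar> * dist (fst p) (snd p) powr \<eta>"
      by (intro order_trans[OF L] mult_right_mono) auto
    thus ?thesis using False by (simp add: q_def pos_divide_le_eq)
  qed (simp add: q_def)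
  hence b2: "bdd_above (range q)" by (intro bdd_aboveI2) auto
  have n: "holder_norm \<eta> v = (SUP x. norm (v x)) + (SUP p. q p)" by (simp add: holder_norm_def q_def)
  have 1: "norm (v x) \<le> (SUP x. norm (v x))" for x using b1 by (intro cSUP_upper) auto
  have 2: "q p \<le> (SUP p. q p)" for p using b2 by (intro cSUP_upper) auto
  have "q (x, x) = 0" by (simp add: q_def)
  hence 3: "0 \<le> (SUP p. q p)" "0 \<le> (SUP x. norm (v x))"
    using 2[of "(x, x)"] order_trans[OF norm_ge_zero 1[of x]] by auto
  show "norm (v x) \<le> holder_norm \<eta> v" "0 \<le> holder_norm \<eta> v" using 1[of x] 3 by (auto simp: n)
  show "norm (v x - v x') \<le> holder_norm \<eta> v * dist x x' powr \<eta>"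
  proof (cases "x = x'")
    case False
    have "norm (v x - v x') / dist x x' powr \<eta> \<le> holder_norm \<eta> v" using 2[of "(x, x')"] 3 False by (simp add: n q_def)
    thus ?thesis using False by (simp add: pos_divide_le_eq)
  qed simp
qed

lemma C0_holder_continuous:
  fixes v :: "'m::metric_space \<Rightarrow> real ^ 'd"
  assumes v: "v \<in> C0_holder \<eta> \<mu>" and \<eta>: "0 < \<eta>"
  shows "continuous_on UNIV v"
proof (intro continuous_at_imp_continuous_on ballI)
  fix x :: 'm
  have "((\<lambda>y. holder_norm \<eta> v * dist y x powr \<eta>) \<longlongrightarrow> holder_norm \<eta> v * dist x x powr \<eta>) (at x)"
    using \<eta> by (intro tendsto_intros) (auto simp: eventually_at_filter)
  hence l: "((\<lambda>y. holder_norm \<eta> v * dist y x powr \<eta>) \<longlongrightarrow> 0) (at x)" by simp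
  have "((\<lambda>y. v y - v x) \<longlongrightarrow> 0) (at x)"
    by (rule Lim_null_comparison[OF _ l]) (use holder_norm_bounds(2)[OF assms] in auto)
  thus "isCont v x" unfolding isCont_def by (rule LIM_zero_cancel)
qed

lemma linear_outer_left: "linear (\<lambda>a. outer a b)"
  by (rule linearI) (auto simp: outer_def vec_eq_iff algebra_simps)

context semiflow
begin

lemma vint_component:
  fixes v :: "'m \<Rightarrow> real ^ 'd"
  assumes [measurable]: "v \<in> borel_measurable borel" and B: "\<And>x. norm (v x) \<le> B" and t: "0 \<le> t"
  shows "integrable lborel (\<lambda>s. indicator {0..t} s *\<^sub>R v (T (max 0 s) x))"
    and "vint T v t x = (\<integral>s. indicator {0..t} s *\<^sub>R v (T (max 0 s) x) \<partial>lborel)"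
    and "vint T v t x $ i = (\<integral>s. indicator {0..t} s * v (T (max 0 s) x) $ i \<partial>lborel)"
proof -
  show int: "integrable lborel (\<lambda>s. indicator {0..t} s *\<^sub>R v (T (max 0 s) x))"
    using B by (intro integrableI_bounded_set_indicator[where B=B]) (auto simp: emeasure_lborel_Icc_eq)
  have "vint T v t x = (LBINT s:{0..t}. v (T s x))"
    unfolding vint_def zero_ereal_def by (rule interval_integral_Icc[OF t])
  also have "\<dots> = (\<integral>s. indicator {0..t} s *\<^sub>R v (T (max 0 s) x) \<partial>lborel)"
    unfolding set_lebesgue_integral_def by (rule Bochner_Integration.integral_cong) (auto simp: indicator_def)
  finally show eq: "vint T v t x = (\<integral>s. indicator {0..t} s *\<^sub>R v (T (max 0 s) x) \<partial>lborel)" .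
  show "vint T v t x $ i = (\<integral>s. indicator {0..t} s * v (T (max 0 s) x) $ i \<partial>lborel)"
    unfolding eq using integral_bounded_linear[OF bounded_linear_vec_nth int, of i] by simp
qed

lemma inner_Sint:
  fixes v :: "'m \<Rightarrow> real ^ 'd"
  assumes v: "v \<in> borel_measurable borel" "\<And>x. norm (v x) \<le> B" and s: "0 \<le> s"
  shows "(LBINT r=0..s. outer (v (T r x)) b) = outer (vint T v s x) b"
proof -
  have bl: "bounded_linear (\<lambda>a. outer a b)" using linear_outer_left by (simp add: linear_conv_bounded_linear)
  have "(LBINT r=0..s. outer (v (T r x)) b) = (LBINT r:{0..s}. outer (v (T r x)) b)"
    unfolding zero_ereal_def by (rule interval_integral_Icc[OF s])
  also have "\<dots> = (\<integral>r. outer (indicator {0..s} r *\<^sub>R v (T (max 0 r) x)) b \<partial>lborel)"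
    unfolding set_lebesgue_integral_def
    by (rule Bochner_Integration.integral_cong) (auto simp: indicator_def outer_def vec_eq_iff)
  also have "\<dots> = outer (vint T v s x) b"
    unfolding vint_component(2)[OF v s] by (rule integral_bounded_linear[OF bl vint_component(1)[OF v s]])
  finally show ?thesis .
qed

text \<open>With \<open>v = A w\<close> componentwise, bilinearity gives the factor
  \<open>A\<^sup>2\<close>. The matrix integrand is shown integrable entrywise first, because
  components may be taken inside only for an integrable function.\<close>

lemma Sint_component:
  fixes v :: "'m \<Rightarrow> real ^ 'd"
  assumes v: "v \<in> borel_measurable borel" and B: "\<And>x. norm (v x) \<le> A" and t: "0 \<le> t"
    and w: "\<And>i. obs (w i)" "\<And>x i. v x $ i = A * w i x"
  shows "vint T v t x $ i = A * J (w i) x t" "Sint T v t x $ i $ j = A\<^sup>2 * Q (w i) (w j) x t"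
proof -
  have vi: "vint T v s x $ i = A * J (w i) x s" if "0 \<le> s" for s i
  proof -
    have "vint T v s x $ i = (\<integral>r. A * (indicator {0..s} r * w i (T (max 0 r) x)) \<partial>lborel)"
      unfolding vint_component(3)[OF v B that] w(2) by (simp add: mult_ac)
    thus ?thesis by (simp add: J_def)
  qed
  show "vint T v t x $ i = A * J (w i) x t" by (rule vi[OF t])
  let ?G = "\<lambda>s. (\<chi> i j. A\<^sup>2 * (indicator {0..t} s * (J (w i) x s * w j (T (max 0 s) x)))) :: real ^ 'd ^ 'd"
  have Gi: "integrable lborel (\<lambda>s. ?G s $ i $ j)" for i j using Q_integrable[OF w(1)[of i] w(1)[of j] order_refl, of t x] by simp
  have "Sint T v t x = (LBINT s:{0..t}. LBINT r=0..s. outer (v (T r x)) (v (T s x)))"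
    unfolding Sint_def zero_ereal_def by (rule interval_integral_Icc[OF t])
  also have "\<dots> = (\<integral>s. ?G s \<partial>lborel)"
    unfolding set_lebesgue_integral_def
  proof (rule Bochner_Integration.integral_cong[OF refl])
    fix s :: real
    have "(LBINT r=0..s. outer (v (T r x)) (v (T s x))) $ i $ j = A\<^sup>2 * (J (w i) x s * w j (T (max 0 s) x))" if "s \<in> {0..t}" for i j
      using that inner_Sint[OF v B, of s x "v (T s x)"] by (simp add: outer_def vi w(2) power2_eq_square mult_ac)
    thus "indicator {0..t} s *\<^sub>R (LBINT r=0..s. outer (v (T r x)) (v (T s x))) = ?G s"
      by (auto simp: indicator_def vec_eq_iff)
  qed
  finally have S: "Sint T v t x = (\<integral>s. ?G s \<partial>lborel)" .
  have int: "integrable lborel ?G"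
  proof (rule Bochner_Integration.integrable_bound)
    show "integrable lborel (\<lambda>s. \<Sum>i\<in>UNIV. \<Sum>j\<in>UNIV. \<bar>?G s $ i $ j\<bar>)"
      using Gi by (intro Bochner_Integration.integrable_sum integrable_abs)
    show "?G \<in> borel_measurable lborel" by (intro borel_measurable_vecI borel_measurable_integrable Gi)
    have "norm (?G s) \<le> (\<Sum>i\<in>UNIV. \<Sum>j\<in>UNIV. \<bar>?G s $ i $ j\<bar>)" for s
      by (intro order_trans[OF norm_vec_le_sum] sum_mono order_trans[OF norm_vec_le_sum]) auto
    thus "AE s in lborel. norm (?G s) \<le> norm (\<Sum>i\<in>UNIV. \<Sum>j\<in>UNIV. \<bar>?G s $ i $ j\<bar>)" by (auto intro: order_trans[OF _ abs_ge_self])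
  qed
  have bl: "bounded_linear (\<lambda>m :: real ^ 'd ^ 'd. m $ i $ j)"
    using bounded_linear_compose[OF bounded_linear_vec_nth bounded_linear_vec_nth] .
  show "Sint T v t x $ i $ j = A\<^sup>2 * Q (w i) (w j) x t"
    unfolding S using integral_bounded_linear[OF bl int] by (simp add: Q_def)
qed

end

context hyperbolic_flow
begin

text \<open>Division by the Hoelder norm yields admissible scalar observables. If the norm is 0,
  division by zero gives the zero function, and \<open>v\<close> vanishes as well, so all four
  claims persist.\<close>

lemma C0_holder_components:
  fixes v :: "'m \<Rightarrow> real ^ 'd"
  assumes v: "v \<in> C0_holder \<eta> \<mu>M"
  defines "w i x \<equiv> v x $ i / holder_norm \<eta> v"
  shows "v \<in> borel_measurable borel" "hobs (w i)" "(\<integral>x. w i x \<partial>\<mu>M) = 0" "v x $ i = holder_norm \<eta> v * w i x"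
proof -
  interpret M: prob_space \<mu>M by (rule prob_\<mu>M)
  let ?A = "holder_norm \<eta> v"
  note hn = holder_norm_bounds[OF v const_bounds(4)]
  show m [measurable]: "v \<in> borel_measurable borel"
    using C0_holder_continuous[OF v const_bounds(4)] by (rule borel_measurable_continuous_onI)
  have m': "v \<in> borel_measurable \<mu>M" using m by (simp add: measurable_cong_sets[OF \<mu>M_eq0(1) refl])
  have c1: "\<bar>v x $ i\<bar> \<le> ?A" for x using component_le_norm_cart[of "v x" i] hn(1)[of x] by linarith
  have c2: "\<bar>v x $ i - v x' $ i\<bar> \<le> ?A * dist x x' powr \<eta>" for x x'
    using component_le_norm_cart[of "v x - v x'" i] hn(2)[of x x'] by simp
  have "\<bar>w i x\<bar> \<le> 1" for x using c1[of x] hn(3) by (cases "?A = 0") (auto simp: w_def)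
  moreover have "\<bar>w i x - w i x'\<bar> \<le> dist x x' powr \<eta>" for x x'
  proof (cases "?A = 0")
    case False
    hence "0 < ?A" using hn(3) by simp
    thus ?thesis using c2[of x x'] by (simp add: w_def diff_divide_distrib[symmetric] pos_divide_le_eq mult.commute)
  qed (simp add: w_def)
  moreover have "w i \<in> borel_measurable borel"
  proof -
    have "(\<lambda>x. v x $ i) \<in> borel_measurable borel"
      using measurable_compose[OF m borel_measurable_continuous_onI[OF linear_continuous_on[OF bounded_linear_vec_nth]]] .
    thus ?thesis unfolding w_def by simp
  qed
  ultimately show "hobs (w i)" by (simp add: hobs_def obs_def)
  have vi: "integrable \<mu>M v" using hn(1) m' by (intro M.integrable_const_bound[where B="?A"]) auto
  have "(\<integral>x. v x $ i \<partial>\<mu>M) = 0"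
    using integral_bounded_linear[OF bounded_linear_vec_nth vi, of i] v by (simp add: C0_holder_def)
  thus "(\<integral>x. w i x \<partial>\<mu>M) = 0" by (simp add: w_def)
  show "v x $ i = ?A * w i x" using c1[of x] by (cases "?A = 0") (auto simp: w_def)
qed

theorem vint_moment_bound:
  assumes p: "2 \<le> p" and Hp: "integrable \<mu>Y (\<lambda>y. \<bar>H y\<bar> powr p)"
  shows "\<exists>K>0. \<forall>v :: 'm \<Rightarrow> real ^ 'd. \<forall>t>0. v \<in> C0_holder \<eta> \<mu>M \<longrightarrow>
     Lq_norm \<mu>M (p - 1) (vint T v t) \<le> ennreal (K * sqrt t * holder_norm \<eta> v)"
proof -
  obtain K where K: "0 < K" and mb: "\<forall>u t. hobs u \<longrightarrow> (\<integral>x. u x \<partial>\<mu>M) = 0 \<longrightarrow> 0 < t \<longrightarrow>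
    (\<integral>\<^sup>+x. ennreal (\<bar>J u x t\<bar> powr (p - 1)) \<partial>\<mu>M) \<le> ennreal (sqrt t powr (p - 1) * K)"
    using moment_bound[OF p Hp] by (elim exE conjE)
  let ?n = "card (UNIV :: 'd set)"
  have "Lq_norm \<mu>M (p - 1) (vint T v t) \<le> ennreal (?n * (?n * K) powr (1 / (p - 1)) * sqrt t * holder_norm \<eta> v)"
    if t: "0 < t" and v: "v \<in> C0_holder \<eta> \<mu>M" for v :: "'m \<Rightarrow> real ^ 'd" and t
  proof -
    define w where "w i x = v x $ i / holder_norm \<eta> v" for i x
    note w = C0_holder_components[OF v, folded w_def]
    note hn = holder_norm_bounds[OF v const_bounds(4)]
    note comp = Sint_component[OF w(1) hn(1) less_imp_le[OF t] hobsD(1)[OF w(2)] w(4)]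
    show ?thesis
    proof (rule Lq_norm_le[where c="\<lambda>i x. J (w i) x t"])
      show "(\<lambda>x. J (w i) x t) \<in> borel_measurable \<mu>M" for i
        by (rule J_meas[OF hobsD(1)[OF w(2)]]) (auto simp: measurable_cong_sets[OF \<mu>M_eq0(1) refl])
      show "norm (vint T v t x) \<le> holder_norm \<eta> v * (\<Sum>i\<in>UNIV. \<bar>J (w i) x t\<bar>)" for x
        using norm_vec_le_sum[of "vint T v t x"] hn(3) by (simp add: comp(1) abs_mult sum_distrib_left)
      show "(\<integral>\<^sup>+x. ennreal (\<bar>J (w i) x t\<bar> powr (p - 1)) \<partial>\<mu>M) \<le> ennreal (sqrt t powr (p - 1) * K)" for i
        by (rule mb[rule_format, OF w(2,3) t])
    qed (use p K t hn(3) in auto)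
  qed
  moreover have "0 < ?n * (?n * K) powr (1 / (p - 1))" using K by (simp add: zero_less_mult_iff)
  ultimately show ?thesis by blast
qed

theorem Sint_moment_bound:
  assumes p: "4 \<le> p" and Hp: "integrable \<mu>Y (\<lambda>y. \<bar>H y\<bar> powr p)"
  shows "\<exists>K>0. \<forall>v :: 'm \<Rightarrow> real ^ 'd. \<forall>t>0. v \<in> C0_holder \<eta> \<mu>M \<longrightarrow>
     Lq_norm \<mu>M ((p - 1) / 2) (Sint T v t) \<le> ennreal (K * t * (holder_norm \<eta> v)\<^sup>2)"
proof -
  obtain K where K: "0 < K" and mb: "\<forall>u v t. hobs u \<longrightarrow> (\<integral>x. u x \<partial>\<mu>M) = 0 \<longrightarrow> hobs v \<longrightarrow> (\<integral>x. v x \<partial>\<mu>M) = 0 \<longrightarrow> 0 < t \<longrightarrow>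
    (\<integral>\<^sup>+x. ennreal (\<bar>Q u v x t\<bar> powr ((p - 1) / 2)) \<partial>\<mu>M) \<le> ennreal (t powr ((p - 1) / 2) * K)"
    using iterated_moment_bound[OF p Hp] by (elim exE conjE)
  let ?n = "card (UNIV :: ('d \<times> 'd) set)"
  have "Lq_norm \<mu>M ((p - 1) / 2) (Sint T v t) \<le> ennreal (?n * (?n * K) powr (1 / ((p - 1) / 2)) * t * (holder_norm \<eta> v)\<^sup>2)"
    if t: "0 < t" and v: "v \<in> C0_holder \<eta> \<mu>M" for v :: "'m \<Rightarrow> real ^ 'd" and t
  proof -
    define w where "w i x = v x $ i / holder_norm \<eta> v" for i x
    note w = C0_holder_components[OF v, folded w_def]
    note hn = holder_norm_bounds[OF v const_bounds(4)]
    note comp = Sint_component[OF w(1) hn(1) less_imp_le[OF t] hobsD(1)[OF w(2)] w(4)]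
    show ?thesis
    proof (rule Lq_norm_le[where c="\<lambda>k x. Q (w (fst k)) (w (snd k)) x t"])
      show "(\<lambda>x. Q (w (fst k)) (w (snd k)) x t) \<in> borel_measurable \<mu>M" for k
        by (rule Q_meas[OF hobsD(1)[OF w(2)] hobsD(1)[OF w(2)]]) (auto simp: measurable_cong_sets[OF \<mu>M_eq0(1) refl])
      have "norm (Sint T v t x) \<le> (\<Sum>i\<in>UNIV. \<Sum>j\<in>UNIV. \<bar>Sint T v t x $ i $ j\<bar>)" for x
        by (intro order_trans[OF norm_vec_le_sum] sum_mono order_trans[OF norm_vec_le_sum]) auto
      thus "norm (Sint T v t x) \<le> (holder_norm \<eta> v)\<^sup>2 * (\<Sum>k\<in>UNIV. \<bar>Q (w (fst k)) (w (snd k)) x t\<bar>)" for x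
        by (simp add: comp(2) abs_mult sum_distrib_left sum.cartesian_product split_beta' UNIV_Times_UNIV[symmetric] del: UNIV_Times_UNIV)
      show "(\<integral>\<^sup>+x. ennreal (\<bar>Q (w (fst k)) (w (snd k)) x t\<bar> powr ((p - 1) / 2)) \<partial>\<mu>M) \<le> ennreal (t powr ((p - 1) / 2) * K)" for k
        by (rule mb[rule_format, OF w(2,3) w(2,3) t])
    qed (use p K t hn(3) in auto)
  qed
  moreover have "0 < ?n * (?n * K) powr (1 / ((p - 1) / 2))" using K by (simp add: zero_less_mult_iff card_gt_0_iff)
  ultimately show ?thesis by blast
qed

end

theorem theorem4p5:
  fixes T :: "real \<Rightarrow> 'm::metric_space \<Rightarrow> 'm"
    and X Y Yhat :: "'m set"
    and h :: "'m \<Rightarrow> real"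
    and \<tau> :: "'m \<Rightarrow> nat"
    and \<mu>Y :: "'m measure"
    and W :: "'m \<Rightarrow> 'm set"
    and Pbar :: "'m set set set"
    and C \<gamma>0 \<eta> :: real
  defines "f \<equiv> fmap T h"
    and "F \<equiv> Fmap T h \<tau>"
    and "H \<equiv> Hfun T h \<tau>"
    and "\<mu>X \<equiv> tower_measure X \<mu>Y (fmap T h) \<tau>"
    and "\<mu>M \<equiv> suspension_measure (tower_measure X \<mu>Y (fmap T h) \<tau>) T h"
    and "\<mu>bar \<equiv> distr \<mu>Y (qspace W Y) W"
  assumes bounded_M: "bounded (UNIV :: 'm set)"
    and sets_XY: "X \<in> sets borel" "Y \<in> sets borel" "Y \<subseteq> X"
    and semiflow: "\<And>x. T 0 x = x" "\<And>s t x. 0 \<le> s \<Longrightarrow> 0 \<le> t \<Longrightarrow> T (s + t) x = T s (T t x)"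
    and T_meas: "(\<lambda>(t, x). T t x) \<in> measurable (restrict_space (borel \<Otimes>\<^sub>M borel) ({0..} \<times> UNIV)) borel"
    and h_pos: "\<And>x. x \<in> X \<Longrightarrow> 0 < h x"
    and h_meas: "h \<in> borel_measurable (restrict_space borel X)"
    and f_X: "\<And>x. x \<in> X \<Longrightarrow> f x \<in> X"
    and \<tau>_pos: "\<And>y. y \<in> Y \<Longrightarrow> 1 \<le> \<tau> y"
    and \<tau>_meas: "\<tau> \<in> measurable (restrict_space borel Y) (count_space UNIV)"
    and F_Y: "\<And>y. y \<in> Y \<Longrightarrow> F y \<in> Y"
    and \<mu>Y_prob: "prob_space \<mu>Y"
    and \<mu>Y_sets: "sets \<mu>Y = sets (restrict_space borel Y)"
    and \<mu>Y_inv: "preserves_measure \<mu>Y F"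
    and \<mu>Y_erg: "ergodic_on \<mu>Y F"
    and \<tau>_int: "integrable \<mu>Y (\<lambda>y. real (\<tau> y))"
    and h_int: "integrable \<mu>X h"
    and W_leaf: "\<And>y. y \<in> Y \<Longrightarrow> y \<in> W y \<and> W y \<subseteq> Y"
    and W_part: "\<And>y y'. y \<in> Y \<Longrightarrow> y' \<in> W y \<Longrightarrow> W y' = W y"
    and W_meas: "\<exists>N \<in> sets \<mu>Y. emeasure \<mu>Y N = 0 \<and>
                   (\<exists>\<A>. countable \<A> \<and> \<A> \<subseteq> sets borel \<and>
                      (\<forall>A\<in>\<A>. A \<subseteq> Y \<and> (\<forall>y\<in>A. W y \<subseteq> A)) \<and>
                      (\<forall>y\<in>Y - N. \<forall>y'\<in>Y - N. W y \<noteq> W y' \<longrightarrow> (\<exists>A\<in>\<A>. y \<in> A \<and> y' \<notin> A)))"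
    and W_F: "\<And>y. y \<in> Y \<Longrightarrow> F ` W y \<subseteq> W (F y)"
    and \<tau>_W: "\<And>y y'. y \<in> Y \<Longrightarrow> y' \<in> W y \<Longrightarrow> \<tau> y' = \<tau> y"
    and GM: "gibbs_markov \<mu>bar (Fbar W F) Pbar"
    and \<mu>bar_inv: "preserves_measure \<mu>bar (Fbar W F)"
    and \<mu>bar_erg: "ergodic_on \<mu>bar (Fbar W F)"
    and H_int: "integrable \<mu>Y H"
    and H_inf: "(INF y\<in>Y. H y) > 0"
    and Yhat: "Yhat \<in> sets borel" "Yhat \<subseteq> Y" "\<And>y. y \<in> Y \<Longrightarrow> \<exists>!z. z \<in> Yhat \<and> z \<in> W y"
    and const_bounds: "1 \<le> C" "0 < \<gamma>0" "\<gamma>0 < 1" "0 < \<eta>" "\<eta> \<le> 1"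
    and H_lip: "\<And>a y y'. a \<in> Pbar \<Longrightarrow> y \<in> Yhat \<Longrightarrow> y' \<in> Yhat \<Longrightarrow> W y \<in> a \<Longrightarrow> W y' \<in> a \<Longrightarrow>
          \<bar>H y - H y'\<bar> \<le> C * (INF z\<in>{z\<in>Y. W z \<in> a}. H z) * gp \<gamma>0 (sep_time Pbar (Fbar W F) (W y) (W y')) 0"
    and flow_holder: "\<And>y t t'. y \<in> Yhat \<Longrightarrow> 0 \<le> t \<Longrightarrow> 0 \<le> t' \<Longrightarrow>
          dist (T t y) (T t' y) \<le> C * \<bar>t - t'\<bar> powr \<eta>"
    and stable_contr: "\<And>y y' t. y \<in> Y \<Longrightarrow> y' \<in> W y \<Longrightarrow> 0 \<le> t \<Longrightarrow>
          dist (T t y) (T t y') \<le> C * \<gamma>0 powr t"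
    and unstable_exp: "\<And>a y y' t. a \<in> Pbar \<Longrightarrow> y \<in> Yhat \<Longrightarrow> y' \<in> Yhat \<Longrightarrow> W y \<in> a \<Longrightarrow> W y' \<in> a \<Longrightarrow>
          0 \<le> t \<Longrightarrow> dist (T t y) (T t y') \<le>
            C * gp \<gamma>0 (sep_time Pbar (Fbar W F) (W y) (W y')) (Jfun T h \<tau> t y)"
  shows "(\<forall>p \<ge> 2. in_Lp \<mu>Y p H \<longrightarrow>
            (\<exists>K>0. \<forall>v::'m \<Rightarrow> real^'d. \<forall>t>0. v \<in> C0_holder \<eta> \<mu>M \<longrightarrow>
               Lq_norm \<mu>M (p - 1) (vint T v t) \<le> ennreal (K * sqrt t * holder_norm \<eta> v)))
       \<and> (\<forall>p \<ge> 4. in_Lp \<mu>Y p H \<longrightarrow>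
            (\<exists>K>0. \<forall>v::'m \<Rightarrow> real^'d. \<forall>t>0. v \<in> C0_holder \<eta> \<mu>M \<longrightarrow>
               Lq_norm \<mu>M ((p - 1) / 2) (Sint T v t) \<le> ennreal (K * t * (holder_norm \<eta> v)\<^sup>2)))"
proof -
  note D = f_def F_def H_def \<mu>X_def \<mu>M_def \<mu>bar_def
  have hf: "hyperbolic_flow T X Y h \<tau> \<mu>Y Yhat W Pbar C \<gamma>0 \<eta>"
    by (intro hyperbolic_flow.intro hyperbolic_flow_axioms.intro induced_flow.intro induced_flow_axioms.intro semiflow.intro)
      (fact sets_XY semiflow T_meas h_pos h_meas f_X[unfolded D] \<tau>_pos \<tau>_meas F_Y[unfolded D] \<mu>Y_prob \<mu>Y_sets
         \<tau>_int H_int[unfolded D] H_inf[unfolded D] \<mu>Y_inv[unfolded D] \<mu>Y_erg[unfolded D] W_leaf W_part W_F[unfolded D]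
         GM[unfolded D] \<mu>bar_inv[unfolded D] \<mu>bar_erg[unfolded D] Yhat const_bounds H_lip[unfolded D] flow_holder stable_contr
         unstable_exp[unfolded D])+
  show ?thesis unfolding in_Lp_def D
    by (intro conjI allI impI hyperbolic_flow.vint_moment_bound[OF hf] hyperbolic_flow.Sint_moment_bound[OF hf]) auto
qed

end
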